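(* Let $1 \leq p, q \leq \infty$. (A) Let $\alpha>0$. (A1) If $\alpha\notin\mathbb{N}$, then $C^{\alpha,p,q}(\mathbb{Z})=\Lambda_H^{\alpha,p,q}$. (A2) If $\alpha\in\mathbb{N}$, then $Z^{\alpha,p,q}(\mathbb{Z})=\Lambda_H^{\alpha,p,q}$. (B) Let $f:\mathbb{Z}\to\mathbb{R}$ be such that $\sum_{j\in\mathbb{Z}}\frac{|f(j)|}{1+|j|^2}<\infty$. (B1) For every $\alpha>0$ with $\alpha\notin\mathbb{N}$, $$f\in C^{\alpha,p,q}(\mathbb{Z})\iff f\in\Lambda_H^{\alpha,p,q}\iff f\in\Lambda_P^{\alpha,p,q}.$$ (B2) For every $\alpha\in\mathbb{N}$, $$f\in Z^{\alpha,p,q}(\mathbb{Z})\iff f\in\Lambda_H^{\alpha,p,q}\iff f\in\Lambda_P^{\alpha,p,q}.$$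
   Context: $\mathbb{N}=\{1,2,\dots\}$; $[x]$ denotes the integer part of $x$; $\|\cdot\|_p$ is the norm of $\ell^p(\mathbb{Z})$ (in the variable marked by a dot, when shown). Discrete derivative: $\delta_{right}f(n)=f(n)-f(n+1)$ for $f:\mathbb{Z}\to\mathbb{R}$; $\delta_{right}^l$ is its $l$-fold composition, $\delta_{right}^0f=f$. Weighted space: $\mu=\sum_{n\in\mathbb{Z}}\frac{1}{1+|n|}\delta_n$ ($\delta_n$ the Dirac measure at $n$). So $g\in\ell^q(\mathbb{Z},\mu)$ means $\sum_{n}|g(n)|^q\frac{1}{1+|n|}<\infty$ if $1\le q<\infty$, and $\ell^\infty(\mathbb{Z},\mu)=\ell^\infty(\mathbb{Z})$. The expression $\frac{f}{1+|\cdot|^\alpha}$ is the sequence $n\mapsto \frac{f(n)}{1+|n|^\alpha}$. Discrete Besov spaces: for $\alpha>0$, $\alpha\notin\mathbb{N}$, $l=[\alpha]$, $C^{\alpha,p,q}(\mathbb{Z})$ is the set of $f:\mathbb{Z}\to\mathbb{R}$ with $$\sum_{j\neq0}\Big\|\frac{\delta_{right}^lf(\cdot+j)-\delta_{right}^lf(\cdot)}{|j|^{\alpha-l}}\Big\|_p^q\frac1{|j|}<\infty\ (1\le q<\infty),\qquad \sup_{j\neq0}\Big\|\frac{\delta_{right}^lf(\cdot+j)-\delta_{right}^lf(\cdot)}{|j|^{\alpha-l}}\Big\|_p<\infty\ (q=\infty).$$ Generalized Zygmund classes: for $\alpha\in\mathbb{N}$, $Z^{\alpha,p,q}(\mathbb{Z})$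 is the set of $f:\mathbb{Z}\to\mathbb{R}$ with $\frac{f}{1+|\cdot|^\alpha}\in\ell^q(\mathbb{Z},\mu)$ and, writing $g=\delta_{right}^{\alpha-1}f$, $$\sum_{j\ne0}\Big\|\frac{g(\cdot-j)-2g(\cdot)+g(\cdot+j)}{|j|}\Big\|_p^q\frac1{|j|}<\infty\ (1\le q<\infty),\qquad \sup_{j\ne0}\Big\|\frac{g(\cdot-j)-2g(\cdot)+g(\cdot+j)}{|j|}\Big\|_p<\infty\ (q=\infty).$$ Semigroups: the discrete Laplacian is $\Delta_df(n)=f(n+1)-2f(n)+f(n-1)$. The heat semigroup is $e^{t\Delta_d}f(n)=\sum_{j\in\mathbb{Z}}G(t,n-j)f(j)$, with $G(t,n)=e^{-2t}I_n(2t)$, $t>0$, $n\in\mathbb{Z}$, and $I_n$ the modified Bessel function of the first kind of order $n$. The Poisson semigroup is $e^{-y\sqrt{-\Delta_d}}f(n)=\frac{y}{2\sqrt\pi}\int_0^\infty\frac{e^{-y^2/(4t)}}{t^{3/2}}e^{t\Delta_d}f(n)\,dt$, $y>0$. Mixed norms: for a function $F$ of $t>0$ with values in sequences on $\mathbb{Z}$, $\|F\|_{p,q}=\left(\int_0^\infty\|F(t)\|_p^q\frac{dt}{t}\right)^{1/q}$ for $1\le q<\infty$ and $\|F\|_{p,\infty}=\operatorname{ess\,sup}_{t>0}\|F(t)\|_p$ (with respect to $dt/t$). For $\alpha>0$: $\Lambda_H^{\alpha,p,q}$ is the set of $f:\mathbb{Z}\to\mathbb{R}$ with $\frac{f}{1+|\cdot|^\alpha}\in\ell^q(\mathbb{Z},\mu)$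 and $\|t^{k-\alpha/2}\partial_t^ke^{t\Delta_d}f\|_{p,q}<\infty$, where $k=[\alpha/2]+1$; $\Lambda_P^{\alpha,p,q}$ is the set of $f:\mathbb{Z}\to\mathbb{R}$ with $\sum_{n\in\mathbb{Z}}\frac{|f(n)|}{1+|n|^2}<\infty$ and $\|y^{l-\alpha}\partial_y^le^{-y\sqrt{-\Delta_d}}f\|_{p,q}<\infty$, where $l=[\alpha]+1$ (the mixed norm being taken in the variable $y>0$). *)

theory Defs
  imports "HOL-Probability.Probability"
begin

text \<open>
  Exponents \<open>p, q\<close> in \<open>[1, \<infinity>]\<close> are elements of \<^typ>\<open>ennreal\<close>, with \<open>\<top>\<close> for \<open>\<infinity>\<close>.  All norms take
  values in \<^typ>\<open>ennreal\<close>, so that ``the norm is finite'' is \<open>\<dots> < \<top>\<close>.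
\<close>

text \<open>Powers of extended nonnegative numbers, for exponents \<open>a > 0\<close> only (so \<open>\<top>\<close> has power \<open>\<top>\<close>).\<close>
definition epowr :: "ennreal \<Rightarrow> real \<Rightarrow> ennreal" where
  "epowr x a = (if x = \<top> then \<top> else ennreal (enn2real x powr a))"

definition lp_norm :: "ennreal \<Rightarrow> (int \<Rightarrow> real) \<Rightarrow> ennreal" where
  "lp_norm p f =
     (if p = \<top> then (SUP n. ennreal \<bar>f n\<bar>)
      else epowr (\<Sum>\<^sub>\<infinity>n\<in>UNIV. ennreal (\<bar>f n\<bar> powr enn2real p)) (1 / enn2real p))"

text \<open>The space \<open>\<ell>\<^sup>q(\<int>, \<mu>)\<close> for \<open>\<mu> = \<Sum>\<^sub>n (1 + |n|)\<^sup>-\<^sup>1 \<delta>\<^sub>n\<close>.\<close>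
definition lq_mu :: "ennreal \<Rightarrow> (int \<Rightarrow> real) set" where
  "lq_mu q = {g. if q = \<top> then bounded (range g)
                 else (\<lambda>n. \<bar>g n\<bar> powr enn2real q * (1 / (1 + \<bar>real_of_int n\<bar>))) summable_on UNIV}"

definition growth :: "real \<Rightarrow> ennreal \<Rightarrow> (int \<Rightarrow> real) \<Rightarrow> bool" where
  "growth \<alpha> q f \<longleftrightarrow> (\<lambda>n. f n / (1 + \<bar>real_of_int n\<bar> powr \<alpha>)) \<in> lq_mu q"

definition delta_right :: "(int \<Rightarrow> real) \<Rightarrow> int \<Rightarrow> real" where
  "delta_right f n = f n - f (n + 1)"

text \<open>
  For \<open>q < \<infinity>\<close> this is \<open>\<Sum>\<^sub>j N(j)\<^sup>q / |j|\<close> over \<open>j \<noteq> 0\<close>, without the root \<open>1/q\<close>.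
\<close>
definition jump_size :: "ennreal \<Rightarrow> (int \<Rightarrow> ennreal) \<Rightarrow> ennreal" where
  "jump_size q N =
     (if q = \<top> then (SUP j\<in>-{0}. N j)
      else (\<Sum>\<^sub>\<infinity>j\<in>-{0}. epowr (N j) (enn2real q) * ennreal (1 / \<bar>real_of_int j\<bar>)))"

text \<open>The discrete Besov space \<open>C\<^sup>\<alpha>\<^sup>,\<^sup>p\<^sup>,\<^sup>q(\<int>)\<close>, used only for \<open>\<alpha> > 0\<close> not an integer.\<close>
definition Besov :: "real \<Rightarrow> ennreal \<Rightarrow> ennreal \<Rightarrow> (int \<Rightarrow> real) set" where
  "Besov \<alpha> p q =
     {f. let l = nat \<lfloor>\<alpha>\<rfloor>; g = (delta_right ^^ l) f in
         jump_size q (\<lambda>j. lp_norm p (\<lambda>n. (g (n + j) - g n) / \<bar>real_of_int j\<bar> powr (\<alpha> - real l))) < \<top>}"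

text \<open>The class \<open>Z\<^sup>\<alpha>\<^sup>,\<^sup>p\<^sup>,\<^sup>q(\<int>)\<close>, used only for integers \<open>\<alpha> \<ge> 1\<close> (so \<open>nat \<lfloor>\<alpha>\<rfloor>\<close> is \<open>\<alpha>\<close>).\<close>
definition Zygmund :: "real \<Rightarrow> ennreal \<Rightarrow> ennreal \<Rightarrow> (int \<Rightarrow> real) set" where
  "Zygmund \<alpha> p q =
     {f. growth \<alpha> q f \<and>
         (let g = (delta_right ^^ (nat \<lfloor>\<alpha>\<rfloor> - 1)) f in
          jump_size q (\<lambda>j. lp_norm p (\<lambda>n. (g (n - j) - 2 * g n + g (n + j)) / \<bar>real_of_int j\<bar>)) < \<top>)}"

text \<open>
  Modified Bessel function of the first kind and integer order \<open>n\<close>, for \<open>x > 0\<close>: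
  \<open>I\<^sub>n(x) = \<Sum>\<^sub>m (x/2)\<^sup>2\<^sup>m\<^sup>+\<^sup>n / (m! \<Gamma>(m + n + 1))\<close>.  As \<^const>\<open>rGamma\<close> is the entire function \<open>1/\<Gamma>\<close>,
  terms at the poles of \<open>\<Gamma>\<close> vanish and negative orders need no separate case.
\<close>
definition Bessel_I :: "int \<Rightarrow> real \<Rightarrow> real" where
  "Bessel_I n x = (\<Sum>m. (x / 2) powi (2 * int m + n) * rGamma (real m + real_of_int n + 1) / fact m)"

definition heat_kernel :: "real \<Rightarrow> int \<Rightarrow> real" where
  "heat_kernel t n = exp (- 2 * t) * Bessel_I n (2 * t)"

definition heat :: "real \<Rightarrow> (int \<Rightarrow> real) \<Rightarrow> int \<Rightarrow> real" where
  "heat t f n = (\<Sum>\<^sub>\<infinity>j\<in>UNIV. heat_kernel t (n - j) * f j)"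

definition poisson :: "real \<Rightarrow> (int \<Rightarrow> real) \<Rightarrow> int \<Rightarrow> real" where
  "poisson y f n =
     y / (2 * sqrt pi) * (LBINT t:{0<..}. exp (- (y\<^sup>2) / (4 * t)) / t powr (3 / 2) * heat t f n)"

text \<open>The measure \<open>dt/t\<close> on \<open>(0, \<infinity>)\<close>.\<close>
definition dt_over_t :: "real measure" where
  "dt_over_t = density (restrict_space lborel {0<..}) (\<lambda>t. ennreal (1 / t))"

definition mixed_norm :: "ennreal \<Rightarrow> ennreal \<Rightarrow> (real \<Rightarrow> int \<Rightarrow> real) \<Rightarrow> ennreal" where
  "mixed_norm p q F =
     (if q = \<top> then esssup dt_over_t (\<lambda>t. lp_norm p (F t))
      else epowr (\<integral>\<^sup>+t. epowr (lp_norm p (F t)) (enn2real q) \<partial>dt_over_t) (1 / enn2real q))"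

definition Lambda_H :: "real \<Rightarrow> ennreal \<Rightarrow> ennreal \<Rightarrow> (int \<Rightarrow> real) set" where
  "Lambda_H \<alpha> p q =
     {f. growth \<alpha> q f \<and>
         (let k = nat \<lfloor>\<alpha> / 2\<rfloor> + 1 in
          mixed_norm p q (\<lambda>t n. t powr (real k - \<alpha> / 2) * (deriv ^^ k) (\<lambda>s. heat s f n) t) < \<top>)}"

definition poisson_admissible :: "(int \<Rightarrow> real) \<Rightarrow> bool" where
  "poisson_admissible f \<longleftrightarrow> (\<lambda>n. \<bar>f n\<bar> / (1 + \<bar>real_of_int n\<bar>\<^sup>2)) summable_on UNIV"

definition Lambda_P :: "real \<Rightarrow> ennreal \<Rightarrow> ennreal \<Rightarrow> (int \<Rightarrow> real) set" where
  "Lambda_P \<alpha> p q =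
     {f. poisson_admissible f \<and>
         (let l = nat \<lfloor>\<alpha>\<rfloor> + 1 in
          mixed_norm p q (\<lambda>y n. y powr (real l - \<alpha>) * (deriv ^^ l) (\<lambda>s. poisson s f n) y) < \<top>)}"

end

theory Submission
  imports Defs "HOL-Computational_Algebra.Polynomial"
begin

text \<open>
  Every seminorm here is an \<open>L\<^sup>q\<close> norm with respect to a scale-invariant measure (\<open>1/|j|\<close> on the nonzero
  integers, \<open>dt/t\<close> on the half line) of the \<open>\<ell>\<^sup>p\<close> norm of a difference of \<open>f\<close>, or of a time derivative of its
  heat or Poisson extension.  One seminorm is passed to another by dominating its \<open>\<ell>\<^sup>p\<close> norm by an integral of
  the other one against a kernel that decays in the ratio of the two scales; a Schur test does the rest.

  Derivatives of the heat extension are averages of differences against derivatives of the heat kernel.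
  Conversely, differences of \<open>g\<close> are time integrals of \<open>\<Delta>e\<^sup>s\<^sup>\<Delta>g\<close>, and derivatives of high order control those of
  lower order because the growth condition forces the latter to vanish as \<open>t\<close> tends to infinity.

  The Poisson semigroup is an average of the heat semigroup, which gives one direction.  For the other,
  \<open>V(y) = P\<^sub>y \<Delta>\<^sup>k e\<^sup>t\<^sup>\<Delta> f\<close> tends to a multiple of \<open>\<Delta>\<^sup>k e\<^sup>t\<^sup>\<Delta> f\<close> as \<open>y\<close> tends to \<open>0\<close>, and on an interval of length
  \<open>\<surd>t\<close> it is bounded, by interpolation, by integrals of \<open>e\<^sup>t\<^sup>\<Delta> \<partial>\<^sub>y\<^sup>l P\<^sub>y f\<close> and \<open>\<Delta>\<^sup>k e\<^sup>t\<^sup>\<Delta> \<partial>\<^sub>y\<^sup>l P\<^sub>y f\<close>.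
\<close>

text \<open>No Fourier analysis enters. The Laplacian is a sum of two commuting one-sided
  differences, so the heat kernel is the convolution of a Poisson distribution with its mirror
  image. Exponentially tilted l^1 norms are submultiplicative under convolution and explicit for
  Poisson weights; the gain of \<open>t powr (- 1/2)\<close> per difference and the tails on the
  scale \<open>max 1 (sqrt t)\<close> both come from them. Only finiteness of norms is at stake, so
  the inequalities of Jensen and Minkowski are proved with a spare factor 2. Two mismatches shape
  the rest. Time derivatives of the heat extension are differences of even order 2k, while the
  spaces call for an order that may be odd; seminorms are therefore moved one difference up by
  smoothing and two down by integration in time. And growth at infinity is imposed in the heat and
  Zygmund spaces but not in the Besov space, and only through the summability condition in the
  Poisson space; it has to be recovered from the seminorm itself, with \<alpha> = 1 as the delicate
  case.\<close>

abbreviation (input) mag :: "int \<Rightarrow> real" where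
  "mag j \<equiv> \<bar>real_of_int j\<bar>"

text \<open>The tail of the heat kernel at time \<open>t\<close>: its width is
  \<open>sqrt t\<close>, but never less than the lattice spacing 1.\<close>

abbreviation (input) decay :: "real \<Rightarrow> int \<Rightarrow> real" where
  "decay t j \<equiv> exp (- (1 / (2 * max 1 (sqrt t)) * mag j))"

abbreviation (input) int_sum :: "(int \<Rightarrow> ennreal) \<Rightarrow> ennreal" (binder \<open>\<Sum>\<^sup>+\<close> [61] 61) where
  "int_sum f \<equiv> nn_integral (count_space UNIV) f"

section \<open>Extended powers and discrete norms\<close>

lemma epowr_ennreal: "0 \<le> x \<Longrightarrow> epowr (ennreal x) a = ennreal (x powr a)"
  by (simp add: epowr_def)

lemma epowr_top [simp]: "epowr \<top> a = \<top>"
  by (simp add: epowr_def)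

lemma epowr_zero [simp]: "epowr 0 a = 0"
  by (simp add: epowr_def)

lemma epowr_one_right [simp]: "epowr x 1 = x"
  by (cases x) (auto simp: epowr_def)

lemma epowr_eq_0_iff [simp]: "epowr x a = 0 \<longleftrightarrow> x = 0"
  by (cases x) (auto simp: epowr_def ennreal_eq_0_iff)

lemma epowr_less_top_iff [simp]: "epowr x a < \<top> \<longleftrightarrow> x < \<top>"
  by (auto simp: epowr_def top.not_eq_extremum)

lemma epowr_eq_top_iff [simp]: "epowr x a = \<top> \<longleftrightarrow> x = \<top>"
  by (auto simp: epowr_def)

lemma epowr_mono: "x \<le> y \<Longrightarrow> 0 \<le> a \<Longrightarrow> epowr x a \<le> epowr y a"
  unfolding epowr_def
  by (auto simp: top_unique top.not_eq_extremum enn2real_mono intro!: ennreal_leI powr_mono2)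

lemma epowr_mult: "epowr (x * y) a = epowr x a * epowr y a"
  by (cases x; cases y) 
     (auto simp: epowr_ennreal ennreal_mult[symmetric] powr_mult ennreal_top_mult ennreal_mult_top ennreal_eq_0_iff)

lemma epowr_epowr: "epowr (epowr x a) b = epowr x (a * b)"
  by (cases x) (auto simp: epowr_ennreal powr_powr)

lemma epowr_measurable [measurable]:
  assumes [measurable]: "f \<in> borel_measurable M"
  shows "(\<lambda>x. epowr (f x) a) \<in> borel_measurable M"
  unfolding epowr_def by measurable

lemma enn2real_ge_1:
  assumes "1 \<le> (p::ennreal)" "p \<noteq> \<top>" shows "1 \<le> enn2real p"
  using assms by (cases p) auto

text \<open>Jensen's inequality for a weight of mass at most \<open>A\<close>, up to the factor
  \<open>2 powr q\<close>. It rests on x <= c + c^(1-q) x^q, which holds for every c > 0: either x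
  <= c, or x = x^(1-q) x^q <= c^(1-q) x^q. The degenerate values 0 and \<infinity> of the mass and
  of the right-hand integral are split off.\<close>

lemma epowr_weighted_integral_le:
  assumes [measurable]: "w \<in> borel_measurable M" "u \<in> borel_measurable M"
    and A: "(\<integral>\<^sup>+x. w x \<partial>M) \<le> A" and q: "1 \<le> q"
  shows "epowr (\<integral>\<^sup>+x. w x * u x \<partial>M) q \<le>
    ennreal (2 powr q) * epowr A (q - 1) * (\<integral>\<^sup>+x. w x * epowr (u x) q \<partial>M)"
    (is "?L \<le> _ * _ * ?R")
proof (cases "A = 0 \<or> ?R = 0")
  case True
  then have "AE x in M. w x * u x = 0"
  proof
    assume "A = 0"
    then have "AE x in M. w x = 0" using A by (subst nn_integral_0_iff_AE[symmetric]) auto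
    then show ?thesis by eventually_elim simp
  next
    assume "?R = 0"
    then have "AE x in M. w x * epowr (u x) q = 0" by (subst nn_integral_0_iff_AE[symmetric]) auto
    then show ?thesis by eventually_elim auto
  qed
  then have "(\<integral>\<^sup>+x. w x * u x \<partial>M) = 0" by (subst nn_integral_0_iff_AE) auto
  then show ?thesis by simp
next
  case F: False
  show ?thesis
  proof (cases "A = \<top> \<or> ?R = \<top>")
    case True
    then have "ennreal (2 powr q) * epowr A (q - 1) * ?R = \<top>"
      using F by (auto simp: ennreal_mult_eq_top_iff ennreal_eq_0_iff)
    then show ?thesis by simp
  next
    case False
    then obtain a r where ar: "A = ennreal a" "?R = ennreal r" "0 < a" "0 < r"
      using F by (metis ennreal_cases ennreal_eq_0_iff linorder_not_less)
    \<comment> \<open>This \<open>c\<close> balances the two halves: \<open>c * a\<close> equals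
      \<open>c powr (1 - q) * r\<close>.\<close>
    define c where "c = (r / a) powr (1 / q)"
    have c: "0 < c" using ar by (simp add: c_def)
    have pt: "x \<le> ennreal c + ennreal (c powr (1 - q)) * epowr x q" for x
    proof (cases x)
      case (real y)
      have "y \<le> c + c powr (1 - q) * y powr q"
      proof (cases "y \<le> c")
        case False
        then have "y = y powr (1 - q) * y powr q"
          using c by (simp add: powr_add[symmetric])
        also have "\<dots> \<le> c powr (1 - q) * y powr q"
          using False c q by (intro mult_right_mono powr_mono2') auto
        finally show ?thesis using c by simp
      qed (use c in \<open>simp add: add_increasing2\<close>)
      then show ?thesis using real c
        by (simp add: epowr_ennreal ennreal_mult[symmetric] ennreal_plus[symmetric] ennreal_leI del: ennreal_plus)
    qed (use c in \<open>simp add: ennreal_mult_top\<close>)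
    have "(\<integral>\<^sup>+x. w x * u x \<partial>M) \<le> (\<integral>\<^sup>+x. ennreal c * w x + ennreal (c powr (1 - q)) * (w x * epowr (u x) q) \<partial>M)"
      using mult_left_mono[OF pt, of "w _" "u _"]
      by (intro nn_integral_mono) (auto simp: algebra_simps)
    also have "\<dots> = ennreal c * (\<integral>\<^sup>+x. w x \<partial>M) + ennreal (c powr (1 - q)) * ?R"
      by (simp add: nn_integral_add nn_integral_cmult)
    also have "\<dots> \<le> ennreal c * A + ennreal (c powr (1 - q)) * ?R"
      using A by (intro add_right_mono mult_left_mono) auto
    also have "\<dots> = ennreal (c * a + c powr (1 - q) * r)"
      using ar c by (simp add: ennreal_mult[symmetric] ennreal_plus[symmetric] del: ennreal_plus)
    also have "c * a = 2 * (c * a) / 2" by simp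
    also have "c powr (1 - q) * r = c * a"
    proof -
      have "c powr (1 - q) = c * c powr (- q)" using c by (simp add: powr_diff powr_minus field_simps)
      also have "c powr (- q) = a / r" using ar q unfolding c_def
        by (simp add: powr_powr powr_minus)
      finally show ?thesis using ar by simp
    qed
    finally have *: "(\<integral>\<^sup>+x. w x * u x \<partial>M) \<le> ennreal (2 * (c * a))" by (simp add: mult.commute)
    have "?L \<le> epowr (ennreal (2 * (c * a))) q" by (intro epowr_mono *) (use q in auto)
    also have "\<dots> = ennreal (2 powr q * (c powr q * a powr q))"
      using c ar by (simp add: epowr_ennreal powr_mult)
    also have "c powr q * a powr q = a powr (q - 1) * r"
      using ar q by (simp add: c_def powr_powr powr_diff field_simps)
    finally show ?thesis using ar by (simp add: epowr_ennreal ennreal_mult[symmetric] mult.assoc)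
  qed
qed

text \<open>Both sides are the supremum of finite partial sums. With sums as integrals over counting
  measure, monotone convergence and Tonelli become available for the norms of the
  definitions.\<close>

lemma infsum_ennreal_eq_nn_integral:
  fixes f :: "int \<Rightarrow> ennreal"
  shows "(\<Sum>\<^sub>\<infinity>n\<in>A. f n) = (\<Sum>\<^sup>+n. f n * indicator A n)"
proof -
  define g where "g n = f n * indicator A n" for n
  define b where "b = from_nat_into (UNIV::int set)"
  have b: "bij_betw b UNIV UNIV" unfolding b_def
    by (intro bij_betw_from_nat_into) (auto simp: infinite_UNIV_int)
  have "(\<Sum>\<^sub>\<infinity>n\<in>A. f n) = (\<Sum>\<^sub>\<infinity>n\<in>UNIV. g n)"
    by (rule infsum_cong_neutral) (auto simp: g_def)
  also have "\<dots> = (SUP F\<in>{F. finite F \<and> F \<subseteq> UNIV}. sum g F)"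
    by (rule nonneg_infsum_complete) simp
  also have "\<dots> = (\<Sum>\<^sup>+n. g n)"
  proof (rule antisym)
    show "(SUP F\<in>{F. finite F \<and> F \<subseteq> UNIV}. sum g F) \<le> (\<Sum>\<^sup>+n. g n)"
    proof (intro SUP_least)
      fix F :: "int set" assume "F \<in> {F. finite F \<and> F \<subseteq> UNIV}"
      then have "sum g F = (\<Sum>\<^sup>+n. g n * indicator F n)"
        by (simp add: nn_integral_count_space_indicator[symmetric] nn_integral_count_space_finite)
      also have "\<dots> \<le> (\<Sum>\<^sup>+n. g n)"
        by (intro nn_integral_mono) (auto simp: indicator_def)
      finally show "sum g F \<le> \<dots>" .
    qed
    have "(\<Sum>\<^sup>+n. g n) = (\<Sum>n. g (b n))"
      using nn_integral_bij_count_space[OF b, of g] by (simp add: nn_integral_count_space_nat)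
    also have "\<dots> = (SUP n. sum (\<lambda>i. g (b i)) {..<n})" by (simp add: suminf_eq_SUP)
    also have "\<dots> \<le> (SUP F\<in>{F. finite F \<and> F \<subseteq> UNIV}. sum g F)"
    proof (intro SUP_least)
      fix n
      have "sum (\<lambda>i. g (b i)) {..<n} = sum g (b ` {..<n})"
        using b by (subst sum.reindex) (auto simp: bij_betw_def intro: inj_on_subset)
      also have "\<dots> \<le> (SUP F\<in>{F. finite F \<and> F \<subseteq> UNIV}. sum g F)"
        by (intro SUP_upper) auto
      finally show "sum (\<lambda>i. g (b i)) {..<n} \<le> \<dots>" .
    qed
    finally show "(\<Sum>\<^sup>+n. g n) \<le> (SUP F\<in>{F. finite F \<and> F \<subseteq> UNIV}. sum g F)" .
  qed
  finally show ?thesis by (simp add: g_def)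
qed

section \<open>Norms of sequences and Minkowski's inequality\<close>

lemma lp_norm_top: "lp_norm \<top> f = (SUP n. ennreal \<bar>f n\<bar>)"
  by (simp add: lp_norm_def)

lemma lp_norm_finite_exponent:
  assumes "p \<noteq> \<top>"
  shows "lp_norm p f =
    epowr (\<Sum>\<^sup>+n. epowr (ennreal \<bar>f n\<bar>) (enn2real p)) (1 / enn2real p)"
  using assms by (simp add: lp_norm_def infsum_ennreal_eq_nn_integral epowr_ennreal)

lemma lp_norm_mono:
  assumes "\<And>n. \<bar>f n\<bar> \<le> \<bar>g n\<bar>"
  shows "lp_norm p f \<le> lp_norm p g"
proof (cases "p = \<top>")
  case True
  then show ?thesis using assms by (auto simp: lp_norm_top intro!: SUP_mono ennreal_leI)
next
  case False
  then show ?thesis using assms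
    by (auto simp: lp_norm_finite_exponent intro!: epowr_mono nn_integral_mono ennreal_leI)
qed

lemma lp_norm_cmult:
  assumes "1 \<le> p"
  shows "lp_norm p (\<lambda>n. c * f n) = ennreal \<bar>c\<bar> * lp_norm p f"
proof (cases "p = \<top>")
  case True
  then show ?thesis by (simp add: lp_norm_top abs_mult ennreal_mult SUP_mult_left_ennreal)
next
  case False
  then show ?thesis using enn2real_ge_1[OF assms False]
    by (simp add: lp_norm_finite_exponent abs_mult ennreal_mult epowr_mult nn_integral_cmult epowr_epowr)
qed

lemma lp_norm_reindex:
  assumes "bij s"
  shows "lp_norm p (\<lambda>n. f (s n)) = lp_norm p f"
proof (cases "p = \<top>")
  case True
  have "(SUP n. ennreal \<bar>f (s n)\<bar>) = (SUP n\<in>s ` UNIV. ennreal \<bar>f n\<bar>)"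
    by (simp add: image_comp)
  then show ?thesis using True bij_is_surj[OF assms] by (simp add: lp_norm_top)
next
  case False
  then show ?thesis
    using nn_integral_bij_count_space[OF assms, of "\<lambda>n. epowr (ennreal \<bar>f n\<bar>) (enn2real p)"]
    by (simp add: lp_norm_finite_exponent)
qed

lemma bij_int_add: "bij (\<lambda>n::int. n + c)"
  by (rule bij_betw_byWitness[where f' = "\<lambda>n. n - c"]) auto

lemma bij_int_diff: "bij (\<lambda>n::int. c - n)"
  by (rule bij_betw_byWitness[where f' = "\<lambda>n. c - n"]) auto

lemma lp_norm_shift: "lp_norm p (\<lambda>n. f (n + c)) = lp_norm p f"
  by (rule lp_norm_reindex[OF bij_int_add])

lemma lp_norm_shift_diff: "lp_norm p (\<lambda>n. f (n - c)) = lp_norm p f"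
  using lp_norm_shift[of p f "- c"] by simp

lemma abs_le_lp_norm:
  assumes "1 \<le> p"
  shows "ennreal \<bar>f n\<bar> \<le> lp_norm p f"
proof (cases "p = \<top>")
  case True
  then show ?thesis by (auto simp: lp_norm_top intro: SUP_upper)
next
  case False
  note p = enn2real_ge_1[OF assms False]
  have "epowr (ennreal \<bar>f n\<bar>) (enn2real p) = (\<Sum>\<^sup>+k. epowr (ennreal \<bar>f n\<bar>) (enn2real p) * indicator {n} k)"
    by (simp add: nn_integral_cmult_indicator)
  also have "\<dots> \<le> (\<Sum>\<^sup>+k. epowr (ennreal \<bar>f k\<bar>) (enn2real p))"
    by (intro nn_integral_mono) (auto simp: indicator_def)
  finally have "epowr (epowr (ennreal \<bar>f n\<bar>) (enn2real p)) (1 / enn2real p) \<le> lp_norm p f"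
    using p by (simp add: lp_norm_finite_exponent False epowr_mono)
  then show ?thesis using p by (simp add: epowr_epowr)
qed

lemma borel_measurable_nn_integral_int:
  fixes F :: "'a \<Rightarrow> int \<Rightarrow> ennreal"
  assumes [measurable]: "\<And>n. (\<lambda>x. F x n) \<in> borel_measurable M"
  shows "(\<lambda>x. \<Sum>\<^sup>+n. F x n) \<in> borel_measurable M"
proof -
  define b where "b = from_nat_into (UNIV::int set)"
  have b: "bij_betw b UNIV UNIV" unfolding b_def
    by (intro bij_betw_from_nat_into) (auto simp: infinite_UNIV_int)
  have "(\<Sum>\<^sup>+n. F x n) = (\<Sum>n. F x (b n))" for x
    using nn_integral_bij_count_space[OF b, of "F x"] by (simp add: nn_integral_count_space_nat)
  then show ?thesis by simp
qed

lemma lp_norm_measurable [measurable (raw)]: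
  assumes [measurable]: "\<And>n. (\<lambda>x. F x n) \<in> borel_measurable M"
  shows "(\<lambda>x. lp_norm p (F x)) \<in> borel_measurable M"
proof (cases "p = \<top>")
  case True
  then show ?thesis by (simp add: lp_norm_top)
next
  case False
  then show ?thesis
    by (simp add: lp_norm_finite_exponent)
       (intro epowr_measurable borel_measurable_nn_integral_int; measurable)
qed

text \<open>Tonelli without sigma-finiteness of \<open>M\<close>: enumerating the integers turns the
  outer integral into a series.\<close>

lemma nn_integral_int_swap:
  fixes F :: "'a \<Rightarrow> int \<Rightarrow> ennreal"
  assumes [measurable]: "\<And>n. (\<lambda>x. F x n) \<in> borel_measurable M"
  shows "(\<Sum>\<^sup>+n. \<integral>\<^sup>+x. F x n \<partial>M) = (\<integral>\<^sup>+x. \<Sum>\<^sup>+n. F x n \<partial>M)"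
proof -
  define b where "b = from_nat_into (UNIV::int set)"
  have b: "bij_betw b UNIV UNIV" unfolding b_def
    by (intro bij_betw_from_nat_into) (auto simp: infinite_UNIV_int)
  have *: "(\<Sum>\<^sup>+n. G n) = (\<Sum>n. G (b n))" for G
    using nn_integral_bij_count_space[OF b, of G] by (simp add: nn_integral_count_space_nat)
  show ?thesis unfolding * by (subst nn_integral_suminf) auto
qed

text \<open>Minkowski's integral inequality with constant 2. Writing
  \<open>\<bar>F x n\<bar> = w x * v n x\<close> with \<open>w x\<close> the l^p norm of
  \<open>F x\<close>, the p-th powers of \<open>v n x\<close> sum to 1 over \<open>n\<close>
  wherever 0 < \<open>w x\<close> < \<infinity>. Jensen with weight \<open>w\<close> for each
  \<open>n\<close>, followed by summation over \<open>n\<close>, gives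
  \<open>epowr (2 * A) r\<close> for the total mass \<open>A\<close> of \<open>w\<close>.\<close>

lemma lp_norm_nn_integral_le:
  assumes [measurable]: "\<And>n. (\<lambda>x. F x n) \<in> borel_measurable M" and p: "1 \<le> p"
    and le: "\<And>n. ennreal \<bar>u n\<bar> \<le> (\<integral>\<^sup>+x. ennreal \<bar>F x n\<bar> \<partial>M)"
  shows "lp_norm p u \<le> 2 * (\<integral>\<^sup>+x. lp_norm p (F x) \<partial>M)"
proof (cases "p = \<top>")
  case True
  have "lp_norm p u \<le> (\<integral>\<^sup>+x. lp_norm p (F x) \<partial>M)"
    unfolding True lp_norm_top
  proof (intro SUP_least)
    fix n
    have "(\<integral>\<^sup>+x. ennreal \<bar>F x n\<bar> \<partial>M) \<le> (\<integral>\<^sup>+x. (SUP n. ennreal \<bar>F x n\<bar>) \<partial>M)"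
      by (intro nn_integral_mono SUP_upper) auto
    then show "ennreal \<bar>u n\<bar> \<le> (\<integral>\<^sup>+x. (SUP n. ennreal \<bar>F x n\<bar>) \<partial>M)"
      using le[of n] by order
  qed
  also have "\<dots> \<le> 2 * \<dots>" by (simp add: mult_2)
  finally show ?thesis .
next
  case False
  note p1 = enn2real_ge_1[OF p False]
  define r where "r = enn2real p"
  define w where "w x = lp_norm p (F x)" for x
  have [measurable]: "w \<in> borel_measurable M" unfolding w_def by measurable
  define A where "A = (\<integral>\<^sup>+x. w x \<partial>M)"
  show ?thesis
  proof (cases "A = \<top>")
    case False
    define v where "v n x = ennreal \<bar>F x n\<bar> / w x" for n x
    have [measurable]: "v n \<in> borel_measurable M" for n unfolding v_def by measurable
    have AE: "AE x in M. w x \<noteq> \<top>"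
      using nn_integral_PInf_AE[of w M] False unfolding A_def infinity_ennreal_def by auto
    have wF: "ennreal \<bar>F x n\<bar> \<le> w x" for x n unfolding w_def by (rule abs_le_lp_norm[OF p])
    have Fv: "ennreal \<bar>F x n\<bar> = w x * v n x" if wx: "w x \<noteq> \<top>" for x n
    proof (cases "w x = 0")
      case True then show ?thesis using wF[of x n] by simp
    next
      case False
      then obtain r where "w x = ennreal r" "0 < r"
        using wx by (cases "w x") auto
      then have "w x * v n x = ennreal (r * (\<bar>F x n\<bar> / r))"
        unfolding v_def by (simp only: divide_ennreal abs_ge_zero) (subst ennreal_mult, auto)
      then show ?thesis using \<open>0 < r\<close> by simp
    qed
    have sumv: "(\<Sum>\<^sup>+n. w x * epowr (v n x) r) \<le> w x" if wx: "w x \<noteq> \<top>" for x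
    proof (cases "w x = 0")
      case False
      have "w x = epowr (epowr (w x) r) (1/r)" using p1 by (simp add: epowr_epowr r_def)
      have "epowr (w x) r = (\<Sum>\<^sup>+n. epowr (ennreal \<bar>F x n\<bar>) r)"
        using p1 \<open>p \<noteq> \<top>\<close> by (simp add: w_def lp_norm_finite_exponent epowr_epowr r_def)
      also have "\<dots> = epowr (w x) r * (\<Sum>\<^sup>+n. epowr (v n x) r)"
        by (simp add: Fv[OF wx] epowr_mult nn_integral_cmult)
      finally have "epowr (w x) r * 1 = epowr (w x) r * (\<Sum>\<^sup>+n. epowr (v n x) r)" by simp
      then have "(\<Sum>\<^sup>+n. epowr (v n x) r) = 1"
        using False wx by (subst (asm) ennreal_mult_cancel_left) auto
      then show ?thesis by (simp add: nn_integral_cmult)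
    qed simp
    have "(\<Sum>\<^sup>+n. epowr (ennreal \<bar>u n\<bar>) r)
        \<le> (\<Sum>\<^sup>+n. ennreal (2 powr r) * epowr A (r - 1) * (\<integral>\<^sup>+x. w x * epowr (v n x) r \<partial>M))"
    proof (intro nn_integral_mono)
      fix n
      have "(\<integral>\<^sup>+x. ennreal \<bar>F x n\<bar> \<partial>M) = (\<integral>\<^sup>+x. w x * v n x \<partial>M)"
        using AE by (intro nn_integral_cong_AE) (auto elim!: eventually_mono simp: Fv)
      then have "epowr (ennreal \<bar>u n\<bar>) r \<le> epowr (\<integral>\<^sup>+x. w x * v n x \<partial>M) r"
        using le[of n] p1 by (intro epowr_mono) (auto simp: r_def)
      also have "\<dots> \<le> ennreal (2 powr r) * epowr A (r - 1) * (\<integral>\<^sup>+x. w x * epowr (v n x) r \<partial>M)"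
        by (rule epowr_weighted_integral_le) (use p1 in \<open>auto simp: A_def r_def\<close>)
      finally show "epowr (ennreal \<bar>u n\<bar>) r \<le> \<dots>" .
    qed
    also have "\<dots> = ennreal (2 powr r) * epowr A (r - 1) * (\<integral>\<^sup>+x. \<Sum>\<^sup>+n. w x * epowr (v n x) r \<partial>M)"
      by (subst nn_integral_cmult) (auto simp: nn_integral_int_swap)
    also have "\<dots> \<le> ennreal (2 powr r) * epowr A (r - 1) * A"
      unfolding A_def using AE
      by (intro mult_left_mono nn_integral_mono_AE) (auto elim!: eventually_mono intro: sumv)
    also have "\<dots> \<le> ennreal (2 powr r) * epowr A r"
      using \<open>A \<noteq> \<top>\<close> p1 by (cases A) (auto simp: epowr_ennreal ennreal_mult[symmetric] powr_diff r_def field_simps)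
    also have "\<dots> = epowr (2 * A) r"
      by (simp add: epowr_mult) (metis epowr_ennreal ennreal_numeral zero_le_numeral)
    finally have "lp_norm p u \<le> epowr (epowr (2 * A) r) (1 / r)"
      using p1 \<open>p \<noteq> \<top>\<close> by (simp add: lp_norm_finite_exponent r_def epowr_mono)
    then show ?thesis using p1 by (simp add: epowr_epowr r_def A_def w_def)
  qed (simp add: A_def w_def ennreal_mult_top)
qed

text \<open>Minkowski over a finite counting measure: the constant stays 2 however many summands
  there are.\<close>

lemma lp_norm_sum_le:
  assumes "finite I" and p: "1 \<le> p" and le: "\<And>n. \<bar>u n\<bar> \<le> (\<Sum>i\<in>I. \<bar>F i n\<bar>)"
  shows "lp_norm p u \<le> 2 * (\<Sum>i\<in>I. lp_norm p (F i))"
proof -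
  have "lp_norm p u \<le> 2 * (\<integral>\<^sup>+i. lp_norm p (F i) \<partial>count_space I)"
  proof (rule lp_norm_nn_integral_le[OF _ p])
    fix n
    have "ennreal \<bar>u n\<bar> \<le> ennreal (\<Sum>i\<in>I. \<bar>F i n\<bar>)" using le by (rule ennreal_leI)
    also have "\<dots> = (\<integral>\<^sup>+i. ennreal \<bar>F i n\<bar> \<partial>count_space I)"
      using assms(1) by (simp add: nn_integral_count_space_finite)
    finally show "ennreal \<bar>u n\<bar> \<le> \<dots>" .
  qed simp
  then show ?thesis using assms(1) by (simp add: nn_integral_count_space_finite)
qed

section \<open>Scale-invariant measures and the Schur test\<close>

text \<open>An almost everywhere bound stands in for the essential supremum, so that domination
  (\<open>Lfin_mono\<close>) carries no measurability condition.\<close>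

definition Lfin :: "'a measure \<Rightarrow> ennreal \<Rightarrow> ('a \<Rightarrow> ennreal) \<Rightarrow> bool" where
  "Lfin M q \<Phi> \<longleftrightarrow>
    (if q = \<top> then \<exists>C<\<top>. AE x in M. \<Phi> x \<le> C else (\<integral>\<^sup>+x. epowr (\<Phi> x) (enn2real q) \<partial>M) < \<top>)"

lemma Lfin_mono:
  assumes "Lfin M q \<Psi>" "\<And>x. x \<in> space M \<Longrightarrow> \<Phi> x \<le> \<Psi> x"
  shows "Lfin M q \<Phi>"
proof (cases "q = \<top>")
  case True
  then obtain C where C: "C < \<top>" "AE x in M. \<Psi> x \<le> C" using assms(1) by (auto simp: Lfin_def)
  have "AE x in M. \<Phi> x \<le> C" using C(2) AE_space
  proof eventually_elim
    case (elim x)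
    then show ?case using assms(2)[of x] by simp
  qed
  then show ?thesis using True C(1) by (auto simp: Lfin_def)
next
  case False
  have "(\<integral>\<^sup>+x. epowr (\<Phi> x) (enn2real q) \<partial>M) \<le> (\<integral>\<^sup>+x. epowr (\<Psi> x) (enn2real q) \<partial>M)"
    by (intro nn_integral_mono epowr_mono assms(2)) auto
  then show ?thesis using assms(1) False by (auto simp: Lfin_def)
qed

lemma Lfin_cmult:
  assumes "Lfin M q \<Phi>" "c < \<top>" and [measurable]: "\<Phi> \<in> borel_measurable M"
  shows "Lfin M q (\<lambda>x. c * \<Phi> x)"
proof (cases "q = \<top>")
  case True
  then obtain C where C: "C < \<top>" "AE x in M. \<Phi> x \<le> C" using assms(1) by (auto simp: Lfin_def)
  then have "AE x in M. c * \<Phi> x \<le> c * C" by (auto elim!: eventually_mono intro: mult_left_mono)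
  then show ?thesis using True C(1) assms(2)
    by (auto simp: Lfin_def ennreal_mult_less_top intro!: exI[of _ "c * C"])
next
  case False
  then show ?thesis using assms(1,2)
    by (simp add: Lfin_def epowr_mult nn_integral_cmult ennreal_mult_less_top)
qed

lemma Lfin_add:
  assumes "Lfin M q \<Phi>" "Lfin M q \<Psi>" and q: "1 \<le> q"
    and [measurable]: "\<Phi> \<in> borel_measurable M" "\<Psi> \<in> borel_measurable M"
  shows "Lfin M q (\<lambda>x. \<Phi> x + \<Psi> x)"
proof (cases "q = \<top>")
  case True
  then obtain C D where C: "C < \<top>" "AE x in M. \<Phi> x \<le> C" "D < \<top>" "AE x in M. \<Psi> x \<le> D"
    using assms(1,2) by (auto simp: Lfin_def)
  from C(2,4) have "AE x in M. \<Phi> x + \<Psi> x \<le> C + D" by eventually_elim (rule add_mono)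
  then show ?thesis using True C by (auto simp: Lfin_def intro!: exI[of _ "C + D"])
next
  case False
  define r where "r = enn2real q"
  have r: "0 \<le> r" by (simp add: r_def)
  have *: "epowr (a + b) r \<le> epowr 2 r * (epowr a r + epowr b r)" for a b
  proof -
    have "epowr (a + b) r \<le> epowr (2 * max a b) r"
      by (intro epowr_mono) (auto simp: max_def mult_2 add_left_mono add_right_mono r)
    also have "\<dots> \<le> epowr 2 r * (epowr a r + epowr b r)"
      by (auto simp: epowr_mult max_def intro!: mult_left_mono)
    finally show ?thesis .
  qed
  have "(\<integral>\<^sup>+x. epowr (\<Phi> x + \<Psi> x) r \<partial>M) \<le> (\<integral>\<^sup>+x. epowr 2 r * (epowr (\<Phi> x) r + epowr (\<Psi> x) r) \<partial>M)"
    by (intro nn_integral_mono *)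
  also have "\<dots> = epowr 2 r * ((\<integral>\<^sup>+x. epowr (\<Phi> x) r \<partial>M) + (\<integral>\<^sup>+x. epowr (\<Psi> x) r \<partial>M))"
    by (simp add: nn_integral_cmult nn_integral_add)
  also have "\<dots> < \<top>" using assms(1,2) False by (auto simp: Lfin_def r_def ennreal_mult_less_top)
  finally show ?thesis using False by (simp add: Lfin_def r_def)
qed

text \<open>L^1 and L^\<infinity> together control every L^q, because \<Phi>^q <= C^(q-1)
  \<Phi>.\<close>

lemma Lfin_of_integrable_bounded:
  assumes q: "1 \<le> q" and int: "(\<integral>\<^sup>+x. \<Phi> x \<partial>M) < \<top>" and [measurable]: "\<Phi> \<in> borel_measurable M"
    and bnd: "\<And>x. x \<in> space M \<Longrightarrow> \<Phi> x \<le> ennreal C"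
  shows "Lfin M q \<Phi>"
proof (cases "q = \<top>")
  case True
  then show ?thesis using bnd by (auto simp: Lfin_def intro!: exI[of _ "ennreal C"])
next
  case False
  note r = enn2real_ge_1[OF q False]
  have "(\<integral>\<^sup>+x. epowr (\<Phi> x) (enn2real q) \<partial>M) \<le> (\<integral>\<^sup>+x. ennreal (\<bar>C\<bar> powr (enn2real q - 1)) * \<Phi> x \<partial>M)"
  proof (intro nn_integral_mono)
    fix x assume "x \<in> space M"
    then have b: "\<Phi> x \<le> ennreal \<bar>C\<bar>" using bnd ennreal_leI[of C "\<bar>C\<bar>"] by (meson abs_ge_self order_trans)
    then obtain y where y: "\<Phi> x = ennreal y" "0 \<le> y" by (cases "\<Phi> x") (auto simp: top_unique)
    then have "y \<le> \<bar>C\<bar>" using b by simp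
    have "y powr enn2real q \<le> \<bar>C\<bar> powr (enn2real q - 1) * y"
    proof (cases "y = 0")
      case False
      then have "y powr enn2real q = y powr (enn2real q - 1) * y" using y by (simp add: powr_diff)
      also have "\<dots> \<le> \<bar>C\<bar> powr (enn2real q - 1) * y"
        using y \<open>y \<le> \<bar>C\<bar>\<close> r by (intro mult_right_mono powr_mono2) auto
      finally show ?thesis .
    qed simp
    then show "epowr (\<Phi> x) (enn2real q) \<le> ennreal (\<bar>C\<bar> powr (enn2real q - 1)) * \<Phi> x"
      using y by (simp add: epowr_ennreal ennreal_mult[symmetric])
  qed
  also have "\<dots> = ennreal (\<bar>C\<bar> powr (enn2real q - 1)) * (\<integral>\<^sup>+x. \<Phi> x \<partial>M)" by (rule nn_integral_cmult) simp
  also have "\<dots> < \<top>" using int by (simp add: ennreal_mult_less_top)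
  finally show ?thesis using False by (simp add: Lfin_def)
qed

section \<open>Kernels decaying in a ratio of scales, and the Schur test\<close>

text \<open>The model kernel: power decay on both sides of ratio 1. Its invariance under inversion
  of the ratio lets the same function serve for both marginals in the Schur test.\<close>

definition kappa :: "real \<Rightarrow> real \<Rightarrow> real" where
  "kappa a x = min (x powr a) (x powr (- a))"

lemma kappa_nonneg [simp]: "0 \<le> kappa a x"
  by (simp add: kappa_def)

lemma kappa_inverse: "0 < x \<Longrightarrow> 0 < y \<Longrightarrow> kappa a (x / y) = kappa a (y / x)"
  by (simp add: kappa_def powr_divide powr_minus_divide min.commute)

lemma kappa_powr: "0 < x \<Longrightarrow> kappa a (x powr b) = kappa (a * b) x"
  by (simp add: kappa_def powr_powr mult.commute)

lemma kappa_cases: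
  assumes "0 < x" "0 < a"
  shows "kappa a x = (if x \<le> 1 then x powr a else x powr (- a))"
proof (cases "x \<le> 1")
  case True
  then show ?thesis using assms powr_mono'[of "- a" a x] by (simp add: kappa_def)
next
  case False
  then show ?thesis using assms powr_mono[of "- a" a x] by (simp add: kappa_def)
qed

lemma kappa_le_1:
  assumes "0 < x" "0 < a"
  shows "kappa a x \<le> 1"
proof (cases "x \<le> 1")
  case True
  then show ?thesis using assms by (simp add: kappa_cases powr_le1)
next
  case False
  then show ?thesis using assms powr_mono[of "- a" 0 x] by (simp add: kappa_cases)
qed

lemma kappa_measurable [measurable]: "kappa a \<in> borel_measurable borel"
  unfolding kappa_def by measurable

text \<open>
  The instances are \<open>dt/t\<close> with \<open>\<rho> t = t powr b\<close> and \<open>1/|j|\<close> on the nonzero integers with \<open>\<rho> j = |j|\<close>, so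
  that one Schur test transfers seminorms between continuous and discrete scales.
\<close>

definition scale_measure :: "'a measure \<Rightarrow> ('a \<Rightarrow> real) \<Rightarrow> bool" where
  "scale_measure M \<rho> \<longleftrightarrow> sigma_finite_measure M \<and> \<rho> \<in> borel_measurable M \<and> (\<forall>x\<in>space M. 0 < \<rho> x) \<and>
    (\<forall>a>0. \<exists>C. \<forall>r>0. (\<integral>\<^sup>+x. ennreal (kappa a (\<rho> x / r)) \<partial>M) \<le> ennreal C)"

lemma scale_measure_bound:
  assumes "scale_measure M \<rho>" "0 < a"
  obtains C where "0 < C" "\<And>r. 0 < r \<Longrightarrow> (\<integral>\<^sup>+x. ennreal (kappa a (\<rho> x / r)) \<partial>M) \<le> ennreal C"
proof -
  obtain C where C: "\<And>r. 0 < r \<Longrightarrow> (\<integral>\<^sup>+x. ennreal (kappa a (\<rho> x / r)) \<partial>M) \<le> ennreal C"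
    using assms unfolding scale_measure_def by blast
  have "ennreal C \<le> ennreal (max C 1)" by (rule ennreal_leI) simp
  then show thesis by (intro that[of "max C 1"]) (auto intro: order_trans[OF C])
qed

text \<open>For finite \<open>q\<close>: Jensen in \<open>x\<close>, where the kernel has mass at
  most \<open>A\<close> for every \<open>y\<close>; then Fubini, where by
  \<open>kappa_inverse\<close> the marginal in \<open>y\<close> is again a kernel of the same kind,
  of mass at most \<open>B\<close>. For q = \<infinity> the first marginal alone suffices.\<close>

theorem Lfin_schur:
  assumes M: "scale_measure M \<rho>" and N: "scale_measure N \<sigma>" and q: "1 \<le> q" and a: "0 < a"
    and [measurable]: "\<Psi> \<in> borel_measurable M" and \<Psi>: "Lfin M q \<Psi>"
    and le: "\<And>y. y \<in> space N \<Longrightarrow> \<Phi> y \<le> ennreal c * (\<integral>\<^sup>+x. ennreal (kappa a (\<rho> x / \<sigma> y)) * \<Psi> x \<partial>M)"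
  shows "Lfin N q \<Phi>"
proof -
  have [measurable]: "\<rho> \<in> borel_measurable M" "\<sigma> \<in> borel_measurable N"
    and pos: "\<And>x. x \<in> space M \<Longrightarrow> 0 < \<rho> x" "\<And>y. y \<in> space N \<Longrightarrow> 0 < \<sigma> y"
    using M N by (auto simp: scale_measure_def)
  interpret M: sigma_finite_measure M using M by (simp add: scale_measure_def)
  interpret N: sigma_finite_measure N using N by (simp add: scale_measure_def)
  interpret P: pair_sigma_finite M N ..
  obtain A where A: "0 < A" "\<And>r. 0 < r \<Longrightarrow> (\<integral>\<^sup>+x. ennreal (kappa a (\<rho> x / r)) \<partial>M) \<le> ennreal A"
    using scale_measure_bound[OF M a] by blast
  obtain B where B: "0 < B" "\<And>r. 0 < r \<Longrightarrow> (\<integral>\<^sup>+x. ennreal (kappa a (\<sigma> x / r)) \<partial>N) \<le> ennreal B"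
    using scale_measure_bound[OF N a] by blast
  show ?thesis
  proof (cases "q = \<top>")
    case True
    then obtain C where C: "C < \<top>" "AE x in M. \<Psi> x \<le> C" using \<Psi> by (auto simp: Lfin_def)
    have "\<Phi> y \<le> ennreal c * (ennreal A * C)" if y: "y \<in> space N" for y
    proof -
      have "(\<integral>\<^sup>+x. ennreal (kappa a (\<rho> x / \<sigma> y)) * \<Psi> x \<partial>M) \<le> (\<integral>\<^sup>+x. ennreal (kappa a (\<rho> x / \<sigma> y)) * C \<partial>M)"
        using C(2) by (intro nn_integral_mono_AE) (auto elim!: eventually_mono intro: mult_left_mono)
      also have "\<dots> = (\<integral>\<^sup>+x. ennreal (kappa a (\<rho> x / \<sigma> y)) \<partial>M) * C" by (rule nn_integral_multc) measurable
      also have "\<dots> \<le> ennreal A * C" using A(2) pos(2)[OF y] by (intro mult_right_mono) auto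
      finally show ?thesis using le[OF y] by (meson mult_left_mono order_trans zero_le)
    qed
    then show ?thesis using True C(1)
      by (auto simp: Lfin_def ennreal_mult_less_top intro!: exI[of _ "ennreal c * (ennreal A * C)"])
  next
    case False
    define r where "r = enn2real q"
    have r: "1 \<le> r" using enn2real_ge_1[OF q False] by (simp add: r_def)
    define K where "K = epowr (ennreal c) r * (ennreal (2 powr r) * epowr (ennreal A) (r - 1))"
    have K: "K < \<top>" by (simp add: K_def ennreal_mult_less_top)
    have "(\<integral>\<^sup>+y. epowr (\<Phi> y) r \<partial>N) \<le> (\<integral>\<^sup>+y. K * (\<integral>\<^sup>+x. ennreal (kappa a (\<rho> x / \<sigma> y)) * epowr (\<Psi> x) r \<partial>M) \<partial>N)"
    proof (intro nn_integral_mono)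
      fix y assume y: "y \<in> space N"
      have "epowr (\<Phi> y) r \<le> epowr (ennreal c * (\<integral>\<^sup>+x. ennreal (kappa a (\<rho> x / \<sigma> y)) * \<Psi> x \<partial>M)) r"
        using r by (intro epowr_mono le y) auto
      also have "\<dots> \<le> epowr (ennreal c) r * (ennreal (2 powr r) * epowr (ennreal A) (r - 1) *
          (\<integral>\<^sup>+x. ennreal (kappa a (\<rho> x / \<sigma> y)) * epowr (\<Psi> x) r \<partial>M))"
        unfolding epowr_mult using A(2) pos(2)[OF y] r
        by (intro mult_left_mono epowr_weighted_integral_le) auto
      finally show "epowr (\<Phi> y) r \<le> K * (\<integral>\<^sup>+x. ennreal (kappa a (\<rho> x / \<sigma> y)) * epowr (\<Psi> x) r \<partial>M)"
        by (simp add: K_def mult.assoc)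
    qed
    also have "\<dots> = K * (\<integral>\<^sup>+y. \<integral>\<^sup>+x. ennreal (kappa a (\<rho> x / \<sigma> y)) * epowr (\<Psi> x) r \<partial>M \<partial>N)"
      by (rule nn_integral_cmult) measurable
    also have "(\<integral>\<^sup>+y. \<integral>\<^sup>+x. ennreal (kappa a (\<rho> x / \<sigma> y)) * epowr (\<Psi> x) r \<partial>M \<partial>N) =
        (\<integral>\<^sup>+x. \<integral>\<^sup>+y. ennreal (kappa a (\<rho> x / \<sigma> y)) * epowr (\<Psi> x) r \<partial>N \<partial>M)"
      by (rule P.Fubini') measurable
    also have "\<dots> \<le> (\<integral>\<^sup>+x. ennreal B * epowr (\<Psi> x) r \<partial>M)"
    proof (intro nn_integral_mono)
      fix x assume x: "x \<in> space M"
      have "(\<integral>\<^sup>+y. ennreal (kappa a (\<rho> x / \<sigma> y)) * epowr (\<Psi> x) r \<partial>N) = 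
         (\<integral>\<^sup>+y. ennreal (kappa a (\<sigma> y / \<rho> x)) \<partial>N) * epowr (\<Psi> x) r"
        using pos x by (subst nn_integral_multc[symmetric]) (auto intro!: nn_integral_cong simp: kappa_inverse)
      also have "\<dots> \<le> ennreal B * epowr (\<Psi> x) r"
        using B(2) pos(1)[OF x] by (intro mult_right_mono) auto
      finally show "(\<integral>\<^sup>+y. ennreal (kappa a (\<rho> x / \<sigma> y)) * epowr (\<Psi> x) r \<partial>N) \<le> \<dots>" .
    qed
    also have "\<dots> = ennreal B * (\<integral>\<^sup>+x. epowr (\<Psi> x) r \<partial>M)" by (rule nn_integral_cmult) measurable
    finally have "(\<integral>\<^sup>+y. epowr (\<Phi> y) r \<partial>N) \<le> K * (ennreal B * (\<integral>\<^sup>+x. epowr (\<Psi> x) r \<partial>M))"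
      by (simp add: mult_left_mono)
    also have "\<dots> < \<top>" using K \<Psi> False by (simp add: Lfin_def r_def ennreal_mult_less_top)
    finally show ?thesis using False by (simp add: Lfin_def r_def)
  qed
qed

text \<open>The same Jensen argument at one fixed scale, with the kernel bounded by 1 afterwards. It
  extracts plain weighted summability from an L^q condition.\<close>

lemma Lfin_pairing:
  assumes M: "scale_measure M \<rho>" and q: "1 \<le> q" and a: "0 < a" and r0: "0 < r0"
    and [measurable]: "\<Psi> \<in> borel_measurable M" and \<Psi>: "Lfin M q \<Psi>"
  shows "(\<integral>\<^sup>+x. ennreal (kappa a (\<rho> x / r0)) * \<Psi> x \<partial>M) < \<top>"
proof -
  have [measurable]: "\<rho> \<in> borel_measurable M" and pos: "\<And>x. x \<in> space M \<Longrightarrow> 0 < \<rho> x"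
    using M by (auto simp: scale_measure_def)
  obtain A where A: "0 < A" "\<And>r. 0 < r \<Longrightarrow> (\<integral>\<^sup>+x. ennreal (kappa a (\<rho> x / r)) \<partial>M) \<le> ennreal A"
    using scale_measure_bound[OF M a] by blast
  show ?thesis
  proof (cases "q = \<top>")
    case True
    then obtain C where C: "C < \<top>" "AE x in M. \<Psi> x \<le> C" using \<Psi> by (auto simp: Lfin_def)
    have "(\<integral>\<^sup>+x. ennreal (kappa a (\<rho> x / r0)) * \<Psi> x \<partial>M) \<le> (\<integral>\<^sup>+x. ennreal (kappa a (\<rho> x / r0)) * C \<partial>M)"
      using C(2) by (intro nn_integral_mono_AE) (auto elim!: eventually_mono intro: mult_left_mono)
    also have "\<dots> = (\<integral>\<^sup>+x. ennreal (kappa a (\<rho> x / r0)) \<partial>M) * C" by (rule nn_integral_multc) measurable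
    also have "\<dots> \<le> ennreal A * C" using A(2) r0 by (intro mult_right_mono) auto
    also have "\<dots> < \<top>" using C by (simp add: ennreal_mult_less_top)
    finally show ?thesis .
  next
    case False
    define r where "r = enn2real q"
    have r: "1 \<le> r" using enn2real_ge_1[OF q False] by (simp add: r_def)
    have "epowr (\<integral>\<^sup>+x. ennreal (kappa a (\<rho> x / r0)) * \<Psi> x \<partial>M) r \<le>
       ennreal (2 powr r) * epowr (ennreal A) (r - 1) *
          (\<integral>\<^sup>+x. ennreal (kappa a (\<rho> x / r0)) * epowr (\<Psi> x) r \<partial>M)"
      using A(2) r0 r by (intro epowr_weighted_integral_le) auto
    also have "\<dots> \<le> ennreal (2 powr r) * epowr (ennreal A) (r - 1) * (\<integral>\<^sup>+x. epowr (\<Psi> x) r \<partial>M)"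
    proof (intro mult_left_mono nn_integral_mono)
      fix x assume "x \<in> space M"
      then have "ennreal (kappa a (\<rho> x / r0)) \<le> 1" using kappa_le_1[of "\<rho> x / r0" a] pos r0 a by simp
      then show "ennreal (kappa a (\<rho> x / r0)) * epowr (\<Psi> x) r \<le> epowr (\<Psi> x) r"
        using mult_right_mono[of "ennreal (kappa a (\<rho> x / r0))" 1 "epowr (\<Psi> x) r"] by simp
    qed auto
    also have "\<dots> < \<top>" using \<Psi> False by (simp add: Lfin_def r_def ennreal_mult_less_top)
    finally show ?thesis by simp
  qed
qed

section \<open>The measures dt/t and 1/|j|\<close>

lemma space_dt_over_t [simp]: "space dt_over_t = {0<..}"
  by (simp add: dt_over_t_def space_restrict_space)

lemma sets_dt_over_t [measurable_cong]: "sets dt_over_t = sets (restrict_space borel {0<..})"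
  by (auto simp: dt_over_t_def intro!: sets_restrict_space_cong)

lemma nn_integral_dt_over_t:
  assumes "\<phi> \<in> borel_measurable (restrict_space borel {0<..})"
  shows "(\<integral>\<^sup>+t. \<phi> t \<partial>dt_over_t) = (\<integral>\<^sup>+t. \<phi> t * ennreal (1 / t) * indicator {0<..} t \<partial>lborel)"
proof -
  have [measurable]: "\<phi> \<in> borel_measurable (restrict_space lborel {0<..})"
    using assms measurable_cong_sets[OF sets_restrict_space_cong[OF sets_lborel] refl] by blast
  have "(\<lambda>t. ennreal (1 / t)) \<in> borel_measurable (restrict_space lborel {(0::real)<..})"
    by (intro measurable_restrict_space1) measurable
  then show ?thesis unfolding dt_over_t_def
    by (subst nn_integral_density) (auto simp: nn_integral_restrict_space mult_ac)
qed

text \<open>Split at t = r: by scale invariance each half contributes exactly 1/a, whatever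
  \<open>r\<close> is.\<close>

lemma nn_integral_kappa_le:
  assumes a: "0 < a" and r: "0 < r"
  shows "(\<integral>\<^sup>+t. ennreal (kappa a (t / r) / t) * indicator {0<..} t \<partial>lborel) \<le> ennreal (2 / a)"
proof -
  have 1: "(\<integral>\<^sup>+t. ennreal (t powr (a - 1)) * indicator {0..r} t \<partial>lborel) = ennreal (r powr a / a)"
    using has_integral_powr_from_0[of "a - 1" r] a r by (intro nn_integral_has_integral_lebesgue') auto
  have 2: "(\<integral>\<^sup>+t. ennreal (t powr (- a - 1)) * indicator {r..} t \<partial>lborel) = ennreal (r powr (-a) / a)"
    using has_integral_powr_to_inf[of "- a - 1" r] a r by (intro nn_integral_has_integral_lebesgue') auto
  have "(\<integral>\<^sup>+t. ennreal (kappa a (t / r) / t) * indicator {0<..} t \<partial>lborel) \<le>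
    (\<integral>\<^sup>+t. ennreal (r powr (-a)) * (ennreal (t powr (a - 1)) * indicator {0..r} t) +
           ennreal (r powr a) * (ennreal (t powr (- a - 1)) * indicator {r..} t) \<partial>lborel)"
  proof (intro nn_integral_mono)
    fix t :: real
    show "ennreal (kappa a (t / r) / t) * indicator {0<..} t \<le>
      ennreal (r powr (-a)) * (ennreal (t powr (a - 1)) * indicator {0..r} t) +
           ennreal (r powr a) * (ennreal (t powr (- a - 1)) * indicator {r..} t)"
    proof (cases "0 < t")
      case True
      show ?thesis
      proof (cases "t \<le> r")
        case True
        have "kappa a (t / r) / t = r powr (-a) * t powr (a - 1)"
          using True r \<open>0 < t\<close> a
          by (simp add: kappa_cases[of "t / r"] powr_divide) (simp add: powr_minus powr_diff field_simps)
        then show ?thesis using True \<open>0 < t\<close> by (simp add: ennreal_mult)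
      next
        case False
        have "kappa a (t / r) / t = r powr a * t powr (- a - 1)"
          using False r \<open>0 < t\<close> a
          by (simp add: kappa_cases[of "t / r"] powr_divide) (simp add: powr_minus powr_diff field_simps)
        then show ?thesis using False \<open>0 < t\<close> by (simp add: ennreal_mult)
      qed
    qed simp
  qed
  also have "\<dots> = ennreal (r powr (-a)) * ennreal (r powr a / a) + ennreal (r powr a) * ennreal (r powr (-a) / a)"
    by (simp add: nn_integral_add nn_integral_cmult 1 2)
  also have "\<dots> = ennreal (2 / a)"
    using a r by (simp add: ennreal_mult[symmetric] ennreal_plus[symmetric] powr_minus_divide del: ennreal_plus)
  finally show ?thesis .
qed

lemma scale_measure_dt_over_t:
  assumes b: "0 < b"
  shows "scale_measure dt_over_t (\<lambda>t. t powr b)"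
  unfolding scale_measure_def
proof (intro conjI allI impI)
  show "sigma_finite_measure dt_over_t"
  proof -
    have m: "(\<lambda>t. ennreal (1 / t)) \<in> borel_measurable (restrict_space lborel {(0::real)<..})"
      by (intro measurable_restrict_space1) measurable
    have "sigma_finite_measure (restrict_space lborel {(0::real)<..})"
      by (intro sigma_finite_measure_restrict_space) (auto intro: lborel.sigma_finite_measure_axioms)
    then show ?thesis unfolding dt_over_t_def
      by (subst sigma_finite_measure.sigma_finite_iff_density_finite'[OF _ m]) auto
  qed
  show "(\<lambda>t. t powr b) \<in> borel_measurable dt_over_t"
    unfolding measurable_cong_sets[OF sets_dt_over_t refl] by (intro measurable_restrict_space1) measurable
  show "\<forall>x\<in>space dt_over_t. 0 < x powr b" by simp
  fix a :: real assume a: "0 < a"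
  show "\<exists>C. \<forall>r>0. (\<integral>\<^sup>+x. ennreal (kappa a (x powr b / r)) \<partial>dt_over_t) \<le> ennreal C"
  proof (intro exI allI impI)
    fix r :: real assume r: "0 < r"
    \<comment> \<open>Since \<open>s powr b = r\<close>, decay with exponent \<open>a\<close> in the
      ratio \<open>t powr b / r\<close> is decay with exponent \<open>a * b\<close> in
      \<open>t / s\<close>.\<close>
    define s where "s = r powr (1 / b)"
    have s: "0 < s" "s powr b = r" using r b by (auto simp: s_def powr_powr)
    have "(\<integral>\<^sup>+x. ennreal (kappa a (x powr b / r)) \<partial>dt_over_t) =
       (\<integral>\<^sup>+x. ennreal (kappa a (x powr b / r)) * ennreal (1 / x) * indicator {0<..} x \<partial>lborel)"
      by (intro nn_integral_dt_over_t measurable_restrict_space1) measurable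
    also have "\<dots> = (\<integral>\<^sup>+t. ennreal (kappa (a * b) (t / s) / t) * indicator {0<..} t \<partial>lborel)"
    proof (intro nn_integral_cong)
      fix t :: real
      show "ennreal (kappa a (t powr b / r)) * ennreal (1 / t) * indicator {0<..} t =
        ennreal (kappa (a * b) (t / s) / t) * indicator {0<..} t"
      proof (cases "0 < t")
        case True
        then have "kappa (a * b) (t / s) = kappa a (t powr b / r)"
          using s by (subst kappa_powr[symmetric]) (auto simp: powr_divide)
        then show ?thesis using True by (simp add: ennreal_mult[symmetric])
      qed simp
    qed
    also have "\<dots> \<le> ennreal (2 / (a * b))" by (rule nn_integral_kappa_le) (use a b s in auto)
    finally show "(\<integral>\<^sup>+x. ennreal (kappa a (x powr b / r)) \<partial>dt_over_t) \<le> ennreal (2 / (a * b))" .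
  qed
qed

definition jump_measure :: "int measure" where
  "jump_measure = density (count_space (- {0})) (\<lambda>j. ennreal (1 / mag j))"

lemma space_jump_measure [simp]: "space jump_measure = - {0}"
  by (simp add: jump_measure_def)

lemma measurable_jump_measure [measurable (raw), simp]: "f \<in> jump_measure \<rightarrow>\<^sub>M borel"
  by (simp add: jump_measure_def)

lemma nn_integral_jump_measure:
  "(\<integral>\<^sup>+j. \<phi> j \<partial>jump_measure) =
    (\<Sum>\<^sup>+j. \<phi> j * ennreal (1 / mag j) * indicator (- {0}) j)"
  unfolding jump_measure_def
  by (subst nn_integral_density) (auto simp: nn_integral_count_space_indicator mult_ac)

lemma AE_jump_measure: "(AE j in jump_measure. P j) \<longleftrightarrow> (\<forall>j. j \<noteq> 0 \<longrightarrow> P j)"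
  unfolding jump_measure_def by (subst AE_density) (auto simp: AE_count_space)

text \<open>Comparison of the sum with the integral just computed: on the unit interval to the right
  of |j| the function \<open>k\<close> changes by a bounded factor only, since x <= 2|j| there. A
  real \<open>x\<close> lies in at most two of these intervals, those of
  \<open>\<lfloor>x\<rfloor>\<close> and of its negative, which explains the extra factor 2.\<close>

lemma scale_measure_jump: "scale_measure jump_measure (\<lambda>j. mag j)"
  unfolding scale_measure_def
proof (intro conjI allI impI)
  show "sigma_finite_measure jump_measure"
  proof -
    have "sigma_finite_measure (count_space (- {0::int}))"
      by (intro sigma_finite_measure_count_space_countable) auto
    then show ?thesis unfolding jump_measure_def
      by (subst sigma_finite_measure.sigma_finite_iff_density_finite') auto
  qed
  show "\<forall>j\<in>space jump_measure. 0 < mag j" by simp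
  fix a :: real assume a: "0 < a"
  show "\<exists>C. \<forall>r>0. (\<integral>\<^sup>+j. ennreal (kappa a (mag j / r)) \<partial>jump_measure) \<le> ennreal C"
  proof (intro exI allI impI)
    fix r :: real assume r: "0 < r"
    define k where "k x = kappa a (x / r) / x" for x
    have [measurable]: "k \<in> borel_measurable borel" unfolding k_def by measurable
    have k0: "0 \<le> k x" if "0 < x" for x using that by (simp add: k_def)
    have cmp: "k j \<le> 2 powr (a + 1) * k x" if "1 \<le> j" "j \<le> x" "x \<le> j + 1" for j x
    proof -
      have x: "0 < j" "0 < x" "x \<le> 2 * j" using that by auto
      have "kappa a (j / r) \<le> 2 powr a * kappa a (x / r)"
      proof -
        have 1: "(j / r) powr a \<le> 2 powr a * (x / r) powr a"
          using that r a x by (subst powr_mult[symmetric]) (auto intro!: powr_mono2 simp: divide_right_mono)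
        have "j powr (- a) \<le> 2 powr a * x powr (- a)"
        proof -
          have "x powr a \<le> (2 * j) powr a" using x a by (intro powr_mono2) auto
          then show ?thesis using x by (simp add: powr_minus powr_mult field_simps)
        qed
        then have 2: "(j / r) powr (- a) \<le> 2 powr a * (x / r) powr (- a)"
          using x r by (simp add: powr_divide divide_right_mono)
        show ?thesis unfolding kappa_def using 1 2 by (simp add: min_mult_distrib_left min_le_iff_disj)
      qed
      moreover have "1 / j \<le> 2 / x" using x by (simp add: field_simps)
      ultimately have "kappa a (j / r) * (1 / j) \<le> (2 powr a * kappa a (x / r)) * (2 / x)"
        using x by (intro mult_mono) auto
      then show ?thesis using x by (simp add: k_def powr_add mult_ac)
    qed
    have "(\<integral>\<^sup>+j. ennreal (kappa a (mag j / r)) \<partial>jump_measure) =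
       (\<Sum>\<^sup>+j. ennreal (k (mag j)) * indicator (- {0}) j)"
      unfolding nn_integral_jump_measure k_def
      by (intro nn_integral_cong) (auto simp: indicator_def ennreal_mult[symmetric])
    also have "\<dots> \<le> (\<Sum>\<^sup>+j. (\<integral>\<^sup>+x. ennreal (2 powr (a + 1)) * (ennreal (k x) *
        indicator {mag j..<mag j + 1} x) * indicator (- {0}) j \<partial>lborel))"
    proof (intro nn_integral_mono)
      fix j :: int
      show "ennreal (k (mag j)) * indicator (- {0}) j \<le> (\<integral>\<^sup>+x. ennreal (2 powr (a + 1)) * (ennreal (k x) *
        indicator {mag j..<mag j + 1} x) * indicator (- {0}) j \<partial>lborel)"
      proof (cases "j = 0")
        case False
        then have j: "1 \<le> mag j" by linarith
        have "ennreal (k (mag j)) =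
          (\<integral>\<^sup>+x. ennreal (k (mag j)) * indicator {mag j..<mag j + 1} x \<partial>lborel)"
          by (subst nn_integral_cmult_indicator) auto
        also have "\<dots> \<le> (\<integral>\<^sup>+x. ennreal (2 powr (a + 1)) * (ennreal (k x) *
            indicator {mag j..<mag j + 1} x) \<partial>lborel)"
          using cmp[OF j] k0 j
          by (intro nn_integral_mono) (auto simp: indicator_def ennreal_mult[symmetric] intro!: ennreal_leI)
        finally show ?thesis using False by simp
      qed simp
    qed
    also have "\<dots> = (\<integral>\<^sup>+x. (\<Sum>\<^sup>+j. ennreal (2 powr (a + 1)) * (ennreal (k x) *
        indicator {mag j..<mag j + 1} x) * indicator (- {0}) j) \<partial>lborel)"
      by (rule nn_integral_int_swap) measurable
    also have "\<dots> \<le> (\<integral>\<^sup>+x. ennreal (2 powr (a + 1) * 2) * (ennreal (k x) * indicator {0<..} x) \<partial>lborel)"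
    proof (intro nn_integral_mono)
      fix x :: real
      have "(\<Sum>\<^sup>+j. ennreal (2 powr (a + 1)) * (ennreal (k x) *
        indicator {mag j..<mag j + 1} x) * indicator (- {0}) j) \<le>
        (\<Sum>\<^sup>+j. ennreal (2 powr (a + 1)) * (ennreal (k x) * indicator {0<..} x) * indicator {\<lfloor>x\<rfloor>, - \<lfloor>x\<rfloor>} j)"
      proof (intro nn_integral_mono)
        fix j :: int
        have "j = \<lfloor>x\<rfloor> \<or> j = - \<lfloor>x\<rfloor>" if "mag j \<le> x" "x < mag j + 1"
        proof -
          have "\<lfloor>x\<rfloor> = \<bar>j\<bar>" using that by (intro floor_unique) auto
          then show ?thesis by (cases "0 \<le> j") auto
        qed
        moreover have "0 < x" if "mag j \<le> x" "j \<noteq> 0" using that by linarith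
        ultimately show "ennreal (2 powr (a + 1)) * (ennreal (k x) *
        indicator {mag j..<mag j + 1} x) * indicator (- {0}) j \<le>
          ennreal (2 powr (a + 1)) * (ennreal (k x) * indicator {0<..} x) * indicator {\<lfloor>x\<rfloor>, - \<lfloor>x\<rfloor>} j"
          by (auto simp: indicator_def)
      qed
      also have "\<dots> = ennreal (2 powr (a + 1)) * (ennreal (k x) * indicator {0<..} x) * of_nat (card {\<lfloor>x\<rfloor>, - \<lfloor>x\<rfloor>})"
        by (subst nn_integral_cmult_indicator) (auto simp: emeasure_count_space_finite)
      also have "\<dots> \<le> ennreal (2 powr (a + 1)) * (ennreal (k x) * indicator {0<..} x) * 2"
        by (intro mult_left_mono) (auto simp: card_insert_if)
      also have "\<dots> = ennreal (2 powr (a + 1) * 2) * (ennreal (k x) * indicator {0<..} x)"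
        by (simp add: ennreal_mult mult_ac)
      finally show "(\<Sum>\<^sup>+j. ennreal (2 powr (a + 1)) * (ennreal (k x) *
        indicator {mag j..<mag j + 1} x) * indicator (- {0}) j) \<le> \<dots>" .
    qed
    also have "\<dots> = ennreal (2 powr (a + 1) * 2) * (\<integral>\<^sup>+x. ennreal (k x) * indicator {0<..} x \<partial>lborel)"
      by (rule nn_integral_cmult) measurable
    also have "\<dots> \<le> ennreal (2 powr (a + 1) * 2) * ennreal (2 / a)"
      unfolding k_def by (intro mult_left_mono nn_integral_kappa_le a r) auto
    also have "\<dots> = ennreal (2 powr (a + 1) * 2 * (2 / a))" by (rule ennreal_mult[symmetric]) (use a in auto)
    finally show "(\<integral>\<^sup>+j. ennreal (kappa a (mag j / r)) \<partial>jump_measure) \<le>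
      ennreal (2 powr (a + 1) * 2 * (2 / a))" .
  qed
qed simp

section \<open>The norms of the definitions as conditions over scale measures\<close>

lemma mixed_norm_finite_iff:
  assumes [measurable]: "(\<lambda>t. lp_norm p (F t)) \<in> borel_measurable dt_over_t"
  shows "mixed_norm p q F < \<top> \<longleftrightarrow> Lfin dt_over_t q (\<lambda>t. lp_norm p (F t))"
proof (cases "q = \<top>")
  case True
  have "(\<exists>C<\<top>. AE t in dt_over_t. lp_norm p (F t) \<le> C) \<longleftrightarrow> esssup dt_over_t (\<lambda>t. lp_norm p (F t)) < \<top>"
    using esssup_AE[of "\<lambda>t. lp_norm p (F t)" dt_over_t] esssup_I[OF assms] by (meson le_less_trans)
  then show ?thesis using True by (simp add: mixed_norm_def Lfin_def)
qed (simp add: mixed_norm_def Lfin_def)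

lemma jump_size_finite_iff: "jump_size q N < \<top> \<longleftrightarrow> Lfin jump_measure q N"
proof (cases "q = \<top>")
  case True
  have "(SUP j\<in>- {0}. N j) < \<top> \<longleftrightarrow> (\<exists>C<\<top>. \<forall>j. j \<noteq> 0 \<longrightarrow> N j \<le> C)"
  proof
    assume "(SUP j\<in>- {0}. N j) < \<top>"
    then show "\<exists>C<\<top>. \<forall>j. j \<noteq> 0 \<longrightarrow> N j \<le> C"
      by (intro exI[of _ "SUP j\<in>- {0}. N j"]) (auto intro: SUP_upper)
  next
    assume "\<exists>C<\<top>. \<forall>j. j \<noteq> 0 \<longrightarrow> N j \<le> C"
    then obtain C where "C < \<top>" "\<forall>j. j \<noteq> 0 \<longrightarrow> N j \<le> C" by blast
    then have "(SUP j\<in>- {0}. N j) \<le> C" by (intro SUP_least) auto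
    then show "(SUP j\<in>- {0}. N j) < \<top>" using \<open>C < \<top>\<close> by order
  qed
  then show ?thesis using True by (simp add: jump_size_def Lfin_def AE_jump_measure)
next
  case False
  then show ?thesis
    by (simp add: jump_size_def Lfin_def nn_integral_jump_measure infsum_ennreal_eq_nn_integral)
qed

lemma summable_on_int_iff:
  fixes f :: "int \<Rightarrow> real"
  assumes "\<And>n. 0 \<le> f n"
  shows "f summable_on UNIV \<longleftrightarrow> (\<Sum>\<^sup>+n. ennreal (f n)) < \<top>"
proof -
  have "f summable_on UNIV \<longleftrightarrow> (\<lambda>n. norm (f n)) summable_on UNIV"
    using assms by (intro summable_on_cong) auto
  also have "\<dots> \<longleftrightarrow> integrable (count_space UNIV) f"
    by (simp only: abs_summable_equivalent Infinite_Set_Sum.abs_summable_on_def)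
  also have "\<dots> \<longleftrightarrow> (\<Sum>\<^sup>+n. ennreal (f n)) < \<top>"
    using assms by (simp add: integrable_iff_bounded)
  finally show ?thesis .
qed

lemma nn_integral_int_split_zero:
  "(\<integral>\<^sup>+n. \<phi> n \<partial>count_space (UNIV::int set)) = \<phi> 0 + (\<Sum>\<^sup>+n. \<phi> n * indicator (- {0}) n)"
proof -
  have "(\<integral>\<^sup>+n. \<phi> n \<partial>count_space (UNIV::int set)) =
     (\<Sum>\<^sup>+n. \<phi> n * indicator {0} n + \<phi> n * indicator (- {0}) n)"
    by (intro nn_integral_cong) (auto simp: indicator_def)
  also have "\<dots> = (\<Sum>\<^sup>+n. \<phi> n * indicator {0} n) + (\<Sum>\<^sup>+n. \<phi> n * indicator (- {0}) n)"
    by (rule nn_integral_add) auto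
  also have "(\<integral>\<^sup>+n. \<phi> n * indicator {0} n \<partial>count_space (UNIV::int set)) = \<phi> 0"
    by simp
  finally show ?thesis .
qed

text \<open>For n \<noteq> 0 the quantities 1 + |n|^\<alpha> and |n|^\<alpha> agree up to a factor
  2, and so do 1 + |n| and |n|. The value at n = 0 is finite and cannot affect membership, so the
  condition becomes one over the jump measure.\<close>

lemma growth_iff:
  assumes \<alpha>: "0 < \<alpha>" and q: "1 \<le> q"
  shows "growth \<alpha> q f \<longleftrightarrow> Lfin jump_measure q (\<lambda>n. ennreal (\<bar>f n\<bar> / mag n powr \<alpha>))"
proof -
  define g where "g n = f n / (1 + mag n powr \<alpha>)" for n
  define h where "h n = \<bar>f n\<bar> / mag n powr \<alpha>" for n :: int
  have gh: "\<bar>g n\<bar> \<le> h n" "h n \<le> 2 * \<bar>g n\<bar>" if "n \<noteq> 0" for n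
  proof -
    have "1 \<le> mag n powr \<alpha>" using that \<alpha> by (intro ge_one_powr_ge_zero) linarith+
    then have 1: "0 < mag n powr \<alpha>" "1 + mag n powr \<alpha> \<le> 2 * mag n powr \<alpha>"
      by linarith+
    show "\<bar>g n\<bar> \<le> h n"
      using 1 unfolding g_def h_def abs_divide by (intro frac_le) auto
    have "\<bar>f n\<bar> / (2 * mag n powr \<alpha>) \<le> \<bar>g n\<bar>"
      using 1 unfolding g_def abs_divide by (intro frac_le) auto
    then show "h n \<le> 2 * \<bar>g n\<bar>" by (simp add: h_def)
  qed
  have "(\<lambda>n. f n / (1 + mag n powr \<alpha>)) \<in> lq_mu q \<longleftrightarrow> Lfin jump_measure q (\<lambda>n. ennreal \<bar>g n\<bar>)"
  proof (cases "q = \<top>")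
    case True
    have "bounded (range g) \<longleftrightarrow> (\<exists>C<\<top>. \<forall>n. n \<noteq> 0 \<longrightarrow> ennreal \<bar>g n\<bar> \<le> C)"
    proof
      assume "bounded (range g)"
      then obtain C where "\<And>n. \<bar>g n\<bar> \<le> C" by (auto simp: bounded_iff)
      then show "\<exists>C<\<top>. \<forall>n. n \<noteq> 0 \<longrightarrow> ennreal \<bar>g n\<bar> \<le> C" by (intro exI[of _ "ennreal C"]) (auto intro: ennreal_leI)
    next
      assume "\<exists>C<\<top>. \<forall>n. n \<noteq> 0 \<longrightarrow> ennreal \<bar>g n\<bar> \<le> C"
      then obtain C where C: "C < \<top>" "\<And>n. n \<noteq> 0 \<Longrightarrow> ennreal \<bar>g n\<bar> \<le> C" by blast
      then obtain c where c: "C = ennreal c" "0 \<le> c" by (cases C) auto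
      have "\<bar>g n\<bar> \<le> max c \<bar>g 0\<bar>" for n using C(2)[of n] c by (cases "n = 0") auto
      then show "bounded (range g)" by (auto simp: bounded_iff)
    qed
    then show ?thesis using True by (simp add: lq_mu_def Lfin_def AE_jump_measure g_def[abs_def])
  next
    case False
    define r where "r = enn2real q"
    have r: "1 \<le> r" using enn2real_ge_1[OF q False] by (simp add: r_def)
    have "(\<lambda>n. f n / (1 + mag n powr \<alpha>)) \<in> lq_mu q \<longleftrightarrow>
      (\<Sum>\<^sup>+n. ennreal (\<bar>g n\<bar> powr r * (1 / (1 + mag n)))) < \<top>"
      using False by (simp add: lq_mu_def g_def[symmetric] r_def) (subst summable_on_int_iff; simp)
    also have "\<dots> \<longleftrightarrow> (\<Sum>\<^sup>+n. ennreal (\<bar>g n\<bar> powr r * (1 / (1 + mag n))) * indicator (- {0}) n) < \<top>"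
      by (subst nn_integral_int_split_zero) simp
    also have "\<dots> \<longleftrightarrow> (\<Sum>\<^sup>+n. ennreal (\<bar>g n\<bar> powr r) * ennreal (1 / mag n) * indicator (- {0}) n) < \<top>"
      (is "?A < \<top> \<longleftrightarrow> ?B < \<top>")
    proof -
      have "?A \<le> ?B"
        by (intro nn_integral_mono)
          (auto simp: indicator_def ennreal_mult[symmetric] intro!: ennreal_leI divide_left_mono)
      moreover have "?B \<le> (\<Sum>\<^sup>+n. 2 * (ennreal (\<bar>g n\<bar> powr r * (1 / (1 + mag n))) * indicator (- {0}) n))"
      proof (intro nn_integral_mono)
        fix n :: int
        have e2: "ennreal (2 * x) = 2 * ennreal x" for x by (simp add: ennreal_mult')
        have "1 / mag n \<le> 2 * (1 / (1 + mag n))" if "n \<noteq> 0"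
        proof -
          have "1 \<le> mag n" using that by linarith
          then show ?thesis by (simp add: field_simps)
        qed
        then have "n \<noteq> 0 \<Longrightarrow> \<bar>g n\<bar> powr r * (1 / mag n) \<le> \<bar>g n\<bar> powr r * (2 * (1 / (1 + mag n)))"
          by (intro mult_left_mono) auto
        then have "n \<noteq> 0 \<Longrightarrow> ennreal (\<bar>g n\<bar> powr r * (1 / mag n)) \<le> ennreal (2 * (\<bar>g n\<bar> powr r * (1 / (1 + mag n))))"
          by (intro ennreal_leI) (simp add: mult_ac)
        then show "ennreal (\<bar>g n\<bar> powr r) * ennreal (1 / mag n) * indicator (- {0}) n \<le>
          2 * (ennreal (\<bar>g n\<bar> powr r * (1 / (1 + mag n))) * indicator (- {0}) n)"
          by (cases "n = 0") (simp_all add: ennreal_mult[symmetric] e2[symmetric])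
      qed
      moreover have "\<dots> = 2 * ?A" by (rule nn_integral_cmult) simp
      moreover have "2 * ?A < \<top>" if "?A < \<top>" using that by (simp add: ennreal_mult_less_top)
      ultimately show ?thesis using le_less_trans by auto
    qed
    also have "\<dots> \<longleftrightarrow> Lfin jump_measure q (\<lambda>n. ennreal \<bar>g n\<bar>)"
      using False by (simp add: Lfin_def nn_integral_jump_measure epowr_ennreal r_def)
    finally show ?thesis .
  qed
  also have "\<dots> \<longleftrightarrow> Lfin jump_measure q (\<lambda>n. ennreal (h n))"
  proof
    assume "Lfin jump_measure q (\<lambda>n. ennreal \<bar>g n\<bar>)"
    then have "Lfin jump_measure q (\<lambda>n. 2 * ennreal \<bar>g n\<bar>)" by (rule Lfin_cmult) auto
    then show "Lfin jump_measure q (\<lambda>n. ennreal (h n))"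
    proof (rule Lfin_mono)
      fix n assume "n \<in> space jump_measure"
      then have "ennreal (h n) \<le> ennreal (2 * \<bar>g n\<bar>)" using gh by (intro ennreal_leI) auto
      then show "ennreal (h n) \<le> 2 * ennreal \<bar>g n\<bar>" by (simp add: ennreal_mult')
    qed
  next
    assume "Lfin jump_measure q (\<lambda>n. ennreal (h n))"
    then show "Lfin jump_measure q (\<lambda>n. ennreal \<bar>g n\<bar>)"
      by (rule Lfin_mono) (auto intro!: ennreal_leI gh)
  qed
  finally show ?thesis by (simp add: growth_def h_def)
qed

section \<open>Convolution on the integers\<close>

lemma nn_integral_int_shift: "(\<integral>\<^sup>+n. \<phi> (n - j) \<partial>count_space (UNIV::int set)) = (\<Sum>\<^sup>+n. \<phi> n)"
  using nn_integral_bij_count_space[OF bij_int_add[of "- j"], of \<phi>] by simp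

lemma nn_integral_int_reflect: "(\<integral>\<^sup>+n. \<phi> (j - n) \<partial>count_space (UNIV::int set)) = (\<Sum>\<^sup>+n. \<phi> n)"
  by (rule nn_integral_bij_count_space[OF bij_int_diff])

lemma integral_int_shift:
  fixes \<phi> :: "int \<Rightarrow> real"
  shows "(\<integral>n. \<phi> (n + j) \<partial>count_space UNIV) = (\<integral>n. \<phi> n \<partial>count_space UNIV)"
  by (rule integral_bij_count_space[OF bij_int_add])

lemma integral_int_reflect:
  fixes \<phi> :: "int \<Rightarrow> real"
  shows "(\<integral>n. \<phi> (j - n) \<partial>count_space UNIV) = (\<integral>n. \<phi> n \<partial>count_space UNIV)"
  by (rule integral_bij_count_space[OF bij_int_diff])

lemma
  fixes F :: "'a \<Rightarrow> int \<Rightarrow> real"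
  assumes M: "sigma_finite_measure M" and [measurable]: "\<And>k. (\<lambda>x. F x k) \<in> borel_measurable M"
    and fin: "(\<Sum>\<^sup>+k. \<integral>\<^sup>+x. ennreal \<bar>F x k\<bar> \<partial>M) < \<top>"
  shows integral_int_swap:
      "(\<integral>x. (\<integral>k. F x k \<partial>count_space UNIV) \<partial>M) = (\<integral>k. (\<integral>x. F x k \<partial>M) \<partial>count_space UNIV)"
    and integrable_int_integral: "integrable M (\<lambda>x. \<integral>k. F x k \<partial>count_space UNIV)"
proof -
  interpret M: sigma_finite_measure M by fact
  interpret Z: sigma_finite_measure "count_space (UNIV::int set)" by (rule sigma_finite_measure_count_space)
  interpret P: pair_sigma_finite "count_space (UNIV::int set)" M ..
  have m[measurable]: "(\<lambda>z. F (snd z) (fst z)) \<in> borel_measurable (count_space UNIV \<Otimes>\<^sub>M M)"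
    by (intro measurable_pair_measure_countable1) auto
  have "integrable (count_space UNIV \<Otimes>\<^sub>M M) (\<lambda>z. F (snd z) (fst z))"
  proof (rule integrableI_bounded)
    have "(\<integral>\<^sup>+z. ennreal (norm (F (snd z) (fst z))) \<partial>(count_space UNIV \<Otimes>\<^sub>M M)) =
      (\<Sum>\<^sup>+k. \<integral>\<^sup>+x. ennreal \<bar>F x k\<bar> \<partial>M)"
      by (subst M.nn_integral_fst[symmetric]) auto
    then show "(\<integral>\<^sup>+z. ennreal (norm (F (snd z) (fst z))) \<partial>(count_space UNIV \<Otimes>\<^sub>M M)) < \<infinity>"
      using fin by simp
  qed measurable
  then have "integrable (count_space UNIV \<Otimes>\<^sub>M M) (\<lambda>(k, x). F x k)" by (simp add: case_prod_unfold)
  from P.Fubini_integral[OF this] P.integrable_snd[OF this]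
  show "(\<integral>x. (\<integral>k. F x k \<partial>count_space UNIV) \<partial>M) = (\<integral>k. (\<integral>x. F x k \<partial>M) \<partial>count_space UNIV)"
    and "integrable M (\<lambda>x. \<integral>k. F x k \<partial>count_space UNIV)" by auto
qed

section \<open>Rapidly decaying kernels acting on sequences of exponential growth\<close>

text \<open>As a Bochner integral over counting measure it takes the value 0 where the series does
  not converge absolutely; this makes the bound \<open>abs_conv_le\<close> unconditional.\<close>

definition conv :: "(int \<Rightarrow> real) \<Rightarrow> (int \<Rightarrow> real) \<Rightarrow> int \<Rightarrow> real" where
  "conv a f n = (\<integral>j. a j * f (n - j) \<partial>count_space UNIV)"

text \<open>An l^1 norm tilted by a character of the integers. As exp(\<theta>n) = exp(\<theta>j)
  exp(\<theta>(n-j)), it is submultiplicative under convolution; the signed exponent also turns it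
  into a moment generating function for nonnegative kernels.\<close>

definition tnorm :: "real \<Rightarrow> (int \<Rightarrow> real) \<Rightarrow> ennreal" where
  "tnorm \<theta> a = (\<Sum>\<^sup>+j. ennreal (exp (\<theta> * real_of_int j) * \<bar>a j\<bar>))"

text \<open>Finiteness of all exponential moments is preserved by convolution, and such a kernel can
  be convolved with any sequence in \<open>expb\<close>, which contains every sequence subject to
  the growth or summability conditions of the theorem.\<close>

definition rapid :: "(int \<Rightarrow> real) \<Rightarrow> bool" where
  "rapid a \<longleftrightarrow> (\<forall>\<theta>. tnorm \<theta> a < \<top>)"

definition expb :: "(int \<Rightarrow> real) \<Rightarrow> bool" where
  "expb f \<longleftrightarrow> (\<exists>C \<theta>. \<forall>n. \<bar>f n\<bar> \<le> C * exp (\<theta> * mag n))"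

lemma expbI: "(\<And>n. \<bar>f n\<bar> \<le> C * exp (\<theta> * mag n)) \<Longrightarrow> expb f"
  by (auto simp: expb_def)

lemma expbE:
  assumes "expb f"
  obtains C \<theta> where "0 \<le> C" "0 \<le> \<theta>" "\<And>n. \<bar>f n\<bar> \<le> C * exp (\<theta> * mag n)"
proof -
  obtain C \<theta> where C: "\<And>n. \<bar>f n\<bar> \<le> C * exp (\<theta> * mag n)" using assms by (auto simp: expb_def)
  show thesis
  proof (rule that[of "\<bar>C\<bar>" "\<bar>\<theta>\<bar>"])
    fix n
    have "C * exp (\<theta> * mag n) \<le> \<bar>C\<bar> * exp (\<bar>\<theta>\<bar> * mag n)"
      by (intro mult_mono) (auto intro: mult_right_mono)
    then show "\<bar>f n\<bar> \<le> \<bar>C\<bar> * exp (\<bar>\<theta>\<bar> * mag n)" using C[of n] by linarith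
  qed auto
qed

lemma wnorm_le_tnorm:
  "(\<Sum>\<^sup>+j. ennreal (exp (\<theta> * mag j) * \<bar>a j\<bar>)) \<le> tnorm \<theta> a + tnorm (- \<theta>) a"
proof -
  have "(\<Sum>\<^sup>+j. ennreal (exp (\<theta> * mag j) * \<bar>a j\<bar>)) \<le>
    (\<Sum>\<^sup>+j. ennreal (exp (\<theta> * real_of_int j) * \<bar>a j\<bar>) + ennreal (exp (- \<theta> * real_of_int j) * \<bar>a j\<bar>))"
  proof (intro nn_integral_mono)
    fix j :: int
    have "exp (\<theta> * mag j) * \<bar>a j\<bar> \<le> exp (\<theta> * real_of_int j) * \<bar>a j\<bar> + exp (- \<theta> * real_of_int j) * \<bar>a j\<bar>"
      by (cases "0 \<le> j") auto
    then show "ennreal (exp (\<theta> * mag j) * \<bar>a j\<bar>) \<le>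
        ennreal (exp (\<theta> * real_of_int j) * \<bar>a j\<bar>) + ennreal (exp (- \<theta> * real_of_int j) * \<bar>a j\<bar>)"
      by (simp add: ennreal_plus[symmetric] ennreal_leI del: ennreal_plus)
  qed
  also have "\<dots> = tnorm \<theta> a + tnorm (- \<theta>) a" unfolding tnorm_def by (rule nn_integral_add) auto
  finally show ?thesis .
qed

lemma rapid_wnorm: "rapid a \<Longrightarrow> (\<Sum>\<^sup>+j. ennreal (exp (\<theta> * mag j) * \<bar>a j\<bar>)) < \<top>"
  by (rule le_less_trans[OF wnorm_le_tnorm]) (auto simp: rapid_def)

lemma abs_conv_le: "ennreal \<bar>conv a f n\<bar> \<le> (\<Sum>\<^sup>+j. ennreal \<bar>a j\<bar> * ennreal \<bar>f (n - j)\<bar>)"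
proof (cases "integrable (count_space UNIV) (\<lambda>j. a j * f (n - j))")
  case True
  then show ?thesis using integral_norm_bound_ennreal[OF True]
    by (simp add: conv_def abs_mult ennreal_mult)
qed (simp add: conv_def not_integrable_integral_eq)

text \<open>Young's inequality for an l^1 kernel, from Minkowski and translation invariance of the
  norm.\<close>

lemma lp_norm_conv_le:
  assumes p: "1 \<le> p"
  shows "lp_norm p (conv a f) \<le> 2 * (tnorm 0 a * lp_norm p f)"
proof -
  have "lp_norm p (conv a f) \<le> 2 * (\<Sum>\<^sup>+j. lp_norm p (\<lambda>n. a j * f (n - j)))"
    by (rule lp_norm_nn_integral_le[OF _ p]) (use abs_conv_le in \<open>auto simp: abs_mult ennreal_mult\<close>)
  also have "(\<Sum>\<^sup>+j. lp_norm p (\<lambda>n. a j * f (n - j))) =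
      (\<Sum>\<^sup>+j. ennreal \<bar>a j\<bar> * lp_norm p f)"
    by (simp add: lp_norm_cmult[OF p] lp_norm_shift_diff)
  also have "\<dots> = tnorm 0 a * lp_norm p f" unfolding tnorm_def by (simp add: nn_integral_multc)
  finally show ?thesis .
qed

lemma tnorm_conv: "tnorm \<theta> (conv a b) \<le> tnorm \<theta> a * tnorm \<theta> b"
proof -
  let ?e = "\<lambda>j. ennreal (exp (\<theta> * real_of_int j))"
  have "tnorm \<theta> (conv a b) \<le>
    (\<Sum>\<^sup>+n. \<Sum>\<^sup>+j. (?e j * ennreal \<bar>a j\<bar>) * (?e (n - j) * ennreal \<bar>b (n - j)\<bar>))"
    unfolding tnorm_def
  proof (intro nn_integral_mono)
    fix n :: int
    have "ennreal (exp (\<theta> * real_of_int n) * \<bar>conv a b n\<bar>) \<le>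
      ?e n * (\<Sum>\<^sup>+j. ennreal \<bar>a j\<bar> * ennreal \<bar>b (n - j)\<bar>)"
      using abs_conv_le[of a b n] by (simp add: ennreal_mult mult_left_mono)
    also have "\<dots> = (\<Sum>\<^sup>+j. ?e n * (ennreal \<bar>a j\<bar> * ennreal \<bar>b (n - j)\<bar>))"
      by (rule nn_integral_cmult[symmetric]) simp
    also have "\<dots> = (\<Sum>\<^sup>+j. (?e j * ennreal \<bar>a j\<bar>) * (?e (n - j) * ennreal \<bar>b (n - j)\<bar>))"
    proof (intro nn_integral_cong)
      fix j :: int
      have "?e n = ?e j * ?e (n - j)" by (simp add: ennreal_mult[symmetric] exp_add[symmetric] algebra_simps)
      then show "?e n * (ennreal \<bar>a j\<bar> * ennreal \<bar>b (n - j)\<bar>) =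
        (?e j * ennreal \<bar>a j\<bar>) * (?e (n - j) * ennreal \<bar>b (n - j)\<bar>)" by (simp add: mult_ac)
    qed
    finally show "ennreal (exp (\<theta> * real_of_int n) * \<bar>conv a b n\<bar>) \<le> \<dots>" .
  qed
  also have "\<dots> = (\<Sum>\<^sup>+j. \<Sum>\<^sup>+n. (?e j * ennreal \<bar>a j\<bar>) * (?e (n - j) * ennreal \<bar>b (n - j)\<bar>))"
    by (rule nn_integral_int_swap) simp
  also have "\<dots> = (\<Sum>\<^sup>+j. (?e j * ennreal \<bar>a j\<bar>) * tnorm \<theta> b)"
    using nn_integral_int_shift[of "\<lambda>n. ?e n * ennreal \<bar>b n\<bar>"]
    by (simp add: nn_integral_cmult tnorm_def ennreal_mult)
  also have "\<dots> = tnorm \<theta> a * tnorm \<theta> b" by (simp add: nn_integral_multc tnorm_def ennreal_mult)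
  finally show ?thesis .
qed

lemma rapid_conv: "rapid a \<Longrightarrow> rapid b \<Longrightarrow> rapid (conv a b)"
  unfolding rapid_def by (meson ennreal_mult_less_top le_less_trans tnorm_conv)

lemma nn_integral_rapid_expb:
  assumes "rapid a" "expb f"
  obtains K \<theta> where "\<And>n. (\<Sum>\<^sup>+j. ennreal \<bar>a j\<bar> * ennreal \<bar>f (n - j)\<bar>) \<le> ennreal (K * exp (\<theta> * mag n))"
proof -
  obtain C \<theta> where C: "0 \<le> C" "0 \<le> \<theta>" "\<And>n. \<bar>f n\<bar> \<le> C * exp (\<theta> * mag n)"
    using expbE[OF assms(2)] by metis
  define W where "W = (\<Sum>\<^sup>+j. ennreal (exp (\<theta> * mag j) * \<bar>a j\<bar>))"
  have "W < \<top>" unfolding W_def by (rule rapid_wnorm[OF assms(1)])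
  then obtain w where w: "W = ennreal w" "0 \<le> w" by (cases W) auto
  show thesis
  proof (rule that[of "C * w" \<theta>])
    fix n :: int
    have "(\<Sum>\<^sup>+j. ennreal \<bar>a j\<bar> * ennreal \<bar>f (n - j)\<bar>) \<le>
      (\<Sum>\<^sup>+j. ennreal (C * exp (\<theta> * mag n)) * ennreal (exp (\<theta> * mag j) * \<bar>a j\<bar>))"
    proof (intro nn_integral_mono)
      fix j :: int
      have "\<bar>f (n - j)\<bar> \<le> C * (exp (\<theta> * mag n) * exp (\<theta> * mag j))"
      proof -
        have "\<theta> * mag (n - j) \<le> \<theta> * (mag n + mag j)"
          using C(2) by (intro mult_left_mono) auto
        then have "exp (\<theta> * mag (n - j)) \<le> exp (\<theta> * mag n) * exp (\<theta> * mag j)"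
          by (simp add: exp_add[symmetric] distrib_left)
        then show ?thesis using C(3)[of "n - j"] C(1) by (meson mult_left_mono order_trans)
      qed
      then have "\<bar>a j\<bar> * \<bar>f (n - j)\<bar> \<le> \<bar>a j\<bar> * (C * (exp (\<theta> * mag n) * exp (\<theta> * mag j)))"
        by (intro mult_left_mono) auto
      then show "ennreal \<bar>a j\<bar> * ennreal \<bar>f (n - j)\<bar> \<le>
        ennreal (C * exp (\<theta> * mag n)) * ennreal (exp (\<theta> * mag j) * \<bar>a j\<bar>)"
        using C(1) by (simp add: ennreal_mult[symmetric] ennreal_leI mult_ac)
    qed
    also have "\<dots> = ennreal (C * exp (\<theta> * mag n)) * W" unfolding W_def by (rule nn_integral_cmult) simp
    also have "\<dots> = ennreal (C * w * exp (\<theta> * mag n))" using w C by (simp add: ennreal_mult[symmetric] mult_ac)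
    finally show "(\<Sum>\<^sup>+j. ennreal \<bar>a j\<bar> * ennreal \<bar>f (n - j)\<bar>) \<le> \<dots>" .
  qed
qed

lemma conv_integrable:
  assumes "rapid a" "expb f"
  shows "integrable (count_space UNIV) (\<lambda>j. a j * f (n - j))"
proof (rule integrableI_bounded)
  obtain K \<theta> where K: "\<And>n. (\<Sum>\<^sup>+j. ennreal \<bar>a j\<bar> * ennreal \<bar>f (n - j)\<bar>) \<le> ennreal (K * exp (\<theta> * mag n))"
    using nn_integral_rapid_expb[OF assms] by blast
  show "(\<Sum>\<^sup>+j. ennreal (norm (a j * f (n - j)))) < \<infinity>"
    using le_less_trans[OF K[of n]] by (simp add: abs_mult ennreal_mult)
qed simp

lemma expb_nn:
  assumes "\<And>n. ennreal \<bar>f n\<bar> \<le> ennreal (K * exp (\<theta> * mag n))"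
  shows "expb f"
proof (rule expbI[of f "\<bar>K\<bar>" \<theta>])
  fix n
  have "ennreal (K * exp (\<theta> * mag n)) \<le> ennreal (\<bar>K\<bar> * exp (\<theta> * mag n))"
    by (intro ennreal_leI mult_right_mono) auto
  then have "ennreal \<bar>f n\<bar> \<le> ennreal (\<bar>K\<bar> * exp (\<theta> * mag n))" using assms[of n] by order
  then show "\<bar>f n\<bar> \<le> \<bar>K\<bar> * exp (\<theta> * mag n)" by (subst (asm) ennreal_le_iff) auto
qed

lemma expb_conv: assumes "rapid a" "expb f" shows "expb (conv a f)"
proof -
  obtain K \<theta> where K: "\<And>n. (\<Sum>\<^sup>+j. ennreal \<bar>a j\<bar> * ennreal \<bar>f (n - j)\<bar>) \<le> ennreal (K * exp (\<theta> * mag n))"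
    using nn_integral_rapid_expb[OF assms] by blast
  show ?thesis by (rule expb_nn[of _ K \<theta>]) (rule order_trans[OF abs_conv_le K])
qed

lemma rapid_expb: assumes "rapid a" shows "expb a"
proof -
  have "tnorm 0 a < \<top>" using assms by (auto simp: rapid_def)
  then obtain w where w: "tnorm 0 a = ennreal w" "0 \<le> w" by (cases "tnorm 0 a") auto
  have "ennreal \<bar>a n\<bar> \<le> ennreal (w * exp (0 * mag n))" for n
  proof -
    have "ennreal \<bar>a n\<bar> = (\<Sum>\<^sup>+k. ennreal \<bar>a n\<bar> * indicator {n} k)" by simp
    also have "\<dots> \<le> tnorm 0 a" unfolding tnorm_def by (intro nn_integral_mono) (auto simp: indicator_def)
    finally show ?thesis using w by simp
  qed
  then show ?thesis by (rule expb_nn)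
qed

lemma conv_shift_right: "conv a (\<lambda>n. f (n + c)) n = conv a f (n + c)"
  by (simp add: conv_def algebra_simps)

lemma conv_shift_left: "conv (\<lambda>j. a (j + c)) f n = conv a f (n + c)"
  using integral_int_shift[of "\<lambda>j. a j * f (n + c - j)" c] by (simp add: conv_def algebra_simps)

lemma conv_commute: "conv a b = conv b a"
proof
  fix n
  show "conv a b n = conv b a n"
    using integral_int_reflect[of "\<lambda>j. a j * b (n - j)" n] by (simp add: conv_def mult.commute)
qed

lemma conv_diff_right: "rapid a \<Longrightarrow> expb f \<Longrightarrow> expb g \<Longrightarrow> conv a (\<lambda>n. f n - g n) n = conv a f n - conv a g n"
  unfolding conv_def by (simp add: right_diff_distrib conv_integrable)

lemma conv_diff_left: "rapid a \<Longrightarrow> rapid b \<Longrightarrow> expb f \<Longrightarrow> conv (\<lambda>n. a n - b n) f n = conv a f n - conv b f n"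
  unfolding conv_def by (simp add: left_diff_distrib conv_integrable)

lemma conv_cmult_right: "conv a (\<lambda>n. c * f n) n = c * conv a f n"
  unfolding conv_def by (simp add: mult.left_commute)

text \<open>Fubini for the triple product. The required absolute convergence holds because the
  convolution of |b| with |f| is again of exponential growth, so that summing it against |a| is
  finite.\<close>

lemma conv_assoc:
  assumes "rapid a" "rapid b" "expb f"
  shows "conv a (conv b f) = conv (conv a b) f"
proof
  fix n
  define F where "F j k = a j * b (k - j) * f (n - k)" for j k
  obtain K \<theta> where K: "\<And>n. (\<Sum>\<^sup>+j. ennreal \<bar>b j\<bar> * ennreal \<bar>f (n - j)\<bar>) \<le> ennreal (K * exp (\<theta> * mag n))"
    using nn_integral_rapid_expb[OF assms(2,3)] by blast
  have e: "expb (\<lambda>n. \<bar>K\<bar> * exp (\<theta> * mag n))" by (rule expbI[of _ "\<bar>K\<bar>" \<theta>]) (simp add: abs_mult)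
  have "(\<Sum>\<^sup>+k. \<Sum>\<^sup>+j. ennreal \<bar>F j k\<bar>) =
    (\<Sum>\<^sup>+j. \<Sum>\<^sup>+k. ennreal \<bar>F j k\<bar>)" by (rule nn_integral_int_swap) simp
  also have "\<dots> \<le> (\<Sum>\<^sup>+j. ennreal \<bar>a j\<bar> * ennreal \<bar>\<bar>K\<bar> * exp (\<theta> * mag (n - j))\<bar>)"
  proof (intro nn_integral_mono)
    fix j
    have "(\<Sum>\<^sup>+k. ennreal \<bar>F j k\<bar>) =
      (\<Sum>\<^sup>+k. ennreal \<bar>a j\<bar> * (ennreal \<bar>b (k - j)\<bar> * ennreal \<bar>f ((n - j) - (k - j))\<bar>))"
      by (simp add: F_def abs_mult ennreal_mult mult.assoc)
    also have "\<dots> = (\<Sum>\<^sup>+k. ennreal \<bar>a j\<bar> * (ennreal \<bar>b k\<bar> * ennreal \<bar>f ((n - j) - k)\<bar>))"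
      by (rule nn_integral_int_shift)
    also have "\<dots> = ennreal \<bar>a j\<bar> * (\<Sum>\<^sup>+k. ennreal \<bar>b k\<bar> * ennreal \<bar>f ((n - j) - k)\<bar>)"
      by (rule nn_integral_cmult) simp
    also have "\<dots> \<le> ennreal \<bar>a j\<bar> * ennreal (K * exp (\<theta> * mag (n - j)))"
      by (intro mult_left_mono K) auto
    also have "\<dots> \<le> ennreal \<bar>a j\<bar> * ennreal \<bar>\<bar>K\<bar> * exp (\<theta> * mag (n - j))\<bar>"
      by (intro mult_left_mono ennreal_leI) (auto simp: abs_mult intro!: mult_right_mono)
    finally show "(\<Sum>\<^sup>+k. ennreal \<bar>F j k\<bar>) \<le> \<dots>" .
  qed
  also have "\<dots> < \<top>"
    using conv_integrable[OF assms(1) e, of n] by (simp add: integrable_iff_bounded abs_mult ennreal_mult)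
  finally have fin: "(\<Sum>\<^sup>+k. \<Sum>\<^sup>+j. ennreal \<bar>F j k\<bar>) < \<top>" .
  have "conv b f (n - j) = (\<integral>k. b (k - j) * f (n - k) \<partial>count_space UNIV)" for j
    using integral_int_shift[of "\<lambda>k. b k * f (n - j - k)" "- j"] by (simp add: conv_def)
  then have "conv a (conv b f) n = (\<integral>j. a j * (\<integral>k. b (k - j) * f (n - k) \<partial>count_space UNIV) \<partial>count_space UNIV)"
    by (simp add: conv_def[of a])
  also have "\<dots> = (\<integral>j. (\<integral>k. F j k \<partial>count_space UNIV) \<partial>count_space UNIV)"
    by (simp add: F_def mult.assoc)
  also have "\<dots> = (\<integral>k. (\<integral>j. F j k \<partial>count_space UNIV) \<partial>count_space UNIV)"
    by (rule integral_int_swap[OF _ _ fin]) (auto intro: sigma_finite_measure_count_space)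
  also have "\<dots> = conv (conv a b) f n" by (simp add: F_def conv_def)
  finally show "conv a (conv b f) n = conv (conv a b) f n" .
qed

lemma conv_left_commute:
  assumes "rapid a" "rapid b" "expb f"
  shows "conv a (conv b f) = conv b (conv a f)"
  using conv_assoc[OF assms] conv_assoc[OF assms(2,1,3)] conv_commute[of a b] by simp

lemma expb_shift: assumes "expb f" shows "expb (\<lambda>n. f (n + c))"
proof -
  obtain C \<theta> where C: "0 \<le> C" "0 \<le> \<theta>" "\<And>n. \<bar>f n\<bar> \<le> C * exp (\<theta> * mag n)"
    using expbE[OF assms] by metis
  show ?thesis
  proof (rule expbI[of _ "C * exp (\<theta> * mag c)" \<theta>])
    fix n
    have "\<theta> * mag (n + c) \<le> \<theta> * mag c + \<theta> * mag n"
      using C(2) by (subst distrib_left[symmetric]) (intro mult_left_mono, auto)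
    then have "exp (\<theta> * mag (n + c)) \<le> exp (\<theta> * mag c) * exp (\<theta> * mag n)"
      by (simp add: exp_add[symmetric])
    then have "C * exp (\<theta> * mag (n + c)) \<le> C * (exp (\<theta> * mag c) * exp (\<theta> * mag n))"
      using C(1) by (rule mult_left_mono)
    then show "\<bar>f (n + c)\<bar> \<le> C * exp (\<theta> * mag c) * exp (\<theta> * mag n)"
      using C(3)[of "n + c"] by simp
  qed
qed

lemma expb_add: assumes "expb f" "expb g" shows "expb (\<lambda>n. f n + g n)"
proof -
  obtain C \<theta> where C: "0 \<le> C" "0 \<le> \<theta>" "\<And>n. \<bar>f n\<bar> \<le> C * exp (\<theta> * mag n)"
    using expbE[OF assms(1)] by metis
  obtain D \<eta> where D: "0 \<le> D" "0 \<le> \<eta>" "\<And>n. \<bar>g n\<bar> \<le> D * exp (\<eta> * mag n)"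
    using expbE[OF assms(2)] by metis
  show ?thesis
  proof (rule expbI[of _ "C + D" "\<theta> + \<eta>"])
    fix n
    have "C * exp (\<theta> * mag n) \<le> C * exp ((\<theta> + \<eta>) * mag n)"
         "D * exp (\<eta> * mag n) \<le> D * exp ((\<theta> + \<eta>) * mag n)"
      using C D by (auto intro!: mult_left_mono simp: distrib_right)
    then show "\<bar>f n + g n\<bar> \<le> (C + D) * exp ((\<theta> + \<eta>) * mag n)"
      using C(3)[of n] D(3)[of n] abs_triangle_ineq[of "f n" "g n"]
      unfolding distrib_right[of C D] by linarith
  qed
qed

lemma expb_cmult: assumes "expb f" shows "expb (\<lambda>n. c * f n)"
proof -
  obtain C \<theta> where C: "\<And>n. \<bar>f n\<bar> \<le> C * exp (\<theta> * mag n)" using assms by (auto simp: expb_def)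
  have "\<bar>c * f n\<bar> \<le> \<bar>c\<bar> * C * exp (\<theta> * mag n)" for n
    using mult_left_mono[OF C[of n], of "\<bar>c\<bar>"] by (simp add: abs_mult mult.assoc)
  then show ?thesis by (rule expbI)
qed

lemma expb_diff: "expb f \<Longrightarrow> expb g \<Longrightarrow> expb (\<lambda>n. f n - g n)"
  using expb_add[of f "\<lambda>n. -1 * g n"] expb_cmult[of g "-1"] by simp

lemma tnorm_shift: "tnorm \<theta> (\<lambda>j. a (j + c)) = ennreal (exp (- \<theta> * c)) * tnorm \<theta> a"
proof -
  have "tnorm \<theta> (\<lambda>j. a (j + c)) = (\<Sum>\<^sup>+j. ennreal (exp (- \<theta> * c)) * ennreal (exp (\<theta> * real_of_int (j + c)) * \<bar>a (j + c)\<bar>))"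
    unfolding tnorm_def
  proof (intro nn_integral_cong)
    fix j :: int
    have "exp (\<theta> * real_of_int j) = exp (- \<theta> * c) * exp (\<theta> * real_of_int (j + c))"
      by (simp add: exp_add[symmetric] algebra_simps)
    then show "ennreal (exp (\<theta> * real_of_int j) * \<bar>a (j + c)\<bar>) =
        ennreal (exp (- \<theta> * c)) * ennreal (exp (\<theta> * real_of_int (j + c)) * \<bar>a (j + c)\<bar>)"
      by (simp only: ennreal_mult[symmetric] exp_ge_zero mult_nonneg_nonneg abs_ge_zero mult.assoc)
  qed
  also have "\<dots> = (\<Sum>\<^sup>+j. ennreal (exp (- \<theta> * c)) * ennreal (exp (\<theta> * real_of_int j) * \<bar>a j\<bar>))"
    using nn_integral_bij_count_space[OF bij_int_add[of c], of "\<lambda>j. ennreal (exp (- \<theta> * c)) * ennreal (exp (\<theta> * real_of_int j) * \<bar>a j\<bar>)"] by simp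
  finally show ?thesis by (simp add: nn_integral_cmult tnorm_def)
qed

lemma tnorm_cmult: "tnorm \<theta> (\<lambda>j. c * a j) = ennreal \<bar>c\<bar> * tnorm \<theta> a"
  unfolding tnorm_def
  by (subst nn_integral_cmult[symmetric]) (auto intro!: nn_integral_cong simp: abs_mult ennreal_mult[symmetric] mult_ac)

lemma tnorm_diff: "tnorm \<theta> (\<lambda>j. a j - b j) \<le> tnorm \<theta> a + tnorm \<theta> b"
proof -
  have "tnorm \<theta> (\<lambda>j. a j - b j) \<le> (\<Sum>\<^sup>+j. ennreal (exp (\<theta> * real_of_int j) * \<bar>a j\<bar>) + ennreal (exp (\<theta> * real_of_int j) * \<bar>b j\<bar>))"
    unfolding tnorm_def
  proof (intro nn_integral_mono)
    fix j :: int
    have "exp (\<theta> * real_of_int j) * \<bar>a j - b j\<bar> \<le> exp (\<theta> * real_of_int j) * (\<bar>a j\<bar> + \<bar>b j\<bar>)"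
      by (intro mult_left_mono) auto
    then show "ennreal (exp (\<theta> * real_of_int j) * \<bar>a j - b j\<bar>) \<le>
      ennreal (exp (\<theta> * real_of_int j) * \<bar>a j\<bar>) + ennreal (exp (\<theta> * real_of_int j) * \<bar>b j\<bar>)"
      by (simp add: ennreal_plus[symmetric] ennreal_leI distrib_left del: ennreal_plus)
  qed
  also have "\<dots> = tnorm \<theta> a + tnorm \<theta> b" unfolding tnorm_def by (rule nn_integral_add) auto
  finally show ?thesis .
qed

lemma rapid_shift: "rapid a \<Longrightarrow> rapid (\<lambda>j. a (j + c))"
  by (simp add: rapid_def tnorm_shift ennreal_mult_less_top)

lemma rapid_diff: "rapid a \<Longrightarrow> rapid b \<Longrightarrow> rapid (\<lambda>j. a j - b j)"
  unfolding rapid_def by (metis ennreal_add_less_top le_less_trans tnorm_diff)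

lemma expb_delta_right: "expb f \<Longrightarrow> expb (delta_right f)"
  unfolding delta_right_def[abs_def] by (intro expb_diff expb_shift)

lemma rapid_delta_right: "rapid f \<Longrightarrow> rapid (delta_right f)"
  unfolding delta_right_def[abs_def] by (intro rapid_diff rapid_shift)

lemma expb_delta_right_funpow: "expb f \<Longrightarrow> expb ((delta_right ^^ l) f)"
  by (induction l) (auto simp: expb_delta_right)

lemma rapid_delta_right_funpow: "rapid f \<Longrightarrow> rapid ((delta_right ^^ l) f)"
  by (induction l) (auto simp: rapid_delta_right)

lemma delta_right_conv_right: "rapid a \<Longrightarrow> expb f \<Longrightarrow> delta_right (conv a f) = conv a (delta_right f)"
  unfolding delta_right_def[abs_def]
  by (simp add: fun_eq_iff conv_diff_right expb_shift conv_shift_right)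

lemma delta_right_conv_left: "rapid a \<Longrightarrow> expb f \<Longrightarrow> delta_right (conv a f) = conv (delta_right a) f"
  unfolding delta_right_def[abs_def]
  by (simp add: fun_eq_iff conv_diff_left rapid_shift conv_shift_left)

lemma delta_right_funpow_conv_right: "rapid a \<Longrightarrow> expb f \<Longrightarrow> (delta_right ^^ l) (conv a f) = conv a ((delta_right ^^ l) f)"
  by (induction l) (auto simp: delta_right_conv_right expb_delta_right_funpow)

lemma delta_right_funpow_conv_left: "rapid a \<Longrightarrow> expb f \<Longrightarrow> (delta_right ^^ l) (conv a f) = conv ((delta_right ^^ l) a) f"
  by (induction l) (auto simp: delta_right_conv_left rapid_delta_right_funpow)

section \<open>The Laplacian as a shifted second difference\<close>

definition lap :: "(int \<Rightarrow> real) \<Rightarrow> int \<Rightarrow> real" where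
  "lap f n = f (n + 1) - 2 * f n + f (n - 1)"

lemma lap_eq_delta_right: "lap f n = (delta_right ^^ 2) f (n - 1)"
  by (simp add: lap_def delta_right_def numeral_2_eq_2)

lemma delta_right_funpow_shift: "(delta_right ^^ l) (\<lambda>n. f (n + c)) = (\<lambda>n. (delta_right ^^ l) f (n + c))"
  by (induction l) (auto simp: fun_eq_iff delta_right_def algebra_simps)

text \<open>The l^p norms do not see the shift by \<open>k\<close>, so inside norms powers of the
  Laplacian and even powers of \<open>delta_right\<close> are interchangeable.\<close>

lemma lap_funpow_eq_delta_right: "(lap ^^ k) f = (\<lambda>n. (delta_right ^^ (2 * k)) f (n - int k))"
proof (induction k)
  case (Suc k)
  have "(lap ^^ Suc k) f = lap (\<lambda>n. (delta_right ^^ (2 * k)) f (n - int k))" by (simp add: Suc)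
  also have "\<dots> = (\<lambda>n. (delta_right ^^ 2) (\<lambda>n. (delta_right ^^ (2 * k)) f (n - int k)) (n - 1))"
    by (simp add: fun_eq_iff lap_eq_delta_right)
  also have "(delta_right ^^ 2) (\<lambda>n. (delta_right ^^ (2 * k)) f (n - int k)) =
     (\<lambda>n. (delta_right ^^ 2) ((delta_right ^^ (2 * k)) f) (n - int k))"
    using delta_right_funpow_shift[of 2 "(delta_right ^^ (2 * k)) f" "- int k"] by simp
  also have "(delta_right ^^ 2) ((delta_right ^^ (2 * k)) f) = (delta_right ^^ (2 * Suc k)) f"
  proof -
    have "2 * Suc k = 2 + 2 * k" by simp
    then show ?thesis by (simp only: funpow_add o_apply)
  qed
  finally show ?case by (simp add: algebra_simps)
qed simp

lemma expb_lap: "expb f \<Longrightarrow> expb (lap f)"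
  unfolding lap_def[abs_def]
  using expb_shift[of f 1] expb_shift[of f "-1"] by (auto intro!: expb_add expb_diff expb_cmult)

lemma rapid_lap: "rapid a \<Longrightarrow> rapid (lap a)"
  using rapid_shift[OF rapid_delta_right_funpow[of a 2], of "-1"]
  unfolding lap_eq_delta_right[abs_def] by simp

lemma expb_lap_funpow: "expb f \<Longrightarrow> expb ((lap ^^ k) f)"
  by (induction k) (auto simp: expb_lap)

lemma lap_conv_right: assumes "rapid a" "expb f" shows "lap (conv a f) = conv a (lap f)"
proof
  fix n
  have "lap (conv a f) n = conv a ((delta_right ^^ 2) f) (n - 1)"
    using assms by (simp add: lap_eq_delta_right delta_right_funpow_conv_right)
  also have "\<dots> = conv a (lap f) n"
    using conv_shift_right[of a "(delta_right ^^ 2) f" "-1" n] by (simp add: lap_eq_delta_right[abs_def])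
  finally show "lap (conv a f) n = conv a (lap f) n" .
qed

lemma lap_funpow_conv_right: "rapid a \<Longrightarrow> expb f \<Longrightarrow> (lap ^^ k) (conv a f) = conv a ((lap ^^ k) f)"
  by (induction k) (auto simp: lap_conv_right expb_lap_funpow)

lemma lp_norm_lap_funpow: "lp_norm p ((lap ^^ k) f) = lp_norm p ((delta_right ^^ (2 * k)) f)"
  using lp_norm_shift_diff[of p "(delta_right ^^ (2 * k)) f" "int k"] by (simp add: lap_funpow_eq_delta_right)

section \<open>The discrete heat kernel\<close>

text \<open>Dominated convergence along sequences; the mean value inequality bounds every difference
  quotient by the common majorant \<open>g\<close> of the derivatives.\<close>

lemma has_real_derivative_integral:
  fixes F F' :: "real \<Rightarrow> 'a \<Rightarrow> real"
  assumes \<epsilon>: "0 < \<epsilon>" and g: "integrable M g"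
    and deriv: "\<And>x y. x \<in> space M \<Longrightarrow> \<bar>y - y0\<bar> < \<epsilon> \<Longrightarrow> ((\<lambda>y. F y x) has_real_derivative F' y x) (at y)"
    and bound: "\<And>x y. x \<in> space M \<Longrightarrow> \<bar>y - y0\<bar> < \<epsilon> \<Longrightarrow> \<bar>F' y x\<bar> \<le> g x"
    and int: "\<And>y. \<bar>y - y0\<bar> < \<epsilon> \<Longrightarrow> integrable M (F y)"
    and [measurable]: "F' y0 \<in> borel_measurable M"
  shows "((\<lambda>y. \<integral>x. F y x \<partial>M) has_real_derivative (\<integral>x. F' y0 x \<partial>M)) (at y0)"
proof -
  define B where "B = ball y0 \<epsilon>"
  have B: "\<bar>y - y0\<bar> < \<epsilon>" if "y \<in> B" for y using that by (auto simp: B_def dist_real_def abs_minus_commute)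
  have "((\<lambda>y. \<integral>x. F y x \<partial>M) has_real_derivative (\<integral>x. F' y0 x \<partial>M)) (at y0 within B)"
    unfolding has_field_derivative_iff tendsto_at_iff_sequentially comp_def
  proof (intro allI impI)
    fix X :: "nat \<Rightarrow> real" assume X: "\<forall>i. X i \<in> B - {y0}" "X \<longlonglongrightarrow> y0"
    define Q where "Q i x = (F (X i) x - F y0 x) / (X i - y0)" for i x
    have [simp]: "integrable M (F (X i))" "integrable M (F y0)" for i
      using X B \<epsilon> by (auto intro!: int)
    have "((\<integral>x. F (X i) x \<partial>M) - (\<integral>x. F y0 x \<partial>M)) / (X i - y0) = (\<integral>x. Q i x \<partial>M)" for i
      by (simp add: Q_def)
    moreover have "(\<lambda>i. \<integral>x. Q i x \<partial>M) \<longlonglongrightarrow> (\<integral>x. F' y0 x \<partial>M)"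
    proof (rule integral_dominated_convergence[OF _ _ g])
      show "Q i \<in> borel_measurable M" for i
        unfolding Q_def by (intro borel_measurable_divide borel_measurable_diff borel_measurable_integrable) auto
      show "AE x in M. (\<lambda>i. Q i x) \<longlonglongrightarrow> F' y0 x"
      proof (rule AE_I2)
        fix x assume "x \<in> space M"
        then have "((\<lambda>y. F y x) has_real_derivative F' y0 x) (at y0)" using deriv \<epsilon> by simp
        then have "((\<lambda>y. (F y x - F y0 x) / (y - y0)) \<longlongrightarrow> F' y0 x) (at y0)" by (simp add: has_field_derivative_iff)
        then show "(\<lambda>i. Q i x) \<longlonglongrightarrow> F' y0 x"
          unfolding tendsto_at_iff_sequentially comp_def Q_def using X by auto
      qed
      show "AE x in M. norm (Q i x) \<le> g x" for i
      proof (rule AE_I2)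
        fix x assume x: "x \<in> space M"
        have "norm (F (X i) x - F y0 x) \<le> g x * norm (X i - y0)"
        proof (rule field_differentiable_bound[of B _ "\<lambda>y. F' y x"])
          show "convex B" by (simp add: B_def)
          show "((\<lambda>y. F y x) has_field_derivative F' z x) (at z within B)" if "z \<in> B" for z
            using deriv[OF x B[OF that]] by (rule has_field_derivative_at_within)
          show "norm (F' z x) \<le> g x" if "z \<in> B" for z using bound[OF x B[OF that]] by simp
          show "X i \<in> B" "y0 \<in> B" using X \<epsilon> by (auto simp: B_def)
        qed
        moreover have "X i \<noteq> y0" using X by auto
        ultimately show "norm (Q i x) \<le> g x" by (simp add: Q_def abs_divide divide_le_eq)
      qed
    qed measurable
    ultimately show "(\<lambda>i. ((\<integral>x. F (X i) x \<partial>M) - (\<integral>x. F y0 x \<partial>M)) / (X i - y0)) \<longlonglongrightarrow> (\<integral>x. F' y0 x \<partial>M)"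
      by simp
  qed
  moreover have "at y0 within B = at y0" using \<epsilon> unfolding B_def by (intro at_within_open) auto
  ultimately show ?thesis by metis
qed

lemma nn_integral_int_nonneg:
  assumes "\<And>j. j < 0 \<Longrightarrow> \<phi> j = 0"
  shows "(\<integral>\<^sup>+j. \<phi> j \<partial>count_space (UNIV::int set)) = (\<Sum>n. \<phi> (int n))"
proof -
  have "bij_betw int UNIV {0..}" by (rule bij_betw_byWitness[where f' = nat]) auto
  then have "(\<Sum>n. \<phi> (int n)) = (\<integral>\<^sup>+j. \<phi> j \<partial>count_space {0..})"
    using nn_integral_bij_count_space[of int UNIV "{0..}" \<phi>] by (simp add: nn_integral_count_space_nat)
  also have "\<dots> = (\<Sum>\<^sup>+j. \<phi> j)"
    using assms by (intro nn_integral_count_space_eq) (auto simp: not_le)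
  finally show ?thesis ..
qed

lemma integral_int_restrict:
  fixes \<phi> :: "int \<Rightarrow> real"
  assumes "\<And>j. j \<notin> A \<Longrightarrow> \<phi> j = 0"
  shows "(\<integral>j. \<phi> j \<partial>count_space UNIV) = (\<integral>j. \<phi> j \<partial>count_space A)"
proof -
  have "(\<integral>j. \<phi> j \<partial>count_space A) = (\<integral>j. \<phi> j \<partial>restrict_space (count_space UNIV) A)"
    by (simp add: restrict_count_space)
  also have "\<dots> = (\<integral>j. indicator A j *\<^sub>R \<phi> j \<partial>count_space UNIV)"
    by (rule integral_restrict_space) simp
  also have "\<dots> = (\<integral>j. \<phi> j \<partial>count_space UNIV)"
    using assms by (intro Bochner_Integration.integral_cong) (auto simp: indicator_def)
  finally show ?thesis ..
qed

section \<open>The heat kernel as a convolution of two Poisson distributions\<close>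

text \<open>The law of a Poisson variable of mean \<open>t\<close>, that is, the kernel of the
  one-sided semigroup with generator f(n-1) - f(n). The formula is kept for all real
  \<open>t\<close>.\<close>

definition pker :: "real \<Rightarrow> int \<Rightarrow> real" where
  "pker t j = (if 0 \<le> j then exp (- t) * t ^ nat j / fact (nat j) else 0)"

definition rker :: "real \<Rightarrow> int \<Rightarrow> real" where
  "rker t j = pker t (- j)"

text \<open>The Laplacian splits into f(n+1) - f(n) and f(n-1) - f(n), which commute, so its
  semigroup is the product of the two one-sided ones. Being defined for every real \<open>t\<close>,
  it is the convolution unit at \<open>t = 0\<close> and differentiable there.\<close>

definition hker :: "real \<Rightarrow> int \<Rightarrow> real" where
  "hker t = conv (rker t) (pker t)"

abbreviation (input) hnorm :: "ennreal \<Rightarrow> real \<Rightarrow> (int \<Rightarrow> real) \<Rightarrow> ennreal" where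
  "hnorm p t F \<equiv> lp_norm p (conv (hker t) F)"

lemma exp_power_sums: "(\<lambda>n. x ^ n / fact n) sums exp (x::real)"
  using exp_converges[of x] by (simp add: divide_inverse mult.commute)

lemma pker_nonneg: "0 \<le> t \<Longrightarrow> 0 \<le> pker t j"
  by (simp add: pker_def)

text \<open>The moment generating function of the Poisson distribution.\<close>

lemma tnorm_pker: "0 \<le> t \<Longrightarrow> tnorm \<theta> (pker t) = ennreal (exp (t * (exp \<theta> - 1)))"
proof -
  assume t: "0 \<le> t"
  have "tnorm \<theta> (pker t) = (\<Sum>n. ennreal (exp (\<theta> * real_of_int (int n)) * \<bar>pker t (int n)\<bar>))"
    unfolding tnorm_def by (rule nn_integral_int_nonneg) (simp add: pker_def)
  also have "\<dots> = (\<Sum>n. ennreal (exp (- t) * ((t * exp \<theta>) ^ n / fact n)))"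
    using t by (intro suminf_cong) (simp add: pker_def abs_mult exp_of_nat_mult[symmetric] power_mult_distrib mult_ac)
  also have "\<dots> = ennreal (exp (- t) * exp (t * exp \<theta>))"
    using t by (intro suminf_ennreal_eq sums_mult exp_power_sums) auto
  finally show ?thesis by (simp add: exp_add[symmetric] algebra_simps)
qed

lemma abs_pker: "\<bar>pker t j\<bar> = exp (\<bar>t\<bar> - t) * pker \<bar>t\<bar> j"
  by (simp add: pker_def abs_mult power_abs exp_diff exp_minus field_simps)

lemma tnorm_mono: "(\<And>j. \<bar>a j\<bar> \<le> \<bar>b j\<bar>) \<Longrightarrow> tnorm \<theta> a \<le> tnorm \<theta> b"
  unfolding tnorm_def by (intro nn_integral_mono ennreal_leI mult_left_mono) auto

lemma rapid_pker: "rapid (pker t)"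
  unfolding rapid_def
proof
  fix \<theta>
  have "tnorm \<theta> (pker t) \<le> tnorm \<theta> (\<lambda>j. exp (\<bar>t\<bar> - t) * pker \<bar>t\<bar> j)"
    by (rule tnorm_mono) (simp add: abs_pker abs_mult pker_nonneg)
  also have "\<dots> < \<top>" by (simp add: tnorm_cmult tnorm_pker ennreal_mult_less_top)
  finally show "tnorm \<theta> (pker t) < \<top>" .
qed

lemma tnorm_reflect: "tnorm \<theta> (\<lambda>j. a (- j)) = tnorm (- \<theta>) a"
  unfolding tnorm_def
  using nn_integral_int_reflect[of "\<lambda>j. ennreal (exp (- \<theta> * real_of_int j) * \<bar>a j\<bar>)" 0] by simp

lemma rapid_rker: "rapid (rker t)"
  using rapid_pker[of t] unfolding rapid_def rker_def[abs_def] tnorm_reflect by simp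

lemma rapid_hker: "rapid (hker t)"
  unfolding hker_def by (intro rapid_conv rapid_pker rapid_rker)

lemma expb_hker: "expb (hker t)"
  by (intro rapid_expb rapid_hker)

lemma conv_unit: "conv (\<lambda>j. if j = 0 then 1 else 0) f = f"
proof
  fix n
  have "conv (\<lambda>j. if j = 0 then 1 else 0) f n = (\<integral>j. (if j = 0 then 1 else 0) * f (n - j) \<partial>count_space {0})"
    unfolding conv_def by (rule integral_int_restrict) auto
  then show "conv (\<lambda>j. if j = 0 then 1 else 0) f n = f n" by (simp add: lebesgue_integral_count_space_finite)
qed

lemma pker_0: "pker 0 = (\<lambda>j. if j = 0 then 1 else 0)"
  by (auto simp: pker_def fun_eq_iff)

lemma hker_0: "hker 0 = (\<lambda>j. if j = 0 then 1 else 0)"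
proof -
  have "rker 0 = (\<lambda>j. if j = 0 then 1 else 0)" by (auto simp: rker_def fun_eq_iff pker_0)
  then show ?thesis by (simp only: hker_def conv_unit pker_0)
qed

text \<open>Sums of independent Poisson variables are Poisson; analytically, the Cauchy product of
  two exponential series.\<close>

lemma conv_pker: "conv (pker s) (pker t) = pker (s + t)"
proof
  fix n
  show "conv (pker s) (pker t) n = pker (s + t) n"
  proof (cases "0 \<le> n")
    case False
    then have z: "pker s j * pker t (n - j) = 0" for j by (auto simp: pker_def)
    show ?thesis using False unfolding conv_def z by (simp add: pker_def)
  next
    case True
    define N where "N = nat n"
    have n: "n = int N" using True by (simp add: N_def)
    have "conv (pker s) (pker t) n = (\<integral>j. pker s j * pker t (n - j) \<partial>count_space (int ` {..N}))"
      unfolding conv_def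
    proof (rule integral_int_restrict)
      fix j assume "j \<notin> int ` {..N}"
      then have "j < 0 \<or> int N < j" by (metis atMost_iff imageI int_nat_eq linorder_not_le nat_le_iff)
      then show "pker s j * pker t (n - j) = 0" by (auto simp: pker_def n)
    qed
    also have "\<dots> = (\<Sum>k\<le>N. pker s (int k) * pker t (n - int k))"
      by (simp add: lebesgue_integral_count_space_finite sum.reindex)
    also have "\<dots> = exp (- (s + t)) * (\<Sum>k\<le>N. (s ^ k /\<^sub>R fact k) * (t ^ (N - k) /\<^sub>R fact (N - k)))"
      unfolding sum_distrib_left
    proof (intro sum.cong refl)
      fix k assume "k \<in> {..N}"
      then have "n - int k = int (N - k)" by (simp add: n of_nat_diff)
      then show "pker s (int k) * pker t (n - int k) = exp (- (s + t)) * ((s ^ k /\<^sub>R fact k) * (t ^ (N - k) /\<^sub>R fact (N - k)))"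
        by (simp add: pker_def exp_add exp_diff exp_minus field_simps)
    qed
    also have "(\<Sum>k\<le>N. (s ^ k /\<^sub>R fact k) * (t ^ (N - k) /\<^sub>R fact (N - k))) = (s + t) ^ N /\<^sub>R fact N"
      by (rule exp_series_add_commuting[symmetric]) simp
    also have "exp (- (s + t)) * ((s + t) ^ N /\<^sub>R fact N) = pker (s + t) n"
      by (simp add: pker_def n field_simps)
    finally show ?thesis .
  qed
qed

lemma conv_reflect: "conv (\<lambda>j. a (- j)) (\<lambda>j. b (- j)) n = conv a b (- n)"
  using integral_int_reflect[of "\<lambda>j. a j * b (- n - j)" 0] by (simp add: conv_def add.commute)

lemma conv_rker: "conv (rker s) (rker t) = rker (s + t)"
  by (simp add: fun_eq_iff rker_def[abs_def] conv_reflect conv_pker)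

lemma hker_reflect: "hker t (- n) = hker t n"
proof -
  have "hker t (- n) = conv (\<lambda>j. pker t j) (\<lambda>j. pker t (- j)) n"
    unfolding hker_def using conv_reflect[of "rker t" "pker t" n] by (simp add: rker_def)
  then show ?thesis unfolding hker_def using conv_commute[of "pker t" "rker t"] by (simp add: rker_def[abs_def])
qed

lemma conv_hker: "conv (hker s) (hker t) = hker (s + t)"
proof -
  note r = rapid_pker rapid_rker rapid_expb rapid_conv
  have "conv (hker s) (hker t) = conv (rker s) (conv (pker s) (conv (rker t) (pker t)))"
    unfolding hker_def by (rule conv_assoc[symmetric]) (auto intro!: r)
  also have "conv (pker s) (conv (rker t) (pker t)) = conv (rker t) (conv (pker s) (pker t))"
    by (rule conv_left_commute) (auto intro!: r)
  also have "conv (rker s) \<dots> = conv (conv (rker s) (rker t)) (conv (pker s) (pker t))"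
    by (rule conv_assoc) (auto intro!: r)
  finally show ?thesis by (simp add: conv_pker conv_rker hker_def)
qed

lemma conv_hker_conv_hker: "expb f \<Longrightarrow> conv (hker s) (conv (hker t) f) = conv (hker (s + t)) f"
  by (simp add: conv_assoc rapid_hker conv_hker)

lemma poisson_moments:
  fixes t :: real
  shows "(\<lambda>n. real n * (t ^ n / fact n)) sums (t * exp t)"
    and "(\<lambda>n. real n * (real n - 1) * (t ^ n / fact n)) sums (t\<^sup>2 * exp t)"
proof -
  have "(\<lambda>n. real (Suc n) * (t ^ Suc n / fact (Suc n))) sums (t * exp t)"
    using sums_mult[OF exp_power_sums[of t], of t] by (simp add: fact_Suc field_simps del: of_nat_Suc)
  from sums_Suc[OF this] show 1: "(\<lambda>n. real n * (t ^ n / fact n)) sums (t * exp t)" by simp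
  have "(\<lambda>n. real (Suc n) * (real (Suc n) - 1) * (t ^ Suc n / fact (Suc n))) sums (t * (t * exp t))"
  proof -
    have "real (Suc n) * (real (Suc n) - 1) * (t ^ Suc n / fact (Suc n)) = t * (real n * (t ^ n / fact n))" for n
    proof -
      have f: "t ^ Suc n / fact (Suc n) = t / real (Suc n) * (t ^ n / fact n)" by (simp add: fact_Suc del: of_nat_Suc)
      have "real (Suc n) * (t / real (Suc n)) = t" by simp
      then show ?thesis unfolding f by (simp add: mult_ac del: of_nat_Suc)
    qed
    then show ?thesis using sums_mult[OF 1, of t] by (simp add: mult_ac)
  qed
  from sums_Suc[OF this] show "(\<lambda>n. real n * (real n - 1) * (t ^ n / fact n)) sums (t\<^sup>2 * exp t)"
    by (simp add: power2_eq_square mult.assoc)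
qed

text \<open>The variance \<open>t\<close> of the Poisson law, divided by the square of its
  mean.\<close>

lemma poisson_variance:
  fixes t :: real assumes "0 < t"
  shows "(\<lambda>n. pker t (int n) * (1 - real n / t)\<^sup>2) sums (1 / t)"
proof -
  have "(\<lambda>n. exp (- t) * ((t ^ n / fact n) + (1 / t\<^sup>2) * (real n * (real n - 1) * (t ^ n / fact n))
      + (1 / t\<^sup>2 - 2 / t) * (real n * (t ^ n / fact n)))) sums
      (exp (- t) * (exp t + (1 / t\<^sup>2) * (t\<^sup>2 * exp t) + (1 / t\<^sup>2 - 2 / t) * (t * exp t)))"
    by (intro sums_mult sums_add poisson_moments exp_power_sums)
  also have "(\<lambda>n. exp (- t) * ((t ^ n / fact n) + (1 / t\<^sup>2) * (real n * (real n - 1) * (t ^ n / fact n))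
      + (1 / t\<^sup>2 - 2 / t) * (real n * (t ^ n / fact n)))) = (\<lambda>n. pker t (int n) * (1 - real n / t)\<^sup>2)"
  proof
    fix n
    have "1 + (1 / t\<^sup>2) * (real n * (real n - 1)) + (1 / t\<^sup>2 - 2 / t) * real n = (1 - real n / t)\<^sup>2"
      using assms by (simp add: field_simps power2_eq_square)
    then have "exp (- t) * (t ^ n / fact n) * (1 + (1 / t\<^sup>2) * (real n * (real n - 1)) + (1 / t\<^sup>2 - 2 / t) * real n) =
      exp (- t) * (t ^ n / fact n) * (1 - real n / t)\<^sup>2" by simp
    then show "exp (- t) * ((t ^ n / fact n) + (1 / t\<^sup>2) * (real n * (real n - 1) * (t ^ n / fact n))
      + (1 / t\<^sup>2 - 2 / t) * (real n * (t ^ n / fact n))) = pker t (int n) * (1 - real n / t)\<^sup>2"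
      by (simp add: pker_def algebra_simps)
  qed
  also have "exp (- t) * (exp t + (1 / t\<^sup>2) * (t\<^sup>2 * exp t) + (1 / t\<^sup>2 - 2 / t) * (t * exp t)) = 1 / t"
    using assms by (simp add: exp_minus field_simps power2_eq_square)
  finally show ?thesis .
qed

text \<open>This is where one difference gains \<open>t powr (- 1/2)\<close>. Consecutive Poisson
  weights differ by the factor \<open>1 - real m / t\<close>, whose second moment is 1/t.
  Cauchy-Schwarz, in the form u v <= (l/2) u^2 + v^2/(2l), separates it from the tilt u =
  exp(-\<theta>m), whose second moment is the moment generating function at -2\<theta>.\<close>

lemma tnorm_delta_rker:
  assumes t: "0 < t"
  shows "tnorm \<theta> (delta_right (rker t)) \<le> ennreal (t powr (- 1/2) * exp (t * (exp (- 2 * \<theta>) - 1) / 2))"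
proof -
  define A where "A = t * (exp (- 2 * \<theta>) - 1)"
  \<comment> \<open>Chosen so that both halves equal \<open>t powr (- 1/2) * exp (A / 2) / 2\<close>
    after summation.\<close>
  define l where "l = exp (- A / 2) * t powr (- 1/2)"
  have l: "0 < l" using t by (simp add: l_def)
  have d: "delta_right (rker t) n = (\<lambda>m. pker t m - pker t (m - 1)) (- n)" for n
  proof -
    have e: "- (n + 1) = - n - 1" by simp
    show ?thesis by (simp only: delta_right_def rker_def e)
  qed
  have p: "pker t (int m) - pker t (int m - 1) = pker t (int m) * (1 - real m / t)" for m
  proof (cases m)
    case (Suc k)
    then have e: "int m - 1 = int k" by simp
    show ?thesis using t unfolding e by (simp add: pker_def Suc fact_Suc field_simps del: of_nat_Suc)
  qed (simp add: pker_def)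
  have "tnorm \<theta> (delta_right (rker t)) = tnorm (- \<theta>) (\<lambda>m. pker t m - pker t (m - 1))"
    unfolding d[abs_def] by (rule tnorm_reflect)
  also have "\<dots> = (\<Sum>m. ennreal (exp (- \<theta> * real_of_int (int m)) * \<bar>pker t (int m) - pker t (int m - 1)\<bar>))"
    unfolding tnorm_def by (rule nn_integral_int_nonneg) (simp add: pker_def)
  also have "\<dots> \<le> (\<Sum>m. ennreal ((l / 2) * (exp (- t) * ((t * exp (- 2 * \<theta>)) ^ m / fact m)) +
      (1 / (2 * l)) * (pker t (int m) * (1 - real m / t)\<^sup>2)))"
  proof (intro suminf_le ennreal_leI)
    fix m
    define u where "u = exp (- \<theta> * real m)"
    define v where "v = \<bar>1 - real m / t\<bar>"
    have "0 \<le> (l * u - v)\<^sup>2" by simp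
    then have "u * v \<le> (l / 2) * u\<^sup>2 + (1 / (2 * l)) * v\<^sup>2"
      using l by (simp add: field_simps power2_eq_square)
    then have "pker t (int m) * (u * v) \<le> pker t (int m) * ((l / 2) * u\<^sup>2 + (1 / (2 * l)) * v\<^sup>2)"
      using t by (intro mult_left_mono pker_nonneg) auto
    also have "\<dots> = (l / 2) * (pker t (int m) * u\<^sup>2) + (1 / (2 * l)) * (pker t (int m) * (1 - real m / t)\<^sup>2)"
      by (simp add: v_def algebra_simps)
    also have "pker t (int m) * u\<^sup>2 = exp (- t) * ((t * exp (- 2 * \<theta>)) ^ m / fact m)"
    proof -
      have "u\<^sup>2 = exp (- 2 * \<theta>) ^ m" unfolding u_def by (simp add: exp_of_nat_mult[symmetric] exp_double[symmetric] mult_ac)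
      then show ?thesis by (simp add: pker_def power_mult_distrib)
    qed
    finally show "exp (- \<theta> * real_of_int (int m)) * \<bar>pker t (int m) - pker t (int m - 1)\<bar> \<le>
      (l / 2) * (exp (- t) * ((t * exp (- 2 * \<theta>)) ^ m / fact m)) +
      (1 / (2 * l)) * (pker t (int m) * (1 - real m / t)\<^sup>2)"
      using t pker_nonneg[of t "int m"] by (simp add: p abs_mult u_def v_def mult_ac)
  qed auto
  also have "\<dots> = ennreal ((l / 2) * (exp (- t) * exp (t * exp (- 2 * \<theta>))) + (1 / (2 * l)) * (1 / t))"
    using l t
    by (intro suminf_ennreal_eq sums_add sums_mult exp_power_sums poisson_variance add_nonneg_nonneg)
       (auto simp: pker_nonneg)
  also have "(l / 2) * (exp (- t) * exp (t * exp (- 2 * \<theta>))) + (1 / (2 * l)) * (1 / t) = t powr (- 1/2) * exp (A / 2)"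
  proof -
    have 1: "exp (- t) * exp (t * exp (- 2 * \<theta>)) = exp (A / 2) * exp (A / 2)"
      by (simp add: A_def exp_add[symmetric] algebra_simps)
    have 2: "l * exp (A / 2) = t powr (- 1/2)" by (simp add: l_def exp_minus)
    have 3: "1 / (l * t) = exp (A / 2) * t powr (- 1/2)"
    proof -
      have "t powr (- 1/2) * t powr (- 1/2) = 1 / t" using t by (simp add: powr_add[symmetric] powr_minus_divide)
      then have "1 / t = t powr (- 1/2) * t powr (- 1/2)" by simp
      moreover have "1 / l = exp (A / 2) / t powr (- 1/2)" by (simp add: l_def exp_minus field_simps)
      ultimately have "1 / l * (1 / t) = exp (A / 2) / t powr (- 1/2) * (t powr (- 1/2) * t powr (- 1/2))" by simp
      then show ?thesis using t by simp
    qed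
    have "(l / 2) * (exp (A / 2) * exp (A / 2)) = (1/2) * ((l * exp (A / 2)) * exp (A / 2))" by simp
    moreover have "(1 / (2 * l)) * (1 / t) = (1/2) * (1 / (l * t))" by simp
    ultimately have "(l / 2) * (exp (A / 2) * exp (A / 2)) + (1 / (2 * l)) * (1 / t) =
      (1/2) * (t powr (- 1/2) * exp (A / 2)) + (1/2) * (exp (A / 2) * t powr (- 1/2))"
      by (simp only: 2 3)
    then show ?thesis unfolding 1 by simp
  qed
  finally show ?thesis by (simp add: A_def)
qed

lemma exp_le_quadratic: fixes x :: real assumes "\<bar>x\<bar> \<le> 1" shows "exp x \<le> 1 + x + x\<^sup>2"
proof (cases "0 \<le> x")
  case True
  then show ?thesis using exp_bound[of x] assms by simp
next
  case False
  define y where "y = - x"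
  have y: "0 \<le> y" using False by (simp add: y_def)
  have "1 \<le> (1 - y + y\<^sup>2) * (1 + y + y\<^sup>2 / 2)"
  proof -
    have "(1 - y + y\<^sup>2) * (1 + y + y\<^sup>2 / 2) = 1 + (y^2 + y^3 + y^4) / 2"
      by (simp add: field_simps power2_eq_square power3_eq_cube power4_eq_xxxx)
    then show ?thesis using y by simp
  qed
  also have "\<dots> \<le> (1 - y + y\<^sup>2) * exp y"
  proof (intro mult_left_mono exp_lower_Taylor_quadratic y)
    have "0 \<le> (1 - y / 2)\<^sup>2 + 3/4 * y\<^sup>2" by simp
    then show "0 \<le> 1 - y + y\<^sup>2" by (simp add: power2_eq_square algebra_simps)
  qed
  finally show ?thesis by (simp add: y_def exp_minus field_simps)
qed

text \<open>The two reflected factors contribute exponents with opposite linear terms in \<theta>;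
  they cancel and a quadratic, Gaussian exponent remains.\<close>

lemma tnorm_hker:
  assumes t: "0 \<le> t" and \<theta>: "\<bar>\<theta>\<bar> \<le> 1/2"
  shows "tnorm \<theta> (hker t) \<le> ennreal (exp (3 * t * \<theta>\<^sup>2))"
proof -
  have "tnorm \<theta> (hker t) \<le> tnorm \<theta> (rker t) * tnorm \<theta> (pker t)" unfolding hker_def by (rule tnorm_conv)
  also have "\<dots> = ennreal (exp (t * ((exp (- \<theta>) - 1) + (exp \<theta> - 1))))"
    using t by (simp add: rker_def[abs_def] tnorm_reflect tnorm_pker ennreal_mult[symmetric] exp_add[symmetric] algebra_simps)
  also have "\<dots> \<le> ennreal (exp (3 * t * \<theta>\<^sup>2))"
  proof -
    have "(exp (- \<theta>) - 1) + (exp \<theta> - 1) \<le> 3 * \<theta>\<^sup>2"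
    proof -
      have "exp \<theta> \<le> 1 + \<theta> + \<theta>\<^sup>2" "exp (- \<theta>) \<le> 1 - \<theta> + \<theta>\<^sup>2"
        using exp_le_quadratic[of \<theta>] exp_le_quadratic[of "- \<theta>"] \<theta> by auto
      then show ?thesis using zero_le_power2[of \<theta>] by linarith
    qed
    then have "t * ((exp (- \<theta>) - 1) + (exp \<theta> - 1)) \<le> t * (3 * \<theta>\<^sup>2)" using t by (rule mult_left_mono)
    then show ?thesis by (simp add: mult_ac)
  qed
  finally show ?thesis .
qed

text \<open>The differenced factor contributes (exp(-2\<theta>) - 1)/2, with linear term -\<theta>,
  so it still cancels against the linear term of the other factor. The quadratic bounds add up to
  2\<theta>^2 + \<theta>^2, and |\<theta>| <= 1/2 keeps the argument 2\<theta> in the range of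
  \<open>exp_le_quadratic\<close>.\<close>

lemma tnorm_delta_hker:
  assumes t: "0 < t" and \<theta>: "\<bar>\<theta>\<bar> \<le> 1/2"
  shows "tnorm \<theta> (delta_right (hker t)) \<le> ennreal (t powr (- 1/2) * exp (3 * t * \<theta>\<^sup>2))"
proof -
  have "delta_right (hker t) = conv (delta_right (rker t)) (pker t)"
    unfolding hker_def by (intro delta_right_conv_left rapid_rker rapid_expb rapid_pker)
  then have "tnorm \<theta> (delta_right (hker t)) \<le> tnorm \<theta> (delta_right (rker t)) * tnorm \<theta> (pker t)"
    by (simp add: tnorm_conv)
  also have "\<dots> \<le> ennreal (t powr (- 1/2) * exp (t * (exp (- 2 * \<theta>) - 1) / 2)) * ennreal (exp (t * (exp \<theta> - 1)))"
    using t by (intro mult_mono tnorm_delta_rker) (auto simp: tnorm_pker)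
  also have "\<dots> = ennreal (t powr (- 1/2) * exp (t * ((exp (- 2 * \<theta>) - 1) / 2 + (exp \<theta> - 1))))"
    by (simp add: ennreal_mult[symmetric] exp_add[symmetric] mult.assoc distrib_left)
  also have "\<dots> \<le> ennreal (t powr (- 1/2) * exp (3 * t * \<theta>\<^sup>2))"
  proof -
    have lin: "(a - 1) / 2 + (b - 1) \<le> 3 * y" if "a \<le> 1 - 2 * x + 4 * y" "b \<le> 1 + x + y" for a b x y :: real
      using that by (simp add: field_simps)
    have "(exp (- 2 * \<theta>) - 1) / 2 + (exp \<theta> - 1) \<le> 3 * \<theta>\<^sup>2"
      by (rule lin[where x = \<theta>])
        (use \<theta> exp_le_quadratic[of "- 2 * \<theta>"] exp_le_quadratic[of \<theta>] in \<open>auto simp: abs_mult\<close>)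
    then have "t * ((exp (- 2 * \<theta>) - 1) / 2 + (exp \<theta> - 1)) \<le> t * (3 * \<theta>\<^sup>2)" using t by (intro mult_left_mono) auto
    then show ?thesis by (intro ennreal_leI mult_left_mono) (auto simp: mult_ac)
  qed
  finally show ?thesis .
qed

text \<open>The semigroup law splits time \<open>m * s\<close> into \<open>m\<close> steps, and each
  step absorbs one difference: gains multiply while the Gaussian exponents add up to that of the
  total time.\<close>

lemma tnorm_delta_funpow_hker_aux:
  assumes s: "0 < s" and \<theta>: "\<bar>\<theta>\<bar> \<le> 1/2"
  shows "tnorm \<theta> ((delta_right ^^ m) (hker (real m * s))) \<le> ennreal ((s powr (- 1/2)) ^ m * exp (3 * (real m * s) * \<theta>\<^sup>2))"
proof (induction m)
  case 0
  show ?case using tnorm_hker[of 0 \<theta>] \<theta> by simp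
next
  case (Suc m)
  have "hker (real (Suc m) * s) = conv (hker s) (hker (real m * s))" by (simp add: conv_hker algebra_simps)
  then have "(delta_right ^^ Suc m) (hker (real (Suc m) * s)) = delta_right (conv (hker s) ((delta_right ^^ m) (hker (real m * s))))"
    by (simp add: delta_right_funpow_conv_right rapid_hker expb_hker)
  also have "\<dots> = conv (delta_right (hker s)) ((delta_right ^^ m) (hker (real m * s)))"
    by (intro delta_right_conv_left rapid_hker expb_delta_right_funpow expb_hker)
  finally have "tnorm \<theta> ((delta_right ^^ Suc m) (hker (real (Suc m) * s))) \<le>
     tnorm \<theta> (delta_right (hker s)) * tnorm \<theta> ((delta_right ^^ m) (hker (real m * s)))"
    by (simp add: tnorm_conv del: funpow.simps)
  also have "\<dots> \<le> ennreal (s powr (- 1/2) * exp (3 * s * \<theta>\<^sup>2)) * ennreal ((s powr (- 1/2)) ^ m * exp (3 * (real m * s) * \<theta>\<^sup>2))"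
    by (intro mult_mono tnorm_delta_hker s \<theta> Suc) auto
  also have "\<dots> = ennreal ((s powr (- 1/2)) ^ Suc m * exp (3 * (real (Suc m) * s) * \<theta>\<^sup>2))"
    by (simp add: ennreal_mult[symmetric] exp_add[symmetric] algebra_simps)
  finally show ?case .
qed

lemma tnorm_delta_funpow_hker:
  obtains C where "0 < C"
    "\<And>t \<theta>. 0 < t \<Longrightarrow> \<bar>\<theta>\<bar> \<le> 1/2 \<Longrightarrow>
       tnorm \<theta> ((delta_right ^^ m) (hker t)) \<le> ennreal (C * t powr (- real m / 2) * exp (3 * t * \<theta>\<^sup>2))"
proof (cases "m = 0")
  case True
  show thesis by (rule that[of 1]) (use tnorm_hker True in auto)
next
  case False
  show thesis
  \<comment> \<open>Steps of length \<open>t / m\<close> turn \<open>s powr (- 1/2)\<close>, taken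
    to the power \<open>m\<close>, into \<open>t powr (- m / 2)\<close> times this constant.\<close>
  proof (rule that[of "real m powr (real m / 2)"])
    fix t \<theta> :: real assume t: "0 < t" and \<theta>: "\<bar>\<theta>\<bar> \<le> 1/2"
    have "tnorm \<theta> ((delta_right ^^ m) (hker (real m * (t / real m)))) \<le>
      ennreal (((t / real m) powr (- 1/2)) ^ m * exp (3 * (real m * (t / real m)) * \<theta>\<^sup>2))"
      by (rule tnorm_delta_funpow_hker_aux) (use t \<theta> False in auto)
    moreover have "((t / real m) powr (- 1/2)) ^ m = real m powr (real m / 2) * t powr (- real m / 2)"
    proof -
      have "((t / real m) powr (- 1/2)) ^ m = (t / real m) powr (- real m / 2)"
        using t False by (subst powr_realpow[symmetric]) (auto simp: powr_powr)
      also have "\<dots> = real m powr (real m / 2) * t powr (- real m / 2)"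
        using t False by (simp add: powr_divide powr_minus field_simps)
      finally show ?thesis .
    qed
    ultimately show "tnorm \<theta> ((delta_right ^^ m) (hker t)) \<le>
      ennreal (real m powr (real m / 2) * t powr (- real m / 2) * exp (3 * t * \<theta>\<^sup>2))"
      using False by simp
  qed (use False in simp)
qed

section \<open>The heat equation for the kernel\<close>

text \<open>The forward equation of the Poisson process; at \<open>j = 0\<close> it persists because
  the weight at -1 is 0.\<close>

lemma DERIV_pker: "((\<lambda>t. pker t j) has_real_derivative pker t (j - 1) - pker t j) (at t)"
proof (cases "0 \<le> j")
  case False
  then show ?thesis by (simp add: pker_def)
next
  case True
  then obtain m where j: "j = int m" using nonneg_int_cases by blast
  show ?thesis
  proof (cases m)
    case 0
    then show ?thesis unfolding j by (auto simp: pker_def intro!: derivative_eq_intros)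
  next
    case (Suc k)
    then have e: "int m - 1 = int k" by simp
    have "((\<lambda>t. exp (- t) * t ^ m / fact m) has_real_derivative
       (exp (- t) * (real m * t ^ (m - 1)) - exp (- t) * t ^ m) / fact m) (at t)"
      by (auto intro!: derivative_eq_intros simp: field_simps)
    moreover have "(exp (- t) * (real m * t ^ (m - 1)) - exp (- t) * t ^ m) / fact m = pker t (int k) - pker t (int m)"
      by (simp add: pker_def Suc fact_Suc field_simps del: of_nat_Suc)
    ultimately show ?thesis unfolding j e by (simp add: pker_def)
  qed
qed

lemma pker_mono: "0 \<le> s \<Longrightarrow> s \<le> t \<Longrightarrow> pker s j \<le> exp (t - s) * pker t j"
  by (auto simp: pker_def exp_diff exp_minus field_simps intro!: divide_right_mono mult_left_mono power_mono)

lemma abs_pker_le: assumes "\<bar>t\<bar> \<le> R" shows "\<bar>pker t j\<bar> \<le> exp (2 * R) * pker R j"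
proof -
  have "\<bar>pker t j\<bar> = exp (\<bar>t\<bar> - t) * pker \<bar>t\<bar> j" by (rule abs_pker)
  also have "\<dots> \<le> exp (\<bar>t\<bar> - t) * (exp (R - \<bar>t\<bar>) * pker R j)"
    using assms by (intro mult_left_mono pker_mono) auto
  also have "\<dots> = exp (R - t) * pker R j" by (simp add: exp_add[symmetric] mult.assoc[symmetric])
  also have "\<dots> \<le> exp (2 * R) * pker R j" using assms by (intro mult_right_mono pker_nonneg) auto
  finally show ?thesis .
qed

lemma hker_nonneg: "0 \<le> t \<Longrightarrow> 0 \<le> hker t n"
  unfolding hker_def conv_def rker_def by (intro Bochner_Integration.integral_nonneg) (simp add: pker_nonneg)

text \<open>Since exp(t) \<open>pker t j\<close> = t^j/j! increases in \<open>t\<close>, the kernel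
  at time \<open>R\<close> dominates all kernels with |t| <= R. It provides the summable majorant
  for differentiation under the sum.\<close>

lemma abs_hker_le: assumes "\<bar>t\<bar> \<le> R" shows "\<bar>hker t n\<bar> \<le> exp (4 * R) * hker R n"
proof -
  have "\<bar>hker t n\<bar> \<le> (\<integral>j. \<bar>rker t j * pker t (n - j)\<bar> \<partial>count_space UNIV)"
    unfolding hker_def conv_def by (rule integral_abs_bound)
  also have "\<dots> \<le> (\<integral>j. exp (4 * R) * (rker R j * pker R (n - j)) \<partial>count_space UNIV)"
  proof (rule integral_mono)
    show "integrable (count_space UNIV) (\<lambda>j. \<bar>rker t j * pker t (n - j)\<bar>)"
      by (intro integrable_abs conv_integrable rapid_rker rapid_expb rapid_pker)
    show "integrable (count_space UNIV) (\<lambda>j. exp (4 * R) * (rker R j * pker R (n - j)))"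
      by (intro integrable_mult_right conv_integrable rapid_rker rapid_expb rapid_pker)
    fix j
    have R: "0 \<le> R" using assms by simp
    have "\<bar>rker t j\<bar> * \<bar>pker t (n - j)\<bar> \<le> (exp (2 * R) * rker R j) * (exp (2 * R) * pker R (n - j))"
      unfolding rker_def using R by (intro mult_mono abs_pker_le assms mult_nonneg_nonneg pker_nonneg) auto
    also have "\<dots> = exp (4 * R) * (rker R j * pker R (n - j))"
    proof -
      have "exp (4 * R) = exp (2 * R) * exp (2 * R)" by (simp add: exp_add[symmetric])
      then show ?thesis by simp
    qed
    finally show "\<bar>rker t j * pker t (n - j)\<bar> \<le> exp (4 * R) * (rker R j * pker R (n - j))"
      by (simp add: abs_mult)
  qed
  also have "\<dots> = exp (4 * R) * hker R n" by (simp add: hker_def conv_def)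
  finally show ?thesis .
qed

text \<open>Product rule inside the convolution: the reflected factor yields the forward difference
  of \<open>hker t\<close>, the other one the backward difference, and their sum is the
  Laplacian.\<close>

lemma DERIV_hker: "((\<lambda>t. hker t n) has_real_derivative lap (hker t) n) (at t)"
proof -
  define p' where "p' t j = pker t (j - 1) - pker t j" for t j
  define r' where "r' t j = rker t (j + 1) - rker t j" for t j
  define R where "R = \<bar>t\<bar> + 1"
  define E where "E = exp (2 * R)"
  define G where "G j = E * (rker R (j + 1) + rker R j) * (E * pker R (n - j)) + E * rker R j * (E * (pker R (n - j - 1) + pker R (n - j)))" for j
  note r = rapid_pker rapid_rker rapid_expb rapid_conv rapid_shift rapid_diff
  have bR: "\<bar>s\<bar> \<le> R" if "\<bar>s - t\<bar> < 1" for s using that by (auto simp: R_def)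
  have R0: "0 \<le> R" by (simp add: R_def)
  have bp: "\<bar>pker s j\<bar> \<le> E * pker R j" "\<bar>rker s j\<bar> \<le> E * rker R j" if "\<bar>s - t\<bar> < 1" for s j
    using abs_pker_le[OF bR[OF that]] by (auto simp: E_def rker_def)
  have i1: "integrable (count_space UNIV) (\<lambda>j. rker s (j + c) * pker u (n - j + d))" for s u c d
    using conv_integrable[OF rapid_shift[OF rapid_rker] expb_shift[OF rapid_expb[OF rapid_pker]], of s c u d n] by (simp add: algebra_simps)
  have "((\<lambda>t. \<integral>j. rker t j * pker t (n - j) \<partial>count_space UNIV) has_real_derivative
     (\<integral>j. r' t j * pker t (n - j) + rker t j * p' t (n - j) \<partial>count_space UNIV)) (at t)"
  proof (rule has_real_derivative_integral[where \<epsilon> = 1 and g = G])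
    show "integrable (count_space UNIV) G"
    proof -
      have "G = (\<lambda>j. E * E * (rker R (j + 1) * pker R (n - j + 0)) + E * E * (rker R (j + 0) * pker R (n - j + 0)) +
         (E * E * (rker R (j + 0) * pker R (n - j + (-1))) + E * E * (rker R (j + 0) * pker R (n - j + 0))))"
        by (simp add: G_def fun_eq_iff algebra_simps)
      then show ?thesis by (simp only:) (intro Bochner_Integration.integrable_add integrable_mult_right i1)
    qed
    fix j s assume s: "\<bar>s - t\<bar> < 1"
    have "((\<lambda>y. rker y j) has_real_derivative r' s j) (at s)"
    proof -
      have "- (j + 1) = - j - 1" by simp
      then show ?thesis using DERIV_pker[of "- j" s] by (simp only: rker_def r'_def)
    qed
    moreover have "((\<lambda>y. pker y (n - j)) has_real_derivative p' s (n - j)) (at s)"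
      unfolding p'_def by (rule DERIV_pker)
    ultimately show "((\<lambda>y. rker y j * pker y (n - j)) has_real_derivative r' s j * pker s (n - j) + rker s j * p' s (n - j)) (at s)"
      by (auto intro!: derivative_eq_intros)
    have "\<bar>r' s j\<bar> \<le> E * (rker R (j + 1) + rker R j)"
      using bp(2)[OF s, of j] bp(2)[OF s, of "j + 1"] by (simp add: r'_def distrib_left)
    moreover have "\<bar>p' s (n - j)\<bar> \<le> E * (pker R (n - j - 1) + pker R (n - j))"
      using bp(1)[OF s, of "n - j"] bp(1)[OF s, of "n - j - 1"] by (simp add: p'_def distrib_left)
    moreover have "0 \<le> E" "\<And>j. 0 \<le> pker R j" "\<And>j. 0 \<le> rker R j" using R0 by (auto simp: E_def rker_def pker_nonneg)
    ultimately have "\<bar>r' s j\<bar> * \<bar>pker s (n - j)\<bar> + \<bar>rker s j\<bar> * \<bar>p' s (n - j)\<bar> \<le> G j"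
      unfolding G_def using bp[OF s] by (intro add_mono mult_mono) auto
    then show "\<bar>r' s j * pker s (n - j) + rker s j * p' s (n - j)\<bar> \<le> G j"
      using abs_triangle_ineq[of "r' s j * pker s (n - j)" "rker s j * p' s (n - j)"]
      unfolding abs_mult by linarith
  next
    fix s
    show "integrable (count_space UNIV) (\<lambda>j. rker s j * pker s (n - j))" using i1[of s 0 s 0] by simp
  qed auto
  also have "(\<integral>j. r' t j * pker t (n - j) + rker t j * p' t (n - j) \<partial>count_space UNIV) =
      conv (r' t) (pker t) n + conv (rker t) (p' t) n"
  proof -
    have "rapid (r' t)" unfolding r'_def by (intro r)
    moreover have "expb (p' t)" unfolding p'_def using rapid_shift[OF rapid_pker, of t "-1"] by (auto intro!: r)
    ultimately show ?thesis unfolding conv_def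
      by (intro Bochner_Integration.integral_add conv_integrable) (simp_all add: rapid_rker rapid_pker rapid_expb)
  qed
  also have "conv (r' t) (pker t) n = hker t (n + 1) - hker t n"
    unfolding r'_def using conv_shift_left[of "rker t" 1 "pker t" n]
    by (subst conv_diff_left) (auto intro!: r simp: hker_def)
  also have "conv (rker t) (p' t) n = hker t (n - 1) - hker t n"
    unfolding p'_def using conv_shift_right[of "rker t" "pker t" "-1" n] rapid_shift[OF rapid_pker, of t "-1"]
    by (subst conv_diff_right) (auto intro!: r simp: hker_def)
  finally show ?thesis by (simp add: hker_def[symmetric] conv_def[symmetric] lap_def algebra_simps)
qed

lemma conv_lap_hker: "expb f \<Longrightarrow> conv (lap (hker t)) f = conv (hker t) (lap f)"
proof -
  assume f: "expb f"
  have "lap (hker t) = (\<lambda>n. (delta_right ^^ 2) (hker t) (n - 1))" by (simp add: fun_eq_iff lap_eq_delta_right)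
  then have "conv (lap (hker t)) f n = conv ((delta_right ^^ 2) (hker t)) f (n - 1)" for n
    using conv_shift_left[of "(delta_right ^^ 2) (hker t)" "-1" f n] by simp
  also have "conv ((delta_right ^^ 2) (hker t)) f (n - 1) = (delta_right ^^ 2) (conv (hker t) f) (n - 1)" for n
    by (simp only: delta_right_funpow_conv_left[OF rapid_hker f])
  also have "\<dots> n = lap (conv (hker t) f) n" for n by (simp add: lap_eq_delta_right)
  finally show ?thesis by (simp add: fun_eq_iff lap_conv_right[OF rapid_hker f])
qed

lemma DERIV_conv_hker:
  assumes f: "expb f"
  shows "((\<lambda>t. conv (hker t) f n) has_real_derivative conv (hker t) (lap f) n) (at t)"
proof -
  define R where "R = \<bar>t\<bar> + 1"
  define E where "E = exp (4 * R)"
  define G where "G j = E * (hker R (j + 1) + 2 * hker R j + hker R (j - 1)) * \<bar>f (n - j)\<bar>" for j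
  have bR: "\<bar>s\<bar> \<le> R" if "\<bar>s - t\<bar> < 1" for s using that by (auto simp: R_def)
  have i1: "integrable (count_space UNIV) (\<lambda>j. hker s (j + c) * f (n - j))" for s c
    by (intro conv_integrable rapid_shift rapid_hker f)
  have i2: "integrable (count_space UNIV) (\<lambda>j. hker R (j + c) * \<bar>f (n - j)\<bar>)" for c
    using integrable_abs[OF i1[of R c]] hker_nonneg[of R] by (simp add: abs_mult R_def)
  have "((\<lambda>t. \<integral>j. hker t j * f (n - j) \<partial>count_space UNIV) has_real_derivative
     (\<integral>j. lap (hker t) j * f (n - j) \<partial>count_space UNIV)) (at t)"
  proof (rule has_real_derivative_integral[where \<epsilon> = 1 and g = G])
    show "integrable (count_space UNIV) G"
    proof -
      have "G = (\<lambda>j. E * (hker R (j + 1) * \<bar>f (n - j)\<bar>) + 2 * E * (hker R (j + 0) * \<bar>f (n - j)\<bar>) + E * (hker R (j + (-1)) * \<bar>f (n - j)\<bar>))"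
        by (simp add: G_def fun_eq_iff algebra_simps)
      then show ?thesis by (simp only:) (intro Bochner_Integration.integrable_add integrable_mult_right i2)
    qed
    fix j s assume s: "\<bar>s - t\<bar> < 1"
    show "((\<lambda>y. hker y j * f (n - j)) has_real_derivative lap (hker s) j * f (n - j)) (at s)"
      by (intro DERIV_cmult_right DERIV_hker)
    have "\<bar>lap (hker s) j\<bar> \<le> E * (hker R (j + 1) + 2 * hker R j + hker R (j - 1))"
      using abs_hker_le[OF bR[OF s], of "j + 1"] abs_hker_le[OF bR[OF s], of j] abs_hker_le[OF bR[OF s], of "j - 1"]
      unfolding lap_def distrib_left E_def[symmetric] by linarith
    then show "\<bar>lap (hker s) j * f (n - j)\<bar> \<le> G j" unfolding G_def abs_mult by (rule mult_right_mono) simp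
  next
    fix s
    show "integrable (count_space UNIV) (\<lambda>j. hker s j * f (n - j))" using i1[of s 0] by simp
  qed auto
  then show ?thesis using conv_lap_hker[OF f, of t] by (simp add: conv_def fun_eq_iff)
qed

lemma continuous_conv_hker: "expb f \<Longrightarrow> continuous_on S (\<lambda>t. conv (hker t) f n)"
  by (intro continuous_at_imp_continuous_on ballI DERIV_isCont[OF DERIV_conv_hker])

lemma measurable_conv_hker [measurable]: "expb f \<Longrightarrow> (\<lambda>t. conv (hker t) f n) \<in> borel_measurable borel"
  by (rule borel_measurable_continuous_onI) (rule continuous_conv_hker)

section \<open>Identification with the Bessel kernel and time derivatives of the heat
  extension\<close>

text \<open>The convolution is the sum over m >= 0 of \<open>pker t m * pker t (n + m)\<close>,
  which matches the Bessel series term by term. Where n + m < 0 both terms vanish: the Poisson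
  weight by its support, the Bessel term because \<open>rGamma\<close> is 0 at the poles of
  \<Gamma>.\<close>

lemma heat_kernel_eq_hker:
  assumes t: "0 < t"
  shows "heat_kernel t n = hker t n"
proof -
  have int: "integrable (count_space UNIV) (\<lambda>m. pker t m * pker t (n + m))"
    using integrable_bij_count_space[OF bij_int_diff[of 0], of "\<lambda>m. pker t m * pker t (n + m)"]
      conv_integrable[OF rapid_rker rapid_expb[OF rapid_pker], of t t n] by (simp add: rker_def)
  have bij: "bij_betw int UNIV {0..}" by (rule bij_betw_byWitness[where f' = nat]) auto
  have "hker t n = (\<integral>m. pker t m * pker t (n + m) \<partial>count_space UNIV)"
    unfolding hker_def conv_def using integral_int_reflect[of "\<lambda>m. pker t m * pker t (n + m)" 0] by (simp add: rker_def)
  also have "\<dots> = (\<integral>m. pker t m * pker t (n + m) \<partial>count_space {0..})"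
    by (rule integral_int_restrict) (auto simp: pker_def)
  also have "\<dots> = (\<integral>m. pker t (int m) * pker t (n + int m) \<partial>count_space UNIV)"
    by (rule integral_bij_count_space[OF bij, symmetric])
  finally have h: "hker t n = (\<integral>m. pker t (int m) * pker t (n + int m) \<partial>count_space UNIV)" .
  have "integrable (count_space {0..}) (\<lambda>m. pker t m * pker t (n + m))"
    using int integrable_restrict_space[of "{0..}" "count_space UNIV" "\<lambda>m. pker t m * pker t (n + m)"]
      integrable_mult_indicator[of "{0..}" "count_space UNIV" "\<lambda>m. pker t m * pker t (n + m)"]
    by (simp add: restrict_count_space)
  then have "integrable (count_space UNIV) (\<lambda>m. pker t (int m) * pker t (n + int m))"
    by (subst integrable_bij_count_space[OF bij])
  from sums_integral_count_space_nat[OF this]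
  have s: "(\<lambda>m. pker t (int m) * pker t (n + int m)) sums hker t n" by (simp add: h)
  define B where "B m = (2 * t / 2) powi (2 * int m + n) * rGamma (real m + real_of_int n + 1) / fact m" for m
  have trm: "pker t (int m) * pker t (n + int m) = exp (- 2 * t) * B m" for m
  proof (cases "0 \<le> n + int m")
    case True
    then obtain N where N: "n + int m = int N" using nonneg_int_cases by blast
    have e: "2 * int m + n = int (m + N)" using N by simp
    have "real m + real_of_int n + 1 = 1 + of_nat N" using N by linarith
    then have g: "rGamma (real m + real_of_int n + 1) = 1 / fact N"
      by (simp only: rGamma_inverse_Gamma Gamma_fact) (simp add: divide_inverse)
    have ee: "exp (- 2 * t) = exp (- t) * exp (- t)" by (simp add: exp_add[symmetric])
    show ?thesis unfolding B_def e power_int_of_nat g N ee by (simp add: pker_def power_add mult_ac)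
  next
    case False
    then have "real m + real_of_int n + 1 = of_int (int m + n + 1)" "int m + n + 1 \<le> 0" by auto
    then have "rGamma (real m + real_of_int n + 1) = 0"
      by (simp only: rGamma_eq_zero_iff) (auto simp: nonpos_Ints_def intro!: exI[of _ "int m + n + 1"])
    then show ?thesis using False by (simp add: B_def pker_def)
  qed
  have "(\<lambda>m. exp (2 * t) * (exp (- 2 * t) * B m)) sums (exp (2 * t) * hker t n)"
    using s unfolding trm by (rule sums_mult)
  then have "B sums (exp (2 * t) * hker t n)" by (simp add: mult.assoc[symmetric] exp_add[symmetric])
  then have "Bessel_I n (2 * t) = exp (2 * t) * hker t n" unfolding Bessel_I_def B_def[symmetric] by (rule sums_unique[symmetric])
  then show ?thesis by (simp add: heat_kernel_def mult.assoc[symmetric] exp_add[symmetric])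
qed

lemma heat_eq_conv:
  assumes "0 < t" "expb f"
  shows "heat t f n = conv (hker t) f n"
proof -
  have int: "integrable (count_space UNIV) (\<lambda>j. hker t (n - j) * f j)"
    using integrable_bij_count_space[OF bij_int_diff[of n], of "\<lambda>j. hker t (n - j) * f j"]
      conv_integrable[OF rapid_hker assms(2), of t n] by simp
  have "heat t f n = (\<Sum>\<^sub>\<infinity>j\<in>UNIV. hker t (n - j) * f j)"
    by (simp add: heat_def heat_kernel_eq_hker assms)
  also have "\<dots> = infsetsum (\<lambda>j. hker t (n - j) * f j) UNIV"
    by (rule infsetsum_infsum[symmetric]) (simp add: Infinite_Set_Sum.abs_summable_on_def int)
  also have "\<dots> = (\<integral>j. hker t (n - j) * f j \<partial>count_space UNIV)" by (simp add: infsetsum_def)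
  also have "\<dots> = conv (hker t) f n"
    using integral_int_reflect[of "\<lambda>j. hker t (n - j) * f j" n] by (simp add: conv_def)
  finally show ?thesis .
qed

text \<open>The function is known only on an open set, as the semigroups are for positive times;
  locality of the derivative carries the induction.\<close>

lemma funpow_deriv_eq:
  fixes \<phi> :: "real \<Rightarrow> real"
  assumes S: "open S" and "\<And>t. t \<in> S \<Longrightarrow> \<phi> t = u 0 t"
    and "\<And>k t. t \<in> S \<Longrightarrow> (u k has_real_derivative u (Suc k) t) (at t)"
    and "t \<in> S"
  shows "(deriv ^^ k) \<phi> t = u k t"
  using assms(4)
proof (induction k arbitrary: t)
  case (Suc k)
  have "((deriv ^^ k) \<phi> has_real_derivative u (Suc k) t) (at t)"
    by (rule has_field_derivative_transform_within_open[OF assms(3)[OF Suc.prems] S Suc.prems]) (simp add: Suc.IH)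
  then show ?case by (simp add: DERIV_imp_deriv)
qed (use assms in simp)

lemma funpow_deriv_heat:
  assumes "0 < t" "expb f"
  shows "(deriv ^^ k) (\<lambda>s. heat s f n) t = conv (hker t) ((lap ^^ k) f) n"
proof (rule funpow_deriv_eq[where S = "{0<..}" and u = "\<lambda>k t. conv (hker t) ((lap ^^ k) f) n"])
  fix k t
  show "((\<lambda>t. conv (hker t) ((lap ^^ k) f) n) has_real_derivative conv (hker t) ((lap ^^ Suc k) f) n) (at t)"
    using DERIV_conv_hker[OF expb_lap_funpow[OF assms(2)], of k n t] by simp
qed (use assms in \<open>auto simp: heat_eq_conv\<close>)

section \<open>Smoothing in norm and pointwise bounds\<close>

lemma abs_diff_le_nn_integral:
  assumes ab: "a \<le> b" and d: "\<And>x. a \<le> x \<Longrightarrow> x \<le> b \<Longrightarrow> (u has_real_derivative u' x) (at x)"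
    and c: "continuous_on {a..b} u'"
  shows "ennreal \<bar>u b - u a\<bar> \<le> (\<integral>\<^sup>+x. ennreal \<bar>u' x\<bar> * indicator {a..b} x \<partial>lborel)"
proof -
  have "integral\<^sup>L lborel (\<lambda>x. indicator {a..b} x *\<^sub>R u' x) = u b - u a"
    using d by (intro integral_FTC_atLeastAtMost ab c)
      (auto simp: has_real_derivative_iff_has_vector_derivative[symmetric] intro: has_field_derivative_at_within)
  moreover have i: "integrable lborel (\<lambda>x. indicator {a..b} x *\<^sub>R u' x)"
    using borel_integrable_atLeastAtMost'[OF c] by (simp add: set_integrable_def)
  ultimately have "ennreal \<bar>u b - u a\<bar> \<le> (\<integral>\<^sup>+x. ennreal (norm (indicator {a..b} x *\<^sub>R u' x)) \<partial>lborel)"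
    using integral_norm_bound_ennreal[OF i] by simp
  also have "\<dots> = (\<integral>\<^sup>+x. ennreal \<bar>u' x\<bar> * indicator {a..b} x \<partial>lborel)"
    by (intro nn_integral_cong) (auto simp: indicator_def)
  finally show ?thesis .
qed

lemma lp_norm_smoothing:
  assumes p: "1 \<le> p"
  obtains C where "0 < C" "\<And>t F. 0 < t \<Longrightarrow> expb F \<Longrightarrow>
    lp_norm p ((delta_right ^^ m) (conv (hker t) F)) \<le> ennreal (C * t powr (- real m / 2)) * lp_norm p F"
proof -
  obtain C where C: "0 < C" "\<And>t \<theta>. 0 < t \<Longrightarrow> \<bar>\<theta>\<bar> \<le> 1/2 \<Longrightarrow>
       tnorm \<theta> ((delta_right ^^ m) (hker t)) \<le> ennreal (C * t powr (- real m / 2) * exp (3 * t * \<theta>\<^sup>2))"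
    using tnorm_delta_funpow_hker[of m] by metis
  show thesis
  proof (rule that[of "2 * C"])
    fix t :: real and F :: "int \<Rightarrow> real" assume t: "0 < t" and F: "expb F"
    have "lp_norm p ((delta_right ^^ m) (conv (hker t) F)) \<le> 2 * (tnorm 0 ((delta_right ^^ m) (hker t)) * lp_norm p F)"
      unfolding delta_right_funpow_conv_left[OF rapid_hker F] by (rule lp_norm_conv_le[OF p])
    also have "\<dots> \<le> 2 * (ennreal (C * t powr (- real m / 2)) * lp_norm p F)"
      using C(2)[OF t, of 0] by (intro mult_left_mono mult_right_mono) auto
    also have "\<dots> = ennreal (2 * C * t powr (- real m / 2)) * lp_norm p F"
    proof -
      have "ennreal (2 * C * t powr (- real m / 2)) = 2 * ennreal (C * t powr (- real m / 2))"
        using C(1) by (simp add: mult.assoc ennreal_mult')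
      then show ?thesis by (simp add: mult.assoc)
    qed
    finally show "lp_norm p ((delta_right ^^ m) (conv (hker t) F)) \<le> \<dots>" .
  qed (use C in simp)
qed

lemma tnorm_ge: "ennreal (exp (\<theta> * real_of_int j) * \<bar>a j\<bar>) \<le> tnorm \<theta> a"
proof -
  have "ennreal (exp (\<theta> * real_of_int j) * \<bar>a j\<bar>) = (\<Sum>\<^sup>+k. ennreal (exp (\<theta> * real_of_int k) * \<bar>a k\<bar>) * indicator {j} k)"
    by simp
  also have "\<dots> \<le> tnorm \<theta> a" unfolding tnorm_def by (intro nn_integral_mono) (auto simp: indicator_def)
  finally show ?thesis .
qed

lemma rapid_tendsto_zero: assumes "rapid a" shows "(\<lambda>N. a (j + int N)) \<longlonglongrightarrow> 0"
proof -
  have "tnorm 1 a < \<top>" using assms by (simp add: rapid_def)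
  then obtain W where W: "tnorm 1 a = ennreal W" "0 \<le> W" by (cases "tnorm 1 a") auto
  have b: "\<bar>a n\<bar> \<le> W * exp (- real_of_int n)" for n
  proof -
    have "exp (real_of_int n) * \<bar>a n\<bar> \<le> W" using tnorm_ge[of 1 n a] W by (simp add: ennreal_le_iff)
    then show ?thesis by (simp add: exp_minus field_simps)
  qed
  have lim: "(\<lambda>N. W * exp (- real_of_int j) * exp (-1) ^ N) \<longlonglongrightarrow> W * exp (- real_of_int j) * 0"
    by (intro tendsto_intros LIMSEQ_realpow_zero) auto
  have bd: "\<bar>a (j + int N)\<bar> \<le> W * exp (- real_of_int j) * exp (-1) ^ N" for N
  proof -
    have "exp (- real_of_int (j + int N)) = exp (- real_of_int j) * exp (-1) ^ N"
      by (simp add: exp_of_nat_mult[symmetric] exp_add[symmetric])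
    then show ?thesis using b[of "j + int N"] by simp
  qed
  show ?thesis
  proof (rule Lim_null_comparison)
    show "\<forall>\<^sub>F N in sequentially. norm (a (j + int N)) \<le> W * exp (- real_of_int j) * exp (-1) ^ N"
      by (intro always_eventually allI) (simp only: real_norm_def bd)
  qed (rule lim[unfolded mult_zero_right])
qed

text \<open>Telescoping towards +\<infinity>: \<open>a j\<close> is the sum of the differences at
  all i >= j, and the tilt only grows along that ray. A pointwise bound thus costs one difference,
  which for the heat kernel is worth a further factor 1/\<open>max 1 (sqrt t)\<close>.\<close>

lemma rapid_pointwise_nonneg:
  assumes a: "rapid a" and \<theta>: "0 \<le> \<theta>"
  shows "ennreal (exp (\<theta> * real_of_int j) * \<bar>a j\<bar>) \<le> tnorm \<theta> (delta_right a)"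
proof -
  have "tnorm \<theta> (delta_right a) < \<top>" using rapid_delta_right[OF a] by (simp add: rapid_def)
  then obtain W where W: "tnorm \<theta> (delta_right a) = ennreal W" "0 \<le> W" by (cases "tnorm \<theta> (delta_right a)") auto
  have tele: "a j = a (j + int N) + (\<Sum>i<N. delta_right a (j + int i))" for N
    by (induction N) (auto simp: delta_right_def algebra_simps)
  have bnd: "exp (\<theta> * real_of_int j) * \<bar>a j\<bar> \<le> exp (\<theta> * real_of_int j) * \<bar>a (j + int N)\<bar> + W" for N
  proof -
    have "(\<Sum>i<N. exp (\<theta> * real_of_int j) * \<bar>delta_right a (j + int i)\<bar>) \<le>
      (\<Sum>i<N. exp (\<theta> * real_of_int (j + int i)) * \<bar>delta_right a (j + int i)\<bar>)"
      using \<theta> by (intro sum_mono mult_right_mono) (auto intro!: mult_left_mono)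
    also have "\<dots> = (\<Sum>k\<in>(\<lambda>i. j + int i) ` {..<N}. exp (\<theta> * real_of_int k) * \<bar>delta_right a k\<bar>)"
      by (subst sum.reindex) (auto simp: inj_on_def)
    also have "\<dots> \<le> W"
    proof -
      let ?F = "(\<lambda>i. j + int i) ` {..<N}"
      have "ennreal (\<Sum>k\<in>?F. exp (\<theta> * real_of_int k) * \<bar>delta_right a k\<bar>) =
        (\<Sum>\<^sup>+k. ennreal (exp (\<theta> * real_of_int k) * \<bar>delta_right a k\<bar>) * indicator ?F k)"
        by (simp add: nn_integral_count_space_indicator[symmetric] nn_integral_count_space_finite)
      also have "\<dots> \<le> tnorm \<theta> (delta_right a)" unfolding tnorm_def by (intro nn_integral_mono) (auto simp: indicator_def)
      finally show ?thesis using W by (simp add: ennreal_le_iff)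
    qed
    finally have s: "(\<Sum>i<N. exp (\<theta> * real_of_int j) * \<bar>delta_right a (j + int i)\<bar>) \<le> W" .
    have "\<bar>a j\<bar> \<le> \<bar>a (j + int N)\<bar> + (\<Sum>i<N. \<bar>delta_right a (j + int i)\<bar>)"
      using tele[of N] sum_abs[of "\<lambda>i. delta_right a (j + int i)" "{..<N}"] by linarith
    then have "exp (\<theta> * real_of_int j) * \<bar>a j\<bar> \<le> exp (\<theta> * real_of_int j) * (\<bar>a (j + int N)\<bar> + (\<Sum>i<N. \<bar>delta_right a (j + int i)\<bar>))"
      by (intro mult_left_mono) auto
    then show ?thesis using s by (simp add: distrib_left sum_distrib_left)
  qed
  have lim: "(\<lambda>N. exp (\<theta> * real_of_int j) * \<bar>a (j + int N)\<bar> + W) \<longlonglongrightarrow> exp (\<theta> * real_of_int j) * \<bar>0\<bar> + W"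
    by (intro tendsto_intros rapid_tendsto_zero a)
  have "exp (\<theta> * real_of_int j) * \<bar>a j\<bar> \<le> exp (\<theta> * real_of_int j) * \<bar>0\<bar> + W"
    by (rule LIMSEQ_le_const[OF lim]) (use bnd in blast)
  then have "exp (\<theta> * real_of_int j) * \<bar>a j\<bar> \<le> W" by simp
  then show ?thesis using W by (simp add: ennreal_leI)
qed

lemma rapid_pointwise:
  assumes a: "rapid a" and \<theta>: "0 \<le> \<theta>"
  shows "ennreal (exp (\<theta> * mag j) * \<bar>a j\<bar>) \<le> tnorm \<theta> (delta_right a) + tnorm (- \<theta>) (delta_right a)"
proof (cases "0 \<le> j")
  case True
  then show ?thesis using rapid_pointwise_nonneg[OF a \<theta>, of j] by (simp add: add_increasing2)
next
  case False
  define b where "b i = a (- i)" for i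
  have "rapid b" using a unfolding b_def rapid_def tnorm_reflect by simp
  then have "ennreal (exp (\<theta> * real_of_int (- j)) * \<bar>b (- j)\<bar>) \<le> tnorm \<theta> (delta_right b)"
    by (rule rapid_pointwise_nonneg[OF _ \<theta>])
  also have "tnorm \<theta> (delta_right b) = tnorm (- \<theta>) (\<lambda>i. delta_right a (i + (- 1)))"
  proof -
    have "delta_right b i = - (\<lambda>i. delta_right a (i + (- 1))) (- i)" for i
    proof -
      have "- (i + 1) = - i + (- 1)" by simp
      then show ?thesis by (simp only: delta_right_def b_def) simp
    qed
    then have "tnorm \<theta> (delta_right b) = tnorm \<theta> (\<lambda>i. (\<lambda>i. delta_right a (i + (- 1))) (- i))"
      unfolding tnorm_def by simp
    then show ?thesis using tnorm_reflect[of \<theta> "\<lambda>i. delta_right a (i + (- 1))"] by simp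
  qed
  also have "\<dots> \<le> tnorm (- \<theta>) (delta_right a)"
  proof -
    have "ennreal (exp (- \<theta>)) * tnorm (- \<theta>) (delta_right a) \<le> 1 * tnorm (- \<theta>) (delta_right a)"
      using \<theta> by (intro mult_right_mono) auto
    then show ?thesis unfolding tnorm_shift by simp
  qed
  finally show ?thesis using False by (simp add: b_def add_increasing)
qed

section \<open>From differences to the heat semigroup\<close>

text \<open>Kernels with the size and localisation of an \<open>m\<close>-th difference of the heat
  kernel. The tilt is the inverse of the spatial scale \<open>max 1 (sqrt t)\<close>, so that
  t\<theta>^2 and with it the Gaussian factor stays bounded.\<close>

definition kernel_family :: "nat \<Rightarrow> (real \<Rightarrow> int \<Rightarrow> real) \<Rightarrow> bool" where
  "kernel_family m A \<longleftrightarrow> (\<exists>C>0. \<forall>t>0. \<forall>\<sigma>\<in>{-1, 1}.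
     tnorm (\<sigma> / (2 * max 1 (sqrt t))) (A t) \<le> ennreal (C / max 1 (sqrt t) ^ m))"

lemma powr_half_eq_sqrt_power:
  assumes "0 < t"
  shows "t powr (- real m / 2) = 1 / sqrt t ^ m"
proof -
  have "sqrt t ^ m = sqrt t powr real m" using assms by (intro powr_realpow[symmetric]) simp
  also have "\<dots> = (t powr (1/2)) powr real m" using assms by (subst powr_half_sqrt) auto
  also have "\<dots> = t powr (real m / 2)" by (simp add: powr_powr)
  finally show ?thesis using powr_minus_divide[of t "real m / 2"] by simp
qed

lemma exp_half_le_2: "exp (1/2 :: real) \<le> 2"
  using exp_le_quadratic[of "1/2"] by (simp add: power2_eq_square)

lemma tnorm_delta_right: assumes "\<bar>\<theta>\<bar> \<le> 1/2" shows "tnorm \<theta> (delta_right a) \<le> 3 * tnorm \<theta> a"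
proof -
  have "tnorm \<theta> (delta_right a) \<le> tnorm \<theta> a + tnorm \<theta> (\<lambda>n. a (n + 1))"
    unfolding delta_right_def[abs_def] by (rule tnorm_diff)
  also have "\<dots> = tnorm \<theta> a + ennreal (exp (- \<theta>)) * tnorm \<theta> a" by (simp add: tnorm_shift)
  also have "\<dots> \<le> tnorm \<theta> a + ennreal 2 * tnorm \<theta> a"
  proof (intro add_left_mono mult_right_mono ennreal_leI)
    have "exp (- \<theta>) \<le> exp (1/2)" using assms by simp
    then show "exp (- \<theta>) \<le> 2" using exp_half_le_2 by linarith
  qed simp
  also have "\<dots> = (1 + 2) * tnorm \<theta> a" by (simp only: distrib_right mult_1_left ennreal_numeral zero_le_numeral)
  finally show ?thesis by simp
qed

lemma tnorm_delta_right_funpow: assumes "\<bar>\<theta>\<bar> \<le> 1/2" shows "tnorm \<theta> ((delta_right ^^ m) a) \<le> 3 ^ m * tnorm \<theta> a"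
proof (induction m)
  case (Suc m)
  have "tnorm \<theta> ((delta_right ^^ Suc m) a) \<le> 3 * tnorm \<theta> ((delta_right ^^ m) a)"
    using tnorm_delta_right[OF assms] by simp
  also have "\<dots> \<le> 3 * (3 ^ m * tnorm \<theta> a)" by (intro mult_left_mono Suc) auto
  finally show ?case by (simp add: mult.assoc)
qed simp

lemma kernel_family_delta_hker: "kernel_family m (\<lambda>t. (delta_right ^^ m) (hker t))"
proof -
  obtain C where C: "0 < C" "\<And>t \<theta>. 0 < t \<Longrightarrow> \<bar>\<theta>\<bar> \<le> 1/2 \<Longrightarrow>
       tnorm \<theta> ((delta_right ^^ m) (hker t)) \<le> ennreal (C * t powr (- real m / 2) * exp (3 * t * \<theta>\<^sup>2))"
    using tnorm_delta_funpow_hker[of m] by metis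
  define D where "D = max (C * exp 1) (3 ^ m * exp 1)"
  show ?thesis unfolding kernel_family_def
  proof (intro exI[of _ D] conjI allI impI ballI)
    show "0 < D" by (simp add: D_def less_max_iff_disj)
    fix t \<sigma> :: real assume t: "0 < t" and \<sigma>: "\<sigma> \<in> {-1, 1}"
    define R where "R = max 1 (sqrt t)"
    define \<theta> where "\<theta> = \<sigma> / (2 * R)"
    have R: "1 \<le> R" "sqrt t \<le> R" by (auto simp: R_def)
    have \<theta>: "\<bar>\<theta>\<bar> = 1 / (2 * R)" using \<sigma> R by (auto simp: \<theta>_def abs_divide)
    have "1 / (2 * R) \<le> 1/2" using R by (simp add: field_simps)
    then have \<theta>2: "\<bar>\<theta>\<bar> \<le> 1/2" unfolding \<theta> .
    have \<theta>s: "\<theta>\<^sup>2 = 1 / (4 * R\<^sup>2)" using \<sigma> by (auto simp: \<theta>_def power_divide power_mult_distrib)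
    have "t \<le> R\<^sup>2" using R t by (metis real_sqrt_ge_zero real_sqrt_pow2 less_imp_le power_mono)
    then have "3 * t \<le> 4 * R\<^sup>2" using zero_le_power2[of R] by linarith
    then have e: "3 * t * \<theta>\<^sup>2 \<le> 1" using R unfolding \<theta>s by (simp add: field_simps)
    have "tnorm \<theta> ((delta_right ^^ m) (hker t)) \<le> ennreal (D / R ^ m)"
    proof (cases "1 \<le> t")
      case True
      then have R': "R = sqrt t" by (simp add: R_def)
      have q: "t powr (- real m / 2) = 1 / R ^ m"
        using powr_half_eq_sqrt_power[OF t] by (simp add: R')
      have "C * t powr (- real m / 2) * exp (3 * t * \<theta>\<^sup>2) \<le> C * t powr (- real m / 2) * exp 1"
        using C(1) e by (intro mult_left_mono) auto
      also have "\<dots> \<le> D / R ^ m"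
        unfolding q using R by (simp add: D_def divide_right_mono)
      finally show ?thesis using order_trans[OF C(2)[OF t \<theta>2] ennreal_leI] by blast
    next
      case False
      then have R': "R = 1" by (simp add: R_def)
      have "tnorm \<theta> ((delta_right ^^ m) (hker t)) \<le> 3 ^ m * ennreal (exp (3 * t * \<theta>\<^sup>2))"
        using tnorm_delta_right_funpow[OF \<theta>2, of m "hker t"] tnorm_hker[OF less_imp_le[OF t] \<theta>2]
        by (meson mult_left_mono order_trans zero_le)
      also have "\<dots> = ennreal (3 ^ m * exp (3 * t * \<theta>\<^sup>2))"
      proof -
        have "(3::ennreal) ^ m = ennreal (3 ^ m)" by (metis ennreal_numeral ennreal_power zero_le_numeral)
        then show ?thesis by (simp add: ennreal_mult)
      qed
      also have "\<dots> \<le> ennreal (D / R ^ m)"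
      proof (rule ennreal_leI)
        have "3 ^ m * exp (3 * t * \<theta>\<^sup>2) \<le> 3 ^ m * exp 1" using e by (intro mult_left_mono) auto
        also have "3 ^ m * exp 1 \<le> D / R ^ m" by (simp add: D_def R')
        finally show "3 ^ m * exp (3 * t * \<theta>\<^sup>2) \<le> D / R ^ m" .
      qed
      finally show ?thesis .
    qed
    then show "tnorm (\<sigma> / (2 * max 1 (sqrt t))) ((delta_right ^^ m) (hker t)) \<le> ennreal (D / max 1 (sqrt t) ^ m)"
      by (simp add: \<theta>_def R_def)
  qed
qed

lemma kernel_family_lap_hker: "kernel_family 2 (\<lambda>t. lap (hker t))"
proof -
  obtain C where C: "0 < C" "\<And>t \<sigma>. 0 < t \<Longrightarrow> \<sigma> \<in> {-1, 1} \<Longrightarrow>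
       tnorm (\<sigma> / (2 * max 1 (sqrt t))) ((delta_right ^^ 2) (hker t)) \<le> ennreal (C / max 1 (sqrt t) ^ 2)"
    using kernel_family_delta_hker[of 2] unfolding kernel_family_def by blast
  show ?thesis unfolding kernel_family_def
  proof (intro exI[of _ "2 * C"] conjI allI impI ballI)
    fix t \<sigma> :: real assume t: "0 < t" and \<sigma>: "\<sigma> \<in> {-1, 1}"
    define \<theta> where "\<theta> = \<sigma> / (2 * max 1 (sqrt t))"
    have "\<sigma> \<le> max 1 (sqrt t)" "0 < max 1 (sqrt t)" using \<sigma> by auto
    then have "\<theta> \<le> 1/2" unfolding \<theta>_def by (simp only: divide_le_eq) auto
    then have e: "exp \<theta> \<le> 2" using exp_half_le_2 exp_le_cancel_iff[of \<theta> "1/2"] by linarith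
    have "tnorm \<theta> (lap (hker t)) = ennreal (exp \<theta>) * tnorm \<theta> ((delta_right ^^ 2) (hker t))"
      using tnorm_shift[of \<theta> "(delta_right ^^ 2) (hker t)" "-1"] by (simp add: lap_eq_delta_right[abs_def])
    also have "\<dots> \<le> ennreal 2 * ennreal (C / max 1 (sqrt t) ^ 2)"
      using C(2)[OF t \<sigma>] e by (intro mult_mono ennreal_leI) (auto simp: \<theta>_def)
    also have "\<dots> = ennreal (2 * C / max 1 (sqrt t) ^ 2)" using C(1) by (simp add: ennreal_mult[symmetric] del: ennreal_numeral)
    finally show "tnorm (\<sigma> / (2 * max 1 (sqrt t))) (lap (hker t)) \<le> ennreal (2 * C / max 1 (sqrt t) ^ 2)"
      by (simp add: \<theta>_def)
  qed (use C in simp)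
qed

lemma power_le_fact_exp: fixes x :: real assumes "0 \<le> x" shows "x ^ m \<le> fact m * exp x"
proof -
  have "(\<Sum>n\<in>{m}. x ^ n / fact n) \<le> exp x"
    using exp_power_sums[of x] assms by (subst sums_unique[OF exp_power_sums]) (intro sum_le_suminf; auto simp: sums_summable)
  then show ?thesis by (simp add: field_simps)
qed

text \<open>With R = \<open>max 1 (sqrt t)\<close>, the bound |j|^m <= m! (2R)^m exp(|j|/(2R))
  trades the exponential weight for an \<open>m\<close>-th moment; the power of R it costs is
  exactly the decay built into the family, so the moment is bounded uniformly in
  \<open>t\<close>.\<close>

lemma kernel_family_moments:
  assumes "kernel_family m A"
  obtains C where "0 < C"
    "\<And>t. 0 < t \<Longrightarrow> (\<Sum>\<^sup>+j. ennreal \<bar>A t j\<bar>) \<le> ennreal (C * t powr (- real m / 2))"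
    "\<And>t. 0 < t \<Longrightarrow> (\<Sum>\<^sup>+j. ennreal (mag j ^ m * \<bar>A t j\<bar>)) \<le> ennreal C"
proof -
  obtain C where C: "0 < C" "\<And>t \<sigma>. 0 < t \<Longrightarrow> \<sigma> \<in> {-1, 1} \<Longrightarrow>
       tnorm (\<sigma> / (2 * max 1 (sqrt t))) (A t) \<le> ennreal (C / max 1 (sqrt t) ^ m)"
    using assms unfolding kernel_family_def by blast
  define D where "D = fact m * 2 ^ m * (2 * C)"
  have D: "2 * C \<le> D"
  proof -
    have "1 * 1 \<le> fact m * (2::real) ^ m" by (intro mult_mono) auto
    then show ?thesis unfolding D_def using C(1) mult_right_mono[of 1 "fact m * 2 ^ m" "2 * C"] by simp
  qed
  have W: "(\<Sum>\<^sup>+j. ennreal (exp (1 / (2 * max 1 (sqrt t)) * mag j) * \<bar>A t j\<bar>)) \<le>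
      ennreal (2 * C / max 1 (sqrt t) ^ m)" if "0 < t" for t
  proof -
    have "(\<Sum>\<^sup>+j. ennreal (exp (1 / (2 * max 1 (sqrt t)) * mag j) * \<bar>A t j\<bar>)) \<le>
      tnorm (1 / (2 * max 1 (sqrt t))) (A t) + tnorm (- (1 / (2 * max 1 (sqrt t)))) (A t)"
      by (rule wnorm_le_tnorm)
    also have "\<dots> \<le> ennreal (C / max 1 (sqrt t) ^ m) + ennreal (C / max 1 (sqrt t) ^ m)"
      using C(2)[OF that, of 1] C(2)[OF that, of "-1"] by (intro add_mono) auto
    also have "\<dots> = ennreal (2 * C / max 1 (sqrt t) ^ m)"
      using C(1) by (simp add: ennreal_plus[symmetric] del: ennreal_plus)
    finally show ?thesis .
  qed
  show thesis
  proof (rule that[of D])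
    show "0 < D" using D C(1) by linarith
    fix t :: real assume t: "0 < t"
    define R where "R = max 1 (sqrt t)"
    have R: "1 \<le> R" "sqrt t \<le> R" by (auto simp: R_def)
    have "(\<Sum>\<^sup>+j. ennreal \<bar>A t j\<bar>) \<le> (\<Sum>\<^sup>+j. ennreal (exp (1 / (2 * R) * mag j) * \<bar>A t j\<bar>))"
    proof (intro nn_integral_mono ennreal_leI)
      fix j :: int
      have "1 \<le> exp (1 / (2 * R) * mag j)" using R by simp
      then show "\<bar>A t j\<bar> \<le> exp (1 / (2 * R) * mag j) * \<bar>A t j\<bar>"
        using mult_right_mono[of 1 "exp (1 / (2 * R) * mag j)" "\<bar>A t j\<bar>"] by simp
    qed
    also have "\<dots> \<le> ennreal (2 * C / R ^ m)" using W[OF t] by (simp add: R_def)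
    also have "\<dots> \<le> ennreal (D * t powr (- real m / 2))"
    proof (rule ennreal_leI)
      have "sqrt t ^ m \<le> R ^ m" using R t by (intro power_mono) auto
      then have "2 * C / R ^ m \<le> D / sqrt t ^ m" using D C(1) t by (intro frac_le) auto
      also have "\<dots> = D * t powr (- real m / 2)"
        using powr_half_eq_sqrt_power[OF t] by simp
      finally show "2 * C / R ^ m \<le> D * t powr (- real m / 2)" .
    qed
    finally show "(\<Sum>\<^sup>+j. ennreal \<bar>A t j\<bar>) \<le> ennreal (D * t powr (- real m / 2))" .
    have "(\<Sum>\<^sup>+j. ennreal (mag j ^ m * \<bar>A t j\<bar>)) \<le>
      (\<Sum>\<^sup>+j. ennreal (fact m * (2 * R) ^ m) * ennreal (exp (1 / (2 * R) * mag j) * \<bar>A t j\<bar>))"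
    proof (intro nn_integral_mono)
      fix j :: int
      define x where "x = 1 / (2 * R) * mag j"
      have "mag j = (2 * R) * x" using R by (simp add: x_def)
      then have "mag j ^ m = (2 * R) ^ m * x ^ m" by (simp only: power_mult_distrib)
      also have "\<dots> \<le> (2 * R) ^ m * (fact m * exp x)"
        using R by (intro mult_left_mono power_le_fact_exp) (auto simp: x_def)
      finally have "mag j ^ m * \<bar>A t j\<bar> \<le> (2 * R) ^ m * (fact m * exp x) * \<bar>A t j\<bar>" by (rule mult_right_mono) simp
      then have "ennreal (mag j ^ m * \<bar>A t j\<bar>) \<le> ennreal (fact m * (2 * R) ^ m * (exp x * \<bar>A t j\<bar>))"
        by (intro ennreal_leI) (simp add: mult_ac)
      then show "ennreal (mag j ^ m * \<bar>A t j\<bar>) \<le> ennreal (fact m * (2 * R) ^ m) * ennreal (exp (1 / (2 * R) * mag j) * \<bar>A t j\<bar>)"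
        using R unfolding x_def by (subst ennreal_mult[symmetric]) auto
    qed
    also have "\<dots> = ennreal (fact m * (2 * R) ^ m) * (\<Sum>\<^sup>+j. ennreal (exp (1 / (2 * R) * mag j) * \<bar>A t j\<bar>))"
      by (rule nn_integral_cmult) simp
    also have "\<dots> \<le> ennreal (fact m * (2 * R) ^ m) * ennreal (2 * C / R ^ m)"
      using W[OF t] by (intro mult_left_mono) (auto simp: R_def)
    also have "\<dots> = ennreal D"
      using R C(1) by (subst ennreal_mult[symmetric]) (auto simp: D_def power_mult_distrib)
    finally show "(\<Sum>\<^sup>+j. ennreal (mag j ^ m * \<bar>A t j\<bar>)) \<le> ennreal D" .
  qed
qed

text \<open>Difference norms are not monotone in the step; domination by running averages is the substitute.\<close>

definition averaging :: "(int \<Rightarrow> ennreal) \<Rightarrow> bool" where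
  "averaging N \<longleftrightarrow> N 0 = 0 \<and> (\<exists>c. \<forall>j. j \<noteq> 0 \<longrightarrow> N j \<le> ennreal (c / mag j) * (\<Sum>i\<in>{1..\<bar>j\<bar>}. N i))"

text \<open>Replacing N j by its running average and exchanging the sums leaves, in front of N i,
  the sum of |A t j| / |j| over |j| >= i. The total mass bounds this tail by
  \<open>t powr (- m / 2)\<close> / i, the \<open>m\<close>-th moment by i^(-m) / i; the common
  factor 1/i is the density of the jump measure.\<close>

lemma kernel_family_averaging:
  assumes A: "kernel_family m A" and N: "averaging N"
  obtains C where "0 < C" "\<And>t. 0 < t \<Longrightarrow> (\<Sum>\<^sup>+j. ennreal \<bar>A t j\<bar> * N j) \<le>
    ennreal C * (\<integral>\<^sup>+i. ennreal (min (t powr (- real m / 2)) (mag i powr (- real m))) * N i \<partial>jump_measure)"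
proof -
  obtain C where C: "0 < C"
    "\<And>t. 0 < t \<Longrightarrow> (\<Sum>\<^sup>+j. ennreal \<bar>A t j\<bar>) \<le> ennreal (C * t powr (- real m / 2))"
    "\<And>t. 0 < t \<Longrightarrow> (\<Sum>\<^sup>+j. ennreal (mag j ^ m * \<bar>A t j\<bar>)) \<le> ennreal C"
    by (rule kernel_family_moments[OF A]) blast
  obtain c0 where c0: "\<And>j. j \<noteq> 0 \<Longrightarrow> N j \<le> ennreal (c0 / mag j) * (\<Sum>i\<in>{1..\<bar>j\<bar>}. N i)" and N0: "N 0 = 0"
    using N unfolding averaging_def by blast
  define c where "c = \<bar>c0\<bar> + 1"
  have c: "N j \<le> ennreal c * (ennreal (1 / mag j) * (\<Sum>i\<in>{1..\<bar>j\<bar>}. N i))" if "j \<noteq> 0" for j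
  proof -
    have "ennreal (c0 / mag j) \<le> ennreal (c * (1 / mag j))"
      by (intro ennreal_leI) (auto simp: c_def intro!: divide_right_mono)
    also have "\<dots> = ennreal c * ennreal (1 / mag j)" by (rule ennreal_mult) (auto simp: c_def)
    finally have "ennreal (c0 / mag j) * (\<Sum>i\<in>{1..\<bar>j\<bar>}. N i) \<le>
      ennreal c * ennreal (1 / mag j) * (\<Sum>i\<in>{1..\<bar>j\<bar>}. N i)" by (rule mult_right_mono) simp
    then show ?thesis using c0[OF that] unfolding mult.assoc by (rule order_trans[rotated])
  qed
  show thesis
  proof (rule that[of "c * C"])
    show "0 < c * C" using C(1) by (simp add: c_def)
    fix t :: real assume t: "0 < t"
    let ?a = "\<lambda>j. ennreal \<bar>A t j\<bar>"
    define \<mu> where "\<mu> i = min (t powr (- real m / 2)) (mag i powr (- real m))" for i :: int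
    have tail: "(\<Sum>\<^sup>+j. ?a j * ennreal (1 / mag j) * indicator {j. i \<le> \<bar>j\<bar>} j) \<le>
        ennreal (C * (\<mu> i * (1 / mag i)))" (is "?T \<le> _") if i: "1 \<le> i" for i
    proof -
      have "?T \<le> (\<Sum>\<^sup>+j. ennreal (1 / real_of_int i) * ?a j)"
      proof (intro nn_integral_mono)
        fix j :: int
        have "i \<le> \<bar>j\<bar> \<Longrightarrow> 1 / mag j \<le> 1 / real_of_int i" using i by (intro divide_left_mono) auto
        then show "?a j * ennreal (1 / mag j) * indicator {j. i \<le> \<bar>j\<bar>} j \<le> ennreal (1 / real_of_int i) * ?a j"
          by (auto simp: indicator_def mult.commute[of "ennreal (1 / real_of_int i)"] intro!: mult_left_mono ennreal_leI)
      qed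
      also have "\<dots> = ennreal (1 / real_of_int i) * (\<Sum>\<^sup>+j. ?a j)" by (rule nn_integral_cmult) simp
      also have "\<dots> \<le> ennreal (1 / real_of_int i) * ennreal (C * t powr (- real m / 2))" by (intro mult_left_mono C t) auto
      also have "\<dots> = ennreal (C * (t powr (- real m / 2) * (1 / mag i)))"
        using i C by (subst ennreal_mult[symmetric]) (auto simp: mult_ac)
      finally have 1: "?T \<le> ennreal (C * (t powr (- real m / 2) * (1 / mag i)))" .
      have "?T \<le> (\<Sum>\<^sup>+j. ennreal (mag i powr (- real m) * (1 / mag i)) * ennreal (mag j ^ m * \<bar>A t j\<bar>))"
      proof (intro nn_integral_mono)
        fix j :: int
        have "1 / mag j \<le> mag i powr (- real m) * (1 / mag i) * mag j ^ m" if "i \<le> \<bar>j\<bar>"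
        proof -
          have "real_of_int i ^ m \<le> mag j ^ m" "1 / mag j \<le> 1 / real_of_int i"
            using that i by (auto intro!: power_mono divide_left_mono)
          then have "real_of_int i ^ m * (1 / mag j) \<le> mag j ^ m * (1 / real_of_int i)"
            using i by (intro mult_mono) auto
          then show ?thesis using i by (simp add: powr_minus powr_realpow field_simps)
        qed
        then have "i \<le> \<bar>j\<bar> \<Longrightarrow> \<bar>A t j\<bar> * (1 / mag j) \<le>
          \<bar>A t j\<bar> * (mag i powr (- real m) * (1 / mag i) * mag j ^ m)"
          by (intro mult_left_mono) auto
        then show "?a j * ennreal (1 / mag j) * indicator {j. i \<le> \<bar>j\<bar>} j \<le>
          ennreal (mag i powr (- real m) * (1 / mag i)) * ennreal (mag j ^ m * \<bar>A t j\<bar>)"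
          by (cases "i \<le> \<bar>j\<bar>") (auto simp: ennreal_mult[symmetric] mult_ac intro!: ennreal_leI)
      qed
      also have "\<dots> = ennreal (mag i powr (- real m) * (1 / mag i)) *
          (\<Sum>\<^sup>+j. ennreal (mag j ^ m * \<bar>A t j\<bar>))" by (rule nn_integral_cmult) simp
      also have "\<dots> \<le> ennreal (mag i powr (- real m) * (1 / mag i)) * ennreal C"
        by (intro mult_left_mono C t) auto
      also have "\<dots> = ennreal (C * (mag i powr (- real m) * (1 / mag i)))"
        using C by (subst ennreal_mult[symmetric]) (auto simp: mult_ac)
      finally have 2: "?T \<le> \<dots>" .
      show ?thesis using 1 2 by (auto simp: \<mu>_def min_def)
    qed
    have "(\<Sum>\<^sup>+j. ?a j * N j) \<le>
      (\<Sum>\<^sup>+j. \<Sum>\<^sup>+i. ennreal c * (?a j * ennreal (1 / mag j) * indicator {j. i \<le> \<bar>j\<bar>} j * (N i * indicator {1..} i)))"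
    proof (intro nn_integral_mono)
      fix j :: int
      show "?a j * N j \<le> (\<Sum>\<^sup>+i. ennreal c * (?a j * ennreal (1 / mag j) * indicator {j. i \<le> \<bar>j\<bar>} j * (N i * indicator {1..} i)))"
      proof (cases "j = 0")
        case False
        have "?a j * N j \<le> ?a j * (ennreal c * (ennreal (1 / mag j) * (\<Sum>i\<in>{1..\<bar>j\<bar>}. N i)))"
          by (intro mult_left_mono c False) auto
        also have "(\<Sum>i\<in>{1..\<bar>j\<bar>}. N i) = (\<Sum>\<^sup>+i. N i * indicator {1..\<bar>j\<bar>} i)"
          by (simp add: nn_integral_count_space_indicator[symmetric] nn_integral_count_space_finite)
        also have "?a j * (ennreal c * (ennreal (1 / mag j) * \<dots>)) =
          (\<Sum>\<^sup>+i. ?a j * (ennreal c * (ennreal (1 / mag j) * (N i * indicator {1..\<bar>j\<bar>} i))))"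
          by (simp add: nn_integral_cmult)
        also have "\<dots> = (\<Sum>\<^sup>+i. ennreal c * (?a j * ennreal (1 / mag j) * indicator {j. i \<le> \<bar>j\<bar>} j * (N i * indicator {1..} i)))"
          by (intro nn_integral_cong) (auto simp: indicator_def mult_ac)
        finally show ?thesis .
      qed (simp add: N0)
    qed
    also have "\<dots> = (\<Sum>\<^sup>+i. \<Sum>\<^sup>+j. ennreal c * (?a j * ennreal (1 / mag j) * indicator {j. i \<le> \<bar>j\<bar>} j * (N i * indicator {1..} i)))"
      by (rule nn_integral_int_swap) simp
    also have "\<dots> \<le> (\<Sum>\<^sup>+i. ennreal (c * C) * (ennreal (\<mu> i) * N i * ennreal (1 / mag i) * indicator (- {0}) i))"
    proof (intro nn_integral_mono)
      fix i :: int
      show "(\<Sum>\<^sup>+j. ennreal c * (?a j * ennreal (1 / mag j) * indicator {j. i \<le> \<bar>j\<bar>} j * (N i * indicator {1..} i))) \<le>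
         ennreal (c * C) * (ennreal (\<mu> i) * N i * ennreal (1 / mag i) * indicator (- {0}) i)"
      proof (cases "1 \<le> i")
        case True
        have "(\<Sum>\<^sup>+j. ennreal c * (?a j * ennreal (1 / mag j) * indicator {j. i \<le> \<bar>j\<bar>} j * (N i * indicator {1..} i))) =
          ennreal c * ((\<Sum>\<^sup>+j. ?a j * ennreal (1 / mag j) * indicator {j. i \<le> \<bar>j\<bar>} j) * N i)"
          using True by (simp add: nn_integral_cmult nn_integral_multc)
        also have "\<dots> \<le> ennreal c * (ennreal (C * (\<mu> i * (1 / mag i))) * N i)"
          by (intro mult_left_mono mult_right_mono tail True) auto
        also have "\<dots> = ennreal (c * C) * (ennreal (\<mu> i) * N i * ennreal (1 / mag i) * indicator (- {0}) i)"
        proof -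
          have "ennreal (C * (\<mu> i * (1 / mag i))) = ennreal C * (ennreal (\<mu> i) * ennreal (1 / mag i))"
            using C(1) by (subst ennreal_mult; (subst ennreal_mult)?) (auto simp: \<mu>_def)
          moreover have "ennreal (c * C) = ennreal c * ennreal C" using C(1) by (subst ennreal_mult) (auto simp: c_def)
          ultimately show ?thesis using True by (simp add: mult_ac)
        qed
        finally show ?thesis .
      qed simp
    qed
    also have "\<dots> = ennreal (c * C) * (\<integral>\<^sup>+i. ennreal (\<mu> i) * N i \<partial>jump_measure)"
      by (simp add: nn_integral_cmult nn_integral_jump_measure)
    finally show "(\<Sum>\<^sup>+j. ?a j * N j) \<le> ennreal (c * C) *
       (\<integral>\<^sup>+i. ennreal (min (t powr (- real m / 2)) (mag i powr (- real m))) * N i \<partial>jump_measure)"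
      unfolding \<mu>_def .
  qed
qed

text \<open>With r = sqrt t and x = i/r, the weighted kernel of the preceding bound is at most
  x^\<beta> i^(-\<beta>) for x <= 1 and x^(\<beta>-m) i^(-\<beta>) for x > 1. It decays on both
  sides precisely when 0 < \<beta> < m, with the exponent \<open>a\<close> below, and the Schur test
  applies.\<close>

lemma Lfin_averaging_kernel:
  assumes A: "kernel_family m A" and N: "averaging N" and \<beta>: "0 < \<beta>" "\<beta> < real m" and q: "1 \<le> q"
    and fin: "Lfin jump_measure q (\<lambda>j. N j * ennreal (mag j powr (- \<beta>)))"
    and K: "0 \<le> K" and \<Phi>: "\<And>t. 0 < t \<Longrightarrow> \<Phi> t \<le> ennreal K * (\<Sum>\<^sup>+j. ennreal \<bar>A t j\<bar> * N j)"
  shows "Lfin dt_over_t q (\<lambda>t. ennreal (t powr (real m / 2 - \<beta> / 2)) * \<Phi> t)"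
proof -
  obtain C where C: "0 < C" "\<And>t. 0 < t \<Longrightarrow> (\<Sum>\<^sup>+j. ennreal \<bar>A t j\<bar> * N j) \<le>
    ennreal C * (\<integral>\<^sup>+i. ennreal (min (t powr (- real m / 2)) (mag i powr (- real m))) * N i \<partial>jump_measure)"
    by (rule kernel_family_averaging[OF A N]) blast
  define a where "a = min \<beta> (real m - \<beta>)"
  have a: "0 < a" "a \<le> \<beta>" "a \<le> real m - \<beta>" using \<beta> by (auto simp: a_def)
  have key: "t powr (real m / 2 - \<beta> / 2) * min (t powr (- real m / 2)) (i powr (- real m)) \<le>
      kappa a (i / t powr (1/2)) * i powr (- \<beta>)" if t: "0 < t" and i: "0 < i" for t i
  proof -
    define r where "r = t powr (1/2)"
    define x where "x = i / r"
    have r: "0 < r" using t by (auto simp: r_def)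
    have rp: "t powr (y / 2) = r powr y" for y by (simp add: r_def powr_powr)
    have x: "0 < x" "i = x * r" using r i by (auto simp: x_def)
    have e1: "t powr (real m / 2 - \<beta> / 2) = r powr (real m - \<beta>)" using rp[of "real m - \<beta>"] by (simp add: diff_divide_distrib)
    have e2: "t powr (- real m / 2) = r powr (- real m)" by (rule rp)
    show ?thesis
    proof (cases "x \<le> 1")
      case True
      have "t powr (real m / 2 - \<beta> / 2) * min (t powr (- real m / 2)) (i powr (- real m)) \<le>
        r powr (real m - \<beta>) * r powr (- real m)"
        unfolding e1 e2[symmetric] by (intro mult_left_mono) auto
      also have "\<dots> = r powr (- \<beta>)" by (simp add: powr_add[symmetric])
      also have "\<dots> = x powr \<beta> * i powr (- \<beta>)"
        unfolding x(2) using x(1) r by (simp add: powr_mult powr_minus field_simps)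
      also have "\<dots> \<le> x powr a * i powr (- \<beta>)"
        using True x a by (intro mult_right_mono powr_mono') auto
      finally show ?thesis using True x(1) a by (simp add: kappa_cases x_def r_def)
    next
      case False
      have "t powr (real m / 2 - \<beta> / 2) * min (t powr (- real m / 2)) (i powr (- real m)) \<le>
        r powr (real m - \<beta>) * i powr (- real m)"
        unfolding e1 by (intro mult_left_mono) auto
      also have "\<dots> = x powr (\<beta> - real m) * i powr (- \<beta>)"
        unfolding x(2) using x(1) r by (simp add: powr_mult powr_diff powr_minus field_simps)
      also have "\<dots> \<le> x powr (- a) * i powr (- \<beta>)"
        using False x a by (intro mult_right_mono powr_mono) auto
      finally show ?thesis using False x(1) a by (simp add: kappa_cases x_def r_def)
    qed
  qed
  show ?thesis
  proof (rule Lfin_schur[OF scale_measure_jump scale_measure_dt_over_t[of "1/2"] q a(1) _ fin, where c = "K * C"])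
    fix t :: real assume "t \<in> space dt_over_t"
    then have t: "0 < t" by simp
    have "ennreal (t powr (real m / 2 - \<beta> / 2)) * \<Phi> t \<le> ennreal (t powr (real m / 2 - \<beta> / 2)) * (ennreal K *
       (ennreal C * (\<integral>\<^sup>+i. ennreal (min (t powr (- real m / 2)) (mag i powr (- real m))) * N i \<partial>jump_measure)))"
      by (intro mult_left_mono order_trans[OF \<Phi>[OF t]] C t) auto
    also have "\<dots> = ennreal (K * C) * (\<integral>\<^sup>+i. ennreal (t powr (real m / 2 - \<beta> / 2)) * (ennreal (min (t powr (- real m / 2)) (mag i powr (- real m))) * N i) \<partial>jump_measure)"
      using K C(1) by (subst nn_integral_cmult) (auto simp: ennreal_mult mult_ac)
    also have "\<dots> \<le> ennreal (K * C) * (\<integral>\<^sup>+i. ennreal (kappa a (mag i / t powr (1/2))) * (N i * ennreal (mag i powr (- \<beta>))) \<partial>jump_measure)"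
    proof (intro mult_left_mono nn_integral_mono)
      fix i assume "i \<in> space jump_measure"
      then have "0 < mag i" by simp
      from ennreal_leI[OF key[OF t this]]
      have "ennreal (t powr (real m / 2 - \<beta> / 2)) * ennreal (min (t powr (- real m / 2)) (mag i powr (- real m))) \<le>
        ennreal (kappa a (mag i / t powr (1/2))) * ennreal (mag i powr (- \<beta>))"
        by (simp add: ennreal_mult)
      from mult_right_mono[OF this, of "N i"]
      show "ennreal (t powr (real m / 2 - \<beta> / 2)) * (ennreal (min (t powr (- real m / 2)) (mag i powr (- real m))) * N i) \<le>
        ennreal (kappa a (mag i / t powr (1/2))) * (N i * ennreal (mag i powr (- \<beta>)))"
        by (simp add: mult_ac)
    qed simp
    finally show "ennreal (t powr (real m / 2 - \<beta> / 2)) * \<Phi> t \<le> \<dots>" .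
  qed auto
qed

lemma averagingI:
  assumes "N 0 = 0" "\<And>j. N (- j) = N j" "\<And>j. 1 \<le> j \<Longrightarrow> (\<Sum>i\<in>{1..j}. N j) \<le> ennreal c * (\<Sum>i\<in>{1..j}. N i)"
  shows "averaging N"
  unfolding averaging_def
proof (intro conjI exI[of _ c] allI impI)
  fix j :: int assume "j \<noteq> 0"
  define k where "k = \<bar>j\<bar>"
  have k: "1 \<le> k" using \<open>j \<noteq> 0\<close> by (simp add: k_def)
  have Nk: "N j = N k" using assms(2)[of j] by (cases "0 \<le> j") (auto simp: k_def)
  have "ennreal (1 / real_of_int k) * (\<Sum>i\<in>{1..k}. N k) = ennreal (1 / real_of_int k) * (ennreal (real_of_int k) * N k)"
    using k by (simp add: ennreal_of_nat_eq_real_of_nat)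
  also have "\<dots> = N k" using k by (simp add: mult.assoc[symmetric] ennreal_mult[symmetric])
  finally have "N k \<le> ennreal (1 / real_of_int k) * (ennreal c * (\<Sum>i\<in>{1..k}. N i))"
    using mult_left_mono[OF assms(3)[OF k], of "ennreal (1 / real_of_int k)"] by simp
  also have "\<dots> \<le> ennreal (c / real_of_int k) * (\<Sum>i\<in>{1..k}. N i)"
  proof (cases "0 \<le> c")
    case True
    then show ?thesis using k by (simp add: mult.assoc[symmetric] ennreal_mult[symmetric])
  next
    case False
    then show ?thesis by (simp add: ennreal_neg)
  qed
  finally show "N j \<le> ennreal (c / mag j) * (\<Sum>i\<in>{1..\<bar>j\<bar>}. N i)"
    unfolding Nk by (simp add: k_def)
qed (rule assms(1))

section \<open>First and second differences with arbitrary step\<close>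

definition diff1 :: "(int \<Rightarrow> real) \<Rightarrow> int \<Rightarrow> int \<Rightarrow> real" where
  "diff1 g j n = g (n + j) - g n"

definition diff2 :: "(int \<Rightarrow> real) \<Rightarrow> int \<Rightarrow> int \<Rightarrow> real" where
  "diff2 g j n = g (n - j) - 2 * g n + g (n + j)"

lemma lp_norm_zero [simp]: "1 \<le> p \<Longrightarrow> lp_norm p (\<lambda>n. 0) = 0"
  using lp_norm_cmult[of p 0 "\<lambda>n. 0"] by simp

lemma lp_norm_abs_cong: "(\<And>n. \<bar>f n\<bar> = \<bar>g n\<bar>) \<Longrightarrow> lp_norm p f = lp_norm p g"
  by (intro antisym lp_norm_mono) auto

lemma lp_norm_add_le:
  assumes p: "1 \<le> p" and le: "\<And>n. \<bar>u n\<bar> \<le> \<bar>f n\<bar> + \<bar>g n\<bar>"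
  shows "lp_norm p u \<le> 2 * (lp_norm p f + lp_norm p g)"
  using lp_norm_sum_le[of "{0::nat, 1}" p u "\<lambda>i. if i = 0 then f else g"] assms by simp

lemma lp_norm_diff1_minus: "lp_norm p (diff1 g (- j)) = lp_norm p (diff1 g j)"
proof -
  have "lp_norm p (diff1 g (- j)) = lp_norm p (\<lambda>n. diff1 g j (n - j))"
    by (rule lp_norm_abs_cong) (simp add: diff1_def abs_minus_commute)
  then show ?thesis by (simp add: lp_norm_shift_diff)
qed

lemma diff2_minus: "diff2 g (- j) = diff2 g j"
  by (simp add: fun_eq_iff diff2_def)

lemma sum_reflect_le:
  fixes N :: "int \<Rightarrow> ennreal"
  assumes "N 0 = 0"
  shows "(\<Sum>i\<in>{1..j}. N (j - i)) \<le> (\<Sum>i\<in>{1..j}. N i)"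
proof -
  have "(\<Sum>i\<in>{1..j}. N (j - i)) = (\<Sum>i\<in>(\<lambda>i. j - i) ` {1..j}. N i)"
    by (subst sum.reindex) (auto simp: inj_on_def)
  also have "\<dots> \<le> (\<Sum>i\<in>insert 0 {1..j}. N i)" by (intro sum_mono2) auto
  also have "\<dots> = (\<Sum>i\<in>{1..j}. N i)" using assms by simp
  finally show ?thesis .
qed

text \<open>A step \<open>j\<close> is a step \<open>i\<close> followed by a step
  \<open>j - i\<close>, for every \<open>i\<close> from 1 to \<open>j\<close>; averaging over
  \<open>i\<close> gives two copies of the running average, since the reflected sum has the same
  terms apart from a zero one.\<close>

lemma averaging_diff1:
  assumes p: "1 \<le> p"
  shows "averaging (\<lambda>j. lp_norm p (diff1 g j))"
proof (rule averagingI[where c = 4])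
  let ?N = "\<lambda>j. lp_norm p (diff1 g j)"
  show N0: "?N 0 = 0" using p by (simp add: diff1_def[abs_def])
  fix j :: int assume "1 \<le> j"
  have "?N j \<le> 2 * (?N i + ?N (j - i))" for i
  proof -
    have "?N j \<le> 2 * (?N i + lp_norm p (\<lambda>n. diff1 g (j - i) (n + i)))"
      by (rule lp_norm_add_le[OF p]) (simp add: diff1_def)
    then show ?thesis by (simp add: lp_norm_shift)
  qed
  then have "(\<Sum>i\<in>{1..j}. ?N j) \<le> (\<Sum>i\<in>{1..j}. 2 * (?N i + ?N (j - i)))" by (rule sum_mono)
  also have "\<dots> = 2 * ((\<Sum>i\<in>{1..j}. ?N i) + (\<Sum>i\<in>{1..j}. ?N (j - i)))"
    by (simp add: sum_distrib_left[symmetric] sum.distrib)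
  also have "\<dots> \<le> 2 * ((\<Sum>i\<in>{1..j}. ?N i) + (\<Sum>i\<in>{1..j}. ?N i))"
    by (intro mult_left_mono add_left_mono sum_reflect_le N0) auto
  also have "\<dots> = ennreal 4 * (\<Sum>i\<in>{1..j}. ?N i)" by (simp add: mult_2[symmetric] mult.assoc[symmetric])
  finally show "(\<Sum>i\<in>{1..j}. ?N j) \<le> ennreal 4 * (\<Sum>i\<in>{1..j}. ?N i)" .
qed (rule lp_norm_diff1_minus)

text \<open>With \<open>i = a - j\<close> and \<open>b = a - 2j\<close> one has
  \<open>diff2 g a n + diff2 g b n = diff2 g i (n + j) + diff2 g i (n - j) + 2 * diff2 g j n\<close>.\<close>

lemma averaging_diff2:
  assumes p: "1 \<le> p"
  shows "averaging (\<lambda>j. lp_norm p (diff2 g j))"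
proof (rule averagingI[where c = 24])
  let ?N = "\<lambda>j. lp_norm p (diff2 g j)"
  show N0: "?N 0 = 0" using p by (simp add: diff2_def[abs_def])
  show Nm: "?N (- j) = ?N j" for j by (simp add: diff2_minus)
  fix a :: int assume a: "1 \<le> a"
  define S where "S = (\<Sum>i\<in>{1..a}. ?N i)"
  have tri: "?N a \<le> 2 * (?N (a - 2 * j) + 2 * ?N (a - j) + 2 * ?N j)" for j
  proof -
    let ?F = "[diff2 g (a - 2 * j), \<lambda>n. diff2 g (a - j) (n + j), \<lambda>n. diff2 g (a - j) (n - j), diff2 g j, diff2 g j]"
    have "?N a \<le> 2 * (\<Sum>k<5. lp_norm p (?F ! k))"
    proof (rule lp_norm_sum_le[OF _ p])
      fix n
      have "diff2 g a n = - diff2 g (a - 2 * j) n + diff2 g (a - j) (n + j) + diff2 g (a - j) (n - j) + 2 * diff2 g j n"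
        by (simp add: diff2_def algebra_simps)
      then have "\<bar>diff2 g a n\<bar> \<le> \<bar>diff2 g (a - 2 * j) n\<bar> + \<bar>diff2 g (a - j) (n + j)\<bar> + \<bar>diff2 g (a - j) (n - j)\<bar> + \<bar>diff2 g j n\<bar> + \<bar>diff2 g j n\<bar>"
        by linarith
      also have "\<dots> = (\<Sum>k<5. \<bar>(?F ! k) n\<bar>)" by (simp add: eval_nat_numeral)
      finally show "\<bar>diff2 g a n\<bar> \<le> (\<Sum>k<5. \<bar>(?F ! k) n\<bar>)" .
    qed simp
    also have "(\<Sum>k<5. lp_norm p (?F ! k)) = ?N (a - 2 * j) + ?N (a - j) + ?N (a - j) + ?N j + ?N j"
      by (simp add: eval_nat_numeral lp_norm_shift lp_norm_shift_diff)
    also have "\<dots> = ?N (a - 2 * j) + 2 * ?N (a - j) + 2 * ?N j" by (simp only: mult_2 add.assoc)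
    finally show ?thesis .
  qed
  \<comment> \<open>The values |a - 2j| stay in the range 0..a and each is attained at most twice,
    once with 2j <= a and once with 2j > a; on either part the map is injective.\<close>
  have half: "(\<Sum>j\<in>{1..a}. ?N (a - 2 * j)) \<le> S + S"
  proof -
    let ?h = "\<lambda>j. \<bar>a - 2 * j\<bar>"
    let ?L = "{1..a} \<inter> {j. 2 * j \<le> a}" and ?R = "{1..a} \<inter> {j. a < 2 * j}"
    have N: "?N (a - 2 * j) = ?N (?h j)" for j using Nm[of "a - 2 * j"] by (cases "0 \<le> a - 2 * j") auto
    have part: "(\<Sum>j\<in>B. ?N (?h j)) \<le> S" if "B \<subseteq> {1..a}" "inj_on ?h B" for B
    proof -
      have "(\<Sum>j\<in>B. ?N (?h j)) = (\<Sum>i\<in>?h ` B. ?N i)" using that(2) by (subst sum.reindex) auto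
      also have "\<dots> \<le> (\<Sum>i\<in>insert 0 {1..a}. ?N i)" using that(1) by (intro sum_mono2) force+
      also have "\<dots> = S" using N0 by (simp add: S_def)
      finally show ?thesis .
    qed
    have "{1..a} = ?L \<union> ?R" "?L \<inter> ?R = {}" "finite ?L" "finite ?R" by auto
    then have "(\<Sum>j\<in>?L \<union> ?R. ?N (?h j)) = (\<Sum>j\<in>?L. ?N (?h j)) + (\<Sum>j\<in>?R. ?N (?h j))"
      by (intro sum.union_disjoint)
    then have "(\<Sum>j\<in>{1..a}. ?N (a - 2 * j)) = (\<Sum>j\<in>?L. ?N (?h j)) + (\<Sum>j\<in>?R. ?N (?h j))"
      unfolding N using \<open>{1..a} = ?L \<union> ?R\<close> by simp
    also have "\<dots> \<le> S + S" by (intro add_mono part) (auto simp: inj_on_def)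
    finally show ?thesis .
  qed
  have "(\<Sum>j\<in>{1..a}. ?N a) \<le> (\<Sum>j\<in>{1..a}. 2 * (?N (a - 2 * j) + 2 * ?N (a - j) + 2 * ?N j))"
    by (intro sum_mono tri)
  also have "\<dots> = 2 * ((\<Sum>j\<in>{1..a}. ?N (a - 2 * j)) + 2 * (\<Sum>j\<in>{1..a}. ?N (a - j)) + 2 * S)"
    by (simp add: sum_distrib_left[symmetric] sum.distrib S_def)
  also have "\<dots> \<le> 2 * ((S + S) + 2 * S + 2 * S)"
    using sum_reflect_le[of ?N a] N0 half by (intro mult_left_mono add_mono) (auto simp: S_def)
  also have "\<dots> \<le> ennreal 24 * S"
  proof -
    have "2 * ((S + S) + 2 * S + 2 * S) = 12 * S" by (simp add: mult_2[symmetric] mult.assoc[symmetric] distrib_right[symmetric] del: distrib_right_numeral)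
    also have "\<dots> \<le> 24 * S" by (intro mult_right_mono) auto
    finally show ?thesis by simp
  qed
  finally show "(\<Sum>j\<in>{1..a}. ?N a) \<le> ennreal 24 * (\<Sum>j\<in>{1..a}. ?N j)" by (simp add: S_def)
qed

lemma integrable_rapid: "rapid a \<Longrightarrow> integrable (count_space UNIV) a"
  using rapid_wnorm[of a 0] by (intro integrableI_bounded) auto

lemma integral_delta_right: "rapid a \<Longrightarrow> (\<integral>j. delta_right a j \<partial>count_space UNIV) = 0"
  using integral_int_shift[of a 1] integrable_rapid[OF rapid_shift, of a 1] integrable_rapid[of a]
  by (simp add: delta_right_def)

lemma integral_lap: "rapid a \<Longrightarrow> (\<integral>j. lap a j \<partial>count_space UNIV) = 0"
  using integral_int_shift[of "delta_right (delta_right a)" "-1"] integral_delta_right[OF rapid_delta_right, of a]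
  by (simp add: lap_eq_delta_right numeral_2_eq_2)

lemma conv_mean_zero:
  assumes "rapid a" "(\<integral>j. a j \<partial>count_space UNIV) = 0" "expb g"
  shows "conv a g n = (\<integral>j. a j * (g (n - j) - g n) \<partial>count_space UNIV)"
proof -
  have "(\<integral>j. a j * (g (n - j) - g n) \<partial>count_space UNIV) =
    (\<integral>j. a j * g (n - j) \<partial>count_space UNIV) - (\<integral>j. a j * g n \<partial>count_space UNIV)"
    unfolding right_diff_distrib
    by (intro Bochner_Integration.integral_diff conv_integrable[OF assms(1,3)] integrable_mult_left integrable_rapid[OF assms(1)])
  then show ?thesis using assms(2) by (simp add: conv_def)
qed

text \<open>A kernel of total mass 0 may be applied to g(n-j) - g(n) instead of g(n-j); Minkowski
  does the rest.\<close>

lemma lp_norm_conv_diff1: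
  assumes p: "1 \<le> p" and a: "rapid a" "(\<integral>j. a j \<partial>count_space UNIV) = 0" and g: "expb g"
  shows "lp_norm p (conv a g) \<le> 2 * (\<Sum>\<^sup>+j. ennreal \<bar>a j\<bar> * lp_norm p (diff1 g j))"
proof -
  have i: "integrable (count_space UNIV) (\<lambda>j. a j * (g (n - j) - g n))" for n
    unfolding right_diff_distrib
    by (intro Bochner_Integration.integrable_diff conv_integrable[OF a(1) g] integrable_mult_left integrable_rapid[OF a(1)])
  have "lp_norm p (conv a g) \<le> 2 * (\<Sum>\<^sup>+j. lp_norm p (\<lambda>n. a j * diff1 g (- j) n))"
    by (rule lp_norm_nn_integral_le[OF _ p])
       (use integral_norm_bound_ennreal[OF i] in \<open>auto simp: conv_mean_zero[OF a g] diff1_def\<close>)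
  then show ?thesis by (simp add: lp_norm_cmult[OF p] lp_norm_diff1_minus)
qed

text \<open>Evenness allows the contributions of j and -j to be added, so that twice the convolution
  is the sum of a(j) times the symmetric second difference.\<close>

lemma lp_norm_conv_diff2:
  assumes p: "1 \<le> p" and a: "rapid a" "(\<integral>j. a j \<partial>count_space UNIV) = 0" "\<And>j. a (- j) = a j" and g: "expb g"
  shows "lp_norm p (conv a g) \<le> 2 * (\<Sum>\<^sup>+j. ennreal \<bar>a j\<bar> * lp_norm p (diff2 g j))"
proof -
  have i: "integrable (count_space UNIV) (\<lambda>j. a j * (g (n - j) - g n))" for n
    unfolding right_diff_distrib
    by (intro Bochner_Integration.integrable_diff conv_integrable[OF a(1) g] integrable_mult_left integrable_rapid[OF a(1)])
  have i': "integrable (count_space UNIV) (\<lambda>j. a j * (g (n + j) - g n))" for n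
    using i[of n] integrable_bij_count_space[OF bij_int_diff[of 0], of "\<lambda>j. a j * (g (n - j) - g n)"] by (simp add: a(3))
  have sym: "(\<integral>j. a j * (g (n + j) - g n) \<partial>count_space UNIV) = conv a g n" for n
    using integral_int_reflect[of "\<lambda>j. a j * (g (n - j) - g n)" 0] by (simp add: conv_mean_zero[OF a(1,2) g] a(3))
  have rep: "2 * conv a g n = (\<integral>j. a j * diff2 g j n \<partial>count_space UNIV)" for n
  proof -
    have "(\<integral>j. a j * diff2 g j n \<partial>count_space UNIV) =
      (\<integral>j. a j * (g (n - j) - g n) + a j * (g (n + j) - g n) \<partial>count_space UNIV)"
      by (intro Bochner_Integration.integral_cong) (auto simp: diff2_def algebra_simps)
    also have "\<dots> = conv a g n + conv a g n"
      using i i' by (subst Bochner_Integration.integral_add) (auto simp: sym conv_mean_zero[OF a(1,2) g])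
    finally show ?thesis by simp
  qed
  have i2: "integrable (count_space UNIV) (\<lambda>j. a j * diff2 g j n)" for n
  proof -
    have "(\<lambda>j. a j * diff2 g j n) = (\<lambda>j. a j * (g (n - j) - g n) + a j * (g (n + j) - g n))"
      by (auto simp: diff2_def algebra_simps)
    then show ?thesis using i i' by simp
  qed
  have "lp_norm p (conv a g) \<le> 2 * (\<Sum>\<^sup>+j. lp_norm p (\<lambda>n. a j * diff2 g j n))"
  proof (rule lp_norm_nn_integral_le[OF _ p])
    fix n
    have "ennreal \<bar>conv a g n\<bar> \<le> ennreal \<bar>2 * conv a g n\<bar>" by (intro ennreal_leI) simp
    also have "\<dots> \<le> (\<Sum>\<^sup>+j. ennreal \<bar>a j * diff2 g j n\<bar>)"
      unfolding rep using integral_norm_bound_ennreal[OF i2] by simp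
    finally show "ennreal \<bar>conv a g n\<bar> \<le> \<dots>" .
  qed simp
  then show ?thesis by (simp add: lp_norm_cmult[OF p])
qed

lemma measurable_lp_norm_conv_hker [measurable]:
  assumes "expb g"
  shows "(\<lambda>t. hnorm p t g) \<in> borel_measurable borel"
  by (rule lp_norm_measurable) (rule measurable_conv_hker[OF assms])

lemma diff1_imp_heat:
  assumes p: "1 \<le> p" and q: "1 \<le> q" and g: "expb g" and \<beta>: "0 < \<beta>" "\<beta> < 1"
    and fin: "Lfin jump_measure q (\<lambda>j. lp_norm p (diff1 g j) * ennreal (mag j powr (- \<beta>)))"
  shows "Lfin dt_over_t q (\<lambda>t. ennreal (t powr (1 / 2 - \<beta> / 2)) * hnorm p t (delta_right g))"
proof -
  have "hnorm p t (delta_right g) \<le> ennreal 2 * (\<Sum>\<^sup>+j. ennreal \<bar>(delta_right ^^ 1) (hker t) j\<bar> * lp_norm p (diff1 g j))" for t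
  proof -
    have "conv (hker t) (delta_right g) = conv (delta_right (hker t)) g"
      using delta_right_conv_left[OF rapid_hker g] delta_right_conv_right[OF rapid_hker g] by simp
    then show ?thesis
      using lp_norm_conv_diff1[OF p rapid_delta_right[OF rapid_hker] integral_delta_right[OF rapid_hker] g] by simp
  qed
  from Lfin_averaging_kernel[OF kernel_family_delta_hker[of 1] averaging_diff1[OF p] \<beta>(1) _ q fin _ this]
  show ?thesis using \<beta>(2) by simp
qed

text \<open>The Laplacian of the heat kernel is even, has mass 0 and forms a family of order 2,
  hence the range \<beta> < 2; the Zygmund classes use \<beta> = 1, which a first difference cannot
  reach.\<close>

lemma diff2_imp_heat:
  assumes p: "1 \<le> p" and q: "1 \<le> q" and g: "expb g" and \<beta>: "0 < \<beta>" "\<beta> < 2"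
    and fin: "Lfin jump_measure q (\<lambda>j. lp_norm p (diff2 g j) * ennreal (mag j powr (- \<beta>)))"
  shows "Lfin dt_over_t q (\<lambda>t. ennreal (t powr (1 - \<beta> / 2)) * hnorm p t (lap g))"
proof -
  have even: "lap (hker t) (- j) = lap (hker t) j" for t j
  proof -
    have e: "- (j + 1) = - j - 1" "- (j - 1) = - j + 1" by auto
    show ?thesis using hker_reflect[of t "j + 1"] hker_reflect[of t "j - 1"] hker_reflect[of t j]
      unfolding e by (simp add: lap_def)
  qed
  have "hnorm p t (lap g) \<le> ennreal 2 * (\<Sum>\<^sup>+j. ennreal \<bar>lap (hker t) j\<bar> * lp_norm p (diff2 g j))" for t
    using lp_norm_conv_diff2[OF p rapid_lap[OF rapid_hker] integral_lap[OF rapid_hker] even g] by (simp add: conv_lap_hker[OF g])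
  from Lfin_averaging_kernel[OF kernel_family_lap_hker averaging_diff2[OF p] \<beta>(1) _ q fin _ this]
  show ?thesis using \<beta>(2) by simp
qed

section \<open>From the heat semigroup to differences\<close>

lemma lp_norm_nn_integral_set_le:
  assumes [measurable]: "\<And>n. (\<lambda>x. F x n) \<in> borel_measurable M" "S \<in> sets M" and p: "1 \<le> p"
    and le: "\<And>n. ennreal \<bar>u n\<bar> \<le> (\<integral>\<^sup>+x. ennreal \<bar>F x n\<bar> * indicator S x \<partial>M)"
  shows "lp_norm p u \<le> 2 * (\<integral>\<^sup>+x. lp_norm p (F x) * indicator S x \<partial>M)"
proof -
  have "lp_norm p u \<le> 2 * (\<integral>\<^sup>+x. lp_norm p (\<lambda>n. indicator S x * F x n) \<partial>M)"
  proof (rule lp_norm_nn_integral_le[OF _ p])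
    fix n
    have "(\<integral>\<^sup>+x. ennreal \<bar>F x n\<bar> * indicator S x \<partial>M) = (\<integral>\<^sup>+x. ennreal \<bar>indicator S x * F x n\<bar> \<partial>M)"
      by (intro nn_integral_cong) (auto simp: indicator_def)
    then show "ennreal \<bar>u n\<bar> \<le> (\<integral>\<^sup>+x. ennreal \<bar>indicator S x * F x n\<bar> \<partial>M)" using le[of n] by simp
  qed measurable
  also have "(\<integral>\<^sup>+x. lp_norm p (\<lambda>n. indicator S x * F x n) \<partial>M) = (\<integral>\<^sup>+x. lp_norm p (F x) * indicator S x \<partial>M)"
    by (intro nn_integral_cong) (auto simp: lp_norm_cmult[OF p] indicator_def)
  finally show ?thesis .
qed

text \<open>The Schur test in the shape in which estimates arise: Lebesgue integrals over time. The
  factor \<open>s powr (c - 1)\<close> demanded of the kernel is the weight \<open>s powr c\<close>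
  of the hypothesis together with the density 1/s of dt/t.\<close>

lemma Lfin_schur_dt:
  assumes N: "scale_measure N \<sigma>" and q: "1 \<le> q" and a: "0 < a" and b: "0 < b" and K: "0 \<le> K"
    and m: "\<Psi> \<in> borel_measurable (restrict_space borel {0<..})"
    and fin: "Lfin dt_over_t q (\<lambda>s. ennreal (s powr c) * \<Psi> s)"
    and le: "\<And>y. y \<in> space N \<Longrightarrow> \<Phi> y \<le> (\<integral>\<^sup>+s. ennreal (k y s) * \<Psi> s * indicator (S y) s \<partial>lborel)"
    and S: "\<And>y. y \<in> space N \<Longrightarrow> S y \<subseteq> {0..}"
    and ker: "\<And>y s. y \<in> space N \<Longrightarrow> s \<in> S y \<Longrightarrow> 0 < s \<Longrightarrow> k y s \<le> K * (kappa a (s powr b / \<sigma> y) * s powr (c - 1))"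
  shows "Lfin N q \<Phi>"
proof (rule Lfin_schur[OF scale_measure_dt_over_t[OF b] N q a _ fin, where c = K])
  have "(\<lambda>s. ennreal (s powr c)) \<in> borel_measurable (restrict_space borel {0<..})"
    by (intro measurable_restrict_space1) measurable
  then have pm': "(\<lambda>s. ennreal (s powr c) * \<Psi> s) \<in> borel_measurable (restrict_space borel {0<..})"
    using m by (rule borel_measurable_times_ennreal)
  then show "(\<lambda>s. ennreal (s powr c) * \<Psi> s) \<in> borel_measurable dt_over_t"
    unfolding measurable_cong_sets[OF sets_dt_over_t refl] .
  fix y assume y: "y \<in> space N"
  have km: "(\<lambda>s. ennreal (kappa a (s powr b / \<sigma> y)) * (ennreal (s powr c) * \<Psi> s)) \<in> borel_measurable (restrict_space borel {0<..})"
    by (rule borel_measurable_times_ennreal[OF _ pm']) (intro measurable_restrict_space1; measurable)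
  have "\<Phi> y \<le> (\<integral>\<^sup>+s. ennreal (k y s) * \<Psi> s * indicator (S y) s \<partial>lborel)" by (rule le[OF y])
  also have "\<dots> \<le> (\<integral>\<^sup>+s. ennreal K * (ennreal (kappa a (s powr b / \<sigma> y)) * (ennreal (s powr c) * \<Psi> s) * ennreal (1 / s) * indicator {0<..} s) \<partial>lborel)"
  proof (intro nn_integral_mono_AE)
    \<comment> \<open>The time sets may contain the point 0, which the measure dt/t does not see; it
      is discarded as a null set.\<close>
    have "AE s in lborel. s \<noteq> (0::real)" by (rule AE_lborel_singleton)
    then show "AE s in lborel. ennreal (k y s) * \<Psi> s * indicator (S y) s \<le>
      ennreal K * (ennreal (kappa a (s powr b / \<sigma> y)) * (ennreal (s powr c) * \<Psi> s) * ennreal (1 / s) * indicator {0<..} s)"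
    proof eventually_elim
      case (elim s)
      show ?case
      proof (cases "s \<in> S y")
        case True
        then have s: "0 < s" using S[OF y] elim by force
        have "s powr (c - 1) = s powr c * (1 / s)" using s by (simp add: powr_diff)
        then have "ennreal (k y s) \<le> ennreal (K * (kappa a (s powr b / \<sigma> y) * (s powr c * (1 / s))))"
          using ker[OF y True s] by (intro ennreal_leI) simp
        also have "\<dots> = ennreal K * (ennreal (kappa a (s powr b / \<sigma> y)) * (ennreal (s powr c) * ennreal (1 / s)))"
          using K s by (simp add: ennreal_mult[symmetric])
        finally have "ennreal (k y s) * \<Psi> s \<le> ennreal K * (ennreal (kappa a (s powr b / \<sigma> y)) * (ennreal (s powr c) * ennreal (1 / s))) * \<Psi> s"
          by (rule mult_right_mono) simp
        then show ?thesis using True s by (simp add: mult_ac)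
      qed simp
    qed
  qed
  also have "\<dots> \<le> ennreal K * (\<integral>\<^sup>+s. ennreal (kappa a (s powr b / \<sigma> y)) * (ennreal (s powr c) * \<Psi> s) \<partial>dt_over_t)"
  proof -
    define h where "h s = ennreal (kappa a (s powr b / \<sigma> y)) * (ennreal (s powr c) * \<Psi> s)" for s
    have hm: "h \<in> borel_measurable (restrict_space borel {0<..})" using km by (simp add: h_def[abs_def])
    have "(\<lambda>s. h s * indicator {0<..} s) \<in> borel_measurable borel"
      using hm by (simp add: borel_measurable_restrict_space_iff_ennreal mult.commute)
    then have [measurable]: "(\<lambda>s. h s * indicator {0<..} s) \<in> borel_measurable lborel" by simp
    have "(\<integral>\<^sup>+s. ennreal K * (h s * ennreal (1 / s) * indicator {0<..} s) \<partial>lborel) =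
      (\<integral>\<^sup>+s. ennreal K * ((h s * indicator {0<..} s) * ennreal (1 / s)) \<partial>lborel)"
      by (intro nn_integral_cong) (simp add: mult_ac)
    also have "\<dots> = ennreal K * (\<integral>\<^sup>+s. (h s * indicator {0<..} s) * ennreal (1 / s) \<partial>lborel)"
      by (rule nn_integral_cmult) measurable
    also have "(\<integral>\<^sup>+s. (h s * indicator {0<..} s) * ennreal (1 / s) \<partial>lborel) = (\<integral>\<^sup>+s. h s \<partial>dt_over_t)"
      by (subst nn_integral_dt_over_t[OF hm]) (intro nn_integral_cong, simp add: mult_ac)
    finally show ?thesis by (simp add: h_def)
  qed
  finally show "\<Phi> y \<le> ennreal K * (\<integral>\<^sup>+s. ennreal (kappa a (s powr b / \<sigma> y)) * (ennreal (s powr c) * \<Psi> s) \<partial>dt_over_t)" .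
qed

section \<open>Trading differences for powers of time\<close>

definition heat_fin :: "ennreal \<Rightarrow> ennreal \<Rightarrow> real \<Rightarrow> (int \<Rightarrow> real) \<Rightarrow> bool" where
  "heat_fin p q c F \<longleftrightarrow> Lfin dt_over_t q (\<lambda>t. ennreal (t powr c) * hnorm p t F)"

lemma measurable_heat_restrict:
  "expb F \<Longrightarrow> (\<lambda>t. hnorm p t F) \<in> borel_measurable (restrict_space borel {0<..})"
  by (intro measurable_restrict_space1 measurable_lp_norm_conv_hker)

lemma nn_integral_interval_const:
  assumes "a \<le> b" shows "(\<integral>\<^sup>+s. c * indicator {a..b} s \<partial>lborel) = c * ennreal (b - a)"
  using assms by (simp add: nn_integral_cmult_indicator)

text \<open>A further difference is absorbed by the semigroup acting over time t - s, at the price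
  (t-s)^(-1/2). Averaging over t/2 <= s <= 3t/4 keeps t - s comparable with t and puts the estimate
  in integral form for the Schur test.\<close>

lemma heat_fin_delta:
  assumes p: "1 \<le> p" and q: "1 \<le> q" and F: "expb F" and fin: "heat_fin p q c F"
  shows "heat_fin p q (c + 1/2) (delta_right F)"
proof -
  obtain C where C: "0 < C" "\<And>t F. 0 < t \<Longrightarrow> expb F \<Longrightarrow>
    lp_norm p ((delta_right ^^ 1) (conv (hker t) F)) \<le> ennreal (C * t powr (- real 1 / 2)) * lp_norm p F"
    by (rule lp_norm_smoothing[OF p, where m = 1]) blast
  have [measurable]: "(\<lambda>t. hnorm p t F) \<in> borel_measurable borel" by (rule measurable_lp_norm_conv_hker[OF F])
  \<comment> \<open>A factor 4 normalises the interval of length t/4, and a factor 2 bounds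
    (t-s)^(-1/2) by 2 t^(-1/2).\<close>
  define D where "D = 8 * C"
  have D: "0 < D" using C by (simp add: D_def)
  have le: "ennreal (t powr (c + 1/2)) * hnorm p t (delta_right F) \<le>
     (\<integral>\<^sup>+s. ennreal (D * t powr (c - 1)) * hnorm p s F * indicator {t/2..3*t/4} s \<partial>lborel)" if t: "0 < t" for t
  proof -
    let ?X = "hnorm p t (delta_right F)"
    have pt: "?X \<le> ennreal (2 * C * t powr (- 1/2)) * hnorm p s F" if s: "t/2 \<le> s" "s \<le> 3*t/4" for s
    proof -
      have ts: "0 < t - s" using s t by simp
      have "conv (hker t) (delta_right F) = (delta_right ^^ 1) (conv (hker (t - s)) (conv (hker s) F))"
        by (simp add: conv_hker_conv_hker F delta_right_conv_right rapid_hker)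
      then have "?X \<le> ennreal (C * (t - s) powr (- real 1 / 2)) * hnorm p s F"
        using C(2)[OF ts expb_conv[OF rapid_hker F]] by simp
      also have "\<dots> \<le> ennreal (2 * C * t powr (- 1/2)) * hnorm p s F"
      proof (intro mult_right_mono ennreal_leI)
        have "(t - s) powr (- 1/2) \<le> (t / 4) powr (- 1/2)" using s t by (intro powr_mono2') auto
        also have "\<dots> = 2 * t powr (- 1/2)"
        proof -
          have "(4::real) powr (1/2) = 2" using powr_half_sqrt[of 4] by simp
          then show ?thesis using t by (simp add: powr_divide powr_minus field_simps)
        qed
        finally show "C * (t - s) powr (- real 1 / 2) \<le> 2 * C * t powr (- 1/2)" using C(1) by simp
      qed simp
      finally show ?thesis .
    qed
    have "?X * ennreal (t / 4) = (\<integral>\<^sup>+s. ?X * indicator {t/2..3*t/4} s \<partial>lborel)"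
      using t by (subst nn_integral_interval_const) auto
    also have "\<dots> \<le> (\<integral>\<^sup>+s. ennreal (2 * C * t powr (- 1/2)) * (hnorm p s F * indicator {t/2..3*t/4} s) \<partial>lborel)"
      using pt by (intro nn_integral_mono) (auto simp: indicator_def)
    also have "\<dots> = ennreal (2 * C * t powr (- 1/2)) * (\<integral>\<^sup>+s. hnorm p s F * indicator {t/2..3*t/4} s \<partial>lborel)"
      by (rule nn_integral_cmult) measurable
    finally have 1: "?X * ennreal (t / 4) \<le> \<dots>" .
    have "ennreal (t powr (c + 1/2)) * ?X = ennreal (4 / t * t powr (c + 1/2)) * (?X * ennreal (t / 4))"
    proof -
      have "ennreal (t powr (c + 1/2)) = ennreal (4 / t * t powr (c + 1/2)) * ennreal (t / 4)"
        using t by (subst ennreal_mult[symmetric]) auto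
      then show ?thesis by (simp add: mult_ac)
    qed
    also have "\<dots> \<le> ennreal (4 / t * t powr (c + 1/2)) * (ennreal (2 * C * t powr (- 1/2)) *
        (\<integral>\<^sup>+s. hnorm p s F * indicator {t/2..3*t/4} s \<partial>lborel))" by (intro mult_left_mono 1) auto
    also have "\<dots> = ennreal (D * t powr (c - 1)) * (\<integral>\<^sup>+s. hnorm p s F * indicator {t/2..3*t/4} s \<partial>lborel)"
    proof -
      have "4 / t * t powr (c + 1/2) * (2 * C * t powr (- 1/2)) = D * t powr (c - 1)"
      proof -
        have "t powr (c + 1/2) * t powr (- 1/2) = t powr c" by (simp add: powr_add[symmetric])
        then have "4 / t * t powr (c + 1/2) * (2 * C * t powr (- 1/2)) = D * (t powr c / t)" by (simp add: D_def field_simps)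
        then show ?thesis using t by (simp add: powr_diff)
      qed
      moreover have "ennreal (4 / t * t powr (c + 1/2)) * ennreal (2 * C * t powr (- 1/2)) = ennreal (4 / t * t powr (c + 1/2) * (2 * C * t powr (- 1/2)))"
        using t C(1) by (subst ennreal_mult[symmetric]) auto
      ultimately show ?thesis by (simp add: mult.assoc[symmetric])
    qed
    also have "\<dots> = (\<integral>\<^sup>+s. ennreal (D * t powr (c - 1)) * hnorm p s F * indicator {t/2..3*t/4} s \<partial>lborel)"
      by (subst nn_integral_cmult[symmetric]) (auto simp: mult.assoc)
    finally show ?thesis .
  qed
  show ?thesis unfolding heat_fin_def
  proof (rule Lfin_schur_dt[OF scale_measure_dt_over_t[of "1/2"] q, where a = 1 and b = "1/2" and K = "D * (2 powr \<bar>c - 1\<bar> * 2)"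
      and c = c and k = "\<lambda>t s. D * t powr (c - 1)" and S = "\<lambda>t. {t/2..3*t/4}" and \<Psi> = "\<lambda>s. hnorm p s F"])
    fix t s :: real assume t: "t \<in> space dt_over_t" and s: "s \<in> {t/2..3*t/4}" "0 < s"
    then have ts: "0 < t" "t \<le> 2 * s" "s \<le> t" by auto
    have 1: "t powr (c - 1) \<le> 2 powr \<bar>c - 1\<bar> * s powr (c - 1)"
    proof (cases "0 \<le> c - 1")
      case True
      then have "t powr (c - 1) \<le> (2 * s) powr (c - 1)" using ts by (intro powr_mono2) auto
      then show ?thesis using True s by (simp add: powr_mult)
    next
      case False
      then have "t powr (c - 1) \<le> s powr (c - 1)" using ts s by (intro powr_mono2') auto
      also have "\<dots> \<le> 2 powr \<bar>c - 1\<bar> * s powr (c - 1)"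
        using mult_right_mono[of 1 "2 powr \<bar>c - 1\<bar>" "s powr (c - 1)"] by (simp add: ge_one_powr_ge_zero)
      finally show ?thesis .
    qed
    have 2: "1 \<le> 2 * kappa 1 (s powr (1/2) / t powr (1/2))"
    proof -
      have e: "s powr (1/2) / t powr (1/2) = (s / t) powr (1/2)" using s ts by (simp add: powr_divide)
      have "kappa 1 (s powr (1/2) / t powr (1/2)) = kappa (1/2) (s / t)" unfolding e using s ts by (subst kappa_powr) auto
      also have "\<dots> = (s / t) powr (1/2)" using s ts by (subst kappa_cases) auto
      also have "\<dots> \<ge> (1 / 4) powr (1/2)" using s ts by (intro powr_mono2) (auto simp: field_simps)
      moreover have "(1 / 4) powr (1/2) = (1/2 :: real)" using powr_half_sqrt[of "1/4"] by (simp add: real_sqrt_divide)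
      ultimately show ?thesis by linarith
    qed
    have "D * t powr (c - 1) \<le> D * (2 powr \<bar>c - 1\<bar> * s powr (c - 1)) * 1" using 1 D by simp
    also have "\<dots> \<le> D * (2 powr \<bar>c - 1\<bar> * s powr (c - 1)) * (2 * kappa 1 (s powr (1/2) / t powr (1/2)))"
      using D by (intro mult_left_mono 2) auto
    finally show "D * t powr (c - 1) \<le> D * (2 powr \<bar>c - 1\<bar> * 2) * (kappa 1 (s powr (1/2) / t powr (1/2)) * s powr (c - 1))"
      by (simp add: mult_ac)
  qed (use D le fin F measurable_heat_restrict in \<open>auto simp: heat_fin_def\<close>)
qed

definition vanishing :: "(int \<Rightarrow> real) \<Rightarrow> bool" where
  "vanishing F \<longleftrightarrow> (\<forall>n. ((\<lambda>t. conv (hker t) F n) \<longlongrightarrow> 0) at_top)"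

text \<open>Integration of the heat equation from \<open>t\<close> to \<infinity>, where the
  boundary term disappears by \<open>vanishing\<close>. The resulting kernel is (t/s)^c on s >= t,
  which decays because c > 0.\<close>

lemma heat_fin_lap_imp:
  assumes p: "1 \<le> p" and q: "1 \<le> q" and F: "expb F" and c: "0 < c" and van: "vanishing F"
    and fin: "heat_fin p q (c + 1) (lap F)"
  shows "heat_fin p q c F"
proof -
  have [measurable]: "(\<lambda>t. hnorm p t (lap F)) \<in> borel_measurable borel"
    by (intro measurable_lp_norm_conv_hker expb_lap F)
  have le: "ennreal (t powr c) * hnorm p t F \<le>
     (\<integral>\<^sup>+s. ennreal (2 * t powr c) * hnorm p s (lap F) * indicator {t..} s \<partial>lborel)" for t
  proof -
    have pt: "ennreal \<bar>conv (hker t) F n\<bar> \<le> (\<integral>\<^sup>+s. ennreal \<bar>conv (hker s) (lap F) n\<bar> * indicator {t..} s \<partial>lborel)" (is "_ \<le> ?I") for n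
    proof (cases ?I)
      case (real I)
      have bd: "\<bar>conv (hker t) F n\<bar> \<le> \<bar>conv (hker r) F n\<bar> + I" if "t \<le> r" for r
      proof -
        have "ennreal \<bar>conv (hker r) F n - conv (hker t) F n\<bar> \<le> (\<integral>\<^sup>+s. ennreal \<bar>conv (hker s) (lap F) n\<bar> * indicator {t..r} s \<partial>lborel)"
          by (intro abs_diff_le_nn_integral that DERIV_conv_hker continuous_conv_hker expb_lap F)
        also have "\<dots> \<le> ?I" by (intro nn_integral_mono) (auto simp: indicator_def)
        finally have "\<bar>conv (hker r) F n - conv (hker t) F n\<bar> \<le> I" using real by simp
        then show ?thesis by linarith
      qed
      have "((\<lambda>r. \<bar>conv (hker r) F n\<bar> + I) \<longlongrightarrow> \<bar>0\<bar> + I) at_top"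
        using van unfolding vanishing_def by (intro tendsto_intros) auto
      then have "\<bar>conv (hker t) F n\<bar> \<le> \<bar>0\<bar> + I"
        by (rule tendsto_lowerbound) (auto intro: eventually_mono[OF eventually_ge_at_top[of t]] bd)
      then show ?thesis using real by simp
    qed simp
    have "hnorm p t F \<le> 2 * (\<integral>\<^sup>+s. hnorm p s (lap F) * indicator {t..} s \<partial>lborel)"
      by (rule lp_norm_nn_integral_set_le[OF _ _ p pt]) (auto intro: measurable_conv_hker expb_lap F)
    then have "ennreal (t powr c) * hnorm p t F \<le>
      ennreal (t powr c) * (2 * (\<integral>\<^sup>+s. hnorm p s (lap F) * indicator {t..} s \<partial>lborel))" by (rule mult_left_mono) simp
    also have "\<dots> = ennreal (2 * t powr c) * (\<integral>\<^sup>+s. hnorm p s (lap F) * indicator {t..} s \<partial>lborel)"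
      by (simp add: ennreal_mult mult_ac)
    also have "\<dots> = (\<integral>\<^sup>+s. ennreal (2 * t powr c) * hnorm p s (lap F) * indicator {t..} s \<partial>lborel)"
      by (subst nn_integral_cmult[symmetric]) (auto simp: mult.assoc)
    finally show ?thesis .
  qed
  show ?thesis unfolding heat_fin_def
  proof (rule Lfin_schur_dt[OF scale_measure_dt_over_t[of "1/2"] q, where a = "2 * c" and b = "1/2" and K = 2
      and c = "c + 1" and k = "\<lambda>t s. 2 * t powr c" and S = "\<lambda>t. {t..}" and \<Psi> = "\<lambda>s. hnorm p s (lap F)"])
    fix t s :: real assume t: "t \<in> space dt_over_t" and s: "s \<in> {t..}" "0 < s"
    then have ts: "0 < t" "t \<le> s" by auto
    have e: "s powr (1/2) / t powr (1/2) = (s / t) powr (1/2)" using s ts by (simp add: powr_divide)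
    have "kappa (2 * c) (s powr (1/2) / t powr (1/2)) = kappa c (s / t)" unfolding e using s ts by (subst kappa_powr) auto
    also have "\<dots> = kappa c (t / s)" using s ts by (simp add: kappa_inverse)
    also have "\<dots> = (t / s) powr c" using s ts c by (subst kappa_cases) auto
    also have "\<dots> = t powr c * s powr (- c)" using s ts by (simp add: powr_divide powr_minus field_simps)
    finally show "2 * t powr c \<le> 2 * (kappa (2 * c) (s powr (1/2) / t powr (1/2)) * s powr (c + 1 - 1))"
      using s by (simp add: powr_minus field_simps)
  qed (use c le fin F measurable_heat_restrict expb_lap in \<open>auto simp: heat_fin_def\<close>)
qed

lemma heat_fin_shift: "heat_fin p q c (\<lambda>n. F (n + k)) \<longleftrightarrow> heat_fin p q c F"
proof -
  have "conv (hker t) (\<lambda>n. F (n + k)) = (\<lambda>n. conv (hker t) F (n + k))" for t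
    by (simp add: fun_eq_iff conv_shift_right)
  then show ?thesis by (simp add: heat_fin_def lp_norm_shift)
qed

lemma heat_fin_lap: "heat_fin p q c (lap F) \<longleftrightarrow> heat_fin p q c ((delta_right ^^ 2) F)"
  using heat_fin_shift[of p q c "(delta_right ^^ 2) F" "-1"] by (simp add: lap_eq_delta_right[abs_def])

section \<open>Decay of the heat extension for large times\<close>

text \<open>The order is m + 1 and not m since the pointwise bound \<open>rapid_pointwise\<close>
  consumes one more difference.\<close>

lemma hker_pointwise:
  obtains C where "0 < C" "\<And>t j. 0 < t \<Longrightarrow> \<bar>(delta_right ^^ m) (hker t) j\<bar> \<le>
    C / max 1 (sqrt t) ^ (m + 1) * decay t j"
proof -
  obtain C where C: "0 < C" "\<And>t \<sigma>. 0 < t \<Longrightarrow> \<sigma> \<in> {-1, 1} \<Longrightarrow>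
       tnorm (\<sigma> / (2 * max 1 (sqrt t))) ((delta_right ^^ (m + 1)) (hker t)) \<le> ennreal (C / max 1 (sqrt t) ^ (m + 1))"
    using kernel_family_delta_hker[of "m + 1"] unfolding kernel_family_def by blast
  show thesis
  proof (rule that[of "2 * C"])
    fix t :: real and j :: int assume t: "0 < t"
    define R where "R = max 1 (sqrt t)"
    have R: "1 \<le> R" by (simp add: R_def)
    have "ennreal (exp (1 / (2 * R) * mag j) * \<bar>(delta_right ^^ m) (hker t) j\<bar>) \<le>
      tnorm (1 / (2 * R)) (delta_right ((delta_right ^^ m) (hker t))) + tnorm (- (1 / (2 * R))) (delta_right ((delta_right ^^ m) (hker t)))"
      using R by (intro rapid_pointwise rapid_delta_right_funpow rapid_hker) auto
    also have "\<dots> \<le> ennreal (C / R ^ (m + 1)) + ennreal (C / R ^ (m + 1))"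
      using C(2)[OF t, of 1] C(2)[OF t, of "-1"] by (intro add_mono) (auto simp: R_def)
    also have "\<dots> = ennreal (2 * C / R ^ (m + 1))"
      using C(1) R by (simp add: ennreal_plus[symmetric] del: ennreal_plus)
    finally have "exp (1 / (2 * R) * mag j) * \<bar>(delta_right ^^ m) (hker t) j\<bar> \<le> 2 * C / R ^ (m + 1)"
      using C(1) R by (subst (asm) ennreal_le_iff) auto
    then have "exp (- (1 / (2 * R) * mag j)) * (exp (1 / (2 * R) * mag j) * \<bar>(delta_right ^^ m) (hker t) j\<bar>) \<le>
      exp (- (1 / (2 * R) * mag j)) * (2 * C / R ^ (m + 1))" by (rule mult_left_mono) simp
    then have "\<bar>(delta_right ^^ m) (hker t) j\<bar> \<le> exp (- (1 / (2 * R) * mag j)) * (2 * C / R ^ (m + 1))"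
      by (simp only: mult.assoc[symmetric] exp_add[symmetric] add.left_inverse exp_zero mult_1_left)
    then show "\<bar>(delta_right ^^ m) (hker t) j\<bar> \<le>
       2 * C / max 1 (sqrt t) ^ (m + 1) * decay t j"
      by (simp only: R_def mult.commute)
  qed (use C in simp)
qed

definition wsummable :: "nat \<Rightarrow> (int \<Rightarrow> real) \<Rightarrow> bool" where
  "wsummable m f \<longleftrightarrow> (\<Sum>\<^sup>+n. ennreal (\<bar>f n\<bar> / (1 + mag n) ^ m)) < \<top>"

lemma wsummable_expb: assumes "wsummable m f" shows "expb f"
proof -
  obtain W where W: "(\<Sum>\<^sup>+n. ennreal (\<bar>f n\<bar> / (1 + mag n) ^ m)) = ennreal W" "0 \<le> W"
    using assms unfolding wsummable_def by (auto simp: less_top_ennreal)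
  have "\<bar>f n\<bar> \<le> W * fact m * exp 1 * exp (1 * mag n)" for n
  proof -
    have "ennreal (\<bar>f n\<bar> / (1 + mag n) ^ m) = (\<Sum>\<^sup>+k. ennreal (\<bar>f k\<bar> / (1 + mag k) ^ m) * indicator {n} k)"
      by simp
    also have "\<dots> \<le> ennreal W" unfolding W(1)[symmetric] by (intro nn_integral_mono) (auto simp: indicator_def)
    finally have "\<bar>f n\<bar> / (1 + mag n) ^ m \<le> W" using W(2) by simp
    then have "\<bar>f n\<bar> \<le> W * (1 + mag n) ^ m" by (subst (asm) pos_divide_le_eq) auto
    also have "\<dots> \<le> W * (fact m * exp (1 + mag n))"
      using W(2) by (intro mult_left_mono power_le_fact_exp) auto
    finally show ?thesis by (simp add: exp_add mult_ac)
  qed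
  then show ?thesis by (rule expbI)
qed

lemma wsummable_mono: assumes "wsummable m f" "m \<le> k" shows "wsummable k f"
proof -
  have "(\<Sum>\<^sup>+n. ennreal (\<bar>f n\<bar> / (1 + mag n) ^ k)) \<le>
    (\<Sum>\<^sup>+n. ennreal (\<bar>f n\<bar> / (1 + mag n) ^ m))"
    using assms(2) by (intro nn_integral_mono ennreal_leI divide_left_mono power_increasing) auto
  then show ?thesis using assms(1) unfolding wsummable_def by (rule le_less_trans)
qed

lemma one_plus_abs_mult: "1 + mag (n - j) \<le> (1 + mag n) * (1 + mag j)"
proof -
  have "mag (n - j) \<le> mag n + mag j" by simp
  moreover have "0 \<le> mag n * mag j" by simp
  ultimately show ?thesis unfolding distrib_left distrib_right by linarith
qed

lemma wsummable_translate_le: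
  "(\<Sum>\<^sup>+j. ennreal (\<bar>f (n - j)\<bar> / (1 + mag j) ^ m)) \<le>
    ennreal ((1 + mag n) ^ m) * (\<Sum>\<^sup>+j. ennreal (\<bar>f j\<bar> / (1 + mag j) ^ m))"
proof -
  have "(\<Sum>\<^sup>+j. ennreal (\<bar>f (n - j)\<bar> / (1 + mag j) ^ m)) \<le>
     (\<Sum>\<^sup>+j. ennreal ((1 + mag n) ^ m) * ennreal (\<bar>f (n - j)\<bar> / (1 + mag (n - j)) ^ m))"
  proof (intro nn_integral_mono)
    fix j :: int
    have "(1 + mag (n - j)) ^ m \<le> ((1 + mag n) * (1 + mag j)) ^ m"
      by (intro power_mono one_plus_abs_mult) auto
    then have "1 / (1 + mag j) ^ m \<le> (1 + mag n) ^ m / (1 + mag (n - j)) ^ m"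
      by (simp add: power_mult_distrib divide_simps)
    from mult_left_mono[OF this, of "\<bar>f (n - j)\<bar>"]
    have "\<bar>f (n - j)\<bar> / (1 + mag j) ^ m \<le> (1 + mag n) ^ m * (\<bar>f (n - j)\<bar> / (1 + mag (n - j)) ^ m)"
      by (simp add: mult_ac)
    then show "ennreal (\<bar>f (n - j)\<bar> / (1 + mag j) ^ m) \<le>
      ennreal ((1 + mag n) ^ m) * ennreal (\<bar>f (n - j)\<bar> / (1 + mag (n - j)) ^ m)"
      by (subst ennreal_mult[symmetric]) (auto intro: ennreal_leI)
  qed
  also have "\<dots> = (\<Sum>\<^sup>+j. ennreal ((1 + mag n) ^ m) * ennreal (\<bar>f j\<bar> / (1 + mag j) ^ m))"
    by (rule nn_integral_int_reflect)
  finally show ?thesis by (simp add: nn_integral_cmult)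
qed

lemma wsummable_translate:
  assumes "wsummable m f"
  shows "integrable (count_space UNIV) (\<lambda>j. f (n - j) / (1 + mag j) ^ m)"
proof (rule integrableI_bounded)
  have "(\<Sum>\<^sup>+j. ennreal (norm (f (n - j) / (1 + mag j) ^ m))) \<le>
    ennreal ((1 + mag n) ^ m) * (\<Sum>\<^sup>+j. ennreal (\<bar>f j\<bar> / (1 + mag j) ^ m))"
    using wsummable_translate_le[of f n m] by (simp add: abs_divide)
  also have "\<dots> < \<infinity>" using assms by (simp add: wsummable_def ennreal_mult_less_top)
  finally show "(\<Sum>\<^sup>+j. ennreal (norm (f (n - j) / (1 + mag j) ^ m))) < \<infinity>" .
qed simp

text \<open>Dominated convergence: uniformly in t >= 1 the kernel lies below a multiple of
  (1+|j|)^(-(m+1)), the very weight against which \<open>f\<close> is summable, and it tends to 0 at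
  each point.\<close>

lemma conv_tendsto_zero:
  assumes f: "wsummable (m + 1) f" and C: "0 < C" "\<And>t j. 0 < t \<Longrightarrow> \<bar>A t j\<bar> \<le>
    C / max 1 (sqrt t) ^ (m + 1) * decay t j"
  shows "((\<lambda>t. \<integral>j. A t j * f (n - j) \<partial>count_space UNIV) \<longlongrightarrow> 0) at_top"
proof -
  define M where "M = m + 1"
  \<comment> \<open>The constant comes from 1+|j| <= 2R(1+x) with x = |j|/(2R), R = sqrt t >= 1, and
    from (1+x)^M <= M! exp(1+x).\<close>
  define K where "K = C * (2 ^ M * fact M * exp 1)"
  have K: "0 < K" using C by (simp add: K_def)
  have bnd: "\<bar>A t j\<bar> \<le> K / (1 + mag j) ^ M" if t: "1 \<le> t" for t j
  proof -
    define R where "R = sqrt t"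
    have R: "max 1 (sqrt t) = R" "1 \<le> R" using t by (auto simp: R_def)
    define x where "x = 1 / (2 * R) * mag j"
    have x: "0 \<le> x" using R by (simp add: x_def)
    have "1 + mag j \<le> 2 * R * (1 + x)"
    proof -
      have "2 * R * (1 + x) = 2 * R + mag j" using R by (simp add: x_def distrib_left)
      then show ?thesis using R by simp
    qed
    then have "(1 + mag j) ^ M \<le> (2 * R * (1 + x)) ^ M" by (intro power_mono) auto
    also have "\<dots> = (2 * R) ^ M * (1 + x) ^ M" by (rule power_mult_distrib)
    also have "\<dots> \<le> (2 * R) ^ M * (fact M * exp (1 + x))" using R x by (intro mult_left_mono power_le_fact_exp) auto
    finally have "(1 + mag j) ^ M * exp (- x) \<le> (2 * R) ^ M * (fact M * exp (1 + x)) * exp (- x)"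
      by (rule mult_right_mono) simp
    also have "\<dots> = (2 ^ M * fact M * exp 1) * R ^ M" by (simp add: power_mult_distrib exp_add exp_minus)
    finally have "exp (- x) / R ^ M \<le> (2 ^ M * fact M * exp 1) / (1 + mag j) ^ M"
      using R by (simp add: divide_simps mult_ac)
    from mult_left_mono[OF this, of C] have "C / R ^ M * exp (- x) \<le> K / (1 + mag j) ^ M"
      using C(1) by (simp add: K_def)
    then show ?thesis using C(2)[of t j] t unfolding R M_def[symmetric] x_def[symmetric] by simp
  qed
  have "((\<lambda>t. \<integral>j. A t j * f (n - j) \<partial>count_space UNIV) \<longlongrightarrow> (\<integral>j. 0 \<partial>count_space (UNIV::int set))) at_top"
  proof (rule integral_dominated_convergence_at_top[where w = "\<lambda>j. K * \<bar>f (n - j) / (1 + mag j) ^ M\<bar>"])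
    show "integrable (count_space UNIV) (\<lambda>j. K * \<bar>f (n - j) / (1 + mag j) ^ M\<bar>)"
      using wsummable_translate[OF f, of n] unfolding M_def by (intro integrable_mult_right integrable_abs)
    show "\<forall>\<^sub>F t in at_top. AE j in count_space UNIV. norm (A t j * f (n - j)) \<le> K * \<bar>f (n - j) / (1 + mag j) ^ M\<bar>"
      using eventually_ge_at_top[of 1]
    proof eventually_elim
      case (elim t)
      show ?case
      proof (rule AE_I2)
        fix j :: int
        have "\<bar>A t j\<bar> * \<bar>f (n - j)\<bar> \<le> K / (1 + mag j) ^ M * \<bar>f (n - j)\<bar>"
          by (intro mult_right_mono bnd elim) auto
        then show "norm (A t j * f (n - j)) \<le> K * \<bar>f (n - j) / (1 + mag j) ^ M\<bar>"
          by (simp add: abs_mult abs_divide)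
      qed
    qed
    show "AE j in count_space UNIV. ((\<lambda>t. A t j * f (n - j)) \<longlongrightarrow> 0) at_top"
    proof (rule AE_I2)
      fix j :: int
      have "((\<lambda>t. A t j) \<longlongrightarrow> 0) at_top"
      proof (rule Lim_null_comparison)
        show "\<forall>\<^sub>F t in at_top. norm (A t j) \<le> C * inverse (sqrt t)"
          using eventually_ge_at_top[of 1]
        proof eventually_elim
          case (elim t)
          have m1: "max 1 (sqrt t) = sqrt t" "1 \<le> sqrt t" using elim by auto
          have "\<bar>A t j\<bar> \<le> C / sqrt t ^ (m + 1) * exp (- (1 / (2 * sqrt t) * mag j))"
            using C(2)[of t j] elim unfolding m1 by simp
          also have "\<dots> \<le> C / sqrt t ^ 1 * 1"
            using m1(2) C(1) by (intro mult_mono divide_left_mono power_increasing) auto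
          finally show ?case by (simp add: divide_inverse)
        qed
        have "((\<lambda>t. C * inverse (sqrt t)) \<longlongrightarrow> C * 0) at_top"
          by (intro tendsto_mult tendsto_const tendsto_inverse_0_at_top sqrt_at_top)
        then show "((\<lambda>t. C * inverse (sqrt t)) \<longlongrightarrow> 0) at_top" by simp
      qed
      then show "((\<lambda>t. A t j * f (n - j)) \<longlongrightarrow> 0) at_top"
        by (rule tendsto_mult_left_zero)
    qed
  qed auto
  then show ?thesis by simp
qed

text \<open>The \<open>m\<close> differences are moved onto the heat kernel, whose decay of order m
  + 1 then matches the summability of \<open>f\<close>.\<close>

lemma vanishing_delta_right:
  assumes f: "wsummable (m + 1) f"
  shows "vanishing ((delta_right ^^ m) f)"
  unfolding vanishing_def
proof
  fix n
  have ef: "expb f" by (rule wsummable_expb[OF f])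
  obtain C where C: "0 < C" "\<And>t j. 0 < t \<Longrightarrow> \<bar>(delta_right ^^ m) (hker t) j\<bar> \<le>
    C / max 1 (sqrt t) ^ (m + 1) * decay t j"
    by (rule hker_pointwise[of m]) blast
  have "((\<lambda>t. \<integral>j. (delta_right ^^ m) (hker t) j * f (n - j) \<partial>count_space UNIV) \<longlongrightarrow> 0) at_top"
    by (rule conv_tendsto_zero[OF f C])
  moreover have "conv (hker t) ((delta_right ^^ m) f) n = (\<integral>j. (delta_right ^^ m) (hker t) j * f (n - j) \<partial>count_space UNIV)" for t
    using delta_right_funpow_conv_left[OF rapid_hker ef] delta_right_funpow_conv_right[OF rapid_hker ef]
    by (metis conv_def)
  ultimately show "((\<lambda>t. conv (hker t) ((delta_right ^^ m) f) n) \<longlongrightarrow> 0) at_top" by simp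
qed

section \<open>Differences bounded by time integrals of the heat extension\<close>

lemma lp_norm_diff1_le: assumes p: "1 \<le> p" shows "lp_norm p (diff1 F (int j)) \<le> ennreal (2 * real j) * lp_norm p (delta_right F)"
proof -
  have "diff1 F (int j) n = - (\<Sum>a<j. delta_right F (n + int a))" for n
    by (induction j) (auto simp: diff1_def delta_right_def algebra_simps)
  then have "lp_norm p (diff1 F (int j)) \<le> 2 * (\<Sum>a<j. lp_norm p (\<lambda>n. delta_right F (n + int a)))"
    by (intro lp_norm_sum_le[OF _ p]) (auto intro: sum_abs)
  also have "\<dots> = ennreal (2 * real j) * lp_norm p (delta_right F)"
    by (simp add: lp_norm_shift ennreal_mult ennreal_of_nat_eq_real_of_nat mult.assoc)
  finally show ?thesis .
qed

lemma diff2_eq_sum_lap: "diff2 F (int j) n = (\<Sum>a<j. \<Sum>b<j. lap F (n + int a - int b))"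
proof -
  define E where "E m = F (m + 1) - F m" for m
  have 1: "(\<Sum>b<k. lap F (m - int b)) = E m - E (m - int k)" for m k
    by (induction k) (auto simp: E_def lap_def algebra_simps)
  have 2: "(\<Sum>a<k. E (m + int a)) = F (m + int k) - F m" for m k
    by (induction k) (auto simp: E_def algebra_simps)
  have "(\<Sum>a<j. \<Sum>b<j. lap F (n + int a - int b)) = (\<Sum>a<j. E (n + int a)) - (\<Sum>a<j. E (n - int j + int a))"
    unfolding 1 sum_subtractf by (simp add: algebra_simps)
  then show ?thesis unfolding 2 by (simp add: diff2_def)
qed

lemma lp_norm_diff2_le_lap: assumes p: "1 \<le> p" shows "lp_norm p (diff2 F (int j)) \<le> ennreal (2 * (real j)\<^sup>2) * lp_norm p (lap F)"
proof -
  have "lp_norm p (diff2 F (int j)) \<le> 2 * (\<Sum>(a, b)\<in>{..<j} \<times> {..<j}. lp_norm p (\<lambda>n. lap F (n + (int a - int b))))"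
  proof -
    have "lp_norm p (diff2 F (int j)) \<le> 2 * (\<Sum>z\<in>{..<j} \<times> {..<j}. lp_norm p (\<lambda>n. lap F (n + (int (fst z) - int (snd z)))))"
    proof (rule lp_norm_sum_le[OF _ p])
      fix n
      have "diff2 F (int j) n = (\<Sum>z\<in>{..<j} \<times> {..<j}. lap F (n + (int (fst z) - int (snd z))))"
        by (simp add: diff2_eq_sum_lap sum.cartesian_product case_prod_unfold algebra_simps)
      then show "\<bar>diff2 F (int j) n\<bar> \<le> (\<Sum>z\<in>{..<j} \<times> {..<j}. \<bar>lap F (n + (int (fst z) - int (snd z)))\<bar>)"
        by (simp add: sum_abs)
    qed simp
    then show ?thesis by (simp add: case_prod_unfold)
  qed
  also have "\<dots> = ennreal (2 * (real j)\<^sup>2) * lp_norm p (lap F)"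
    by (simp add: lp_norm_shift case_prod_unfold ennreal_mult ennreal_of_nat_eq_real_of_nat mult.assoc power2_eq_square)
  finally show ?thesis .
qed

lemma lp_norm_diff2_le: assumes p: "1 \<le> p" shows "lp_norm p (diff2 F j) \<le> 8 * lp_norm p F"
proof -
  let ?F = "[\<lambda>n. F (n - j), F, F, \<lambda>n. F (n + j)]"
  have "lp_norm p (diff2 F j) \<le> 2 * (\<Sum>k<4. lp_norm p (?F ! k))"
  proof (rule lp_norm_sum_le[OF _ p])
    fix n
    have "\<bar>diff2 F j n\<bar> \<le> \<bar>F (n - j)\<bar> + \<bar>F n\<bar> + \<bar>F n\<bar> + \<bar>F (n + j)\<bar>" unfolding diff2_def by linarith
    also have "\<dots> = (\<Sum>k<4. \<bar>(?F ! k) n\<bar>)" by (simp add: eval_nat_numeral)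
    finally show "\<bar>diff2 F j n\<bar> \<le> (\<Sum>k<4. \<bar>(?F ! k) n\<bar>)" .
  qed simp
  also have "(\<Sum>k<4. lp_norm p (?F ! k)) = lp_norm p F + lp_norm p F + lp_norm p F + lp_norm p F"
    by (simp add: eval_nat_numeral lp_norm_shift lp_norm_shift_diff)
  also have "\<dots> = 4 * lp_norm p F"
  proof -
    have "(4::ennreal) = 1 + 1 + 1 + 1" by simp
    then show ?thesis by (simp only: distrib_right mult_1_left)
  qed
  finally show ?thesis by (simp add: mult.assoc[symmetric])
qed

lemma lp_norm_diff1_le': assumes p: "1 \<le> p" shows "lp_norm p (diff1 F j) \<le> 4 * lp_norm p F"
proof -
  have "lp_norm p (diff1 F j) \<le> 2 * (lp_norm p (\<lambda>n. F (n + j)) + lp_norm p F)"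
    by (rule lp_norm_add_le[OF p]) (simp add: diff1_def)
  then show ?thesis by (simp add: lp_norm_shift mult_2[symmetric] mult.assoc[symmetric])
qed

text \<open>The semigroup is bounded in norm, so its value at time \<open>t\<close> is controlled by
  those at all s <= t/2, hence by their average. This converts an endpoint value into an integral to
  which the Schur test applies.\<close>

lemma heat_average:
  assumes p: "1 \<le> p" and F: "expb F"
  obtains C where "0 < C" "\<And>t. 0 < t \<Longrightarrow> ennreal t * hnorm p t F \<le>
    ennreal C * (\<integral>\<^sup>+s. hnorm p s F * indicator {0..t} s \<partial>lborel)"
proof -
  obtain C where C: "0 < C" "\<And>t F. 0 < t \<Longrightarrow> expb F \<Longrightarrow>
    lp_norm p ((delta_right ^^ 0) (conv (hker t) F)) \<le> ennreal (C * t powr (- real 0 / 2)) * lp_norm p F"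
    by (rule lp_norm_smoothing[OF p, where m = 0]) blast
  have [measurable]: "(\<lambda>t. hnorm p t F) \<in> borel_measurable borel" by (rule measurable_lp_norm_conv_hker[OF F])
  show thesis
  proof (rule that[of "2 * C"])
    fix t :: real assume t: "0 < t"
    let ?X = "hnorm p t F"
    have pt: "?X \<le> ennreal C * hnorm p s F" if s: "0 \<le> s" "s \<le> t/2" for s
    proof -
      have ts: "0 < t - s" using s t by simp
      have "conv (hker t) F = conv (hker (t - s)) (conv (hker s) F)" by (simp add: conv_hker_conv_hker F)
      then show ?thesis using C(2)[OF ts expb_conv[OF rapid_hker F, of s]] ts by simp
    qed
    have "?X * ennreal (t / 2) = (\<integral>\<^sup>+s. ?X * indicator {0..t/2} s \<partial>lborel)"
      using t by (subst nn_integral_interval_const) auto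
    also have "\<dots> \<le> (\<integral>\<^sup>+s. ennreal C * (hnorm p s F * indicator {0..t} s) \<partial>lborel)"
      using pt t by (intro nn_integral_mono) (auto simp: indicator_def)
    also have "\<dots> = ennreal C * (\<integral>\<^sup>+s. hnorm p s F * indicator {0..t} s \<partial>lborel)"
      by (rule nn_integral_cmult) measurable
    finally have 1: "?X * ennreal (t / 2) \<le> \<dots>" .
    have "ennreal t = 2 * ennreal (t / 2)" using ennreal_mult'[of 2 "t / 2"] by simp
    then have "ennreal t * ?X = 2 * (?X * ennreal (t / 2))" by (simp add: mult_ac)
    also have "\<dots> \<le> 2 * (ennreal C * (\<integral>\<^sup>+s. hnorm p s F * indicator {0..t} s \<partial>lborel))"
      by (intro mult_left_mono 1) auto
    finally show "ennreal t * ?X \<le> ennreal (2 * C) * (\<integral>\<^sup>+s. hnorm p s F * indicator {0..t} s \<partial>lborel)"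
      using C(1) by (simp add: ennreal_mult mult.assoc)
  qed (use C in simp)
qed

lemma abs_conv_hker_diff_le:
  assumes g: "expb g" and t: "0 \<le> t"
  shows "ennreal \<bar>g n - conv (hker t) g n\<bar> \<le> (\<integral>\<^sup>+s. ennreal \<bar>conv (hker s) (lap g) n\<bar> * indicator {0..t} s \<partial>lborel)"
proof -
  have "ennreal \<bar>conv (hker t) g n - conv (hker 0) g n\<bar> \<le> (\<integral>\<^sup>+s. ennreal \<bar>conv (hker s) (lap g) n\<bar> * indicator {0..t} s \<partial>lborel)"
    by (intro abs_diff_le_nn_integral t DERIV_conv_hker continuous_conv_hker expb_lap g)
  then show ?thesis by (simp add: hker_0 conv_unit abs_minus_commute)
qed

lemma lp_norm_heat_diff_le:
  assumes p: "1 \<le> p" and g: "expb g" and t: "0 \<le> t"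
  shows "lp_norm p (\<lambda>n. g n - conv (hker t) g n) \<le> 2 * (\<integral>\<^sup>+s. hnorm p s (lap g) * indicator {0..t} s \<partial>lborel)"
  by (rule lp_norm_nn_integral_set_le[OF _ _ p abs_conv_hker_diff_le[OF g t]])
     (auto intro: measurable_conv_hker expb_lap g)

text \<open>The sequence is split as its heat extension at time t = j^2 plus the remainder. A second
  difference of the smooth part costs j^2 = t times its Laplacian, rewritten by
  \<open>heat_average\<close>; for the remainder, differences are merely bounded and the heat
  equation on 0..t is used.\<close>

lemma lp_norm_diff2_heat:
  assumes p: "1 \<le> p" and g: "expb g"
  obtains C where "0 < C" "\<And>j. lp_norm p (diff2 g j) \<le>
    ennreal C * (\<integral>\<^sup>+s. hnorm p s (lap g) * indicator {0..(real_of_int j)\<^sup>2} s \<partial>lborel)"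
proof -
  obtain C where C: "0 < C" "\<And>t. 0 < t \<Longrightarrow> ennreal t * hnorm p t (lap g) \<le>
    ennreal C * (\<integral>\<^sup>+s. hnorm p s (lap g) * indicator {0..t} s \<partial>lborel)"
    by (rule heat_average[OF p expb_lap[OF g]]) blast
  show thesis
  \<comment> \<open>Twice the sum of 2C (smooth part) and 16 = 8 * 2 (remainder: eight for the
    second difference, two for Minkowski).\<close>
  proof (rule that[of "4 * C + 32"])
    fix j :: int
    define k where "k = nat \<bar>j\<bar>"
    define t where "t = (real k)\<^sup>2"
    have tj: "(real_of_int j)\<^sup>2 = t" by (simp add: t_def k_def)
    have jk: "diff2 g j = diff2 g (int k)" by (cases "0 \<le> j") (auto simp: k_def diff2_minus)
    define I where "I = (\<integral>\<^sup>+s. hnorm p s (lap g) * indicator {0..t} s \<partial>lborel)"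
    show "lp_norm p (diff2 g j) \<le> ennreal (4 * C + 32) * (\<integral>\<^sup>+s. hnorm p s (lap g) * indicator {0..(real_of_int j)\<^sup>2} s \<partial>lborel)"
    proof (cases "k = 0")
      case True
      then have "j = 0" by (simp add: k_def)
      then show ?thesis using p by (simp add: diff2_def[abs_def])
    next
      case False
      then have t: "0 < t" by (simp add: t_def)
      have "lp_norm p (diff2 g (int k)) \<le> 2 * (lp_norm p (diff2 (conv (hker t) g) (int k)) + lp_norm p (diff2 (\<lambda>n. g n - conv (hker t) g n) (int k)))"
        by (rule lp_norm_add_le[OF p]) (simp add: diff2_def)
      also have "\<dots> \<le> 2 * (ennreal (2 * C) * I + 16 * I)"
      proof (intro mult_left_mono add_mono)
        have "lp_norm p (diff2 (conv (hker t) g) (int k)) \<le> ennreal (2 * t) * hnorm p t (lap g)"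
          using lp_norm_diff2_le_lap[OF p, of "conv (hker t) g" k] by (simp add: lap_conv_right rapid_hker g t_def)
        also have "\<dots> = 2 * (ennreal t * hnorm p t (lap g))" using t by (simp add: ennreal_mult mult.assoc)
        also have "\<dots> \<le> 2 * (ennreal C * I)" unfolding I_def by (intro mult_left_mono C t) auto
        finally show "lp_norm p (diff2 (conv (hker t) g) (int k)) \<le> ennreal (2 * C) * I" using C(1) by (simp add: ennreal_mult mult.assoc)
        have "lp_norm p (diff2 (\<lambda>n. g n - conv (hker t) g n) (int k)) \<le> 8 * (2 * I)"
          unfolding I_def using lp_norm_heat_diff_le[OF p g less_imp_le[OF t]]
          by (intro order_trans[OF lp_norm_diff2_le[OF p]] mult_left_mono) auto
        then show "lp_norm p (diff2 (\<lambda>n. g n - conv (hker t) g n) (int k)) \<le> 16 * I" by (simp add: mult.assoc[symmetric])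
      qed auto
      also have "\<dots> = ennreal (4 * C + 32) * I"
      proof -
        have "ennreal (4 * C + 32) = 2 * (ennreal (2 * C) + 16)"
        proof -
          have "2 * (ennreal (2 * C) + ennreal 16) = ennreal (2 * (2 * C + 16))"
            using C(1) by (simp add: ennreal_mult ennreal_plus)
          then show ?thesis by simp
        qed
        then show ?thesis by (simp add: mult.assoc distrib_right)
      qed
      finally show ?thesis by (simp add: jk tj I_def)
    qed
  qed (use C in simp)
qed

text \<open>The same splitting at t = j^2. The smooth part costs |j| = t/|j| times a first
  difference, whence the weight 1/|j| in front of the second integral.\<close>

lemma lp_norm_diff1_heat:
  assumes p: "1 \<le> p" and g: "expb g"
  obtains C where "0 < C" "\<And>j. j \<noteq> 0 \<Longrightarrow> lp_norm p (diff1 g j) \<le>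
    ennreal C * (\<integral>\<^sup>+s. hnorm p s (lap g) * indicator {0..(real_of_int j)\<^sup>2} s \<partial>lborel) +
    ennreal (C / mag j) * (\<integral>\<^sup>+s. hnorm p s (delta_right g) * indicator {0..(real_of_int j)\<^sup>2} s \<partial>lborel)"
proof -
  obtain C where C: "0 < C" "\<And>t. 0 < t \<Longrightarrow> ennreal t * hnorm p t (delta_right g) \<le>
    ennreal C * (\<integral>\<^sup>+s. hnorm p s (delta_right g) * indicator {0..t} s \<partial>lborel)"
    by (rule heat_average[OF p expb_delta_right[OF g]]) blast
  show thesis
  proof (rule that[of "4 * C + 16"])
    fix j :: int assume j0: "j \<noteq> 0"
    define k where "k = nat \<bar>j\<bar>"
    define t where "t = (real k)\<^sup>2"
    have k: "0 < real k" "mag j = real k" using j0 by (auto simp: k_def)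
    have tj: "(real_of_int j)\<^sup>2 = t" by (simp add: t_def k_def)
    have jk: "lp_norm p (diff1 g j) = lp_norm p (diff1 g (int k))"
      using lp_norm_diff1_minus[of p g j] by (cases "0 \<le> j") (auto simp: k_def)
    have t: "0 < t" using k by (simp add: t_def)
    define I where "I = (\<integral>\<^sup>+s. hnorm p s (lap g) * indicator {0..t} s \<partial>lborel)"
    define J where "J = (\<integral>\<^sup>+s. hnorm p s (delta_right g) * indicator {0..t} s \<partial>lborel)"
    have "lp_norm p (diff1 g (int k)) \<le> 2 * (lp_norm p (diff1 (conv (hker t) g) (int k)) + lp_norm p (diff1 (\<lambda>n. g n - conv (hker t) g n) (int k)))"
      by (rule lp_norm_add_le[OF p]) (simp add: diff1_def)
    also have "\<dots> \<le> 2 * (ennreal (2 * C / real k) * J + 8 * I)"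
    proof (intro mult_left_mono add_mono)
      have "lp_norm p (diff1 (conv (hker t) g) (int k)) \<le> ennreal (2 * real k) * hnorm p t (delta_right g)"
        using lp_norm_diff1_le[OF p, of "conv (hker t) g" k] by (simp add: delta_right_conv_right rapid_hker g)
      also have "\<dots> = ennreal (2 / real k) * (ennreal t * hnorm p t (delta_right g))"
      proof -
        have "2 * real k = 2 / real k * t" using k by (simp add: t_def power2_eq_square)
        then have "ennreal (2 * real k) = ennreal (2 / real k) * ennreal t" using k t by (simp add: ennreal_mult[symmetric])
        then show ?thesis by (simp add: mult.assoc)
      qed
      also have "\<dots> \<le> ennreal (2 / real k) * (ennreal C * J)" unfolding J_def by (intro mult_left_mono C t) auto
      also have "\<dots> = ennreal (2 * C / real k) * J" using C(1) k by (simp add: mult.assoc[symmetric] ennreal_mult[symmetric])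
      finally show "lp_norm p (diff1 (conv (hker t) g) (int k)) \<le> ennreal (2 * C / real k) * J" .
      have "lp_norm p (diff1 (\<lambda>n. g n - conv (hker t) g n) (int k)) \<le> 4 * (2 * I)"
        unfolding I_def using lp_norm_heat_diff_le[OF p g less_imp_le[OF t]]
        by (intro order_trans[OF lp_norm_diff1_le'[OF p]] mult_left_mono) auto
      then show "lp_norm p (diff1 (\<lambda>n. g n - conv (hker t) g n) (int k)) \<le> 8 * I" by (simp add: mult.assoc[symmetric])
    qed auto
    also have "\<dots> = ennreal 16 * I + ennreal (4 * C / real k) * J"
    proof -
      have "ennreal (4 * C / real k) = 2 * ennreal (2 * C / real k)"
      proof -
        have "ennreal 2 * ennreal (2 * C / real k) = ennreal (2 * (2 * C / real k))" using C(1) k by (intro ennreal_mult[symmetric]) auto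
        then show ?thesis by simp
      qed
      then show ?thesis by (simp add: distrib_left mult.assoc[symmetric] add.commute)
    qed
    also have "\<dots> \<le> ennreal (4 * C + 16) * I + ennreal ((4 * C + 16) / real k) * J"
      using C(1) k by (intro add_mono mult_right_mono ennreal_leI divide_right_mono) auto
    finally show "lp_norm p (diff1 g j) \<le>
      ennreal (4 * C + 16) * (\<integral>\<^sup>+s. hnorm p s (lap g) * indicator {0..(real_of_int j)\<^sup>2} s \<partial>lborel) +
      ennreal ((4 * C + 16) / mag j) * (\<integral>\<^sup>+s. hnorm p s (delta_right g) * indicator {0..(real_of_int j)\<^sup>2} s \<partial>lborel)"
      by (simp add: jk tj I_def J_def k)
  qed (use C in simp)
qed

lemma jump_kernel:
  assumes "0 < s" "s \<le> r\<^sup>2" "0 < r" "0 < a"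
  shows "r powr (- a) * s powr (a / 2) = kappa a (s powr (1/2) / r)"
proof -
  have "s powr (1/2) \<le> (r\<^sup>2) powr (1/2)" using assms by (intro powr_mono2) auto
  also have "(r\<^sup>2) powr (1/2) = r" using assms by (simp add: powr_half_sqrt)
  finally have "s powr (1/2) / r \<le> 1" using assms by simp
  then have "kappa a (s powr (1/2) / r) = (s powr (1/2) / r) powr a" using assms by (simp add: kappa_cases)
  also have "\<dots> = r powr (- a) * s powr (a / 2)" using assms by (simp add: powr_divide powr_powr powr_minus field_simps)
  finally show ?thesis ..
qed

text \<open>The factor |j|^(-a) on the range s <= j^2 equals \<open>kappa a (sqrt s / |j|)\<close>
  times s^(-a/2), so that only the decaying side of the kernel occurs. The exponent \<open>e\<close>
  accommodates both bounds: 0 for the Laplacian, 1 for the first difference.\<close>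

lemma Lfin_jump_of_heat:
  assumes q: "1 \<le> q" and F: "expb F" and a: "0 < a" and C: "0 \<le> C"
    and fin: "heat_fin p q c F" and e: "\<beta> = a - e" "c = 1 - a / 2"
    and le: "\<And>j. j \<noteq> 0 \<Longrightarrow> \<Phi> j \<le> ennreal (C * mag j powr (- e)) *
      (\<integral>\<^sup>+s. hnorm p s F * indicator {0..(real_of_int j)\<^sup>2} s \<partial>lborel)"
  shows "Lfin jump_measure q (\<lambda>j. \<Phi> j * ennreal (mag j powr (- \<beta>)))"
proof (rule Lfin_schur_dt[OF scale_measure_jump q, where a = a and b = "1/2" and K = C and c = c
    and k = "\<lambda>j s. C * mag j powr (- a)" and S = "\<lambda>j. {0..(real_of_int j)\<^sup>2}" and \<Psi> = "\<lambda>s. hnorm p s F"])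
  have [measurable]: "(\<lambda>t. hnorm p t F) \<in> borel_measurable borel" by (rule measurable_lp_norm_conv_hker[OF F])
  fix j assume "j \<in> space jump_measure"
  then have j: "j \<noteq> 0" by simp
  define I where "I = (\<integral>\<^sup>+s. hnorm p s F * indicator {0..(real_of_int j)\<^sup>2} s \<partial>lborel)"
  have "\<Phi> j * ennreal (mag j powr (- \<beta>)) \<le> ennreal (C * mag j powr (- e)) * I * ennreal (mag j powr (- \<beta>))"
    unfolding I_def by (intro mult_right_mono le j) auto
  also have "\<dots> = ennreal (C * mag j powr (- a)) * I"
  proof -
    have "C * mag j powr (- e) * mag j powr (- \<beta>) = C * mag j powr (- a)"
      using e by (simp add: mult.assoc powr_add[symmetric])
    then have "ennreal (C * mag j powr (- e)) * ennreal (mag j powr (- \<beta>)) = ennreal (C * mag j powr (- a))"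
      using C by (subst ennreal_mult[symmetric]) auto
    then show ?thesis by (metis mult.assoc mult.commute)
  qed
  also have "\<dots> = (\<integral>\<^sup>+s. ennreal (C * mag j powr (- a)) * hnorm p s F * indicator {0..(real_of_int j)\<^sup>2} s \<partial>lborel)"
    unfolding I_def by (subst nn_integral_cmult[symmetric]) (auto simp: mult.assoc)
  finally show "\<Phi> j * ennreal (mag j powr (- \<beta>)) \<le> \<dots>" .
next
  fix j and s :: real assume j: "j \<in> space jump_measure" and s: "s \<in> {0..(real_of_int j)\<^sup>2}" "0 < s"
  have "mag j powr (- a) * s powr (a / 2) = kappa a (s powr (1/2) / mag j)"
    using j s a by (intro jump_kernel) auto
  moreover have "s powr (a / 2) * s powr (c - 1) = 1" using s e by (simp add: powr_add[symmetric])
  ultimately have "kappa a (s powr (1/2) / mag j) * s powr (c - 1) = mag j powr (- a)"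
    by (metis mult.assoc mult.right_neutral)
  then show "C * mag j powr (- a) \<le> C * (kappa a (s powr (1/2) / mag j) * s powr (c - 1))" by simp
qed (use a C fin F measurable_heat_restrict in \<open>auto simp: heat_fin_def\<close>)

lemma heat_imp_diff2:
  assumes p: "1 \<le> p" and q: "1 \<le> q" and g: "expb g" and \<beta>: "0 < \<beta>" and fin: "heat_fin p q (1 - \<beta> / 2) (lap g)"
  shows "Lfin jump_measure q (\<lambda>j. lp_norm p (diff2 g j) * ennreal (mag j powr (- \<beta>)))"
proof -
  obtain C where C: "0 < C" "\<And>j. lp_norm p (diff2 g j) \<le>
    ennreal C * (\<integral>\<^sup>+s. hnorm p s (lap g) * indicator {0..(real_of_int j)\<^sup>2} s \<partial>lborel)"
    by (rule lp_norm_diff2_heat[OF p g]) blast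
  show ?thesis
    by (rule Lfin_jump_of_heat[OF q expb_lap[OF g] \<beta> less_imp_le[OF C(1)] fin, where e = 0]) (use C in auto)
qed

lemma heat_imp_diff1:
  assumes p: "1 \<le> p" and q: "1 \<le> q" and g: "expb g" and \<beta>: "0 < \<beta>"
    and fin2: "heat_fin p q (1 - \<beta> / 2) (lap g)" and fin1: "heat_fin p q (1 / 2 - \<beta> / 2) (delta_right g)"
  shows "Lfin jump_measure q (\<lambda>j. lp_norm p (diff1 g j) * ennreal (mag j powr (- \<beta>)))"
proof -
  obtain C where C: "0 < C" "\<And>j. j \<noteq> 0 \<Longrightarrow> lp_norm p (diff1 g j) \<le>
    ennreal C * (\<integral>\<^sup>+s. hnorm p s (lap g) * indicator {0..(real_of_int j)\<^sup>2} s \<partial>lborel) +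
    ennreal (C / mag j) * (\<integral>\<^sup>+s. hnorm p s (delta_right g) * indicator {0..(real_of_int j)\<^sup>2} s \<partial>lborel)"
    by (rule lp_norm_diff1_heat[OF p g]) blast
  let ?A = "\<lambda>j::int. ennreal C * (\<integral>\<^sup>+s. hnorm p s (lap g) * indicator {0..(real_of_int j)\<^sup>2} s \<partial>lborel)"
  let ?B = "\<lambda>j::int. ennreal (C / mag j) * (\<integral>\<^sup>+s. hnorm p s (delta_right g) * indicator {0..(real_of_int j)\<^sup>2} s \<partial>lborel)"
  let ?w = "\<lambda>j::int. ennreal (mag j powr (- \<beta>))"
  have A: "Lfin jump_measure q (\<lambda>j. ?A j * ?w j)"
    by (rule Lfin_jump_of_heat[OF q expb_lap[OF g] \<beta> less_imp_le[OF C(1)] fin2, where e = 0]) auto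
  have B: "Lfin jump_measure q (\<lambda>j. ?B j * ?w j)"
    by (rule Lfin_jump_of_heat[OF q expb_delta_right[OF g] _ less_imp_le[OF C(1)] fin1, where e = 1 and a = "1 + \<beta>"])
       (use \<beta> in \<open>auto simp: powr_minus_divide add_divide_distrib\<close>)
  have "Lfin jump_measure q (\<lambda>j. ?A j * ?w j + ?B j * ?w j)" by (rule Lfin_add[OF A B q]) auto
  then show ?thesis
  proof (rule Lfin_mono)
    fix j assume "j \<in> space jump_measure"
    then have "lp_norm p (diff1 g j) \<le> ?A j + ?B j" by (intro C) auto
    from mult_right_mono[OF this, of "?w j"]
    show "lp_norm p (diff1 g j) * ?w j \<le> ?A j * ?w j + ?B j * ?w j" by (simp add: distrib_right)
  qed
qed

section \<open>Growth at infinity\<close>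

definition growth_fin :: "ennreal \<Rightarrow> real \<Rightarrow> (int \<Rightarrow> real) \<Rightarrow> bool" where
  "growth_fin q \<gamma> f \<longleftrightarrow> Lfin jump_measure q (\<lambda>n. ennreal (\<bar>f n\<bar> / mag n powr \<gamma>))"

lemma abs_int_ge_1: "j \<noteq> 0 \<Longrightarrow> 1 \<le> mag j"
  by linarith

lemma nn_integral_int_split_jump:
  "(\<integral>\<^sup>+n. \<phi> n \<partial>count_space (UNIV::int set)) = \<phi> 0 + (\<integral>\<^sup>+n. ennreal (mag n) * \<phi> n \<partial>jump_measure)"
proof -
  have "(\<Sum>\<^sup>+n. \<phi> n * indicator (- {0}) n) = (\<integral>\<^sup>+n. ennreal (mag n) * \<phi> n \<partial>jump_measure)"
    unfolding nn_integral_jump_measure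
  proof (intro nn_integral_cong)
    fix n :: int
    have "n \<noteq> 0 \<Longrightarrow> ennreal (mag n) * ennreal (1 / mag n) = 1" by (simp add: ennreal_mult[symmetric])
    then have "n \<noteq> 0 \<Longrightarrow> \<phi> n = (ennreal (mag n) * ennreal (1 / mag n)) * \<phi> n" by simp
    then show "\<phi> n * indicator (- {0}) n = ennreal (mag n) * \<phi> n * ennreal (1 / mag n) * indicator (- {0}) n"
      by (cases "n = 0") (simp_all add: mult_ac)
  qed
  then show ?thesis by (subst nn_integral_int_split_zero) simp
qed

text \<open>Pairing with the kernel at scale 1: for |n| >= 1 it equals |n|^(\<alpha>-m), which
  combines with the growth weight to |n|^(-m); the remaining power in the exponent m + 1 is the
  1/|n| of the jump measure.\<close>

lemma growth_fin_wsummable: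
  assumes q: "1 \<le> q" and f: "growth_fin q \<alpha> f" and m: "\<alpha> < real m"
  shows "wsummable (m + 1) f"
proof -
  have "(\<integral>\<^sup>+n. ennreal (kappa (real m - \<alpha>) (mag n / 1)) * ennreal (\<bar>f n\<bar> / mag n powr \<alpha>) \<partial>jump_measure) < \<top>"
    by (rule Lfin_pairing[OF scale_measure_jump q]) (use f m in \<open>auto simp: growth_fin_def\<close>)
  moreover have "(\<integral>\<^sup>+n. ennreal (mag n) * ennreal (\<bar>f n\<bar> / (1 + mag n) ^ (m + 1)) \<partial>jump_measure) \<le>
    (\<integral>\<^sup>+n. ennreal (kappa (real m - \<alpha>) (mag n / 1)) * ennreal (\<bar>f n\<bar> / mag n powr \<alpha>) \<partial>jump_measure)"
  proof (intro nn_integral_mono)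
    fix n assume "n \<in> space jump_measure"
    then have n: "1 \<le> mag n" using abs_int_ge_1 by simp
    define x where "x = mag n"
    have x: "1 \<le> x" using n by (simp add: x_def)
    have "kappa (real m - \<alpha>) x = x powr (- (real m - \<alpha>))"
      using x m by (cases "x = 1") (auto simp: kappa_cases)
    then have e: "kappa (real m - \<alpha>) x * (\<bar>f n\<bar> / x powr \<alpha>) = x * (\<bar>f n\<bar> / x ^ (m + 1))"
      using x by (simp add: powr_diff powr_minus powr_realpow field_simps)
    have "x * (\<bar>f n\<bar> / (1 + x) ^ (m + 1)) \<le> x * (\<bar>f n\<bar> / x ^ (m + 1))"
      using x by (intro mult_left_mono divide_left_mono power_mono) auto
    then have "ennreal (x * (\<bar>f n\<bar> / (1 + x) ^ (m + 1))) \<le> ennreal (kappa (real m - \<alpha>) x * (\<bar>f n\<bar> / x powr \<alpha>))"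
      unfolding e by (rule ennreal_leI)
    moreover have "ennreal x * ennreal (\<bar>f n\<bar> / (1 + x) ^ (m + 1)) = ennreal (x * (\<bar>f n\<bar> / (1 + x) ^ (m + 1)))"
      using x by (intro ennreal_mult[symmetric]) auto
    moreover have "ennreal (kappa (real m - \<alpha>) x) * ennreal (\<bar>f n\<bar> / x powr \<alpha>) = ennreal (kappa (real m - \<alpha>) x * (\<bar>f n\<bar> / x powr \<alpha>))"
      by (intro ennreal_mult[symmetric]) auto
    ultimately show "ennreal (mag n) * ennreal (\<bar>f n\<bar> / (1 + mag n) ^ (m + 1)) \<le>
      ennreal (kappa (real m - \<alpha>) (mag n / 1)) * ennreal (\<bar>f n\<bar> / mag n powr \<alpha>)"
      by (simp only: x_def[symmetric] div_by_1)
  qed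
  ultimately show ?thesis unfolding wsummable_def
    by (subst nn_integral_int_split_jump) (auto intro: le_less_trans)
qed

lemma growth_fin_expb:
  assumes q: "1 \<le> q" and f: "growth_fin q \<alpha> f"
  shows "expb f"
proof -
  obtain m where "\<alpha> < real m" using reals_Archimedean2 by blast
  then show ?thesis using growth_fin_wsummable[OF assms] wsummable_expb by blast
qed

lemma summable_imp_wsummable:
  assumes "(\<lambda>n. \<bar>f n\<bar> / (1 + (mag n)\<^sup>2)) summable_on UNIV"
  shows "wsummable 2 f"
proof -
  have "(\<Sum>\<^sup>+n. ennreal (\<bar>f n\<bar> / (1 + mag n) ^ 2)) \<le> (\<Sum>\<^sup>+n. ennreal (\<bar>f n\<bar> / (1 + (mag n)\<^sup>2)))"
  proof (intro nn_integral_mono ennreal_leI divide_left_mono)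
    fix n :: int
    show "1 + (mag n)\<^sup>2 \<le> (1 + mag n) ^ 2" by (simp add: power2_sum)
  next
    fix n :: int
    have "0 < 1 + (mag n)\<^sup>2" by (simp add: add_pos_nonneg)
    then show "0 < (1 + mag n) ^ 2 * (1 + (mag n)\<^sup>2)" by (intro mult_pos_pos zero_less_power) auto
  qed auto
  also have "\<dots> < \<top>" using assms by (subst (asm) summable_on_int_iff) auto
  finally show ?thesis by (simp add: wsummable_def)
qed

lemma Lfin_jump_powr:
  assumes q: "1 \<le> q" and a: "0 < a" and c: "0 \<le> c"
  shows "Lfin jump_measure q (\<lambda>n. ennreal (c * mag n powr (- a)))"
proof (rule Lfin_of_integrable_bounded[OF q, where C = c])
  obtain C where C: "\<And>r. 0 < r \<Longrightarrow> (\<integral>\<^sup>+j. ennreal (kappa a (mag j / r)) \<partial>jump_measure) \<le> ennreal C"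
    by (rule scale_measure_bound[OF scale_measure_jump a]) blast
  have k: "mag n powr (- a) = kappa a (mag n / 1)" if "n \<in> space jump_measure" for n
    using that abs_int_ge_1[of n] a by (cases "mag n = 1") (auto simp: kappa_cases)
  have "(\<integral>\<^sup>+n. ennreal (c * mag n powr (- a)) \<partial>jump_measure) =
    (\<integral>\<^sup>+n. ennreal c * ennreal (kappa a (mag n / 1)) \<partial>jump_measure)"
    using c by (intro nn_integral_cong) (simp add: k ennreal_mult del: div_by_1)
  also have "\<dots> = ennreal c * (\<integral>\<^sup>+n. ennreal (kappa a (mag n / 1)) \<partial>jump_measure)"
    by (rule nn_integral_cmult) simp
  also have "\<dots> \<le> ennreal c * ennreal C" by (intro mult_left_mono C) auto
  also have "\<dots> < \<top>" by (simp add: ennreal_mult_less_top)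
  finally show "(\<integral>\<^sup>+n. ennreal (c * mag n powr (- a)) \<partial>jump_measure) < \<top>" .
  fix n assume n: "n \<in> space jump_measure"
  then have "kappa a (mag n / 1) \<le> 1" using a by (intro kappa_le_1) auto
  then have "c * mag n powr (- a) \<le> c * 1" unfolding k[OF n] by (intro mult_left_mono c)
  then show "ennreal (c * mag n powr (- a)) \<le> ennreal c" by (intro ennreal_leI) simp
qed simp

text \<open>A single value is below the l^p norm: g(n) = g(0) + \<open>diff1 g n 0\<close>. This is
  why the Besov spaces need no separate growth condition.\<close>

lemma diff1_imp_growth_fin:
  assumes p: "1 \<le> p" and q: "1 \<le> q" and \<beta>: "0 < \<beta>"
    and fin: "Lfin jump_measure q (\<lambda>j. lp_norm p (diff1 g j) * ennreal (mag j powr (- \<beta>)))"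
  shows "growth_fin q \<beta> g"
  unfolding growth_fin_def
proof (rule Lfin_mono)
  show "Lfin jump_measure q (\<lambda>n. ennreal (\<bar>g 0\<bar> * mag n powr (- \<beta>)) + lp_norm p (diff1 g n) * ennreal (mag n powr (- \<beta>)))"
    by (rule Lfin_add[OF Lfin_jump_powr[OF q \<beta>] fin q]) auto
  fix n assume "n \<in> space jump_measure"
  let ?w = "mag n powr (- \<beta>)"
  have "\<bar>g n\<bar> / mag n powr \<beta> \<le> \<bar>g 0\<bar> * ?w + \<bar>diff1 g n 0\<bar> * ?w"
    unfolding distrib_right[symmetric] powr_minus divide_inverse by (intro mult_right_mono) (auto simp: diff1_def)
  then have "ennreal (\<bar>g n\<bar> / mag n powr \<beta>) \<le> ennreal (\<bar>g 0\<bar> * ?w + \<bar>diff1 g n 0\<bar> * ?w)" by (rule ennreal_leI)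
  also have "\<dots> = ennreal (\<bar>g 0\<bar> * ?w) + ennreal \<bar>diff1 g n 0\<bar> * ennreal ?w" by (simp add: ennreal_mult)
  also have "\<dots> \<le> ennreal (\<bar>g 0\<bar> * ?w) + lp_norm p (diff1 g n) * ennreal ?w"
    by (intro add_left_mono mult_right_mono abs_le_lp_norm p) auto
  finally show "ennreal (\<bar>g n\<bar> / mag n powr \<beta>) \<le> \<dots>" .
qed

text \<open>A discrete Hardy inequality.\<close>

lemma Lfin_hardy:
  assumes q: "1 \<le> q" and a: "0 < a" and R: "1 \<le> R"
    and fin: "Lfin jump_measure q (\<lambda>i. \<phi> i * ennreal (mag i powr (1 - a)))"
  shows "Lfin jump_measure q (\<lambda>n. ennreal (mag n powr (- a)) *
    (\<integral>\<^sup>+i. ennreal (mag i) * (\<phi> i * indicator {i. mag i \<le> R * mag n} i) \<partial>jump_measure))"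
proof (rule Lfin_schur[OF scale_measure_jump scale_measure_jump q a _ fin, where c = "R powr (2 * a)"])
  fix n assume "n \<in> space jump_measure"
  then have n: "1 \<le> mag n" using abs_int_ge_1 by simp
  \<comment> \<open>Without truncation (x/y)^a would grow with x/y; for u <= R one has u^a <= R^(2a)
    u^(-a), so the truncated kernel lies below a decaying one.\<close>
  have key: "y powr (- a) * x \<le> R powr (2 * a) * (kappa a (x / y) * x powr (1 - a))" if x: "1 \<le> x" "x \<le> R * y" "1 \<le> y" for x y
  proof -
    define u where "u = x / y"
    have u: "0 < u" "u \<le> R" using x by (auto simp: u_def field_simps)
    have R1: "1 \<le> R powr (2 * a)" using R a by (simp add: ge_one_powr_ge_zero)
    have "u powr a \<le> R powr (2 * a) * kappa a u"
    proof (cases "u \<le> 1")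
      case True
      then show ?thesis using u a R1 mult_right_mono[OF R1, of "u powr a"] by (simp add: kappa_cases)
    next
      case False
      have "u powr (2 * a) \<le> R powr (2 * a)" using u a by (intro powr_mono2) auto
      then have "u powr (2 * a) * u powr (- a) \<le> R powr (2 * a) * u powr (- a)" by (intro mult_right_mono) auto
      then show ?thesis using False u a by (simp add: kappa_cases powr_add[symmetric])
    qed
    then have "u powr a * x powr (1 - a) \<le> R powr (2 * a) * kappa a u * x powr (1 - a)" by (rule mult_right_mono) simp
    moreover have "u powr a * x powr (1 - a) = y powr (- a) * x"
      using x by (simp add: u_def powr_divide powr_diff powr_minus field_simps)
    ultimately show ?thesis by (simp add: u_def mult.assoc)
  qed
  have "ennreal (mag n powr (- a)) *
    (\<integral>\<^sup>+i. ennreal (mag i) * (\<phi> i * indicator {i. mag i \<le> R * mag n} i) \<partial>jump_measure) =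
    (\<integral>\<^sup>+i. ennreal (mag n powr (- a)) * (ennreal (mag i) * (\<phi> i * indicator {i. mag i \<le> R * mag n} i)) \<partial>jump_measure)"
    by (rule nn_integral_cmult[symmetric]) simp
  also have "\<dots> \<le> (\<integral>\<^sup>+i. ennreal (R powr (2 * a)) * (ennreal (kappa a (mag i / mag n)) * (\<phi> i * ennreal (mag i powr (1 - a)))) \<partial>jump_measure)"
  proof (intro nn_integral_mono)
    fix i assume "i \<in> space jump_measure"
    then have i: "1 \<le> mag i" using abs_int_ge_1 by simp
    show "ennreal (mag n powr (- a)) * (ennreal (mag i) * (\<phi> i * indicator {i. mag i \<le> R * mag n} i)) \<le>
      ennreal (R powr (2 * a)) * (ennreal (kappa a (mag i / mag n)) * (\<phi> i * ennreal (mag i powr (1 - a))))"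
    proof (cases "mag i \<le> R * mag n")
      case True
      from ennreal_leI[OF key[OF i True n]]
      have "ennreal (mag n powr (- a)) * ennreal (mag i) \<le>
        ennreal (R powr (2 * a)) * (ennreal (kappa a (mag i / mag n)) * ennreal (mag i powr (1 - a)))"
        by (simp add: ennreal_mult)
      from mult_right_mono[OF this, of "\<phi> i"] True show ?thesis by (simp add: mult_ac)
    qed simp
  qed
  also have "\<dots> = ennreal (R powr (2 * a)) * (\<integral>\<^sup>+i. ennreal (kappa a (mag i / mag n)) * (\<phi> i * ennreal (mag i powr (1 - a))) \<partial>jump_measure)"
    by (rule nn_integral_cmult) simp
  finally show "ennreal (mag n powr (- a)) *
    (\<integral>\<^sup>+i. ennreal (mag i) * (\<phi> i * indicator {i. mag i \<le> R * mag n} i) \<partial>jump_measure) \<le> \<dots>" .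
qed simp

lemma sum_eq_nn_integral_jump:
  fixes \<phi> :: "int \<Rightarrow> ennreal"
  assumes "0 \<le> N"
  shows "(\<Sum>i\<in>{-N..N}. \<phi> i) = \<phi> 0 + (\<integral>\<^sup>+i. ennreal (mag i) * (\<phi> i * indicator {-N..N} i) \<partial>jump_measure)"
proof -
  have "(\<Sum>i\<in>{-N..N}. \<phi> i) = (\<Sum>\<^sup>+i. \<phi> i * indicator {-N..N} i)"
    by (simp add: nn_integral_count_space_indicator[symmetric] nn_integral_count_space_finite)
  then show ?thesis using assms by (subst (asm) nn_integral_int_split_jump) simp
qed

text \<open>\<open>h n\<close> differs from \<open>h 0\<close> by a sum of differences between 0 and
  n. Hardy's inequality with exponent \<gamma> + 1 shows that summation raises the growth exponent
  by exactly 1.\<close>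

lemma growth_fin_sum:
  assumes q: "1 \<le> q" and \<gamma>: "0 < \<gamma>" and fin: "growth_fin q \<gamma> (delta_right h)"
  shows "growth_fin q (\<gamma> + 1) h"
  unfolding growth_fin_def
proof (rule Lfin_mono)
  \<comment> \<open>The difference at 0 is kept apart because the jump measure omits the
    origin.\<close>
  define c where "c = \<bar>h 0\<bar> + \<bar>delta_right h 0\<bar>"
  let ?I = "\<lambda>n. \<integral>\<^sup>+i. ennreal (mag i) * (ennreal \<bar>delta_right h i\<bar> * indicator {i. mag i \<le> 1 * mag n} i) \<partial>jump_measure"
  have "Lfin jump_measure q (\<lambda>i. ennreal \<bar>delta_right h i\<bar> * ennreal (mag i powr (1 - (\<gamma> + 1))))"
    using fin unfolding growth_fin_def by (simp add: ennreal_mult[symmetric] powr_minus divide_inverse)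
  from Lfin_hardy[OF q _ order_refl this]
  have 1: "Lfin jump_measure q (\<lambda>n. ennreal (mag n powr (- (\<gamma> + 1))) * ?I n)" using \<gamma> by simp
  have 2: "Lfin jump_measure q (\<lambda>n. ennreal (c * mag n powr (- (\<gamma> + 1))))"
    using \<gamma> by (intro Lfin_jump_powr q) (auto simp: c_def)
  show "Lfin jump_measure q (\<lambda>n. ennreal (c * mag n powr (- (\<gamma> + 1))) + ennreal (mag n powr (- (\<gamma> + 1))) * ?I n)"
    by (rule Lfin_add[OF 2 1 q]) auto
  fix n assume "n \<in> space jump_measure"
  define N where "N = \<bar>n\<bar>"
  have bound: "\<bar>h (int k)\<bar> \<le> \<bar>h 0\<bar> + (\<Sum>i\<in>{- int k..int k}. \<bar>delta_right h i\<bar>)"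
             "\<bar>h (- int k)\<bar> \<le> \<bar>h 0\<bar> + (\<Sum>i\<in>{- int k..int k}. \<bar>delta_right h i\<bar>)" for k
  proof -
    have "h (int k) = h 0 - (\<Sum>i<k. delta_right h (int i))" by (induction k) (auto simp: delta_right_def algebra_simps)
    then have "\<bar>h (int k)\<bar> \<le> \<bar>h 0\<bar> + (\<Sum>i<k. \<bar>delta_right h (int i)\<bar>)"
      using sum_abs[of "\<lambda>i. delta_right h (int i)" "{..<k}"] by linarith
    also have "(\<Sum>i<k. \<bar>delta_right h (int i)\<bar>) = (\<Sum>i\<in>int ` {..<k}. \<bar>delta_right h i\<bar>)" by (simp add: sum.reindex)
    also have "\<dots> \<le> (\<Sum>i\<in>{- int k..int k}. \<bar>delta_right h i\<bar>)" by (intro sum_mono2) auto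
    finally show "\<bar>h (int k)\<bar> \<le> \<bar>h 0\<bar> + (\<Sum>i\<in>{- int k..int k}. \<bar>delta_right h i\<bar>)" by simp
    have "h (- int k) = h 0 + (\<Sum>i<k. delta_right h (- int i - 1))"
    proof (induction k)
      case (Suc k)
      have "- int (Suc k) = - int k - 1" by simp
      then show ?case unfolding sum.lessThan_Suc using Suc by (simp only: delta_right_def) simp
    qed simp
    then have "\<bar>h (- int k)\<bar> \<le> \<bar>h 0\<bar> + (\<Sum>i<k. \<bar>delta_right h (- int i - 1)\<bar>)"
      using sum_abs[of "\<lambda>i. delta_right h (- int i - 1)" "{..<k}"] by linarith
    also have "(\<Sum>i<k. \<bar>delta_right h (- int i - 1)\<bar>) = (\<Sum>i\<in>(\<lambda>i. - int i - 1) ` {..<k}. \<bar>delta_right h i\<bar>)"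
      by (subst sum.reindex) (auto simp: inj_on_def)
    also have "\<dots> \<le> (\<Sum>i\<in>{- int k..int k}. \<bar>delta_right h i\<bar>)" by (intro sum_mono2) auto
    finally show "\<bar>h (- int k)\<bar> \<le> \<bar>h 0\<bar> + (\<Sum>i\<in>{- int k..int k}. \<bar>delta_right h i\<bar>)" by simp
  qed
  have "\<bar>h n\<bar> \<le> \<bar>h 0\<bar> + (\<Sum>i\<in>{- N..N}. \<bar>delta_right h i\<bar>)"
  proof (cases "0 \<le> n")
    case True
    then show ?thesis using bound(1)[of "nat n"] by (simp add: N_def)
  next
    case False
    then show ?thesis using bound(2)[of "nat (- n)"] by (simp add: N_def)
  qed
  then have "ennreal \<bar>h n\<bar> \<le> ennreal \<bar>h 0\<bar> + (\<Sum>i\<in>{- N..N}. ennreal \<bar>delta_right h i\<bar>)"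
    by (simp add: sum_ennreal ennreal_plus[symmetric] sum_nonneg ennreal_leI del: ennreal_plus)
  also have "\<dots> = ennreal c + ?I n"
  proof -
    have "{i. mag i \<le> 1 * mag n} = {- N..N}" by (auto simp: N_def)
    then show ?thesis
      by (subst sum_eq_nn_integral_jump) (auto simp: N_def c_def add.assoc)
  qed
  finally have h: "ennreal \<bar>h n\<bar> \<le> ennreal c + ?I n" .
  have "ennreal (\<bar>h n\<bar> / mag n powr (\<gamma> + 1)) = ennreal (mag n powr (- (\<gamma> + 1))) * ennreal \<bar>h n\<bar>"
  proof -
    have "\<bar>h n\<bar> / mag n powr (\<gamma> + 1) = mag n powr (- (\<gamma> + 1)) * \<bar>h n\<bar>"
      unfolding powr_minus divide_inverse by (rule mult.commute)
    then show ?thesis by (simp only: ennreal_mult powr_ge_zero abs_ge_zero)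
  qed
  also have "\<dots> \<le> ennreal (mag n powr (- (\<gamma> + 1))) * (ennreal c + ?I n)" by (rule mult_left_mono[OF h]) simp
  also have "\<dots> = ennreal (c * mag n powr (- (\<gamma> + 1))) + ennreal (mag n powr (- (\<gamma> + 1))) * ?I n"
    by (simp add: distrib_left ennreal_mult c_def mult.commute)
  finally show "ennreal (\<bar>h n\<bar> / mag n powr (\<gamma> + 1)) \<le> \<dots>" .
qed

lemma growth_fin_funpow:
  assumes q: "1 \<le> q" and \<gamma>: "0 < \<gamma>"
  shows "growth_fin q \<gamma> ((delta_right ^^ l) f) \<Longrightarrow> growth_fin q (\<gamma> + real l) f"
proof (induction l arbitrary: f)
  case (Suc l)
  then have "growth_fin q (\<gamma> + real l) (delta_right f)" by (simp add: funpow_swap1)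
  then have "growth_fin q (\<gamma> + real l + 1) f" using \<gamma> by (intro growth_fin_sum q) auto
  then show ?case by (simp add: add_ac)
qed simp

lemma wsummable_jump:
  assumes "wsummable 2 f"
  shows "(\<integral>\<^sup>+n. ennreal (\<bar>f n\<bar> * mag n powr (- 1)) \<partial>jump_measure) < \<top>"
proof -
  have "(\<integral>\<^sup>+n. ennreal (\<bar>f n\<bar> * mag n powr (- 1)) \<partial>jump_measure) \<le>
    (\<Sum>\<^sup>+n. ennreal 4 * ennreal (\<bar>f n\<bar> / (1 + mag n) ^ 2))"
    unfolding nn_integral_jump_measure
  proof (intro nn_integral_mono)
    fix n :: int
    show "ennreal (\<bar>f n\<bar> * mag n powr (- 1)) * ennreal (1 / mag n) * indicator (- {0}) n \<le>
      ennreal 4 * ennreal (\<bar>f n\<bar> / (1 + mag n) ^ 2)"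
    proof (cases "n = 0")
      case False
      define x where "x = mag n"
      have x: "1 \<le> x" using abs_int_ge_1[OF False] by (simp add: x_def)
      have "(1 + x)\<^sup>2 \<le> (2 * x)\<^sup>2" using x by (intro power_mono) auto
      then have "1 / x\<^sup>2 \<le> 4 / (1 + x)\<^sup>2" using x by (simp add: field_simps)
      then have "\<bar>f n\<bar> * (1 / x\<^sup>2) \<le> \<bar>f n\<bar> * (4 / (1 + x)\<^sup>2)" by (rule mult_left_mono) simp
      then have "\<bar>f n\<bar> * x powr (- 1) * (1 / x) \<le> 4 * (\<bar>f n\<bar> / (1 + x)\<^sup>2)"
        using x by (simp add: powr_minus power2_eq_square field_simps)
      from ennreal_leI[OF this] show ?thesis using False x unfolding x_def[symmetric]
        by (simp add: ennreal_mult[symmetric] del: ennreal_numeral)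
    qed simp
  qed
  also have "\<dots> < \<top>" using assms unfolding wsummable_def by (simp add: nn_integral_cmult ennreal_mult_less_top)
  finally show ?thesis .
qed

text \<open>For \<alpha> >= 2 the sequence |f n| / |n|^\<alpha> is at once integrable for the jump
  measure, being dominated by |f n| / |n|, and bounded, so it lies in every L^q.\<close>

lemma wsummable_growth_fin_ge_2:
  assumes q: "1 \<le> q" and f: "wsummable 2 f" and \<alpha>: "2 \<le> \<alpha>"
  shows "growth_fin q \<alpha> f"
proof -
  obtain W where W: "(\<Sum>\<^sup>+n. ennreal (\<bar>f n\<bar> / (1 + mag n) ^ 2)) = ennreal W" "0 \<le> W"
    using f unfolding wsummable_def by (auto simp: less_top_ennreal)
  have b: "\<bar>f n\<bar> / (1 + mag n) ^ 2 \<le> W" for n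
  proof -
    have "ennreal (\<bar>f n\<bar> / (1 + mag n) ^ 2) = (\<Sum>\<^sup>+k. ennreal (\<bar>f k\<bar> / (1 + mag k) ^ 2) * indicator {n} k)"
      by simp
    also have "\<dots> \<le> ennreal W" unfolding W(1)[symmetric] by (intro nn_integral_mono) (auto simp: indicator_def)
    finally show ?thesis using W(2) by simp
  qed
  have pt: "\<bar>f n\<bar> / mag n powr \<alpha> \<le> \<bar>f n\<bar> * mag n powr (- 1)"
           "\<bar>f n\<bar> / mag n powr \<alpha> \<le> 4 * W" if "n \<in> space jump_measure" for n
  proof -
    define x where "x = mag n"
    have x: "1 \<le> x" using abs_int_ge_1[of n] that by (simp add: x_def)
    have "\<bar>f n\<bar> * x powr (- \<alpha>) \<le> \<bar>f n\<bar> * x powr (- 1)" using x \<alpha> by (intro mult_left_mono powr_mono) auto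
    then show "\<bar>f n\<bar> / mag n powr \<alpha> \<le> \<bar>f n\<bar> * mag n powr (- 1)"
      by (simp add: x_def powr_minus divide_inverse)
    have "x powr 2 \<le> x powr \<alpha>" using x \<alpha> by (intro powr_mono) auto
    then have "x\<^sup>2 \<le> x powr \<alpha>" using x by simp
    then have "\<bar>f n\<bar> / x powr \<alpha> \<le> \<bar>f n\<bar> / x\<^sup>2" using x by (intro divide_left_mono) auto
    also have "\<dots> \<le> 4 * (\<bar>f n\<bar> / (1 + x)\<^sup>2)"
    proof -
      have "(1 + x)\<^sup>2 \<le> (2 * x)\<^sup>2" using x by (intro power_mono) auto
      then have "1 / x\<^sup>2 \<le> 4 / (1 + x)\<^sup>2" using x by (simp add: field_simps)
      then have "\<bar>f n\<bar> * (1 / x\<^sup>2) \<le> \<bar>f n\<bar> * (4 / (1 + x)\<^sup>2)" by (rule mult_left_mono) simp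
      then show ?thesis by (simp add: mult.commute)
    qed
    also have "\<dots> \<le> 4 * W" using b[of n] by (simp add: x_def)
    finally show "\<bar>f n\<bar> / mag n powr \<alpha> \<le> 4 * W" by (simp add: x_def)
  qed
  show ?thesis unfolding growth_fin_def
  proof (rule Lfin_of_integrable_bounded[OF q, where C = "4 * W"])
    have "(\<integral>\<^sup>+n. ennreal (\<bar>f n\<bar> / mag n powr \<alpha>) \<partial>jump_measure) \<le> (\<integral>\<^sup>+n. ennreal (\<bar>f n\<bar> * mag n powr (- 1)) \<partial>jump_measure)"
      by (intro nn_integral_mono ennreal_leI pt)
    then show "(\<integral>\<^sup>+n. ennreal (\<bar>f n\<bar> / mag n powr \<alpha>) \<partial>jump_measure) < \<top>" using wsummable_jump[OF f] by (rule le_less_trans)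
  qed (use pt in \<open>auto intro: ennreal_leI\<close>)
qed

text \<open>Averaging \<open>2 f n = f (n - j) + f (n + j) - diff2 f j n\<close> over \<open>1 \<le> j \<le> |n|\<close>: the means of \<open>|f|\<close> are
  controlled by summability, those of \<open>diff2\<close> by Hardy's inequality.\<close>

lemma diff2_imp_growth_fin_1:
  assumes p: "1 \<le> p" and q: "1 \<le> q" and f: "wsummable 2 f"
    and fin: "Lfin jump_measure q (\<lambda>j. lp_norm p (diff2 f j) * ennreal (mag j powr (- 1)))"
  shows "growth_fin q 1 f"
  unfolding growth_fin_def
proof (rule Lfin_mono)
  obtain W where W: "(\<Sum>\<^sup>+n. ennreal (\<bar>f n\<bar> / (1 + mag n) ^ 2)) = ennreal W" "0 \<le> W"
    using f unfolding wsummable_def by (auto simp: less_top_ennreal)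
  let ?w = "\<lambda>n::int. ennreal (mag n powr (- 2))"
  let ?A = "\<lambda>n. ?w n * (\<integral>\<^sup>+i. ennreal (mag i) * (ennreal \<bar>f i\<bar> * indicator {i. mag i \<le> 2 * mag n} i) \<partial>jump_measure)"
  let ?B = "\<lambda>n. ?w n * (\<integral>\<^sup>+i. ennreal (mag i) * (lp_norm p (diff2 f i) * indicator {i. mag i \<le> 1 * mag n} i) \<partial>jump_measure)"
  have B: "Lfin jump_measure q ?B" using Lfin_hardy[OF q _ order_refl, of 2 "\<lambda>i. lp_norm p (diff2 f i)"] fin by simp
  have A1: "Lfin jump_measure 1 ?A"
  proof -
    have "Lfin jump_measure 1 (\<lambda>i. ennreal \<bar>f i\<bar> * ennreal (mag i powr (1 - 2)))"
      using wsummable_jump[OF f] by (simp add: Lfin_def ennreal_mult[symmetric])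
    then show ?thesis by (intro Lfin_hardy) auto
  qed
  \<comment> \<open>Hardy at q = 1 gives integrability. Boundedness comes from (1+|i|)^2 <= 9 n^2
    for |i| <= 2|n|, which compares the mean of |f| with the weighted sum \<open>W\<close>. The two
    together cover every \<open>q\<close>.\<close>
  have A: "Lfin jump_measure q ?A"
  proof (rule Lfin_of_integrable_bounded[OF q, where C = "9 * W"])
    show "(\<integral>\<^sup>+n. ?A n \<partial>jump_measure) < \<top>" using A1 by (simp add: Lfin_def)
    fix n assume "n \<in> space jump_measure"
    then have n: "1 \<le> mag n" using abs_int_ge_1 by simp
    let ?S = "{i. mag i \<le> 2 * mag n}"
    have "?A n \<le> ?w n * (\<Sum>\<^sup>+i. ennreal \<bar>f i\<bar> * indicator ?S i)"
      by (subst nn_integral_int_split_jump[of "\<lambda>i. ennreal \<bar>f i\<bar> * indicator ?S i"]) (intro mult_left_mono, auto)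
    also have "\<dots> = (\<Sum>\<^sup>+i. ?w n * (ennreal \<bar>f i\<bar> * indicator ?S i))" by (rule nn_integral_cmult[symmetric]) simp
    also have "\<dots> \<le> (\<Sum>\<^sup>+i. ennreal 9 * ennreal (\<bar>f i\<bar> / (1 + mag i) ^ 2))"
    proof (intro nn_integral_mono)
      fix i :: int
      have "mag n powr (- 2) * \<bar>f i\<bar> \<le> 9 * (\<bar>f i\<bar> / (1 + mag i)\<^sup>2)" if "mag i \<le> 2 * mag n"
      proof -
        have "(1 + mag i)\<^sup>2 \<le> (3 * mag n)\<^sup>2" using that n by (intro power_mono) auto
        then have "1 / (mag n)\<^sup>2 \<le> 9 / (1 + mag i)\<^sup>2" using n by (simp add: field_simps)
        then have "1 / (mag n)\<^sup>2 * \<bar>f i\<bar> \<le> 9 / (1 + mag i)\<^sup>2 * \<bar>f i\<bar>" by (rule mult_right_mono) simp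
        moreover have "mag n powr (- 2) = 1 / (mag n)\<^sup>2" using n by (simp add: powr_minus_divide)
        ultimately show ?thesis by simp
      qed
      then show "?w n * (ennreal \<bar>f i\<bar> * indicator ?S i) \<le> ennreal 9 * ennreal (\<bar>f i\<bar> / (1 + mag i) ^ 2)"
        by (cases "i \<in> ?S") (auto simp: ennreal_mult[symmetric] simp del: ennreal_numeral intro!: ennreal_leI)
    qed
    also have "\<dots> = ennreal 9 * ennreal W" unfolding W(1)[symmetric] by (rule nn_integral_cmult) simp
    also have "\<dots> = ennreal (9 * W)" using W(2) by (simp add: ennreal_mult)
    finally show "?A n \<le> ennreal (9 * W)" .
  qed simp
  \<comment> \<open>The value \<open>f 0\<close> occurs twice, once in each translated sum, and is
    invisible to the jump measure.\<close>
  have C: "Lfin jump_measure q (\<lambda>n. ennreal ((2 * \<bar>f 0\<bar>) * mag n powr (- 2)))" by (intro Lfin_jump_powr q) auto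
  have A2: "Lfin jump_measure q (\<lambda>n. 2 * ?A n)" by (rule Lfin_cmult[OF A]) auto
  have AB: "Lfin jump_measure q (\<lambda>n. 2 * ?A n + ?B n)" by (rule Lfin_add[OF A2 B q]) auto
  show "Lfin jump_measure q (\<lambda>n. ennreal ((2 * \<bar>f 0\<bar>) * mag n powr (- 2)) + (2 * ?A n + ?B n))"
    by (rule Lfin_add[OF C AB q]) auto
  fix n assume "n \<in> space jump_measure"
  then have n: "1 \<le> mag n" using abs_int_ge_1 by simp
  define N where "N = \<bar>n\<bar>"
  have N: "1 \<le> N" "real_of_int N = mag n" using n by (auto simp: N_def)
  let ?F = "\<lambda>i. ennreal \<bar>f i\<bar>" and ?D = "\<lambda>j. lp_norm p (diff2 f j)"
  have "?F n \<le> ?F (n - j) + ?F (n + j) + ?D j" for j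
  proof -
    have "\<bar>f n\<bar> \<le> \<bar>f (n - j)\<bar> + \<bar>f (n + j)\<bar> + \<bar>diff2 f j n\<bar>" unfolding diff2_def by linarith
    then have "?F n \<le> ?F (n - j) + ?F (n + j) + ennreal \<bar>diff2 f j n\<bar>"
      by (simp add: ennreal_plus[symmetric] ennreal_leI del: ennreal_plus)
    also have "\<dots> \<le> ?F (n - j) + ?F (n + j) + ?D j" by (intro add_left_mono abs_le_lp_norm p)
    finally show ?thesis .
  qed
  then have "(\<Sum>j\<in>{1..N}. ?F n) \<le> (\<Sum>j\<in>{1..N}. ?F (n - j) + ?F (n + j) + ?D j)" by (rule sum_mono)
  also have "\<dots> = (\<Sum>j\<in>{1..N}. ?F (n - j)) + (\<Sum>j\<in>{1..N}. ?F (n + j)) + (\<Sum>j\<in>{1..N}. ?D j)" by (simp add: sum.distrib)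
  also have "\<dots> \<le> (\<Sum>i\<in>{-(2*N)..2*N}. ?F i) + (\<Sum>i\<in>{-(2*N)..2*N}. ?F i) + (\<Sum>j\<in>{-N..N}. ?D j)"
  proof (intro add_mono)
    have "(\<Sum>j\<in>{1..N}. ?F (n - j)) = (\<Sum>i\<in>(\<lambda>j. n - j) ` {1..N}. ?F i)" by (subst sum.reindex) (auto simp: inj_on_def)
    also have "\<dots> \<le> (\<Sum>i\<in>{-(2*N)..2*N}. ?F i)" by (intro sum_mono2) (auto simp: N_def)
    finally show "(\<Sum>j\<in>{1..N}. ?F (n - j)) \<le> \<dots>" .
    have "(\<Sum>j\<in>{1..N}. ?F (n + j)) = (\<Sum>i\<in>(\<lambda>j. n + j) ` {1..N}. ?F i)" by (subst sum.reindex) (auto simp: inj_on_def)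
    also have "\<dots> \<le> (\<Sum>i\<in>{-(2*N)..2*N}. ?F i)" by (intro sum_mono2) (auto simp: N_def)
    finally show "(\<Sum>j\<in>{1..N}. ?F (n + j)) \<le> \<dots>" .
    show "(\<Sum>j\<in>{1..N}. ?D j) \<le> (\<Sum>j\<in>{-N..N}. ?D j)" using N by (intro sum_mono2) auto
  qed
  finally have s: "(\<Sum>j\<in>{1..N}. ?F n) \<le> \<dots>" .
  define IA where "IA = (\<integral>\<^sup>+i. ennreal (mag i) * (?F i * indicator {i. mag i \<le> 2 * mag n} i) \<partial>jump_measure)"
  define IB where "IB = (\<integral>\<^sup>+i. ennreal (mag i) * (?D i * indicator {i. mag i \<le> 1 * mag n} i) \<partial>jump_measure)"
  have sets: "{i. mag i \<le> 2 * mag n} = {-(2*N)..2*N}" "{i. mag i \<le> 1 * mag n} = {-N..N}"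
    by (auto simp: N_def abs_le_iff)
  have 1: "(\<Sum>i\<in>{-(2*N)..2*N}. ?F i) = ?F 0 + IA" unfolding IA_def sets using N by (subst sum_eq_nn_integral_jump) auto
  have 2: "(\<Sum>j\<in>{-N..N}. ?D j) = IB" unfolding IB_def sets using N p by (subst sum_eq_nn_integral_jump) (auto simp: diff2_def[abs_def])
  have card: "(\<Sum>j\<in>{1..N}. ?F n) = ennreal (mag n) * ?F n"
    using N by (simp add: ennreal_of_nat_eq_real_of_nat)
  have "ennreal (\<bar>f n\<bar> / mag n powr 1) = ?w n * (ennreal (mag n) * ?F n)"
  proof -
    have "y / x powr 1 = x powr (- 2) * (x * y)" if "1 \<le> x" for x y :: real
      using that by (simp add: powr_minus_divide power2_eq_square)
    from this[OF n] have "\<bar>f n\<bar> / mag n powr 1 = mag n powr (- 2) * (mag n * \<bar>f n\<bar>)" .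
    then show ?thesis by (simp add: ennreal_mult)
  qed
  also have "\<dots> \<le> ?w n * ((?F 0 + IA) + (?F 0 + IA) + IB)"
    using s unfolding card 1 2 by (rule mult_left_mono) simp
  also have "\<dots> = ?w n * (2 * ?F 0) + (2 * (?w n * IA) + ?w n * IB)"
    by (simp only: mult_2 distrib_left add_ac)
  also have "?w n * (2 * ?F 0) = ennreal ((2 * \<bar>f 0\<bar>) * mag n powr (- 2))"
    by (simp add: ennreal_mult mult_ac)
  finally show "ennreal (\<bar>f n\<bar> / mag n powr 1) \<le>
    ennreal ((2 * \<bar>f 0\<bar>) * mag n powr (- 2)) + (2 * ?A n + ?B n)" by (simp add: IA_def IB_def)
qed

lemma floor_half: "0 \<le> (\<alpha>::real) \<Longrightarrow> nat \<lfloor>\<alpha> / 2\<rfloor> = nat \<lfloor>\<alpha>\<rfloor> div 2"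
  using floor_divide_real_eq_div[of 2 \<alpha>] by (simp add: nat_div_distrib)

lemma two_mult_div_two: "2 * (L div 2 + 1) = L + 2 \<or> 2 * (L div 2 + 1) = L + (1::nat)"
  by presburger

lemma floor_non_integer:
  fixes \<alpha> :: real
  assumes "0 < \<alpha>" "\<alpha> \<notin> \<nat>"
  shows "real (nat \<lfloor>\<alpha>\<rfloor>) < \<alpha>" "\<alpha> < real (nat \<lfloor>\<alpha>\<rfloor>) + 1"
proof -
  have r: "real (nat \<lfloor>\<alpha>\<rfloor>) = of_int \<lfloor>\<alpha>\<rfloor>" using assms by simp
  have "\<alpha> \<noteq> real (nat \<lfloor>\<alpha>\<rfloor>)" using assms(2) by (metis of_nat_in_Nats)
  then show "real (nat \<lfloor>\<alpha>\<rfloor>) < \<alpha>" "\<alpha> < real (nat \<lfloor>\<alpha>\<rfloor>) + 1" using r of_int_floor_le[of \<alpha>] real_of_int_floor_add_one_gt[of \<alpha>] by linarith+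
qed

section \<open>Heat seminorms of even order against differences of the required order\<close>

text \<open>By the parity of \<open>l\<close> the heat seminorm contains l + 2 or l + 1 differences,
  that is, two or one of \<open>g\<close>. The step to \<open>diff1\<close> needs both orders, the
  step back gives the first order, and \<open>heat_fin_delta\<close> and
  \<open>heat_fin_lap_imp\<close> supply the one that is missing.\<close>

lemma heat_fin_iff_diff1:
  assumes p: "1 \<le> p" and q: "1 \<le> q" and f: "expb f" and \<alpha>: "0 < \<alpha>" "\<alpha> \<notin> \<nat>"
    and l: "l = nat \<lfloor>\<alpha>\<rfloor>" and k: "k = nat \<lfloor>\<alpha> / 2\<rfloor> + 1" and van: "vanishing ((delta_right ^^ (l + 1)) f)"
  shows "heat_fin p q (real k - \<alpha> / 2) ((delta_right ^^ (2 * k)) f) \<longleftrightarrow>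
    Lfin jump_measure q (\<lambda>j. lp_norm p (diff1 ((delta_right ^^ l) f) j) * ennreal (mag j powr (- (\<alpha> - real l))))"
    (is "?H \<longleftrightarrow> ?J")
proof -
  define g where "g = (delta_right ^^ l) f"
  define \<beta> where "\<beta> = \<alpha> - real l"
  have \<beta>: "0 < \<beta>" "\<beta> < 1" using floor_non_integer[OF \<alpha>] unfolding \<beta>_def l by linarith+
  have g: "expb g" unfolding g_def by (rule expb_delta_right_funpow[OF f])
  have van': "vanishing (delta_right g)" using van by (simp add: g_def)
  have kl: "2 * k = l + 2 \<or> 2 * k = l + 1" 
    unfolding k l floor_half[OF less_imp_le[OF \<alpha>(1)]] by (rule two_mult_div_two)
  have lap2: "heat_fin p q c (lap g) \<longleftrightarrow> heat_fin p q c (delta_right (delta_right g))" for c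
    by (simp add: heat_fin_lap numeral_2_eq_2)
  have lap3: "heat_fin p q c (lap (delta_right g)) \<longleftrightarrow> heat_fin p q c (delta_right (delta_right (delta_right g)))" for c
    by (simp add: heat_fin_lap numeral_2_eq_2)
  from kl show ?thesis
  proof
    assume kl: "2 * k = l + 2"
    have H: "?H \<longleftrightarrow> heat_fin p q (1 - \<beta> / 2) (delta_right (delta_right g))"
    proof -
      have "real k - \<alpha> / 2 = 1 - \<beta> / 2" using kl by (simp add: \<beta>_def field_simps)
      moreover have "(delta_right ^^ (2 * k)) f = delta_right (delta_right g)" by (simp add: kl g_def)
      ultimately show ?thesis by simp
    qed
    show ?thesis
    proof
      assume ?H
      then have h2: "heat_fin p q (1 - \<beta> / 2) (delta_right (delta_right g))" by (simp add: H)
      \<comment> \<open>Only two differences can be removed at a time, so order two is raised to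
        three before dropping to one.\<close>
      have "heat_fin p q (1 - \<beta> / 2 + 1/2) (delta_right (delta_right (delta_right g)))"
        by (rule heat_fin_delta[OF p q _ h2]) (intro expb_delta_right g)
      then have "heat_fin p q ((1 / 2 - \<beta> / 2) + 1) (lap (delta_right g))" by (simp add: lap3 algebra_simps)
      then have "heat_fin p q (1 / 2 - \<beta> / 2) (delta_right g)"
        by (rule heat_fin_lap_imp[OF p q expb_delta_right[OF g] _ van', rotated]) (use \<beta> in simp)
      then show ?J using heat_imp_diff1[OF p q g \<beta>(1)] h2 unfolding lap2 g_def[symmetric] \<beta>_def[symmetric] by blast
    next
      assume ?J
      then have "heat_fin p q (1 / 2 - \<beta> / 2) (delta_right g)"
        using diff1_imp_heat[OF p q g \<beta>] by (simp add: heat_fin_def g_def \<beta>_def)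
      then have "heat_fin p q (1 / 2 - \<beta> / 2 + 1/2) (delta_right (delta_right g))"
        by (intro heat_fin_delta[OF p q]) (auto intro: expb_delta_right g)
      then show ?H by (simp add: H)
    qed
  next
    assume kl: "2 * k = l + 1"
    have H: "?H \<longleftrightarrow> heat_fin p q (1 / 2 - \<beta> / 2) (delta_right g)"
    proof -
      have "2 * real k = real l + 1" using kl by (metis of_nat_1 of_nat_add of_nat_mult of_nat_numeral)
      then have "real k - \<alpha> / 2 = 1 / 2 - \<beta> / 2" by (simp add: \<beta>_def field_simps)
      moreover have "(delta_right ^^ (2 * k)) f = delta_right g" by (simp add: kl g_def)
      ultimately show ?thesis by simp
    qed
    show ?thesis
    proof
      assume ?H
      then have h1: "heat_fin p q (1 / 2 - \<beta> / 2) (delta_right g)" by (simp add: H)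
      then have "heat_fin p q (1 / 2 - \<beta> / 2 + 1/2) (delta_right (delta_right g))"
        by (intro heat_fin_delta[OF p q]) (auto intro: expb_delta_right g)
      then have "heat_fin p q (1 - \<beta> / 2) (lap g)" by (simp add: lap2)
      then show ?J using heat_imp_diff1[OF p q g \<beta>(1)] h1 unfolding g_def[symmetric] \<beta>_def[symmetric] by blast
    next
      assume ?J
      then show ?H using diff1_imp_heat[OF p q g \<beta>] by (simp add: H) (simp add: heat_fin_def g_def \<beta>_def)
    qed
  qed
qed

text \<open>The second difference corresponds to a + 1 differences of \<open>f\<close>. When 2k = a
  + 2 there is one too many: it is removed by adding a fourth difference of \<open>g\<close> and
  integrating two of them away.\<close>

lemma heat_fin_iff_diff2:
  assumes p: "1 \<le> p" and q: "1 \<le> q" and f: "expb f" and a: "\<alpha> = real a" "1 \<le> a"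
    and k: "k = nat \<lfloor>\<alpha> / 2\<rfloor> + 1" and van: "vanishing ((delta_right ^^ (a + 1)) f)"
  shows "heat_fin p q (real k - \<alpha> / 2) ((delta_right ^^ (2 * k)) f) \<longleftrightarrow>
    Lfin jump_measure q (\<lambda>j. lp_norm p (diff2 ((delta_right ^^ (a - 1)) f) j) * ennreal (mag j powr (- 1)))"
    (is "?H \<longleftrightarrow> ?J")
proof -
  define g where "g = (delta_right ^^ (a - 1)) f"
  have g: "expb g" unfolding g_def by (rule expb_delta_right_funpow[OF f])
  have kl: "2 * k = a + 2 \<or> 2 * k = a + 1" 
    using two_mult_div_two[of a] unfolding k a(1) by (simp add: floor_half)
  have a1: "(delta_right ^^ (a + 1)) f = delta_right (delta_right g)"
    using a(2) by (cases a) (auto simp: g_def)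
  have lap2: "heat_fin p q c (lap g) \<longleftrightarrow> heat_fin p q c (delta_right (delta_right g))" for c
    by (simp add: heat_fin_lap numeral_2_eq_2)
  have J: "?J \<longleftrightarrow> heat_fin p q (1/2) (delta_right (delta_right g))"
  proof -
    have "Lfin jump_measure q (\<lambda>j. lp_norm p (diff2 g j) * ennreal (mag j powr (- 1))) \<longleftrightarrow> heat_fin p q (1/2) (lap g)"
      using heat_imp_diff2[OF p q g, of 1] diff2_imp_heat[OF p q g, of 1] unfolding heat_fin_def by auto
    then show ?thesis unfolding g_def[symmetric] lap2 .
  qed
  from kl show ?thesis
  proof
    assume kl: "2 * k = a + 2"
    have H: "?H \<longleftrightarrow> heat_fin p q 1 (delta_right (delta_right (delta_right g)))"
    proof -
      have "real k - \<alpha> / 2 = 1" using kl by (simp add: a field_simps)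
      moreover have "(delta_right ^^ (2 * k)) f = delta_right (delta_right (delta_right g))"
        unfolding a1[symmetric] kl by simp
      ultimately show ?thesis by simp
    qed
    show ?thesis unfolding J
    proof
      assume ?H
      then have "heat_fin p q (1 + 1/2) (delta_right (delta_right (delta_right (delta_right g))))"
        unfolding H by (intro heat_fin_delta[OF p q]) (auto intro: expb_delta_right g)
      then have "heat_fin p q (1/2 + 1) (lap (delta_right (delta_right g)))" by (simp add: heat_fin_lap numeral_2_eq_2)
      then show "heat_fin p q (1/2) (delta_right (delta_right g))"
        by (rule heat_fin_lap_imp[OF p q expb_delta_right[OF expb_delta_right[OF g]] _ van[unfolded a1], rotated]) simp
    next
      assume "heat_fin p q (1/2) (delta_right (delta_right g))"
      then have "heat_fin p q (1/2 + 1/2) (delta_right (delta_right (delta_right g)))"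
        by (intro heat_fin_delta[OF p q]) (auto intro: expb_delta_right g)
      then show ?H by (simp add: H)
    qed
  next
    assume kl: "2 * k = a + 1"
    have "2 * real k = real a + 1" using kl by (metis of_nat_1 of_nat_add of_nat_mult of_nat_numeral)
    then have e: "real k - \<alpha> / 2 = 1/2" by (simp add: a field_simps)
    show ?thesis unfolding e J kl a1 ..
  qed
qed

section \<open>The Poisson semigroup\<close>

text \<open>The weight satisfies w(n-j) <= w(n) w(j), so the factor w(j) falls on the kernel, where
  an exponential moment absorbs it.\<close>

lemma wsummable_conv:
  assumes a: "rapid a" and f: "wsummable m f"
  shows "wsummable m (conv a f)"
proof -
  let ?w = "\<lambda>n::int. (1 + mag n) ^ m"
  define W where "W = (\<Sum>\<^sup>+n. ennreal (\<bar>f n\<bar> / ?w n))"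
  have W: "W < \<top>" using f by (simp add: W_def wsummable_def)
  have "(\<Sum>\<^sup>+n. ennreal (\<bar>conv a f n\<bar> / ?w n)) \<le>
    (\<Sum>\<^sup>+n. \<Sum>\<^sup>+j. ennreal (\<bar>a j\<bar> * (\<bar>f (n - j)\<bar> / ?w n)))"
  proof (rule nn_integral_mono)
    fix n :: int
    have "ennreal (\<bar>conv a f n\<bar> / ?w n) = ennreal (1 / ?w n) * ennreal \<bar>conv a f n\<bar>"
      by (simp add: ennreal_mult[symmetric])
    also have "\<dots> \<le> ennreal (1 / ?w n) * (\<Sum>\<^sup>+j. ennreal \<bar>a j\<bar> * ennreal \<bar>f (n - j)\<bar>)"
      by (rule mult_left_mono[OF abs_conv_le]) simp
    also have "\<dots> = (\<Sum>\<^sup>+j. ennreal (\<bar>a j\<bar> * (\<bar>f (n - j)\<bar> / ?w n)))"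
      by (subst nn_integral_cmult[symmetric]) (auto simp: ennreal_mult[symmetric] mult_ac)
    finally show "ennreal (\<bar>conv a f n\<bar> / ?w n) \<le> (\<Sum>\<^sup>+j. ennreal (\<bar>a j\<bar> * (\<bar>f (n - j)\<bar> / ?w n)))" .
  qed
  also have "\<dots> = (\<Sum>\<^sup>+j. \<Sum>\<^sup>+n. ennreal (\<bar>a j\<bar> * (\<bar>f (n - j)\<bar> / ?w n)))"
    by (rule nn_integral_int_swap) simp
  also have "\<dots> \<le> (\<Sum>\<^sup>+j. ennreal (?w j * \<bar>a j\<bar>) * W)"
  proof (rule nn_integral_mono)
    fix j :: int
    have "(\<Sum>\<^sup>+n. ennreal (\<bar>a j\<bar> * (\<bar>f (n - j)\<bar> / ?w n))) \<le>
      (\<Sum>\<^sup>+n. ennreal (?w j * \<bar>a j\<bar>) * ennreal (\<bar>f (n - j)\<bar> / ?w (n - j)))"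
    proof (rule nn_integral_mono)
      fix n :: int
      have "?w (n - j) \<le> ?w n * ?w j"
        unfolding power_mult_distrib[symmetric] by (intro power_mono one_plus_abs_mult) auto
      then have "1 / ?w n \<le> ?w j / ?w (n - j)" by (simp add: divide_simps mult_ac)
      from mult_left_mono[OF this, of "\<bar>a j\<bar> * \<bar>f (n - j)\<bar>"]
      have "\<bar>a j\<bar> * (\<bar>f (n - j)\<bar> / ?w n) \<le> (?w j * \<bar>a j\<bar>) * (\<bar>f (n - j)\<bar> / ?w (n - j))" by (simp add: mult_ac)
      then show "ennreal (\<bar>a j\<bar> * (\<bar>f (n - j)\<bar> / ?w n)) \<le> ennreal (?w j * \<bar>a j\<bar>) * ennreal (\<bar>f (n - j)\<bar> / ?w (n - j))"
        by (subst ennreal_mult[symmetric]) (auto intro: ennreal_leI)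
    qed
    also have "\<dots> = ennreal (?w j * \<bar>a j\<bar>) * W"
      using nn_integral_int_shift[of "\<lambda>n. ennreal (\<bar>f n\<bar> / ?w n)" j] by (simp add: nn_integral_cmult W_def)
    finally show "(\<Sum>\<^sup>+n. ennreal (\<bar>a j\<bar> * (\<bar>f (n - j)\<bar> / ?w n))) \<le> ennreal (?w j * \<bar>a j\<bar>) * W" .
  qed
  also have "\<dots> \<le> (\<Sum>\<^sup>+j. ennreal (fact m * exp 1) * ennreal (exp (1 * mag j) * \<bar>a j\<bar>) * W)"
  proof (rule nn_integral_mono)
    fix j :: int
    have "?w j * \<bar>a j\<bar> \<le> (fact m * exp (1 + mag j)) * \<bar>a j\<bar>"
      by (intro mult_right_mono power_le_fact_exp) auto
    then have "ennreal (?w j * \<bar>a j\<bar>) \<le> ennreal (fact m * exp 1) * ennreal (exp (1 * mag j) * \<bar>a j\<bar>)"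
      by (subst ennreal_mult[symmetric]) (auto intro!: ennreal_leI simp: exp_add mult_ac)
    then show "ennreal (?w j * \<bar>a j\<bar>) * W \<le> ennreal (fact m * exp 1) * ennreal (exp (1 * mag j) * \<bar>a j\<bar>) * W"
      by (rule mult_right_mono) simp
  qed
  also have "\<dots> < \<top>"
    using rapid_wnorm[OF a, of 1] W by (simp add: nn_integral_multc nn_integral_cmult ennreal_mult_less_top)
  finally show ?thesis by (simp add: wsummable_def)
qed

lemma lap_eq_conv: "expb f \<Longrightarrow> lap f = conv (lap (hker 0)) f"
  by (simp add: conv_lap_hker) (simp add: hker_0 conv_unit)

lemma wsummable_lap: "wsummable m f \<Longrightarrow> wsummable m (lap f)"
  using wsummable_conv[OF rapid_lap[OF rapid_hker[of 0]]] wsummable_expb by (simp add: lap_eq_conv)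

lemma wsummable_lap_funpow: "wsummable m f \<Longrightarrow> wsummable m ((lap ^^ k) f)"
  by (induction k) (auto intro: wsummable_lap)

section \<open>Subordination: time integrals of the heat semigroup\<close>

abbreviation lpos :: "real measure" where
  "lpos \<equiv> restrict_space lborel {(0::real)<..}"

lemma sigma_finite_lpos: "sigma_finite_measure lpos"
  by (rule sigma_finite_measure_restrict_space) (auto intro: lborel.sigma_finite_measure_axioms)

lemma exp_neg_cube_le: fixes x :: real assumes "0 \<le> x" shows "x ^ 3 * exp (- x) \<le> 6"
proof -
  have "x ^ 3 * exp (- x) \<le> fact 3 * exp x * exp (- x)"
    by (intro mult_right_mono power_le_fact_exp assms) auto
  then show ?thesis by (simp add: exp_minus fact_numeral mult.assoc)
qed

text \<open>A kernel of size R^(-4) and width R = \<open>max 1 (sqrt t)\<close>, integrated over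
  time, is dominated by the times t of order j^2 and leaves (1+|j|)^(-2), the weight in the
  summability condition on \<open>f\<close>. The constant 96 is 2 * 6 * 8: exp(1/2) <= 2, x^3
  exp(-x) <= 6, and the cube of the factor 2 in 2R.\<close>

lemma exp_scale_integral:
  obtains C where "0 < C" "\<And>j::int. (\<integral>\<^sup>+t. ennreal (decay t j / max 1 (sqrt t) ^ 4) \<partial>lpos)
    \<le> ennreal (C / (1 + mag j) ^ 2)"
proof -
  have sm: "scale_measure dt_over_t (\<lambda>t. t powr (1 / 2))" by (rule scale_measure_dt_over_t) simp
  obtain C where C: "0 < C" "\<And>r. 0 < r \<Longrightarrow> (\<integral>\<^sup>+t. ennreal (kappa 1 (t powr (1 / 2) / r)) \<partial>dt_over_t) \<le> ennreal C"
    by (rule scale_measure_bound[OF sm, of 1]) auto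
  note e2 = exp_half_le_2
  have "(\<integral>\<^sup>+t. ennreal (decay t j / max 1 (sqrt t) ^ 4) \<partial>lpos)
    \<le> ennreal ((96 * C) / (1 + mag j) ^ 2)" for j :: int
  proof -
    define a where "a = 1 + mag j"
    have a: "1 \<le> a" by (simp add: a_def)
    have pt: "decay t j / max 1 (sqrt t) ^ 4 \<le>
      96 / a\<^sup>2 * (1 / t * kappa 1 (t powr (1 / 2) / a))" if t: "0 < t" for t
    proof -
      define r where "r = sqrt t"
      define M where "M = max 1 r"
      have r: "0 < r" "t = r\<^sup>2" "t powr (1 / 2) = r" using t by (auto simp: r_def powr_half_sqrt)
      have M: "1 \<le> M" "r \<le> M" by (auto simp: M_def)
      have le1: "exp (- (1 / (2 * M) * mag j)) \<le> 1" using M by simp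
      show ?thesis unfolding r_def[symmetric] M_def[symmetric] r(3)
      proof (cases "r \<le> a")
        case True
        have k: "kappa 1 (r / a) = r / a" using True a r by (simp add: kappa_cases)
        have "1 / (2 * M) * mag j = a / (2 * M) - 1 / (2 * M)" by (simp add: a_def add_divide_distrib)
        moreover have "1 / (2 * M) \<le> 1 / 2" using M by simp
        ultimately have "exp (- (1 / (2 * M) * mag j)) \<le> exp (1 / 2 + - (a / (2 * M)))" by simp
        also have "\<dots> \<le> 2 * exp (- (a / (2 * M)))" unfolding exp_add by (rule mult_right_mono[OF e2]) simp
        finally have "exp (- (1 / (2 * M) * mag j)) * (a / (2 * M)) ^ 3 \<le> 2 * exp (- (a / (2 * M))) * (a / (2 * M)) ^ 3"
          using a M by (intro mult_right_mono) auto
        also have "\<dots> \<le> 2 * 6" using exp_neg_cube_le[of "a / (2 * M)"] a M by (simp add: mult.commute)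
        finally have "exp (- (1 / (2 * M) * mag j)) * a ^ 3 \<le> 96 * M ^ 3"
          using M by (simp add: power_divide power_mult_distrib field_simps)
        then have "exp (- (1 / (2 * M) * mag j)) / M ^ 4 \<le> 96 / a ^ 3 * (1 / M)"
          using a M by (simp add: field_simps power4_eq_xxxx power3_eq_cube)
        also have "\<dots> \<le> 96 / a ^ 3 * (1 / r)" using M r a by (intro mult_left_mono divide_left_mono) auto
        also have "\<dots> = 96 / a\<^sup>2 * (1 / t * kappa 1 (r / a))"
          using r a unfolding k by (simp add: field_simps power2_eq_square power3_eq_cube)
        finally show "exp (- (1 / (2 * M) * mag j)) / M ^ 4 \<le> 96 / a\<^sup>2 * (1 / t * kappa 1 (r / a))" .
      next
        case False
        then have k: "kappa 1 (r / a) = a / r" using a r by (simp add: kappa_cases powr_minus_divide)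
        have Mr: "M = r" using False a by (simp add: M_def)
        have "exp (- (1 / (2 * M) * mag j)) / M ^ 4 \<le> 1 / M ^ 4" using M le1 by (intro divide_right_mono) auto
        also have "\<dots> \<le> 96 / a * (1 / r ^ 3)" using False a r unfolding Mr by (simp add: field_simps power4_eq_xxxx power3_eq_cube)
        also have "\<dots> = 96 / a\<^sup>2 * (1 / t * kappa 1 (r / a))"
          using r a unfolding k by (simp add: field_simps power2_eq_square power3_eq_cube)
        finally show "exp (- (1 / (2 * M) * mag j)) / M ^ 4 \<le> 96 / a\<^sup>2 * (1 / t * kappa 1 (r / a))" .
      qed
    qed
    have mk: "(\<lambda>t. kappa 1 (t powr (1 / 2) / a)) \<in> borel_measurable lpos"
      unfolding kappa_def by (rule measurable_restrict_space1) simp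
    have "(\<integral>\<^sup>+t. ennreal (decay t j / max 1 (sqrt t) ^ 4) \<partial>lpos) \<le>
      (\<integral>\<^sup>+t. ennreal (96 / a\<^sup>2) * (ennreal (1 / t) * ennreal (kappa 1 (t powr (1 / 2) / a))) \<partial>lpos)"
    proof (rule nn_integral_mono)
      fix t assume "t \<in> space lpos"
      then have t: "0 < t" by (simp add: space_restrict_space)
      then show "ennreal (decay t j / max 1 (sqrt t) ^ 4) \<le>
        ennreal (96 / a\<^sup>2) * (ennreal (1 / t) * ennreal (kappa 1 (t powr (1 / 2) / a)))"
        using pt[OF t] by (simp add: ennreal_mult[symmetric] ennreal_leI)
    qed
    also have "\<dots> = ennreal (96 / a\<^sup>2) * (\<integral>\<^sup>+t. ennreal (kappa 1 (t powr (1 / 2) / a)) \<partial>dt_over_t)"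
      unfolding dt_over_t_def using mk
      by (subst nn_integral_density) (auto simp: nn_integral_cmult intro!: measurable_restrict_space1 nn_integral_cmult)
    also have "\<dots> \<le> ennreal (96 / a\<^sup>2) * ennreal C" using a by (intro mult_left_mono C) auto
    also have "\<dots> = ennreal ((96 * C) / a\<^sup>2)" using C a by (simp add: ennreal_mult[symmetric])
    finally show ?thesis by (simp add: a_def)
  qed
  with C show ?thesis by (intro that[of "96 * C"]) auto
qed

text \<open>The density is a parameter so that one set of lemmas covers the Poisson density, its
  derivative and its antiderivative in \<open>y\<close>.\<close>

definition subord :: "(real \<Rightarrow> real) \<Rightarrow> (int \<Rightarrow> real) \<Rightarrow> int \<Rightarrow> real" where
  "subord \<phi> F n = (\<integral>t. \<phi> t * conv (hker t) F n \<partial>lpos)"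

text \<open>Absolute convergence with a bound uniform up to quadratic growth in \<open>n\<close>;
  the result is then again in \<open>expb\<close> and may be convolved further.\<close>

definition subordinable :: "(real \<Rightarrow> real) \<Rightarrow> (int \<Rightarrow> real) \<Rightarrow> bool" where
  "subordinable \<phi> F \<longleftrightarrow> \<phi> \<in> borel_measurable borel \<and> expb F \<and>
    (\<exists>C. \<forall>n. (\<integral>\<^sup>+t. ennreal \<bar>\<phi> t * conv (hker t) F n\<bar> \<partial>lpos) \<le> ennreal (C * (1 + mag n) ^ 2))"

lemma in_space_lpos [simp]: "t \<in> space lpos \<longleftrightarrow> 0 < t"
  by (simp add: space_restrict_space)

lemma measurable_subord [measurable]:
  assumes "\<phi> \<in> borel_measurable borel" "expb F"
  shows "(\<lambda>t. \<phi> t * conv (hker t) F n) \<in> borel_measurable lpos"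
  using assms by (intro measurable_restrict_space1) simp

lemma subordinable_integrable:
  assumes "subordinable \<phi> F"
  shows "integrable lpos (\<lambda>t. \<phi> t * conv (hker t) F n)"
proof (rule integrableI_bounded)
  show "(\<lambda>t. \<phi> t * conv (hker t) F n) \<in> borel_measurable lpos"
    using assms by (intro measurable_subord) (auto simp: subordinable_def)
  obtain C where "\<And>n. (\<integral>\<^sup>+t. ennreal \<bar>\<phi> t * conv (hker t) F n\<bar> \<partial>lpos) \<le> ennreal (C * (1 + mag n) ^ 2)"
    using assms unfolding subordinable_def by blast
  then show "(\<integral>\<^sup>+t. ennreal (norm (\<phi> t * conv (hker t) F n)) \<partial>lpos) < \<infinity>"
    unfolding real_norm_def by (rule le_less_trans) simp
qed

lemma expb_square: "expb (\<lambda>n. C * (1 + mag n) ^ 2)"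
proof (rule expbI)
  fix n :: int
  have "\<bar>C * (1 + mag n) ^ 2\<bar> \<le> \<bar>C\<bar> * (fact 2 * exp (1 + mag n))"
    unfolding abs_mult by (intro mult_left_mono) (use power_le_fact_exp[of "1 + mag n" 2] in auto)
  then show "\<bar>C * (1 + mag n) ^ 2\<bar> \<le> (\<bar>C\<bar> * 2 * exp 1) * exp (1 * mag n)"
    by (simp add: exp_add mult_ac)
qed

lemma expb_subord:
  assumes "subordinable \<phi> F"
  shows "expb (subord \<phi> F)"
proof -
  obtain C where C: "\<And>n. (\<integral>\<^sup>+t. ennreal \<bar>\<phi> t * conv (hker t) F n\<bar> \<partial>lpos) \<le> ennreal (C * (1 + mag n) ^ 2)"
    using assms unfolding subordinable_def by blast
  obtain K \<theta> where K: "\<And>n. \<bar>C * (1 + mag n) ^ 2\<bar> \<le> K * exp (\<theta> * mag n)"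
    using expb_square[of C] unfolding expb_def by blast
  show ?thesis
  proof (rule expb_nn)
    fix n
    have "ennreal \<bar>subord \<phi> F n\<bar> \<le> (\<integral>\<^sup>+t. ennreal \<bar>\<phi> t * conv (hker t) F n\<bar> \<partial>lpos)"
      using integral_norm_bound_ennreal[OF subordinable_integrable[OF assms], of n] by (simp add: subord_def)
    also note C[of n]
    also have "ennreal (C * (1 + mag n) ^ 2) \<le> ennreal (K * exp (\<theta> * mag n))"
      using K[of n] by (intro ennreal_leI) linarith
    finally show "ennreal \<bar>subord \<phi> F n\<bar> \<le> ennreal (K * exp (\<theta> * mag n))" .
  qed
qed

lemma subord_conv:
  assumes s: "subordinable \<phi> F" and a: "rapid a"
  shows "subord \<phi> (conv a F) = conv a (subord \<phi> F)"
proof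
  fix n
  have F: "expb F" and [measurable]: "\<phi> \<in> borel_measurable borel" using s by (auto simp: subordinable_def)
  obtain C where C: "\<And>n. (\<integral>\<^sup>+t. ennreal \<bar>\<phi> t * conv (hker t) F n\<bar> \<partial>lpos) \<le> ennreal (C * (1 + mag n) ^ 2)"
    using s unfolding subordinable_def by blast
  have m: "(\<lambda>t. a j * (\<phi> t * conv (hker t) F m)) \<in> borel_measurable lpos" for j m
    using F by (intro measurable_restrict_space1) simp
  have "(\<Sum>\<^sup>+j. \<integral>\<^sup>+t. ennreal \<bar>a j * (\<phi> t * conv (hker t) F (n - j))\<bar> \<partial>lpos) \<le>
    (\<Sum>\<^sup>+j. ennreal \<bar>a j\<bar> * ennreal \<bar>C * (1 + mag (n - j)) ^ 2\<bar>)"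
  proof (rule nn_integral_mono)
    fix j
    have "(\<integral>\<^sup>+t. ennreal \<bar>a j * (\<phi> t * conv (hker t) F (n - j))\<bar> \<partial>lpos) = ennreal \<bar>a j\<bar> * (\<integral>\<^sup>+t. ennreal \<bar>\<phi> t * conv (hker t) F (n - j)\<bar> \<partial>lpos)"
      unfolding abs_mult[of "a j"] by (subst nn_integral_cmult[symmetric])
        (auto simp: ennreal_mult intro!: measurable_compose[OF measurable_subord[OF _ F]] nn_integral_cong)
    also have "\<dots> \<le> ennreal \<bar>a j\<bar> * ennreal \<bar>C * (1 + mag (n - j)) ^ 2\<bar>"
      by (intro mult_left_mono order_trans[OF C] ennreal_leI) auto
    finally show "(\<integral>\<^sup>+t. ennreal \<bar>a j * (\<phi> t * conv (hker t) F (n - j))\<bar> \<partial>lpos) \<le> ennreal \<bar>a j\<bar> * ennreal \<bar>C * (1 + mag (n - j)) ^ 2\<bar>" .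
  qed
  also have "\<dots> < \<top>"
  proof -
    obtain K \<theta> where "\<And>n. (\<Sum>\<^sup>+j. ennreal \<bar>a j\<bar> * ennreal \<bar>C * (1 + mag (n - j)) ^ 2\<bar>) \<le> ennreal (K * exp (\<theta> * mag n))"
      by (rule nn_integral_rapid_expb[OF a expb_square[of C]]) blast
    then show ?thesis by (rule le_less_trans) simp
  qed
  finally have fin: "(\<Sum>\<^sup>+j. \<integral>\<^sup>+t. ennreal \<bar>a j * (\<phi> t * conv (hker t) F (n - j))\<bar> \<partial>lpos) < \<top>" .
  have "subord \<phi> (conv a F) n = (\<integral>t. \<phi> t * conv a (conv (hker t) F) n \<partial>lpos)"
    unfolding subord_def conv_left_commute[OF rapid_hker a F] ..
  also have "\<dots> = (\<integral>t. (\<integral>j. a j * (\<phi> t * conv (hker t) F (n - j)) \<partial>count_space UNIV) \<partial>lpos)"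
    by (intro Bochner_Integration.integral_cong refl) (simp add: conv_def[of a] mult.left_commute)
  also have "\<dots> = (\<integral>j. (\<integral>t. a j * (\<phi> t * conv (hker t) F (n - j)) \<partial>lpos) \<partial>count_space UNIV)"
    by (rule integral_int_swap[OF sigma_finite_lpos m fin])
  also have "\<dots> = conv a (subord \<phi> F) n" by (simp add: conv_def[of a] subord_def)
  finally show "subord \<phi> (conv a F) n = conv a (subord \<phi> F) n" .
qed

text \<open>The density and the kernel must jointly provide the decay R^(-4) with R =
  \<open>max 1 (sqrt t)\<close>. The two uses share it out differently: R^(-3) from the density and
  R^(-1) from the heat kernel, or R^(-1) from the density and R^(-3) from the Laplacian of the
  kernel.\<close>

lemma subordinable_bound:
  assumes F: "wsummable 2 F" and K: "0 \<le> K"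
    and A: "\<And>t j. 0 < t \<Longrightarrow> \<bar>\<phi> t * A t j\<bar> \<le> K * (decay t j / max 1 (sqrt t) ^ 4)"
  shows "\<exists>C. \<forall>n. (\<integral>\<^sup>+t. ennreal \<bar>\<phi> t * conv (A t) F n\<bar> \<partial>lpos) \<le> ennreal (C * (1 + mag n) ^ 2)"
proof -
  let ?e = "\<lambda>t j. decay t j / max 1 (sqrt t) ^ 4"
  let ?w = "\<lambda>n::int. (1 + mag n) ^ 2"
  have me: "(\<lambda>t. ?e t j * c) \<in> borel_measurable lpos" for j c
    by (intro measurable_restrict_space1) simp
  obtain C where C: "0 < C" "\<And>j::int. (\<integral>\<^sup>+t. ennreal (?e t j) \<partial>lpos) \<le> ennreal (C / ?w j)"
    by (rule exp_scale_integral) blast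
  obtain W where W: "(\<Sum>\<^sup>+j. ennreal (\<bar>F j\<bar> / ?w j)) = ennreal W" "0 \<le> W"
    using F unfolding wsummable_def by (auto simp: less_top_ennreal)
  have "(\<integral>\<^sup>+t. ennreal \<bar>\<phi> t * conv (A t) F n\<bar> \<partial>lpos) \<le> ennreal ((K * C * W) * ?w n)" for n
  proof -
    have "(\<integral>\<^sup>+t. ennreal \<bar>\<phi> t * conv (A t) F n\<bar> \<partial>lpos) \<le>
      (\<integral>\<^sup>+t. \<Sum>\<^sup>+j. ennreal (?e t j * (K * \<bar>F (n - j)\<bar>)) \<partial>lpos)"
    proof (rule nn_integral_mono)
      fix t assume "t \<in> space lpos"
      then have t: "0 < t" by simp
      have "ennreal \<bar>\<phi> t * conv (A t) F n\<bar> \<le> ennreal \<bar>\<phi> t\<bar> * (\<Sum>\<^sup>+j. ennreal \<bar>A t j\<bar> * ennreal \<bar>F (n - j)\<bar>)"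
        unfolding abs_mult by (subst ennreal_mult) (auto intro: mult_left_mono abs_conv_le)
      also have "\<dots> = (\<Sum>\<^sup>+j. ennreal (\<bar>\<phi> t * A t j\<bar> * \<bar>F (n - j)\<bar>))"
        by (subst nn_integral_cmult[symmetric]) (auto simp: ennreal_mult abs_mult mult.assoc)
      also have "\<dots> \<le> (\<Sum>\<^sup>+j. ennreal (?e t j * (K * \<bar>F (n - j)\<bar>)))"
      proof (intro nn_integral_mono ennreal_leI)
        fix j
        show "\<bar>\<phi> t * A t j\<bar> * \<bar>F (n - j)\<bar> \<le> ?e t j * (K * \<bar>F (n - j)\<bar>)"
          using mult_right_mono[OF A[OF t, of j], of "\<bar>F (n - j)\<bar>"] by (simp add: mult_ac)
      qed
      finally show "ennreal \<bar>\<phi> t * conv (A t) F n\<bar> \<le> (\<Sum>\<^sup>+j. ennreal (?e t j * (K * \<bar>F (n - j)\<bar>)))" .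
    qed
    also have "\<dots> = (\<Sum>\<^sup>+j. \<integral>\<^sup>+t. ennreal (?e t j * (K * \<bar>F (n - j)\<bar>)) \<partial>lpos)"
      by (rule nn_integral_int_swap[symmetric]) (intro measurable_compose[OF me measurable_ennreal])
    also have "\<dots> \<le> (\<Sum>\<^sup>+j. ennreal (K * C) * ennreal (\<bar>F (n - j)\<bar> / ?w j))"
    proof (rule nn_integral_mono)
      fix j
      have "(\<integral>\<^sup>+t. ennreal (?e t j * (K * \<bar>F (n - j)\<bar>)) \<partial>lpos) = (\<integral>\<^sup>+t. ennreal (?e t j * 1) * ennreal (K * \<bar>F (n - j)\<bar>) \<partial>lpos)"
        using K by (intro nn_integral_cong) (simp add: ennreal_mult[symmetric])
      also have "\<dots> = (\<integral>\<^sup>+t. ennreal (?e t j * 1) \<partial>lpos) * ennreal (K * \<bar>F (n - j)\<bar>)"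
        by (rule nn_integral_multc[OF measurable_compose[OF me measurable_ennreal]])
      also have "\<dots> = (\<integral>\<^sup>+t. ennreal (?e t j) \<partial>lpos) * ennreal (K * \<bar>F (n - j)\<bar>)" by simp
      also have "\<dots> \<le> ennreal (C / ?w j) * ennreal (K * \<bar>F (n - j)\<bar>)" by (rule mult_right_mono[OF C(2)]) simp
      also have "\<dots> = ennreal (K * C) * ennreal (\<bar>F (n - j)\<bar> / ?w j)"
        using C K by (simp add: ennreal_mult[symmetric] mult_ac)
      finally show "(\<integral>\<^sup>+t. ennreal (?e t j * (K * \<bar>F (n - j)\<bar>)) \<partial>lpos) \<le> ennreal (K * C) * ennreal (\<bar>F (n - j)\<bar> / ?w j)" .
    qed
    also have "\<dots> = ennreal (K * C) * (\<Sum>\<^sup>+j. ennreal (\<bar>F (n - j)\<bar> / ?w j))" by (simp add: nn_integral_cmult)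
    also have "\<dots> \<le> ennreal (K * C) * (ennreal (?w n) * ennreal W)"
      unfolding W(1)[symmetric] by (rule mult_left_mono[OF wsummable_translate_le]) simp
    also have "\<dots> = ennreal ((K * C * W) * ?w n)" using K C W by (simp add: ennreal_mult[symmetric] mult_ac)
    finally show ?thesis .
  qed
  then show ?thesis by blast
qed

lemma subordinable_0:
  assumes F: "wsummable 2 F" and \<phi>: "\<phi> \<in> borel_measurable borel" and le: "\<And>t. 0 < t \<Longrightarrow> \<bar>\<phi> t\<bar> \<le> K / max 1 (sqrt t) ^ 3"
  shows "subordinable \<phi> F"
proof -
  obtain C where C: "0 < C" "\<And>t j. 0 < t \<Longrightarrow> \<bar>(delta_right ^^ 0) (hker t) j\<bar> \<le>
    C / max 1 (sqrt t) ^ (0 + 1) * decay t j"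
    by (rule hker_pointwise[of 0]) blast
  have "\<bar>\<phi> t * hker t j\<bar> \<le> (\<bar>K\<bar> * C) * (decay t j / max 1 (sqrt t) ^ 4)" if t: "0 < t" for t j
  proof -
    have kk: "\<bar>\<phi> t\<bar> \<le> \<bar>K\<bar> / max 1 (sqrt t) ^ 3" using le[OF t] by (rule order_trans) (intro divide_right_mono; simp)
    have "\<bar>\<phi> t * hker t j\<bar> \<le> (\<bar>K\<bar> / max 1 (sqrt t) ^ 3) * (C / max 1 (sqrt t) ^ 1 * decay t j)"
      unfolding abs_mult using C(2)[OF t, of j] kk
      by (intro mult_mono) auto
    also have "\<dots> = (\<bar>K\<bar> * C) * (decay t j / max 1 (sqrt t) ^ 4)"
      by (simp add: eval_nat_numeral)
    finally show ?thesis .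
  qed
  from subordinable_bound[OF F _ this] C(1) \<phi> wsummable_expb[OF F] show ?thesis by (simp add: subordinable_def)
qed

lemma subordinable_lap:
  assumes F: "wsummable 2 F" and \<phi>: "\<phi> \<in> borel_measurable borel" and le: "\<And>t. 0 < t \<Longrightarrow> \<bar>\<phi> t\<bar> \<le> K / max 1 (sqrt t)"
  shows "subordinable \<phi> (lap F)"
proof -
  have eF: "expb F" by (rule wsummable_expb[OF F])
  obtain C where C: "0 < C" "\<And>t j. 0 < t \<Longrightarrow> \<bar>(delta_right ^^ 2) (hker t) j\<bar> \<le>
    C / max 1 (sqrt t) ^ (2 + 1) * decay t j"
    by (rule hker_pointwise[of 2]) blast
  have "\<bar>\<phi> t * lap (hker t) j\<bar> \<le> (\<bar>K\<bar> * C * exp 1) * (decay t j / max 1 (sqrt t) ^ 4)" if t: "0 < t" for t j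
  proof -
    let ?m = "max 1 (sqrt t)"
    have "1 / (2 * ?m) * mag j \<le> 1 / (2 * ?m) * (mag (j - 1) + 1)" by (intro mult_left_mono) auto
    moreover have "1 / (2 * ?m) \<le> 1" by simp
    ultimately have "- (1 / (2 * ?m) * mag (j - 1)) \<le> 1 + - (1 / (2 * ?m) * mag j)"
      by (simp only: distrib_left mult_1_right)
    then have ex: "exp (- (1 / (2 * ?m) * mag (j - 1))) \<le> exp 1 * exp (- (1 / (2 * ?m) * mag j))"
      unfolding exp_add[symmetric] by simp
    have "\<bar>lap (hker t) j\<bar> \<le> C / ?m ^ 3 * exp (- (1 / (2 * ?m) * mag (j - 1)))"
      using C(2)[OF t, of "j - 1"] by (simp add: lap_eq_delta_right)
    also have "\<dots> \<le> C / ?m ^ 3 * (exp 1 * exp (- (1 / (2 * ?m) * mag j)))"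
      using C(1) by (intro mult_left_mono ex) auto
    finally have l: "\<bar>lap (hker t) j\<bar> \<le> C / ?m ^ 3 * (exp 1 * exp (- (1 / (2 * ?m) * mag j)))" .
    have kk: "\<bar>\<phi> t\<bar> \<le> \<bar>K\<bar> / ?m" using le[OF t] by (rule order_trans) (intro divide_right_mono; simp)
    have "\<bar>\<phi> t * lap (hker t) j\<bar> \<le> (\<bar>K\<bar> / ?m) * (C / ?m ^ 3 * (exp 1 * exp (- (1 / (2 * ?m) * mag j))))"
      unfolding abs_mult using l kk
      by (intro mult_mono) auto
    also have "\<dots> = (\<bar>K\<bar> * C * exp 1) * (exp (- (1 / (2 * ?m) * mag j)) / ?m ^ 4)"
      by (simp add: eval_nat_numeral)
    finally show ?thesis .
  qed
  from subordinable_bound[OF F _ this] C(1) \<phi> expb_lap[OF eF] show ?thesis by (simp add: subordinable_def conv_lap_hker[OF eF])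
qed

text \<open>The factor exp(-c/t) cancels the singularity at t = 0, by (c/t)^m <= m! exp(c/t); for t
  >= 1 it is at most 1.\<close>

lemma exp_over_power_le:
  assumes c: "0 < c"
  obtains K where "1 \<le> K" "\<And>t. 0 < t \<Longrightarrow> exp (- (c / t)) / sqrt t ^ m \<le> K / max 1 (sqrt t) ^ m"
proof -
  define K where "K = max 1 (fact m / c ^ m)"
  have "exp (- (c / t)) / sqrt t ^ m \<le> K / max 1 (sqrt t) ^ m" if t: "0 < t" for t
  proof (cases "1 \<le> t")
    case True
    then have m: "max 1 (sqrt t) = sqrt t" by simp
    have "exp (- (c / t)) \<le> K" using c t by (auto simp: K_def le_max_iff_disj)
    then show ?thesis unfolding m using t by (intro divide_right_mono) auto
  next
    case False
    then have m: "max 1 (sqrt t) = 1" using t by simp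
    have "1 / sqrt t ^ m \<le> (1 / t) ^ m"
    proof -
      have "t = sqrt t * sqrt t" using t by simp
      also have "\<dots> \<le> sqrt t * 1" using False t by (intro mult_left_mono) auto
      finally show ?thesis using t unfolding power_one_over[symmetric] by (intro power_mono) (auto simp: field_simps)
    qed
    then have "exp (- (c / t)) / sqrt t ^ m \<le> exp (- (c / t)) * (1 / t) ^ m"
      using mult_left_mono[of "1 / sqrt t ^ m" "(1 / t) ^ m" "exp (- (c / t))"] by simp
    also have "\<dots> = exp (- (c / t)) * (c / t) ^ m / c ^ m" using c by (simp add: power_divide)
    also have "\<dots> \<le> exp (- (c / t)) * (fact m * exp (c / t)) / c ^ m"
      using c t by (intro divide_right_mono mult_left_mono power_le_fact_exp) auto
    also have "\<dots> = fact m / c ^ m" by (simp add: exp_minus)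
    finally show ?thesis unfolding m by (simp add: K_def)
  qed
  then show ?thesis by (intro that[of K]) (auto simp: K_def)
qed

section \<open>The Poisson density and its derivatives\<close>

text \<open>The density in \<open>t\<close> of the one-sided stable law of index 1/2, the hitting
  time law behind subordination of order 1/2.\<close>

definition poiss :: "real \<Rightarrow> real \<Rightarrow> real" where
  "poiss y t = y * exp (- (y\<^sup>2 / (4 * t))) / (2 * sqrt pi * sqrt t ^ 3)"

text \<open>The heat kernel of the real line at time \<open>t\<close> and point \<open>y\<close>.
  Its derivative in \<open>y\<close> is -1/2 times \<open>poiss\<close>, so it represents odd
  derivatives of the Poisson integral.\<close>

definition gauss :: "real \<Rightarrow> real \<Rightarrow> real" where
  "gauss y t = exp (- (y\<^sup>2 / (4 * t))) / (2 * sqrt pi * sqrt t)"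

text \<open>The derivative of \<^const>\<open>poiss\<close> in \<open>y\<close>, which is also \<open>-2\<close> times that of \<^const>\<open>gauss\<close> in \<open>t\<close>.\<close>

definition poiss' :: "real \<Rightarrow> real \<Rightarrow> real" where
  "poiss' y t = exp (- (y\<^sup>2 / (4 * t))) / (2 * sqrt pi) * (1 / sqrt t ^ 3 - y\<^sup>2 / (2 * sqrt t ^ 5))"

lemma measurable_poiss [measurable]: "poiss y \<in> borel_measurable borel" "gauss y \<in> borel_measurable borel" "poiss' y \<in> borel_measurable borel"
  unfolding poiss_def[abs_def] gauss_def[abs_def] poiss'_def[abs_def] by measurable

lemma DERIV_poiss:
  assumes t: "0 < t"
  shows "((\<lambda>y. poiss y t) has_real_derivative poiss' y t) (at y)"
proof -
  define r where "r = sqrt t"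
  define s where "s = sqrt pi"
  have r: "0 < r" "t = r * r" "sqrt t = r" using t by (auto simp: r_def)
  have s: "0 < s" by (simp add: s_def)
  define c where "c = 1 / (4 * (r * r))"
  define d where "d = 1 / (2 * s * r ^ 3)"
  have eq: "poiss y t = y * exp (- (c * y\<^sup>2)) * d" for y
    by (simp add: poiss_def r(3) s_def[symmetric] c_def d_def) (simp add: r(2))
  define E where "E = exp (- (c * y\<^sup>2))"
  have "((\<lambda>y. y * exp (- (c * y\<^sup>2)) * d) has_real_derivative (E - y * (E * (c * (2 * y)))) * d) (at y)"
    unfolding E_def by (rule derivative_eq_intros refl)+ simp
  moreover have "(E - y * (E * (c * (2 * y)))) * d = poiss' y t"
  proof -
    have "poiss' y t = E / (2 * s) * (1 / r ^ 3 - y\<^sup>2 / (2 * r ^ 5))"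
      by (simp add: poiss'_def r(3) s_def[symmetric] E_def c_def) (simp add: r(2))
    moreover have "1 / r ^ 3 - y\<^sup>2 / (2 * r ^ 5) = (1 - 2 * c * y\<^sup>2) / r ^ 3"
      using r(1) by (simp add: c_def diff_divide_distrib power_numeral_reduce)
    moreover have "(E - y * (E * (c * (2 * y)))) * d = E / (2 * s) * ((1 - 2 * c * y\<^sup>2) / r ^ 3)"
    proof -
      have a: "E - y * (E * (c * (2 * y))) = E * (1 - 2 * c * y\<^sup>2)" by (simp add: algebra_simps power2_eq_square)
      show ?thesis unfolding a by (simp add: d_def)
    qed
    ultimately show ?thesis by simp
  qed
  ultimately show ?thesis unfolding eq by simp
qed

lemma DERIV_gauss:
  assumes t: "0 < t"
  shows "((\<lambda>y. gauss y t) has_real_derivative - (1 / 2) * poiss y t) (at y)"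
proof -
  define r where "r = sqrt t"
  define s where "s = sqrt pi"
  have r: "0 < r" "t = r * r" "sqrt t = r" using t by (auto simp: r_def)
  define c where "c = 1 / (4 * (r * r))"
  define d where "d = 1 / (2 * s * r)"
  have eq: "gauss y t = exp (- (c * y\<^sup>2)) * d" for y
    by (simp add: gauss_def r(3) s_def[symmetric] c_def d_def) (simp add: r(2))
  define E where "E = exp (- (c * y\<^sup>2))"
  have "((\<lambda>y. exp (- (c * y\<^sup>2)) * d) has_real_derivative - (E * (c * (2 * y))) * d) (at y)"
    unfolding E_def by (rule derivative_eq_intros refl)+ simp
  moreover have "- (E * (c * (2 * y))) * d = - (1 / 2) * poiss y t"
  proof -
    have "poiss y t = y * E / (2 * s * r ^ 3)"
      by (simp add: poiss_def r(3) s_def[symmetric] E_def c_def) (simp add: r(2))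
    then show ?thesis by (simp add: c_def d_def power3_eq_cube mult_ac)
  qed
  ultimately show ?thesis unfolding eq by (simp only:)
qed

lemma DERIV_gauss_time:
  assumes t: "0 < t"
  shows "((\<lambda>t. gauss y t) has_real_derivative - (1 / 2) * poiss' y t) (at t)"
proof -
  define r where "r = sqrt t"
  define s where "s = sqrt pi"
  have r: "0 < r" "t = r * r" "sqrt t = r" using t by (auto simp: r_def)
  define k where "k = y\<^sup>2 / 4"
  have eq: "gauss y = (\<lambda>t. exp (- (k * inverse t)) * inverse (sqrt t) * (1 / (2 * s)))"
    by (simp add: fun_eq_iff gauss_def s_def[symmetric] k_def inverse_eq_divide)
  define E where "E = exp (- (k * inverse t))"
  have ds: "((\<lambda>t. inverse (sqrt t)) has_real_derivative - (inverse r * (inverse r / 2) * inverse r)) (at t)"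
    using DERIV_inverse'[OF DERIV_real_sqrt[OF t]] r by simp
  have de: "((\<lambda>t. exp (- (k * inverse t))) has_real_derivative E * (k * (inverse t * inverse t))) (at t)"
  proof -
    have "((\<lambda>t. - (k * inverse t)) has_real_derivative - (k * - (inverse t * 1 * inverse t))) (at t)"
      using t by (intro DERIV_minus DERIV_cmult DERIV_inverse' DERIV_ident) auto
    from DERIV_chain2[OF DERIV_exp this] show ?thesis by (simp add: E_def)
  qed
  have "(gauss y has_real_derivative
    ((E * (k * (inverse t * inverse t))) * inverse (sqrt t) + - (inverse r * (inverse r / 2) * inverse r) * E) * (1 / (2 * s))) (at t)"
    unfolding eq E_def by (rule DERIV_cmult_right[OF DERIV_mult[OF de[unfolded E_def] ds]])
  moreover have "((E * (k * (inverse t * inverse t))) * inverse (sqrt t) + - (inverse r * (inverse r / 2) * inverse r) * E) * (1 / (2 * s))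
    = - (1 / 2) * poiss' y t"
  proof -
    have p: "poiss' y t = E / (2 * s) * (1 / r ^ 3 - y\<^sup>2 / (2 * r ^ 5))"
      by (simp add: poiss'_def r(3) s_def[symmetric] E_def k_def inverse_eq_divide)
    have q: "1 / r ^ 3 = inverse r * inverse r * inverse r" "y\<^sup>2 / (2 * r ^ 5) = 2 * (k * (inverse t * inverse t)) * inverse (sqrt t)"
      using r(1) by (simp_all add: r(3) k_def inverse_eq_divide power_numeral_reduce) (simp add: r(2) mult_ac)
    show ?thesis unfolding p q unfolding r(3) by (simp add: algebra_simps diff_divide_distrib)
  qed
  ultimately show ?thesis by simp
qed

text \<open>Bounds uniform for \<open>y\<close> near \<open>y0\<close>, as majorants for
  differentiation in \<open>y\<close>. The powers of t at infinity are those required by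
  \<open>subordinable_0\<close> and \<open>subordinable_lap\<close>.\<close>

lemma poiss_bounds:
  assumes y: "0 < (y0::real)"
  obtains K where "0 < K" "\<And>y t. \<bar>y - y0\<bar> < y0 / 2 \<Longrightarrow> 0 < t \<Longrightarrow> \<bar>poiss y t\<bar> \<le> K / max 1 (sqrt t) ^ 3"
    "\<And>y t. \<bar>y - y0\<bar> < y0 / 2 \<Longrightarrow> 0 < t \<Longrightarrow> \<bar>gauss y t\<bar> \<le> K / max 1 (sqrt t)"
    "\<And>y t. \<bar>y - y0\<bar> < y0 / 2 \<Longrightarrow> 0 < t \<Longrightarrow> \<bar>poiss' y t\<bar> \<le> K / max 1 (sqrt t) ^ 3"
proof -
  \<comment> \<open>Since y > y0/2, the exponent y^2/(4t) is at least (y0/2)^2/(4t) = c/t.\<close>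
  define c where "c = y0\<^sup>2 / 16"
  have c: "0 < c" using y by (simp add: c_def)
  obtain K1 where K1: "1 \<le> K1" "\<And>t. 0 < t \<Longrightarrow> exp (- (c / t)) / sqrt t ^ 1 \<le> K1 / max 1 (sqrt t) ^ 1"
    by (rule exp_over_power_le[OF c]) blast
  obtain K3 where K3: "1 \<le> K3" "\<And>t. 0 < t \<Longrightarrow> exp (- (c / t)) / sqrt t ^ 3 \<le> K3 / max 1 (sqrt t) ^ 3"
    by (rule exp_over_power_le[OF c]) blast
  obtain K5 where K5: "1 \<le> K5" "\<And>t. 0 < t \<Longrightarrow> exp (- (c / t)) / sqrt t ^ 5 \<le> K5 / max 1 (sqrt t) ^ 5"
    by (rule exp_over_power_le[OF c]) blast
  define K where "K = K1 + K3 + (2 * y0) * K3 + (2 * y0)\<^sup>2 * K5"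
  have K: "0 < K" "K1 \<le> K" "2 * y0 * K3 \<le> K" "K3 + (2 * y0)\<^sup>2 * K5 \<le> K"
    using K1(1) K3(1) K5(1) y unfolding K_def by (auto intro!: add_pos_nonneg add_nonneg_nonneg)
  have pi: "1 \<le> 2 * sqrt pi" using pi_ge_two real_sqrt_ge_one[of pi] by linarith
  have main: "\<bar>poiss y t\<bar> \<le> K / max 1 (sqrt t) ^ 3 \<and> \<bar>gauss y t\<bar> \<le> K / max 1 (sqrt t) \<and> \<bar>poiss' y t\<bar> \<le> K / max 1 (sqrt t) ^ 3"
    if yy: "\<bar>y - y0\<bar> < y0 / 2" and t: "0 < t" for y t
  proof -
    define E where "E = exp (- (y\<^sup>2 / (4 * t)))"
    define M where "M = max 1 (sqrt t)"
    have M: "1 \<le> M" by (simp add: M_def)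
    have r: "0 < sqrt t" using t by simp
    have yb: "y0 / 2 < y" "y < 2 * y0" "0 < y" using yy y unfolding abs_less_iff by linarith+
    have "(y0 / 2)\<^sup>2 \<le> y\<^sup>2" using yb y by (intro power_mono) auto
    then have "c / t \<le> y\<^sup>2 / (4 * t)" using t by (simp add: c_def field_simps)
    then have E: "E \<le> exp (- (c / t))" "0 \<le> E" by (auto simp: E_def)
    have ee: "E / sqrt t ^ m \<le> exp (- (c / t)) / sqrt t ^ m" for m using E t by (intro divide_right_mono) auto
    have e1: "E / sqrt t \<le> K1 / M" using ee[of 1] K1(2)[OF t] by (simp add: M_def)
    have e3: "E / sqrt t ^ 3 \<le> K3 / M ^ 3" using ee[of 3] K3(2)[OF t] by (simp add: M_def)
    have e5: "E / sqrt t ^ 5 \<le> K5 / M ^ 5" using ee[of 5] K5(2)[OF t] by (simp add: M_def)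
    have div_pi: "x / (2 * sqrt pi) \<le> x" if "0 \<le> x" for x
      using mult_left_mono[OF pi that] pi by (simp add: divide_le_eq)
    have "\<bar>poiss y t\<bar> = y * (E / sqrt t ^ 3) / (2 * sqrt pi)" using yb E r unfolding poiss_def E_def[symmetric] by (simp add: abs_mult mult_ac)
    also have "\<dots> \<le> y * (E / sqrt t ^ 3)" using yb E r by (intro div_pi) auto
    also have "\<dots> \<le> (2 * y0) * (K3 / M ^ 3)" using yb E r e3 by (intro mult_mono) auto
    also have "\<dots> \<le> K / M ^ 3" using K(3) M by (simp add: divide_right_mono)
    finally have 1: "\<bar>poiss y t\<bar> \<le> K / M ^ 3" .
    have "\<bar>gauss y t\<bar> = (E / sqrt t) / (2 * sqrt pi)" using E r unfolding gauss_def E_def[symmetric] by (simp add: abs_mult mult_ac)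
    also have "\<dots> \<le> E / sqrt t" using E r by (intro div_pi) auto
    also have "\<dots> \<le> K / M" using e1 K(2) M by (meson divide_right_mono order_trans zero_le_one)
    finally have 2: "\<bar>gauss y t\<bar> \<le> K / M" .
    have "\<bar>poiss' y t\<bar> = \<bar>E / sqrt t ^ 3 - y\<^sup>2 * (E / sqrt t ^ 5) / 2\<bar> / (2 * sqrt pi)"
    proof -
      have "poiss' y t = (E / sqrt t ^ 3 - y\<^sup>2 * (E / sqrt t ^ 5) / 2) / (2 * sqrt pi)"
        unfolding poiss'_def E_def[symmetric] by (simp add: right_diff_distrib diff_divide_distrib mult_ac)
      then show ?thesis by (simp add: abs_divide)
    qed
    also have "\<dots> \<le> \<bar>E / sqrt t ^ 3 - y\<^sup>2 * (E / sqrt t ^ 5) / 2\<bar>" by (intro div_pi) auto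
    also have "\<dots> \<le> E / sqrt t ^ 3 + y\<^sup>2 * (E / sqrt t ^ 5)"
    proof -
      have h: "\<bar>a - b / 2\<bar> \<le> a + b" if "0 \<le> a" "0 \<le> b" for a b :: real using that by (auto simp: abs_le_iff)
      show ?thesis by (rule h) (use E r in auto)
    qed
    also have "\<dots> \<le> K3 / M ^ 3 + (2 * y0)\<^sup>2 * (K5 / M ^ 3)"
    proof (intro add_mono e3 mult_mono)
      show "y\<^sup>2 \<le> (2 * y0)\<^sup>2" using yb by (intro power_mono) auto
      have "K5 / M ^ 5 \<le> K5 / M ^ 3" using K5(1) M by (intro divide_left_mono power_increasing) auto
      then show "E / sqrt t ^ 5 \<le> K5 / M ^ 3" using e5 by linarith
    qed (use yb E r in \<open>auto intro!: power_mono\<close>)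
    also have "\<dots> = (K3 + (2 * y0)\<^sup>2 * K5) / M ^ 3" by (simp add: add_divide_distrib)
    also have "\<dots> \<le> K / M ^ 3" using K(4) M by (intro divide_right_mono) auto
    finally have "\<bar>poiss' y t\<bar> \<le> K / M ^ 3" .
    with 1 2 show ?thesis by (simp add: M_def)
  qed
  then show ?thesis using K(1) by (intro that[of K]) blast+
qed

lemma subordinable_poiss: assumes "wsummable 2 F" "0 < y" shows "subordinable (poiss y) F" "subordinable (poiss' y) F"
proof -
  obtain K where K: "0 < K" "\<And>z t. \<bar>z - y\<bar> < y / 2 \<Longrightarrow> 0 < t \<Longrightarrow> \<bar>poiss z t\<bar> \<le> K / max 1 (sqrt t) ^ 3"
    "\<And>z t. \<bar>z - y\<bar> < y / 2 \<Longrightarrow> 0 < t \<Longrightarrow> \<bar>poiss' z t\<bar> \<le> K / max 1 (sqrt t) ^ 3"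
    by (rule poiss_bounds[OF assms(2)]) blast
  show "subordinable (poiss y) F" "subordinable (poiss' y) F"
    using assms by (auto intro!: subordinable_0[of F _ K] K)
qed

lemma subordinable_gauss: assumes "wsummable 2 F" "0 < y" shows "subordinable (gauss y) (lap F)"
proof -
  obtain K where K: "0 < K" "\<And>z t. \<bar>z - y\<bar> < y / 2 \<Longrightarrow> 0 < t \<Longrightarrow> \<bar>gauss z t\<bar> \<le> K / max 1 (sqrt t)"
    by (rule poiss_bounds[OF assms(2)]) blast
  show ?thesis using assms by (intro subordinable_lap[of F _ K] K) auto
qed

lemma DERIV_subord:
  assumes \<epsilon>: "0 < \<epsilon>" and d: "\<And>y t. \<bar>y - y0\<bar> < \<epsilon> \<Longrightarrow> 0 < t \<Longrightarrow> ((\<lambda>y. \<phi> y t) has_real_derivative \<phi>' y t) (at y)"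
    and bnd: "\<And>y t. \<bar>y - y0\<bar> < \<epsilon> \<Longrightarrow> 0 < t \<Longrightarrow> \<bar>\<phi>' y t\<bar> \<le> g t"
    and s: "\<And>y. \<bar>y - y0\<bar> < \<epsilon> \<Longrightarrow> subordinable (\<phi> y) F" and s': "subordinable (\<phi>' y0) F" and g: "subordinable g F"
  shows "((\<lambda>y. subord (\<phi> y) F n) has_real_derivative subord (\<phi>' y0) F n) (at y0)"
  unfolding subord_def
proof (rule has_real_derivative_integral[OF \<epsilon>, of _ "\<lambda>t. \<bar>g t * conv (hker t) F n\<bar>"])
  show "integrable lpos (\<lambda>t. \<bar>g t * conv (hker t) F n\<bar>)" by (intro integrable_abs subordinable_integrable g)
  show "((\<lambda>y. \<phi> y t * conv (hker t) F n) has_real_derivative \<phi>' y t * conv (hker t) F n) (at y)"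
    if "t \<in> space lpos" "\<bar>y - y0\<bar> < \<epsilon>" for t y
    using DERIV_cmult_right[OF d[OF that(2)], of t "conv (hker t) F n"] that(1) by simp
  show "\<bar>\<phi>' y t * conv (hker t) F n\<bar> \<le> \<bar>g t * conv (hker t) F n\<bar>" if "t \<in> space lpos" "\<bar>y - y0\<bar> < \<epsilon>" for t y
    using bnd[OF that(2), of t] that(1) unfolding abs_mult by (intro mult_right_mono) auto
  show "integrable lpos (\<lambda>t. \<phi> y t * conv (hker t) F n)" if "\<bar>y - y0\<bar> < \<epsilon>" for y
    by (rule subordinable_integrable[OF s[OF that]])
  show "(\<lambda>t. \<phi>' y0 t * conv (hker t) F n) \<in> borel_measurable lpos"
    using s' by (intro measurable_subord) (auto simp: subordinable_def)
qed

lemma DERIV_subord_gauss: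
  assumes F: "wsummable 2 F" and y: "0 < y"
  shows "((\<lambda>y. subord (gauss y) (lap F) n) has_real_derivative - (1 / 2) * subord (poiss y) (lap F) n) (at y)"
proof -
  obtain K where K: "0 < K" "\<And>z t. \<bar>z - y\<bar> < y / 2 \<Longrightarrow> 0 < t \<Longrightarrow> \<bar>poiss z t\<bar> \<le> K / max 1 (sqrt t) ^ 3"
    by (rule poiss_bounds[OF y]) blast
  have zp: "0 < z" if "\<bar>z - y\<bar> < y / 2" for z using that y unfolding abs_less_iff by linarith
  have "((\<lambda>y. subord (gauss y) (lap F) n) has_real_derivative subord (\<lambda>t. - (1 / 2) * poiss y t) (lap F) n) (at y)"
  proof (rule DERIV_subord[where \<epsilon> = "y / 2" and g = "\<lambda>t. K / max 1 (sqrt t) ^ 3"])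
    show half: "\<bar>- (1 / 2) * poiss z t\<bar> \<le> K / max 1 (sqrt t) ^ 3" if "\<bar>z - y\<bar> < y / 2" "0 < t" for z t
    proof -
      have "\<bar>- (1 / 2) * poiss z t\<bar> = \<bar>poiss z t\<bar> / 2" by (simp add: abs_mult)
      then show ?thesis using K(2)[OF that] by linarith
    qed
    show "subordinable (\<lambda>t. - (1 / 2) * poiss y t) (lap F)"
      using y by (intro subordinable_0[of _ _ K] wsummable_lap F half) auto
    show "subordinable (\<lambda>t. K / max 1 (sqrt t) ^ 3) (lap F)"
      by (rule subordinable_0[of _ _ K]) (use wsummable_lap[OF F] K in auto)
  qed (use y F in \<open>auto intro!: DERIV_gauss[simplified] subordinable_gauss zp\<close>)
  moreover have "subord (\<lambda>t. - (1 / 2) * poiss y t) (lap F) n = - (1 / 2) * subord (poiss y) (lap F) n"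
    unfolding subord_def mult.assoc by (rule integral_mult_right_zero)
  ultimately show ?thesis by simp
qed

text \<open>The heat kernel alone decays to first order in the scale, while summability of
  \<open>f\<close> has weight 2; the division by sqrt t supplies the missing order.\<close>

lemma heat_over_sqrt_tendsto_0:
  assumes F: "wsummable 2 F"
  shows "((\<lambda>t. conv (hker t) F n / max 1 (sqrt t)) \<longlongrightarrow> 0) at_top"
proof -
  obtain C where C: "0 < C" "\<And>t j. 0 < t \<Longrightarrow> \<bar>(delta_right ^^ 0) (hker t) j\<bar> \<le>
    C / max 1 (sqrt t) ^ (0 + 1) * decay t j"
    by (rule hker_pointwise[of 0]) blast
  have F': "wsummable (1 + 1) F" using F by (simp add: numeral_2_eq_2)
  have "((\<lambda>t. \<integral>j. (hker t j / max 1 (sqrt t)) * F (n - j) \<partial>count_space UNIV) \<longlongrightarrow> 0) at_top"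
  proof (rule conv_tendsto_zero[OF F' C(1)])
    fix t :: real and j :: int assume t: "0 < t"
    have "\<bar>hker t j / max 1 (sqrt t)\<bar> = \<bar>hker t j\<bar> / max 1 (sqrt t)" by (simp add: abs_divide)
    also have "\<dots> \<le> (C / max 1 (sqrt t) * decay t j) / max 1 (sqrt t)"
      using C(2)[OF t, of j] by (intro divide_right_mono) auto
    finally show "\<bar>hker t j / max 1 (sqrt t)\<bar> \<le> C / max 1 (sqrt t) ^ (1 + 1) * decay t j"
      by simp
  qed
  then show ?thesis by (simp add: conv_def)
qed

text \<open>Integration by parts in time. \<open>poiss'\<close> is -2 times the time derivative of
  \<open>gauss\<close>, and the derivative lands on the heat extension, where it becomes a
  Laplacian. The boundary term vanishes at 0 because of the Gaussian factor and at \<infinity> by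
  \<open>heat_over_sqrt_tendsto_0\<close>. This replaces -P'' by the Laplacian under weak growth
  assumptions.\<close>

lemma subord_poiss'_eq:
  assumes F: "wsummable 2 F" and y: "0 < y"
  shows "subord (poiss' y) F n = 2 * subord (gauss y) (lap F) n"
proof -
  define u where "u t = conv (hker t) F n" for t
  define v where "v t = conv (hker t) (lap F) n" for t
  have eF: "expb F" by (rule wsummable_expb[OF F])
  obtain K where K: "0 < K" "\<And>z t. \<bar>z - y\<bar> < y / 2 \<Longrightarrow> 0 < t \<Longrightarrow> \<bar>gauss z t\<bar> \<le> K / max 1 (sqrt t)"
    by (rule poiss_bounds[OF y]) blast
  have cu: "isCont u t" for t
    using continuous_conv_hker[OF eF, of UNIV n] unfolding u_def continuous_on_eq_continuous_at[OF open_UNIV] by simp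
  have cv: "isCont v t" for t
    using continuous_conv_hker[OF expb_lap[OF eF], of UNIV n] unfolding v_def continuous_on_eq_continuous_at[OF open_UNIV] by simp
  have i1: "integrable lpos (\<lambda>t. poiss' y t * u t)" unfolding u_def by (rule subordinable_integrable[OF subordinable_poiss(2)[OF F y]])
  have i2: "integrable lpos (\<lambda>t. gauss y t * v t)" unfolding v_def by (rule subordinable_integrable[OF subordinable_gauss[OF F y]])
  have i3: "integrable lpos (\<lambda>t. - (1 / 2) * (poiss' y t * u t) + gauss y t * v t)"
    by (intro Bochner_Integration.integrable_add integrable_mult_right i1 i2)
  have e: "einterval (ereal 0) \<infinity> = {0<..}" by (auto simp: einterval_def)
  have "(LBINT t=ereal 0..\<infinity>. - (1 / 2) * (poiss' y t * u t) + gauss y t * v t) = 0 - 0"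
  proof (rule interval_integral_FTC_integrable[where F = "\<lambda>t. gauss y t * u t"])
    fix t assume "ereal 0 < ereal t"
    then have t: "0 < t" by simp
    have "((\<lambda>t. gauss y t * u t) has_real_derivative - (1 / 2) * poiss' y t * u t + v t * gauss y t) (at t)"
      unfolding u_def v_def by (rule DERIV_mult[OF DERIV_gauss_time[OF t] DERIV_conv_hker[OF eF]])
    then show "((\<lambda>t. gauss y t * u t) has_vector_derivative - (1 / 2) * (poiss' y t * u t) + gauss y t * v t) (at t)"
      by (simp add: has_real_derivative_iff_has_vector_derivative[symmetric] mult_ac)
    show "isCont (\<lambda>t. - (1 / 2) * (poiss' y t * u t) + gauss y t * v t) t"
      unfolding poiss'_def gauss_def using t by (intro continuous_intros cu cv) auto
  next
    show "set_integrable lborel (einterval (ereal 0) \<infinity>) (\<lambda>t. - (1 / 2) * (poiss' y t * u t) + gauss y t * v t)"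
      using i3 unfolding e set_integrable_def by (subst (asm) integrable_restrict_space) auto
    have "((\<lambda>t. gauss y t * u t) \<longlongrightarrow> 0) (at_right 0)"
    proof -
      obtain K4 where K4: "1 \<le> K4" "\<And>t. 0 < t \<Longrightarrow> exp (- (y\<^sup>2 / 4 / t)) / sqrt t ^ 2 \<le> K4 / max 1 (sqrt t) ^ 2"
        by (rule exp_over_power_le[of "y\<^sup>2 / 4" 2]) (use y in auto)
      have "((\<lambda>t. gauss y t) \<longlongrightarrow> 0) (at_right 0)"
      proof (rule Lim_null_comparison)
        show "\<forall>\<^sub>F t in at_right 0. norm (gauss y t) \<le> K4 / (2 * sqrt pi) * sqrt t"
          unfolding eventually_at_right_field
        proof (intro exI[of _ 1] conjI allI impI)
          fix t :: real assume t: "0 < t" "t < 1"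
          have "exp (- (y\<^sup>2 / (4 * t))) / sqrt t ^ 2 \<le> K4" using K4(2)[OF t(1)] t by (simp add: max_def split: if_splits)
          then have "exp (- (y\<^sup>2 / (4 * t))) / sqrt t \<le> K4 * sqrt t" using t by (simp add: field_simps power2_eq_square)
          then show "norm (gauss y t) \<le> K4 / (2 * sqrt pi) * sqrt t"
            using t by (simp add: gauss_def abs_mult divide_simps mult_ac)
        qed simp
        have "((\<lambda>t. K4 / (2 * sqrt pi) * sqrt t) \<longlongrightarrow> K4 / (2 * sqrt pi) * sqrt 0) (at_right 0)"
          by (intro tendsto_intros)
        then show "((\<lambda>t. K4 / (2 * sqrt pi) * sqrt t) \<longlongrightarrow> 0) (at_right 0)" by simp
      qed
      moreover have "(u \<longlongrightarrow> u 0) (at_right 0)" using cu[of 0] by (simp add: isCont_def filterlim_at_split)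
      ultimately have "((\<lambda>t. gauss y t * u t) \<longlongrightarrow> 0 * u 0) (at_right 0)" by (rule tendsto_mult)
      then show ?thesis by simp
    qed
    then show "(((\<lambda>t. gauss y t * u t) \<circ> real_of_ereal) \<longlongrightarrow> 0) (at_right (ereal 0))"
      by (simp add: ereal_tendsto_simps)
    \<comment> \<open>At infinity \<open>gauss y t\<close> is of order 1/sqrt t, exactly what makes
      \<open>u t\<close> tend to 0.\<close>
    have "((\<lambda>t. gauss y t * u t) \<longlongrightarrow> 0) at_top"
    proof (rule Lim_null_comparison)
      show "\<forall>\<^sub>F t in at_top. norm (gauss y t * u t) \<le> K * \<bar>u t / max 1 (sqrt t)\<bar>"
        using eventually_gt_at_top[of 0]
      proof eventually_elim
        case (elim t)
        have "\<bar>gauss y t\<bar> * \<bar>u t\<bar> \<le> K / max 1 (sqrt t) * \<bar>u t\<bar>" using K(2)[of y t] elim y by (intro mult_right_mono) auto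
        then show ?case by (simp add: abs_mult abs_divide)
      qed
      have "((\<lambda>t. K * \<bar>u t / max 1 (sqrt t)\<bar>) \<longlongrightarrow> K * \<bar>0\<bar>) at_top"
        unfolding u_def by (intro tendsto_intros heat_over_sqrt_tendsto_0 F)
      then show "((\<lambda>t. K * \<bar>u t / max 1 (sqrt t)\<bar>) \<longlongrightarrow> 0) at_top" by simp
    qed
    then show "(((\<lambda>t. gauss y t * u t) \<circ> real_of_ereal) \<longlongrightarrow> 0) (at_left \<infinity>)" by (simp add: ereal_tendsto_simps)
  qed simp
  then have "(\<integral>t. - (1 / 2) * (poiss' y t * u t) + gauss y t * v t \<partial>lpos) = 0"
    unfolding interval_integral_to_infinity_eq set_lebesgue_integral_def by (subst integral_restrict_space) auto
  also have "(\<integral>t. - (1 / 2) * (poiss' y t * u t) + gauss y t * v t \<partial>lpos) = - (1 / 2) * subord (poiss' y) F n + subord (gauss y) (lap F) n"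
    unfolding subord_def u_def[symmetric] v_def[symmetric]
    by (subst Bochner_Integration.integral_add[OF integrable_mult_right[OF i1] i2]) (simp only: integral_mult_right_zero)
  finally show ?thesis by simp
qed

lemma DERIV_subord_poiss:
  assumes F: "wsummable 2 F" and y: "0 < y"
  shows "((\<lambda>y. subord (poiss y) F n) has_real_derivative 2 * subord (gauss y) (lap F) n) (at y)"
proof -
  obtain K where K: "0 < K" "\<And>z t. \<bar>z - y\<bar> < y / 2 \<Longrightarrow> 0 < t \<Longrightarrow> \<bar>poiss' z t\<bar> \<le> K / max 1 (sqrt t) ^ 3"
    by (rule poiss_bounds[OF y]) blast
  have zp: "0 < z" if "\<bar>z - y\<bar> < y / 2" for z using that y unfolding abs_less_iff by linarith
  show ?thesis unfolding subord_poiss'_eq[OF F y, symmetric]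
  proof (rule DERIV_subord[where \<epsilon> = "y / 2" and g = "\<lambda>t. K / max 1 (sqrt t) ^ 3"])
    show "subordinable (\<lambda>t. K / max 1 (sqrt t) ^ 3) F"
      by (rule subordinable_0[of _ _ K]) (use F K in auto)
  qed (use y F K(2) in \<open>auto intro!: DERIV_poiss subordinable_poiss zp\<close>)
qed

text \<open>
  The \<open>l\<close>-th derivative in \<open>y\<close> of the Poisson integral: each pair of derivatives is traded for \<open>-lap\<close>.
\<close>

definition pder :: "nat \<Rightarrow> (int \<Rightarrow> real) \<Rightarrow> real \<Rightarrow> int \<Rightarrow> real" where
  "pder l F y n =
    (if even l then (- 1) ^ (l div 2) * subord (poiss y) ((lap ^^ (l div 2)) F) n
     else 2 * (- 1) ^ (l div 2) * subord (gauss y) ((lap ^^ (l div 2 + 1)) F) n)"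

lemma DERIV_pder:
  assumes F: "wsummable 2 F" and y: "0 < y"
  shows "((\<lambda>y. pder l F y n) has_real_derivative pder (Suc l) F y n) (at y)"
proof (cases "even l")
  case True
  then obtain k where l: "l = 2 * k" by blast
  have "((\<lambda>y. (- 1) ^ k * subord (poiss y) ((lap ^^ k) F) n) has_real_derivative (- 1) ^ k * (2 * subord (gauss y) (lap ((lap ^^ k) F)) n)) (at y)"
    by (intro DERIV_cmult DERIV_subord_poiss wsummable_lap_funpow F y)
  then show ?thesis by (simp add: pder_def l mult_ac)
next
  case False
  then obtain k where l: "l = 2 * k + 1" using oddE by blast
  have "((\<lambda>y. (2 * (- 1) ^ k) * subord (gauss y) (lap ((lap ^^ k) F)) n) has_real_derivative
    (2 * (- 1) ^ k) * (- (1 / 2) * subord (poiss y) (lap ((lap ^^ k) F)) n)) (at y)"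
    by (intro DERIV_cmult DERIV_subord_gauss wsummable_lap_funpow F y)
  then show ?thesis by (simp add: pder_def l)
qed

lemma poisson_eq_subord:
  assumes "expb F"
  shows "poisson y F n = subord (poiss y) F n"
proof -
  have "poisson y F n = y / (2 * sqrt pi) * (\<integral>t. exp (- (y\<^sup>2) / (4 * t)) / t powr (3 / 2) * heat t F n \<partial>lpos)"
    unfolding poisson_def set_lebesgue_integral_def by (subst integral_restrict_space) auto
  also have "\<dots> = (\<integral>t. y / (2 * sqrt pi) * (exp (- (y\<^sup>2) / (4 * t)) / t powr (3 / 2) * heat t F n) \<partial>lpos)"
    by (rule integral_mult_right_zero[symmetric])
  also have "\<dots> = subord (poiss y) F n"
    unfolding subord_def
  proof (rule Bochner_Integration.integral_cong[OF refl])
    fix t assume "t \<in> space lpos"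
    then have t: "0 < t" by simp
    have "t powr (3 / 2) = sqrt t ^ 3"
      using powr_half_eq_sqrt_power[OF t, of 3] t by (simp add: powr_minus field_simps)
    then show "y / (2 * sqrt pi) * (exp (- (y\<^sup>2) / (4 * t)) / t powr (3 / 2) * heat t F n) = poiss y t * conv (hker t) F n"
      using heat_eq_conv[OF t assms] by (simp add: poiss_def mult_ac)
  qed
  finally show ?thesis .
qed

lemma funpow_deriv_poisson:
  assumes "wsummable 2 F" "0 < y"
  shows "(deriv ^^ l) (\<lambda>s. poisson s F n) y = pder l F y n"
proof (rule funpow_deriv_eq[of "{0<..}" _ "\<lambda>l y. pder l F y n"])
  show "poisson s F n = pder 0 F s n" for s
    by (simp add: pder_def poisson_eq_subord wsummable_expb[OF assms(1)])
qed (use assms in \<open>auto intro: DERIV_pder\<close>)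

lemma measurable_pder [measurable]:
  assumes "expb F"
  shows "(\<lambda>y. pder l F y n) \<in> borel_measurable borel"
proof -
  have *: "(\<lambda>y. subord (\<phi> y) G n) \<in> borel_measurable borel"
    if m: "(\<lambda>z. \<phi> (fst z) (snd z)) \<in> borel_measurable (borel \<Otimes>\<^sub>M borel)" and G: "expb G" for \<phi> G
  proof -
    have m'[measurable]: "(\<lambda>z. \<phi> (fst z) (snd z)) \<in> borel_measurable (borel \<Otimes>\<^sub>M lborel)"
      using m by (simp cong: measurable_cong_sets sets_pair_measure_cong)
    have [measurable]: "(\<lambda>t. conv (hker t) G n) \<in> borel_measurable lborel" using G by simp
    have "(\<lambda>y. \<integral>t. indicator {0<..} t * (\<phi> y t * conv (hker t) G n) \<partial>lborel) \<in> borel_measurable borel"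
      using m' by (intro lborel.borel_measurable_lebesgue_integral) (simp add: split_beta')
    then show ?thesis unfolding subord_def by (subst integral_restrict_space) auto
  qed
  have P: "(\<lambda>y. subord (poiss y) G n) \<in> borel_measurable borel" if "expb G" for G
    by (rule *[of poiss, OF _ that], unfold poiss_def, measurable)
  have Q: "(\<lambda>y. subord (gauss y) G n) \<in> borel_measurable borel" if "expb G" for G
    by (rule *[of gauss, OF _ that], unfold gauss_def, measurable)
  show ?thesis
  proof (cases "even l")
    case True
    then show ?thesis unfolding pder_def using P[OF expb_lap_funpow[OF assms]]
      by (simp only: if_True) (intro borel_measurable_times borel_measurable_const)
  next
    case False
    then show ?thesis unfolding pder_def using Q[OF expb_lap_funpow[OF assms]]
      by (simp only: if_False) (intro borel_measurable_times borel_measurable_const)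
  qed
qed

lemma subordinable_pder:
  assumes F: "wsummable 2 F" and y: "0 < y"
  shows "subordinable (poiss y) ((lap ^^ k) F)" "subordinable (gauss y) ((lap ^^ (k + 1)) F)"
  using subordinable_poiss(1)[OF wsummable_lap_funpow[OF F, of k] y] subordinable_gauss[OF wsummable_lap_funpow[OF F, of k] y] by simp_all

lemma expb_pder:
  assumes F: "wsummable 2 F" and y: "0 < y"
  shows "expb (pder l F y)"
proof -
  have e: "pder l F y = (if even l then (\<lambda>n. (- 1) ^ (l div 2) * subord (poiss y) ((lap ^^ (l div 2)) F) n)
     else (\<lambda>n. 2 * (- 1) ^ (l div 2) * subord (gauss y) ((lap ^^ (l div 2 + 1)) F) n))"
    by (auto simp: pder_def fun_eq_iff)
  show ?thesis unfolding e using expb_subord[OF subordinable_pder(1)[OF F y]] expb_subord[OF subordinable_pder(2)[OF F y]]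
    by (cases "even l") (auto intro!: expb_cmult)
qed

lemma pder_conv:
  assumes F: "wsummable 2 F" and y: "0 < y" and a: "rapid a"
  shows "pder l (conv a F) y = conv a (pder l F y)"
proof
  fix n
  have e: "expb F" by (rule wsummable_expb[OF F])
  show "pder l (conv a F) y n = conv a (pder l F y) n"
  proof (cases "even l")
    case True
    then have "pder l F y = (\<lambda>n. (- 1) ^ (l div 2) * subord (poiss y) ((lap ^^ (l div 2)) F) n)" by (simp add: pder_def fun_eq_iff)
    then show ?thesis using True
      by (simp add: conv_cmult_right) (simp add: pder_def lap_funpow_conv_right[OF a e] subord_conv[OF subordinable_pder(1)[OF F y] a])
  next
    case False
    then have "pder l F y = (\<lambda>n. (2 * (- 1) ^ (l div 2)) * subord (gauss y) ((lap ^^ (l div 2 + 1)) F) n)" by (simp add: pder_def fun_eq_iff)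
    moreover have "pder l (conv a F) y n = (2 * (- 1) ^ (l div 2)) * subord (gauss y) (conv a ((lap ^^ (l div 2 + 1)) F)) n"
      using False by (simp only: pder_def lap_funpow_conv_right[OF a e] if_False)
    ultimately show ?thesis by (simp only: conv_cmult_right subord_conv[OF subordinable_pder(2)[OF F y] a])
  qed
qed

lemma pder_lap:
  assumes F: "wsummable 2 F" and y: "0 < y"
  shows "pder l (lap F) y = lap (pder l F y)"
  using pder_conv[OF F y rapid_lap[OF rapid_hker]] lap_eq_conv[OF wsummable_expb[OF F]] lap_eq_conv[OF expb_pder[OF F y]] by simp

lemma pder_lap_funpow:
  assumes F: "wsummable 2 F" and y: "0 < y"
  shows "pder l ((lap ^^ k) F) y = (lap ^^ k) (pder l F y)"
  by (induction k) (simp_all add: pder_lap[OF wsummable_lap_funpow[OF F] y])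

lemma pder_add: "pder (l + 2 * k) F y n = (- 1) ^ k * pder l ((lap ^^ k) F) y n"
proof -
  have d: "(l + 2 * k) div 2 = l div 2 + k" by simp
  have f: "(lap ^^ (l div 2 + k)) F = (lap ^^ (l div 2)) ((lap ^^ k) F)"
    "(lap ^^ (l div 2 + k + 1)) F = (lap ^^ (l div 2 + 1)) ((lap ^^ k) F)" by (simp_all add: funpow_add)
  show ?thesis unfolding pder_def d f by (simp add: power_add)
qed

section \<open>Total mass of the Poisson density\<close>

lemma wsummable_one: "wsummable 2 (\<lambda>_. 1)"
proof -
  have "Lfin jump_measure 1 (\<lambda>n. ennreal (1 * mag n powr (- (1 / 2))))" by (intro Lfin_jump_powr) auto
  then have "growth_fin 1 (1 / 2) (\<lambda>_. 1)" by (simp add: growth_fin_def powr_minus_divide)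
  from growth_fin_wsummable[OF _ this, of 1] show ?thesis by (simp add: numeral_2_eq_2)
qed

lemma lap_const: "lap (\<lambda>_. c) = (\<lambda>_. 0)"
  by (simp add: lap_def fun_eq_iff)

text \<open>Conservation of mass: the derivative in time vanishes since the Laplacian annihilates
  constants, and at time 0 the kernel is the convolution unit.\<close>

lemma conv_hker_one: "conv (hker t) (\<lambda>_. 1) n = 1"
proof -
  have "((\<lambda>t. conv (hker t) (\<lambda>_. 1) n) has_real_derivative 0) (at t)" for t
    using DERIV_conv_hker[OF wsummable_expb[OF wsummable_one], of n t] by (simp add: lap_const conv_def)
  then have "conv (hker t) (\<lambda>_. 1) n = conv (hker 0) (\<lambda>_. 1) n" by (rule DERIV_isconst_all[rule_format]) 
  then show ?thesis by (simp add: hker_0 conv_unit)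
qed

text \<open>Applied to the constant sequence 1, the derivative formula shows that the mass does not
  depend on \<open>y\<close>, and positivity of the density makes it positive. No explicit integral
  is evaluated.\<close>

lemma integral_poiss:
  obtains c where "0 < c" "\<And>y. 0 < y \<Longrightarrow> integrable lpos (poiss y) \<and> (\<integral>t. poiss y t \<partial>lpos) = c"
proof -
  have s: "subordinable (poiss y) (\<lambda>_. 1)" if "0 < y" for y by (rule subordinable_poiss(1)[OF wsummable_one that])
  have i: "integrable lpos (poiss y)" if "0 < y" for y
    using subordinable_integrable[OF s[OF that], of 0] by (simp add: conv_hker_one)
  have eq: "subord (poiss y) (\<lambda>_. 1) 0 = (\<integral>t. poiss y t \<partial>lpos)" for y by (simp add: subord_def conv_hker_one)
  have d: "((\<lambda>y. \<integral>t. poiss y t \<partial>lpos) has_real_derivative 0) (at y within {0<..})" if "y \<in> {0<..}" for y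
  proof -
    have "subord (gauss y) (lap (\<lambda>_. 1)) 0 = 0" by (simp add: lap_const subord_def conv_def)
    then show ?thesis using DERIV_subord_poiss[OF wsummable_one, of y 0] that unfolding eq by (auto intro: has_field_derivative_at_within)
  qed
  obtain c where c: "\<And>y. y \<in> {0<..} \<Longrightarrow> (\<integral>t. poiss y t \<partial>lpos) = c"
    using has_field_derivative_zero_constant[OF convex_real_interval(3) d] by blast
  have pos: "0 < poiss 1 t" if "0 < t" for t using that by (simp add: poiss_def)
  have "c \<noteq> 0"
  proof
    assume "c = 0"
    moreover have "AE t in lpos. 0 \<le> poiss 1 t" by (rule AE_I2) (auto intro: less_imp_le pos)
    ultimately have "AE t in lpos. poiss 1 t = 0"
      using integral_nonneg_eq_0_iff_AE[OF i[of 1]] c[of 1] by simp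
    with AE_space[of lpos] have "AE t in lpos. False" by eventually_elim (use pos in force)
    then have "emeasure lpos (space lpos) = 0" by (simp add: eventually_False ae_filter_eq_bot_iff)
    moreover have "emeasure lborel {1..2::real} \<le> emeasure lborel {(0::real)<..}" by (rule emeasure_mono) auto
    ultimately show False by (simp add: emeasure_restrict_space space_restrict_space)
  qed
  moreover have "0 \<le> c" unfolding c[of 1, simplified, symmetric] by (rule integral_nonneg_AE) (auto intro!: AE_I2 less_imp_le pos)
  ultimately show ?thesis using i c by (intro that[of c]) auto
qed

section \<open>Recovering the heat semigroup from the Poisson semigroup\<close>

text \<open>The error is the integral of \<open>poiss y t\<close> against u(t) - u(0), and
  \<open>poiss y t\<close> <= y t^(-3/2). Near 0 the heat extension is Lipschitz, leaving the
  integrable t^(-1/2); for t >= 1 integrability was shown in \<open>subordinable_0\<close>. Hence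
  the error is O(y).\<close>

lemma poisson_at_0:
  assumes F: "wsummable 2 F" and c: "\<And>y. 0 < y \<Longrightarrow> integrable lpos (poiss y) \<and> (\<integral>t. poiss y t \<partial>lpos) = c"
  shows "((\<lambda>y. subord (poiss y) F n) \<longlongrightarrow> c * F n) (at_right 0)"
proof -
  define u where "u t = conv (hker t) F n" for t
  define v where "v t = conv (hker t) (lap F) n" for t
  define w where "w t = u t - u 0" for t
  define \<phi> where "\<phi> t = 1 / max 1 (sqrt t) ^ 3" for t :: real
  have u0: "u 0 = F n" by (simp add: u_def hker_0 conv_unit)
  have eF: "expb F" by (rule wsummable_expb[OF F])
  have [measurable]: "u \<in> borel_measurable borel" using eF by (simp add: u_def[abs_def])
  have [measurable]: "w \<in> borel_measurable borel" by (simp add: w_def[abs_def])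
  have [measurable]: "\<phi> \<in> borel_measurable borel" by (simp add: \<phi>_def[abs_def])
  have res: "g \<in> borel_measurable lpos" if "g \<in> borel_measurable borel" for g :: "real \<Rightarrow> real"
    by (rule measurable_restrict_space1) (use that in simp)
  have "compact (v ` {0..1})" unfolding v_def
    by (intro compact_continuous_image continuous_conv_hker expb_lap eF) auto
  then obtain L where "0 < L" "\<forall>x\<in>v ` {0..1}. norm x \<le> L"
    using compact_imp_bounded[of "v ` {0..1}"] unfolding bounded_pos by blast
  then have L: "\<And>t. t \<in> {0..1} \<Longrightarrow> \<bar>v t\<bar> \<le> L" "0 < L" by auto
  have lip: "\<bar>w t\<bar> \<le> L * t" if t: "0 < t" "t \<le> 1" for t
  proof -
    have "norm (u t - u 0) \<le> L * norm (t - 0)"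
    proof (rule field_differentiable_bound[of "{0..1}" u v L])
      show "(u has_field_derivative v s) (at s within {0..1})" for s
        unfolding u_def v_def by (rule has_field_derivative_at_within[OF DERIV_conv_hker[OF eF]])
    qed (use t L in auto)
    then show ?thesis using t by (simp add: w_def)
  qed
  have s1: "subordinable \<phi> F" "subordinable \<phi> (\<lambda>_. 1)"
    using F wsummable_one by (auto intro!: subordinable_0[of _ _ 1] simp: \<phi>_def)
  have i1: "integrable lpos (\<lambda>t. \<phi> t * u t)" "integrable lpos \<phi>"
    using subordinable_integrable[OF s1(1), of n] subordinable_integrable[OF s1(2), of n] by (simp_all add: u_def conv_hker_one)
  have sm: "scale_measure dt_over_t (\<lambda>t. t powr (1 / 2))" by (rule scale_measure_dt_over_t) simp
  obtain C where C: "0 < C" "\<And>r. 0 < r \<Longrightarrow> (\<integral>\<^sup>+t. ennreal (kappa 1 (t powr (1 / 2) / r)) \<partial>dt_over_t) \<le> ennreal C"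
    by (rule scale_measure_bound[OF sm, of 1]) auto
  \<comment> \<open>On 0 < t <= 1 this is t^(-1/2); its integrability on the whole half line is the
    scale measure bound for dt/t.\<close>
  define g where "g t = 1 / t * kappa 1 (t powr (1 / 2))" for t :: real
  have mg[measurable]: "g \<in> borel_measurable borel" unfolding g_def[abs_def] kappa_def by measurable
  have g0: "0 \<le> g t" if "0 < t" for t using that by (simp add: g_def)
  have ig: "integrable lpos g"
  proof (rule integrableI_bounded[OF res[OF mg]])
    have "(\<integral>\<^sup>+t. ennreal (norm (g t)) \<partial>lpos) = (\<integral>\<^sup>+t. ennreal (1 / t) * ennreal (kappa 1 (t powr (1 / 2))) \<partial>lpos)"
      by (intro nn_integral_cong) (simp add: g_def abs_mult ennreal_mult[symmetric])
    also have "\<dots> = (\<integral>\<^sup>+t. ennreal (kappa 1 (t powr (1 / 2) / 1)) \<partial>dt_over_t)"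
      unfolding dt_over_t_def by (subst nn_integral_density) (auto simp: kappa_def intro!: measurable_restrict_space1)
    also have "\<dots> < \<infinity>" by (rule le_less_trans[OF C(2)]) auto
    finally show "(\<integral>\<^sup>+t. ennreal (norm (g t)) \<partial>lpos) < \<infinity>" .
  qed
  define h where "h t = L * g t + (\<bar>\<phi> t * u t\<bar> + \<bar>\<phi> t * u 0\<bar>)" for t
  have ih: "integrable lpos h" unfolding h_def[abs_def]
    by (intro Bochner_Integration.integrable_add integrable_mult_right integrable_mult_left integrable_abs ig i1)
  have h: "\<bar>w t\<bar> / sqrt t ^ 3 \<le> h t" if t: "0 < t" for t
  proof (cases "t \<le> 1")
    case True
    have "t powr (1 / 2) = sqrt t" using t by (simp add: powr_half_sqrt)
    moreover have "kappa 1 (sqrt t) = sqrt t" using t True by (simp add: kappa_cases)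
    ultimately have "g t = 1 / t * sqrt t" by (simp add: g_def)
    then have gt: "g t = t / sqrt t ^ 3"
    proof -
      define r where "r = sqrt t"
      have "0 < r" "sqrt t = r" "t = r * r" using t by (auto simp: r_def)
      then show ?thesis unfolding \<open>g t = 1 / t * sqrt t\<close> by (simp add: power3_eq_cube)
    qed
    have "\<bar>w t\<bar> / sqrt t ^ 3 \<le> (L * t) / sqrt t ^ 3" using lip[OF t True] t by (intro divide_right_mono) auto
    also have "\<dots> = L * g t" by (simp add: gt)
    also have "\<dots> \<le> h t" by (simp add: h_def)
    finally show ?thesis .
  next
    case False
    have "\<phi> t = 1 / sqrt t ^ 3" using False by (simp add: \<phi>_def)
    then have "\<bar>w t\<bar> / sqrt t ^ 3 = \<bar>\<phi> t * u t - \<phi> t * u 0\<bar>" using t by (simp add: w_def abs_mult diff_divide_distrib[symmetric])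
    also have "\<dots> \<le> \<bar>\<phi> t * u t\<bar> + \<bar>\<phi> t * u 0\<bar>" by (rule abs_triangle_ineq4)
    also have "\<dots> \<le> h t" using L(2) g0[OF t] by (simp add: h_def)
    finally show ?thesis .
  qed
  define S where "S = (\<integral>t. h t \<partial>lpos)"
  have main: "\<bar>subord (poiss y) F n - c * F n\<bar> \<le> y * S" if y: "0 < y" for y
  proof -
    have i2: "integrable lpos (\<lambda>t. poiss y t * u t)" unfolding u_def by (rule subordinable_integrable[OF subordinable_poiss(1)[OF F y]])
    have "subord (poiss y) F n - c * F n = (\<integral>t. poiss y t * u t \<partial>lpos) - (\<integral>t. poiss y t * u 0 \<partial>lpos)"
      using c[OF y] by (simp add: subord_def u_def[symmetric] u0)
    also have "\<dots> = (\<integral>t. poiss y t * u t - poiss y t * u 0 \<partial>lpos)"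
      using c[OF y] by (intro Bochner_Integration.integral_diff[symmetric] i2 integrable_mult_left) auto
    also have "\<bar>\<dots>\<bar> \<le> (\<integral>t. y * h t \<partial>lpos)"
    proof (rule order_trans[OF integral_abs_bound integral_mono])
      fix t assume "t \<in> space lpos"
      then have t: "0 < t" by simp
      have pi: "1 \<le> 2 * sqrt pi" using pi_ge_two real_sqrt_ge_one[of pi] by linarith
      have "exp (- (y\<^sup>2 / (4 * t))) / (2 * sqrt pi) \<le> 1" using pi t by (simp add: divide_le_eq) (rule order_trans[of _ 1], auto)
      then have "y / sqrt t ^ 3 * (exp (- (y\<^sup>2 / (4 * t))) / (2 * sqrt pi)) \<le> y / sqrt t ^ 3 * 1"
        using y t by (intro mult_left_mono) auto
      then have "poiss y t \<le> y / sqrt t ^ 3" by (simp add: poiss_def mult_ac)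
      moreover have "0 \<le> poiss y t" using y t by (simp add: poiss_def)
      ultimately have "\<bar>poiss y t\<bar> * \<bar>w t\<bar> \<le> y / sqrt t ^ 3 * \<bar>w t\<bar>" by (intro mult_right_mono) auto
      also have "\<dots> \<le> y * h t" using mult_left_mono[OF h[OF t], of y] y by simp
      finally show "\<bar>poiss y t * u t - poiss y t * u 0\<bar> \<le> y * h t"
        by (simp add: w_def abs_mult[symmetric] right_diff_distrib)
    qed (use c[OF y] i2 ih in auto)
    finally show ?thesis by (simp add: S_def)
  qed
  have "((\<lambda>y. subord (poiss y) F n - c * F n) \<longlongrightarrow> 0) (at_right 0)"
  proof (rule Lim_null_comparison)
    show "\<forall>\<^sub>F y in at_right 0. norm (subord (poiss y) F n - c * F n) \<le> y * S"
      unfolding eventually_at_right_field real_norm_def using main by (intro exI[of _ 1]) auto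
    have "((\<lambda>y. y * S) \<longlongrightarrow> 0 * S) (at_right 0)" by (intro tendsto_intros)
    then show "((\<lambda>y. y * S) \<longlongrightarrow> 0) (at_right 0)" by simp
  qed
  then show ?thesis by (rule LIM_zero_cancel)
qed

section \<open>Interpolation between derivatives on an interval\<close>

lemma power_dvd_pderiv:
  fixes p q :: "real poly"
  shows "p ^ (n + i) dvd q \<Longrightarrow> p ^ n dvd (pderiv ^^ i) q"
proof (induction i arbitrary: q)
  case (Suc i)
  then obtain r where q: "q = p ^ Suc (n + i) * r" by (auto simp: dvd_def)
  have "pderiv q = p ^ (n + i) * (p * pderiv r + smult (of_nat (Suc (n + i))) (pderiv p * r))"
    unfolding q pderiv_mult pderiv_power_Suc by (simp add: algebra_simps)
  then have "p ^ (n + i) dvd pderiv q" by simp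
  from Suc.IH[OF this] show ?case by (simp add: funpow_swap1)
qed simp

lemma poly_power_bound:
  fixes p :: "real poly"
  assumes "monom 1 m dvd p"
  obtains C where "0 \<le> C" "\<And>s. 0 \<le> s \<Longrightarrow> s \<le> 1 \<Longrightarrow> \<bar>poly p s\<bar> \<le> C * s ^ m"
proof -
  obtain r where r: "p = monom 1 m * r" using assms by blast
  have "compact (poly r ` {0..1})" by (intro compact_continuous_image continuous_intros) auto
  then obtain C where C: "0 < C" "\<And>s. s \<in> {0..1} \<Longrightarrow> \<bar>poly r s\<bar> \<le> C"
    using compact_imp_bounded[of "poly r ` {0..1}"] unfolding bounded_pos by auto
  have *: "\<bar>poly p s\<bar> \<le> C * s ^ m" if "0 \<le> s" "s \<le> 1" for s
    using mult_right_mono[OF C(2)[of s], of "s ^ m"] that by (simp add: r poly_monom abs_mult mult.commute)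
  show ?thesis by (rule that[OF less_imp_le[OF C(1)] *])
qed

text \<open>The polynomial is s^(l-1) (1 - s^L)^L. The second factor vanishes to order L at 1 and is
  1 + O(s^L) at 0. So below order L the only Taylor coefficient at 0 is that of s^(l-1), and the
  next power occurring is s^(L+l-1), whose L-th derivative still contains s^(l-1).\<close>

lemma interpolation_poly:
  fixes l L :: nat
  assumes l: "1 \<le> l" "l \<le> L"
  obtains K :: "real poly" and C where "0 \<le> C" "\<And>i. i < L \<Longrightarrow> poly ((pderiv ^^ i) K) 1 = 0"
    "\<And>i. i < L \<Longrightarrow> poly ((pderiv ^^ i) K) 0 = (if i = l - 1 then fact (l - 1) else 0)"
    "\<And>s. 0 \<le> s \<Longrightarrow> s \<le> 1 \<Longrightarrow> \<bar>poly K s\<bar> \<le> C * s ^ (l - 1)"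
    "\<And>s. 0 \<le> s \<Longrightarrow> s \<le> 1 \<Longrightarrow> \<bar>poly ((pderiv ^^ L) K) s\<bar> \<le> C * s ^ (l - 1)"
proof -
  define m :: "real poly" where "m = monom 1 L"
  define P where "P = (1 - m) ^ L"
  define K where "K = monom 1 (l - 1) * P"
  have "m dvd (1 - m) ^ n - 1" for n
  proof (induction n)
    case (Suc n)
    have "(1 - m) ^ Suc n - 1 = ((1 - m) ^ n - 1) - m * (1 - m) ^ n" by (simp add: algebra_simps)
    then show ?case using Suc by (simp only: dvd_diff dvd_triv_left)
  qed simp
  then have "monom 1 L dvd P - 1" by (simp add: P_def m_def)
  then have cP: "coeff P j = (if j = 0 then 1 else 0)" if "j < L" for j
  proof -
    have "coeff (P - 1) j = 0" using \<open>monom 1 L dvd P - 1\<close> that unfolding monom_1_dvd_iff' by blast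
    then show ?thesis by (simp split: if_splits)
  qed
  have cK: "coeff K i = (if i < l - 1 then 0 else coeff P (i - (l - 1)))" for i
    by (simp add: K_def coeff_monom_mult)
  have "[:- 1, 1:] dvd 1 - m" unfolding poly_eq_0_iff_dvd[symmetric] by (simp add: m_def poly_monom)
  then have "[:- 1, 1:] ^ L dvd K" unfolding K_def P_def by (intro dvd_mult dvd_power_same)
  then have one: "poly ((pderiv ^^ i) K) 1 = 0" if "i < L" for i
  proof -
    have "[:- 1, 1:] ^ (Suc 0 + i) dvd K"
      by (rule power_le_dvd[OF \<open>[:- 1, 1:] ^ L dvd K\<close>]) (use that in simp)
    from power_dvd_pderiv[OF this] have "[:- 1, 1:] dvd (pderiv ^^ i) K" by (simp only: power_Suc0_right)
    then show ?thesis by (simp only: poly_eq_0_iff_dvd)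
  qed
  have zero: "poly ((pderiv ^^ i) K) 0 = (if i = l - 1 then fact (l - 1) else 0)" if "i < L" for i
    using that l cP[of "i - (l - 1)"] by (auto simp: poly_0_coeff_0 coeff_higher_pderiv cK pochhammer_fact[symmetric])
  have d0: "monom 1 (l - 1) dvd K" by (simp add: K_def)
  have dL: "monom 1 (l - 1) dvd (pderiv ^^ L) K"
    unfolding monom_1_dvd_iff'
  proof (intro allI impI)
    fix j assume "j < l - 1"
    then have "coeff K (j + L) = 0" using l cP[of "j + L - (l - 1)"] by (auto simp: cK)
    then show "coeff ((pderiv ^^ L) K) j = 0" by (simp add: coeff_higher_pderiv)
  qed
  obtain C0 where C0: "0 \<le> C0" "\<And>s. 0 \<le> s \<Longrightarrow> s \<le> 1 \<Longrightarrow> \<bar>poly K s\<bar> \<le> C0 * s ^ (l - 1)"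
    by (rule poly_power_bound[OF d0]) blast
  obtain C1 where C1: "0 \<le> C1" "\<And>s. 0 \<le> s \<Longrightarrow> s \<le> 1 \<Longrightarrow> \<bar>poly ((pderiv ^^ L) K) s\<bar> \<le> C1 * s ^ (l - 1)"
    by (rule poly_power_bound[OF dL]) blast
  show ?thesis
  proof (rule that[of "C0 + C1" K, OF _ one zero])
    fix s :: real assume s: "0 \<le> s" "s \<le> 1"
    have "0 \<le> C0 * s ^ (l - 1)" "0 \<le> C1 * s ^ (l - 1)" using s C0(1) C1(1) by auto
    then show "\<bar>poly K s\<bar> \<le> (C0 + C1) * s ^ (l - 1)" "\<bar>poly ((pderiv ^^ L) K) s\<bar> \<le> (C0 + C1) * s ^ (l - 1)"
      using C0(2)[OF s] C1(2)[OF s] by (auto simp: distrib_right)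
  qed (use C0 C1 in auto)
qed

text \<open>Integrating \<open>K((s - x)/R) X\<^sub>L(s)\<close> by parts \<open>L\<close> times leaves a single boundary term, at \<open>s = x\<close>.\<close>

lemma interpolation_inequality:
  fixes l L :: nat
  assumes l: "1 \<le> l" "l \<le> L"
  obtains C where "0 \<le> C" "\<And>(X :: nat \<Rightarrow> real \<Rightarrow> real) x R. 0 < R \<Longrightarrow>
    (\<And>i s. x \<le> s \<Longrightarrow> s \<le> x + R \<Longrightarrow> (X i has_real_derivative X (Suc i) s) (at s)) \<Longrightarrow>
    ennreal \<bar>X (L - l) x\<bar> \<le> (\<integral>\<^sup>+s. ennreal (C * (s - x) ^ (l - 1) * (\<bar>X L s\<bar> + \<bar>X 0 s\<bar> / R ^ L)) * indicator {x..x + R} s \<partial>lborel)"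
proof -
  obtain K :: "real poly" and C where C: "0 \<le> C" and K1: "\<And>i. i < L \<Longrightarrow> poly ((pderiv ^^ i) K) 1 = 0"
    and K0: "\<And>i. i < L \<Longrightarrow> poly ((pderiv ^^ i) K) 0 = (if i = l - 1 then fact (l - 1) else 0)"
    and bK: "\<And>s. 0 \<le> s \<Longrightarrow> s \<le> 1 \<Longrightarrow> \<bar>poly K s\<bar> \<le> C * s ^ (l - 1)"
    and bL: "\<And>s. 0 \<le> s \<Longrightarrow> s \<le> 1 \<Longrightarrow> \<bar>poly ((pderiv ^^ L) K) s\<bar> \<le> C * s ^ (l - 1)"
    by (rule interpolation_poly[OF l]) blast
  have "ennreal \<bar>X (L - l) x\<bar> \<le> (\<integral>\<^sup>+s. ennreal (C * (s - x) ^ (l - 1) * (\<bar>X L s\<bar> + \<bar>X 0 s\<bar> / R ^ L)) * indicator {x..x + R} s \<partial>lborel)"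
    if R: "0 < R" and X: "\<And>i s. x \<le> s \<Longrightarrow> s \<le> x + R \<Longrightarrow> (X i has_real_derivative X (Suc i) s) (at s)"
    for X :: "nat \<Rightarrow> real \<Rightarrow> real" and x R
  proof -
    define \<kappa> where "\<kappa> i s = poly ((pderiv ^^ i) K) ((s - x) / R) / R ^ i" for i s
    have d\<kappa>: "(\<kappa> i has_real_derivative \<kappa> (Suc i) s) (at s)" for i s
    proof -
      have "((\<lambda>s. (s - x) / R) has_real_derivative 1 / R) (at s)"
        by (rule derivative_eq_intros refl | use R in simp)+
      from DERIV_chain2[OF poly_DERIV this]
      have "((\<lambda>s. poly ((pderiv ^^ i) K) ((s - x) / R) / R ^ i) has_real_derivative
        (poly (pderiv ((pderiv ^^ i) K)) ((s - x) / R) * (1 / R)) / R ^ i) (at s)" by (rule DERIV_cdivide)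
      then show ?thesis by (simp add: \<kappa>_def[abs_def])
    qed
    \<comment> \<open>The antiderivative collected from L integrations by parts; its derivative
      telescopes to the first and the last product.\<close>
    define W where "W s = (\<Sum>i<L. (- 1) ^ i * (\<kappa> i s * X (L - 1 - i) s))" for s
    define W' where "W' s = \<kappa> 0 s * X L s - (- 1) ^ L * (\<kappa> L s * X 0 s)" for s
    have dW: "(W has_real_derivative W' s) (at s)" if s: "x \<le> s" "s \<le> x + R" for s
    proof -
      have "(W has_real_derivative (\<Sum>i<L. (- 1) ^ i * (\<kappa> (Suc i) s * X (L - 1 - i) s + X (Suc (L - 1 - i)) s * \<kappa> i s))) (at s)"
        unfolding W_def[abs_def] by (intro DERIV_sum DERIV_cmult DERIV_mult d\<kappa> X s)
      also have "(\<Sum>i<L. (- 1) ^ i * (\<kappa> (Suc i) s * X (L - 1 - i) s + X (Suc (L - 1 - i)) s * \<kappa> i s)) =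
        (\<Sum>i<L. (- 1) ^ i * (\<kappa> i s * X (L - i) s) - (- 1) ^ Suc i * (\<kappa> (Suc i) s * X (L - Suc i) s))"
        by (intro sum.cong refl) (auto simp: Suc_diff_Suc algebra_simps)
      also have "\<dots> = W' s" using sum_lessThan_telescope'[of "\<lambda>i. (- 1) ^ i * (\<kappa> i s * X (L - i) s)" L]
        by (simp only: W'_def diff_zero diff_self_eq_0 power_0 mult_1_left)
      finally show ?thesis .
    qed
    have cX: "continuous_on {x..x + R} (X i)" for i
      by (intro continuous_at_imp_continuous_on ballI DERIV_isCont[OF X]) auto
    have c\<kappa>: "continuous_on {x..x + R} (\<kappa> i)" for i
      by (intro continuous_at_imp_continuous_on ballI DERIV_isCont[OF d\<kappa>])
    have "ennreal \<bar>W (x + R) - W x\<bar> \<le> (\<integral>\<^sup>+s. ennreal \<bar>W' s\<bar> * indicator {x..x + R} s \<partial>lborel)"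
      using R dW unfolding W'_def[abs_def] by (intro abs_diff_le_nn_integral continuous_intros cX c\<kappa>) auto
    moreover have "W (x + R) = 0" using R K1 unfolding W_def \<kappa>_def by (intro sum.neutral) auto
    \<comment> \<open>At the left endpoint only i = l - 1 survives, and there L - 1 - i = L -
      l.\<close>
    moreover have "W x = (- 1) ^ (l - 1) * (fact (l - 1) / R ^ (l - 1) * X (L - l) x)"
    proof -
      have "W x = (\<Sum>i<L. if i = l - 1 then (- 1) ^ (l - 1) * (fact (l - 1) / R ^ (l - 1) * X (L - l) x) else 0)"
        unfolding W_def \<kappa>_def using l by (intro sum.cong refl) (auto simp: K0)
      also have "\<dots> = (- 1) ^ (l - 1) * (fact (l - 1) / R ^ (l - 1) * X (L - l) x)" using l by (subst sum.delta) auto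
      finally show ?thesis .
    qed
    ultimately have *: "ennreal (fact (l - 1) / R ^ (l - 1) * \<bar>X (L - l) x\<bar>) \<le> (\<integral>\<^sup>+s. ennreal \<bar>W' s\<bar> * indicator {x..x + R} s \<partial>lborel)"
      using R by (simp add: abs_mult power_abs)
    \<comment> \<open>The power of R is moved to the other side, where it turns z^(l-1) into (s -
      x)^(l-1); the factorial is at least 1.\<close>
    have "\<bar>X (L - l) x\<bar> \<le> R ^ (l - 1) * (fact (l - 1) / R ^ (l - 1) * \<bar>X (L - l) x\<bar>)"
      using R mult_right_mono[OF fact_ge_1[of "l - 1"], of "\<bar>X (L - l) x\<bar>"] by simp
    then have "ennreal \<bar>X (L - l) x\<bar> \<le> ennreal (R ^ (l - 1)) * ennreal (fact (l - 1) / R ^ (l - 1) * \<bar>X (L - l) x\<bar>)"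
      using R by (subst ennreal_mult[symmetric]) (auto intro: ennreal_leI)
    also have "\<dots> \<le> ennreal (R ^ (l - 1)) * (\<integral>\<^sup>+s. ennreal \<bar>W' s\<bar> * indicator {x..x + R} s \<partial>lborel)"
      by (rule mult_left_mono[OF *]) simp
    also have "\<dots> = (\<integral>\<^sup>+s. ennreal (R ^ (l - 1)) * (ennreal \<bar>W' s\<bar> * indicator {x..x + R} s) \<partial>lborel)"
    proof (rule nn_integral_cmult[symmetric])
      have "(\<lambda>s. indicator {x..x + R} s *\<^sub>R W' s) \<in> borel_measurable borel"
        unfolding W'_def[abs_def] by (intro borel_measurable_continuous_on_indicator continuous_intros cX c\<kappa>) auto
      then have "(\<lambda>s. ennreal \<bar>indicator {x..x + R} s *\<^sub>R W' s\<bar>) \<in> borel_measurable lborel" by simp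
      also have "(\<lambda>s. ennreal \<bar>indicator {x..x + R} s *\<^sub>R W' s\<bar>) = (\<lambda>s. ennreal \<bar>W' s\<bar> * indicator {x..x + R} s)"
        by (auto simp: indicator_def fun_eq_iff)
      finally show "(\<lambda>s. ennreal \<bar>W' s\<bar> * indicator {x..x + R} s) \<in> borel_measurable lborel" .
    qed
    also have "\<dots> \<le> (\<integral>\<^sup>+s. ennreal (C * (s - x) ^ (l - 1) * (\<bar>X L s\<bar> + \<bar>X 0 s\<bar> / R ^ L)) * indicator {x..x + R} s \<partial>lborel)"
    proof (rule nn_integral_mono)
      fix s
      show "ennreal (R ^ (l - 1)) * (ennreal \<bar>W' s\<bar> * indicator {x..x + R} s) \<le>
        ennreal (C * (s - x) ^ (l - 1) * (\<bar>X L s\<bar> + \<bar>X 0 s\<bar> / R ^ L)) * indicator {x..x + R} s"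
      proof (cases "s \<in> {x..x + R}")
        case True
        define z where "z = (s - x) / R"
        have z: "0 \<le> z" "z \<le> 1" using True R by (auto simp: z_def)
        have "\<bar>W' s\<bar> \<le> \<bar>\<kappa> 0 s * X L s\<bar> + \<bar>\<kappa> L s * X 0 s\<bar>"
          unfolding W'_def by (rule order_trans[OF abs_triangle_ineq4]) (simp add: abs_mult power_abs)
        also have "\<dots> \<le> (C * z ^ (l - 1)) * \<bar>X L s\<bar> + (C * z ^ (l - 1)) / R ^ L * \<bar>X 0 s\<bar>"
          unfolding abs_mult using bK[OF z] bL[OF z] R
          by (intro add_mono mult_right_mono) (auto simp: \<kappa>_def z_def[symmetric] abs_divide intro!: divide_right_mono)
        also have "\<dots> = C * z ^ (l - 1) * (\<bar>X L s\<bar> + \<bar>X 0 s\<bar> / R ^ L)" by (simp add: distrib_left)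
        finally have "R ^ (l - 1) * \<bar>W' s\<bar> \<le> R ^ (l - 1) * (C * z ^ (l - 1) * (\<bar>X L s\<bar> + \<bar>X 0 s\<bar> / R ^ L))"
          using R by (intro mult_left_mono) auto
        also have "\<dots> = C * (R * z) ^ (l - 1) * (\<bar>X L s\<bar> + \<bar>X 0 s\<bar> / R ^ L)" by (simp add: power_mult_distrib)
        also have "R * z = s - x" using R by (simp add: z_def)
        finally show ?thesis using True R by (simp add: ennreal_mult[symmetric] ennreal_leI)
      qed simp
    qed
    finally show ?thesis .
  qed
  with C show ?thesis by (intro that[of C]) auto
qed

section \<open>From the heat to the Poisson seminorm\<close>

text \<open>For small \<open>z\<close> the exponential outweighs any power of 1/z^2, so it absorbs
  z^(-2\<gamma>) and turns growth z^(-\<gamma>) into decay z^\<gamma>; for z > 1 it is at most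
  1.\<close>

lemma powr_exp_le_kappa:
  assumes \<gamma>: "0 < \<gamma>"
  obtains K where "0 \<le> K" "\<And>z. 0 < z \<Longrightarrow> z powr (- \<gamma>) * exp (- (1 / (4 * z\<^sup>2))) \<le> K * kappa \<gamma> z"
proof -
  define m where "m = nat \<lceil>\<gamma>\<rceil>"
  have m: "\<gamma> \<le> real m" by (simp add: m_def) linarith
  define K where "K = max 1 (4 ^ m * fact m :: real)"
  have K: "0 \<le> K" by (simp add: K_def le_max_iff_disj)
  have *: "z powr (- \<gamma>) * exp (- (1 / (4 * z\<^sup>2))) \<le> K * kappa \<gamma> z" if z: "0 < z" for z
  proof (cases "z \<le> 1")
    case True
    have "(z\<^sup>2) powr (- \<gamma>) \<le> (z\<^sup>2) powr (- real m)" using z True m by (intro powr_mono') (auto simp: power_le_one)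
    also have "\<dots> = 4 ^ m * (1 / (4 * z\<^sup>2)) ^ m" using z by (simp add: powr_minus powr_realpow power_one_over power_mult_distrib inverse_eq_divide)
    also have "\<dots> \<le> 4 ^ m * (fact m * exp (1 / (4 * z\<^sup>2)))" by (intro mult_left_mono power_le_fact_exp) auto
    finally have *: "(z\<^sup>2) powr (- \<gamma>) * exp (- (1 / (4 * z\<^sup>2))) \<le> 4 ^ m * (fact m * exp (1 / (4 * z\<^sup>2))) * exp (- (1 / (4 * z\<^sup>2)))"
      by (rule mult_right_mono) simp
    have e: "4 ^ m * (fact m * exp (1 / (4 * z\<^sup>2))) * exp (- (1 / (4 * z\<^sup>2))) = 4 ^ m * fact m" by (simp add: exp_minus)
    have zz: "z powr (- \<gamma>) = z powr \<gamma> * (z\<^sup>2) powr (- \<gamma>)"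
    proof -
      have "(z\<^sup>2) powr (- \<gamma>) = z powr (- \<gamma>) * z powr (- \<gamma>)" using z by (simp add: power2_eq_square powr_mult)
      then show ?thesis using z by (simp add: powr_minus)
    qed
    have "z powr (- \<gamma>) * exp (- (1 / (4 * z\<^sup>2))) = z powr \<gamma> * ((z\<^sup>2) powr (- \<gamma>) * exp (- (1 / (4 * z\<^sup>2))))"
      unfolding zz by (rule mult.assoc)
    also have "\<dots> \<le> z powr \<gamma> * K" using * unfolding e by (intro mult_left_mono) (auto simp: K_def)
    finally show ?thesis using z \<gamma> True by (simp add: kappa_cases mult.commute)
  next
    case False
    have "z powr (- \<gamma>) * exp (- (1 / (4 * z\<^sup>2))) \<le> z powr (- \<gamma>) * K" using z by (intro mult_left_mono) (auto simp: K_def le_max_iff_disj)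
    then show ?thesis using z \<gamma> False by (simp add: kappa_cases mult.commute)
  qed
  show ?thesis by (rule that[OF K *])
qed

lemma scale_measure_dt_1: "scale_measure dt_over_t (\<lambda>t. t powr 1)"
  by (rule scale_measure_dt_over_t) simp

text \<open>The exponent \<open>e\<close> covers two densities: e = 0 is the bound y t^(-3/2) for
  \<open>poiss\<close>, e = 1 the bound t^(-1/2) for 2 \<open>gauss\<close>. After weighting, the
  kernel depends on z = sqrt t / y alone, apart from \<open>t powr (c - 1)\<close>, and is
  z^(-\<gamma>) exp(-1/(4z^2)).\<close>

lemma subord_norm_fin:
  assumes p: "1 \<le> p" and q: "1 \<le> q" and F: "expb F" and \<gamma>: "0 < \<gamma>"
    and [measurable]: "\<And>y. \<phi> y \<in> borel_measurable borel"
    and \<phi>: "\<And>y t. 0 < y \<Longrightarrow> 0 < t \<Longrightarrow> \<bar>\<phi> y t\<bar> \<le> y powr (1 - e) * t powr (e - 3 / 2) * exp (- (y\<^sup>2 / (4 * t)))"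
    and u: "\<And>y n. 0 < y \<Longrightarrow> ennreal \<bar>u y n\<bar> \<le> (\<integral>\<^sup>+t. ennreal \<bar>\<phi> y t * conv (hker t) F n\<bar> \<partial>lpos)"
    and fin: "heat_fin p q (e - 1 / 2 + \<gamma> / 2) F"
  shows "Lfin dt_over_t q (\<lambda>y. ennreal (y powr (\<gamma> - 1 + e)) * lp_norm p (u y))"
proof -
  define c where "c = e - 1 / 2 + \<gamma> / 2"
  obtain K where K: "0 \<le> K" "\<And>z. 0 < z \<Longrightarrow> z powr (- \<gamma>) * exp (- (1 / (4 * z\<^sup>2))) \<le> K * kappa \<gamma> z"
    by (rule powr_exp_le_kappa[OF \<gamma>]) blast
  have "heat_fin p q c F" using fin by (simp only: c_def)
  show ?thesis
  proof (rule Lfin_schur_dt[OF scale_measure_dt_1 q \<gamma>, where b = "1 / 2" and K = "2 * K" and S = "\<lambda>_. {0<..}"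
        and k = "\<lambda>y t. 2 * (y powr (\<gamma> - 1 + e) * \<bar>\<phi> y t\<bar>)" and \<Psi> = "\<lambda>t. hnorm p t F" and c = c])
    show "(\<lambda>t. hnorm p t F) \<in> borel_measurable (restrict_space borel {0<..})" by (rule measurable_heat_restrict[OF F])
    show "Lfin dt_over_t q (\<lambda>s. ennreal (s powr c) * hnorm p s F)"
      using \<open>heat_fin p q c F\<close> by (simp only: heat_fin_def)
  next
    fix y assume "y \<in> space dt_over_t"
    then have y: "0 < y" by (simp add: space_dt_over_t)
    have m: "(\<lambda>t. \<phi> y t * conv (hker t) F n) \<in> borel_measurable lborel" for n using F by simp
    have "lp_norm p (u y) \<le> 2 * (\<integral>\<^sup>+t. lp_norm p (\<lambda>n. \<phi> y t * conv (hker t) F n) * indicator {0<..} t \<partial>lborel)"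
    proof (rule lp_norm_nn_integral_set_le[OF m _ p])
      show "ennreal \<bar>u y n\<bar> \<le> (\<integral>\<^sup>+t. ennreal \<bar>\<phi> y t * conv (hker t) F n\<bar> * indicator {0<..} t \<partial>lborel)" for n
        using u[OF y, of n] by (subst (asm) nn_integral_restrict_space) auto
    qed simp
    then have "ennreal (y powr (\<gamma> - 1 + e)) * lp_norm p (u y) \<le> ennreal (y powr (\<gamma> - 1 + e)) *
      (2 * (\<integral>\<^sup>+t. lp_norm p (\<lambda>n. \<phi> y t * conv (hker t) F n) * indicator {0<..} t \<partial>lborel))" by (rule mult_left_mono) simp
    also have "\<dots> = ennreal (2 * y powr (\<gamma> - 1 + e)) * (\<integral>\<^sup>+t. lp_norm p (\<lambda>n. \<phi> y t * conv (hker t) F n) * indicator {0<..} t \<partial>lborel)"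
      by (simp add: ennreal_mult mult_ac)
    also have "\<dots> = (\<integral>\<^sup>+t. ennreal (2 * y powr (\<gamma> - 1 + e)) * (lp_norm p (\<lambda>n. \<phi> y t * conv (hker t) F n) * indicator {0<..} t) \<partial>lborel)"
      using m by (intro nn_integral_cmult[symmetric] borel_measurable_times lp_norm_measurable) auto
    also have "\<dots> = (\<integral>\<^sup>+t. ennreal (2 * (y powr (\<gamma> - 1 + e) * \<bar>\<phi> y t\<bar>)) * hnorm p t F * indicator {0<..} t \<partial>lborel)"
      by (intro nn_integral_cong) (simp add: lp_norm_cmult[OF p] ennreal_mult mult_ac)
    finally show "ennreal (y powr (\<gamma> - 1 + e)) * lp_norm p (u y) \<le>
      (\<integral>\<^sup>+t. ennreal (2 * (y powr (\<gamma> - 1 + e) * \<bar>\<phi> y t\<bar>)) * hnorm p t F * indicator {0<..} t \<partial>lborel)" .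
  next
    fix y t :: real assume "y \<in> space dt_over_t" and t: "0 < t"
    then have y: "0 < y" by (simp add: space_dt_over_t)
    define z where "z = t powr (1 / 2) / y"
    have z: "0 < z" using t y by (simp add: z_def)
    have z2: "y\<^sup>2 / (4 * t) = 1 / (4 * z\<^sup>2)"
    proof -
      have "(t powr (1 / 2))\<^sup>2 = t" using t by (simp add: powr_half_sqrt)
      then show ?thesis by (simp add: z_def power_divide)
    qed
    have zg: "z powr (- \<gamma>) = t powr (- \<gamma> / 2) * y powr \<gamma>"
      using t y by (simp add: z_def powr_divide powr_powr powr_minus divide_simps)
    have "y powr (\<gamma> - 1 + e) * \<bar>\<phi> y t\<bar> \<le> y powr (\<gamma> - 1 + e) * (y powr (1 - e) * t powr (e - 3 / 2) * exp (- (y\<^sup>2 / (4 * t))))"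
      by (intro mult_left_mono \<phi> y t) simp
    also have "\<dots> = (y powr (\<gamma> - 1 + e) * y powr (1 - e)) * t powr (e - 3 / 2) * exp (- (y\<^sup>2 / (4 * t)))" by (simp add: mult_ac)
    also have "y powr (\<gamma> - 1 + e) * y powr (1 - e) = y powr \<gamma>" using y by (simp add: powr_add[symmetric])
    also have "t powr (e - 3 / 2) = t powr (- \<gamma> / 2) * t powr (c - 1)"
    proof -
      have "e - 3 / 2 = - \<gamma> / 2 + (c - 1)" by (simp add: c_def)
      then show ?thesis by (simp only: powr_add[symmetric])
    qed
    also have "y powr \<gamma> * (t powr (- \<gamma> / 2) * t powr (c - 1)) * exp (- (y\<^sup>2 / (4 * t))) =
      (z powr (- \<gamma>) * exp (- (1 / (4 * z\<^sup>2)))) * t powr (c - 1)" unfolding zg z2 by (simp add: mult_ac)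
    also have "\<dots> \<le> (K * kappa \<gamma> z) * t powr (c - 1)" by (intro mult_right_mono K z) simp
    finally show "2 * (y powr (\<gamma> - 1 + e) * \<bar>\<phi> y t\<bar>) \<le> 2 * K * (kappa \<gamma> (t powr (1 / 2) / y powr 1) * t powr (c - 1))"
      using y by (simp add: z_def mult.assoc)
  qed (use K in auto)
qed

lemma two_sqrt_pi: "2 \<le> 2 * sqrt pi"
  using pi_ge_two real_sqrt_ge_one[of pi] by linarith

text \<open>By the parity of \<open>l\<close>, the derivative of order \<open>l\<close> is an
  integral of the k-th Laplacian of the heat extension against \<open>poiss\<close> (e = 0) or 2
  \<open>gauss\<close> (e = 1).\<close>

lemma heat_imp_poisson:
  assumes p: "1 \<le> p" and q: "1 \<le> q" and f: "wsummable 2 f" and kl: "2 * k = l + e" "e \<le> 1" "1 \<le> l" and \<alpha>: "\<alpha> < real l" "real l - 1 \<le> \<alpha>"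
    and fin: "heat_fin p q (real k - \<alpha> / 2) ((lap ^^ k) f)"
  shows "Lfin dt_over_t q (\<lambda>y. ennreal (y powr (real l - \<alpha>)) * lp_norm p (pder l f y))"
proof -
  have F: "expb ((lap ^^ k) f)" by (rule wsummable_expb[OF wsummable_lap_funpow[OF f]])
  \<comment> \<open>Forced by matching the weight \<open>y powr (l - \<alpha>)\<close>; it is
    positive because \<alpha> < l and e <= 1.\<close>
  define \<gamma> where "\<gamma> = real l - \<alpha> + 1 - real e"
  have \<gamma>: "0 < \<gamma>" using \<alpha> kl(2) unfolding \<gamma>_def by linarith
  have "2 * real k = real l + real e" using kl(1) by (metis of_nat_add of_nat_mult of_nat_numeral)
  then have c: "real k - \<alpha> / 2 = real e - 1 / 2 + \<gamma> / 2" by (simp add: \<gamma>_def field_simps)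
  have b: "real l - \<alpha> = \<gamma> - 1 + real e" by (simp add: \<gamma>_def)
  define \<phi> where "\<phi> y t = (if e = 0 then poiss y t else 2 * gauss y t)" for y t
  have mphi: "\<phi> y \<in> borel_measurable borel" for y unfolding \<phi>_def[abs_def] by (cases "e = 0") auto
  show ?thesis unfolding b
  proof (rule subord_norm_fin[OF p q F \<gamma> mphi])
    fix y t :: real assume y: "0 < y" and t: "0 < t"
    have E: "E / (2 * sqrt pi) \<le> E" "2 * E / (2 * sqrt pi) \<le> E" if "0 \<le> E" for E
      using mult_left_mono[OF two_sqrt_pi that] two_sqrt_pi that by (auto simp: divide_le_eq mult_ac intro: order_trans[rotated])
    consider "e = 0" | "e = 1" using kl(2) by linarith
    then show "\<bar>\<phi> y t\<bar> \<le> y powr (1 - real e) * t powr (real e - 3 / 2) * exp (- (y\<^sup>2 / (4 * t)))"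
    proof cases
      case 1
      have tp: "t powr (- (3 / 2)) = 1 / sqrt t ^ 3" using powr_half_eq_sqrt_power[OF t, of 3] by simp
      have "\<bar>\<phi> y t\<bar> = (y * (1 / sqrt t ^ 3) * exp (- (y\<^sup>2 / (4 * t)))) / (2 * sqrt pi)"
        using y t 1 by (simp add: \<phi>_def poiss_def abs_mult)
      also have "\<dots> \<le> y * (1 / sqrt t ^ 3) * exp (- (y\<^sup>2 / (4 * t)))" using y t by (intro E) auto
      finally show ?thesis using 1 y tp by simp
    next
      case 2
      have tp: "t powr (- (1 / 2)) = 1 / sqrt t" using powr_half_eq_sqrt_power[OF t, of 1] by simp
      have "\<bar>\<phi> y t\<bar> = 2 * (1 / sqrt t * exp (- (y\<^sup>2 / (4 * t)))) / (2 * sqrt pi)"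
        using t 2 by (simp add: \<phi>_def gauss_def abs_mult)
      also have "\<dots> \<le> 1 / sqrt t * exp (- (y\<^sup>2 / (4 * t)))" using t by (intro E) auto
      finally show ?thesis using 2 y tp by simp
    qed
  next
    fix y n assume y: "(0::real) < y"
    have n: "ennreal \<bar>subord \<psi> ((lap ^^ k) f) n\<bar> \<le> (\<integral>\<^sup>+t. ennreal \<bar>\<psi> t * conv (hker t) ((lap ^^ k) f) n\<bar> \<partial>lpos)"
      if "subordinable \<psi> ((lap ^^ k) f)" for \<psi>
      using integral_norm_bound_ennreal[OF subordinable_integrable[OF that], of n] by (simp add: subord_def)
    consider "e = 0" | "e = 1" using kl(2) by linarith
    then show "ennreal \<bar>pder l f y n\<bar> \<le> (\<integral>\<^sup>+t. ennreal \<bar>\<phi> y t * conv (hker t) ((lap ^^ k) f) n\<bar> \<partial>lpos)"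
    proof cases
      case 1
      then have l: "l = 2 * k" using kl by simp
      have "\<bar>pder l f y n\<bar> = \<bar>subord (poiss y) ((lap ^^ k) f) n\<bar>" by (simp add: pder_def l abs_mult power_abs)
      then show ?thesis using n[OF subordinable_pder(1)[OF f y]] 1 by (simp add: \<phi>_def)
    next
      case 2
      then obtain k' where k': "k = k' + 1" "l = 2 * k' + 1" using kl by (cases k) auto
      have s: "subordinable (gauss y) ((lap ^^ k) f)" unfolding k' by (rule subordinable_pder(2)[OF f y])
      have m: "(\<lambda>t. ennreal \<bar>gauss y t * conv (hker t) ((lap ^^ k) f) n\<bar>) \<in> borel_measurable lpos"
        by (intro measurable_compose[OF measurable_subord[OF _ F]] ) auto
      have "ennreal \<bar>pder l f y n\<bar> = 2 * ennreal \<bar>subord (gauss y) ((lap ^^ k) f) n\<bar>"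
        unfolding k' pder_def by (simp add: abs_mult power_abs ennreal_mult)
      also have "\<dots> \<le> 2 * (\<integral>\<^sup>+t. ennreal \<bar>gauss y t * conv (hker t) ((lap ^^ k) f) n\<bar> \<partial>lpos)"
        by (rule mult_left_mono[OF n[OF s]]) simp
      also have "\<dots> = (\<integral>\<^sup>+t. 2 * ennreal \<bar>gauss y t * conv (hker t) ((lap ^^ k) f) n\<bar> \<partial>lpos)"
        by (rule nn_integral_cmult[OF m, symmetric])
      also have "\<dots> = (\<integral>\<^sup>+t. ennreal \<bar>\<phi> y t * conv (hker t) ((lap ^^ k) f) n\<bar> \<partial>lpos)"
        using 2 by (intro nn_integral_cong) (simp add: \<phi>_def abs_mult ennreal_mult mult.assoc)
      finally show ?thesis .
    qed
  qed (use fin in \<open>simp only: c\<close>)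
qed

section \<open>From the Poisson to the heat seminorm\<close>

text \<open>Interpolation is applied to the derivatives of order l + i of the Poisson integral of
  \<open>g\<close>, the heat extension at time \<open>t\<close>. The target order l + e = 2k is, up
  to sign, the Poisson integral of the k-th Laplacian of \<open>g\<close>. At the top order l + 2k
  the 2k extra derivatives become k Laplacians and smoothing gives t^(-k), which is also the factor
  R^(-2k) at the bottom order when R = sqrt t.\<close>

lemma heat_le_poisson:
  assumes p: "1 \<le> p" and f: "wsummable 2 f" and kl: "2 * k = l + e" "e \<le> 1" "1 \<le> l"
  obtains C where "0 \<le> C" "\<And>t. 0 < t \<Longrightarrow> hnorm p t ((lap ^^ k) f) \<le>
    (\<integral>\<^sup>+s. ennreal (C * t powr (- real k) * s ^ (l - 1)) * lp_norm p (pder l f s) * indicator {0<..2 * sqrt t} s \<partial>lborel)"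
proof -
  have ef: "expb f" by (rule wsummable_expb[OF f])
  obtain c where c: "0 < c" "\<And>y. 0 < y \<Longrightarrow> integrable lpos (poiss y) \<and> (\<integral>t. poiss y t \<partial>lpos) = c"
    by (rule integral_poiss) blast
  have lL: "1 \<le> l" "l \<le> 2 * k" using kl by auto
  have el: "2 * k - l = e" using kl by simp
  obtain A where A: "0 \<le> A" "\<And>(X :: nat \<Rightarrow> real \<Rightarrow> real) x R. 0 < R \<Longrightarrow>
    (\<And>i s. x \<le> s \<Longrightarrow> s \<le> x + R \<Longrightarrow> (X i has_real_derivative X (Suc i) s) (at s)) \<Longrightarrow>
    ennreal \<bar>X (2 * k - l) x\<bar> \<le> (\<integral>\<^sup>+s. ennreal (A * (s - x) ^ (l - 1) * (\<bar>X (2 * k) s\<bar> + \<bar>X 0 s\<bar> / R ^ (2 * k))) * indicator {x..x + R} s \<partial>lborel)"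
    by (rule interpolation_inequality[OF lL]) blast
  obtain C0 where C0: "0 < C0" "\<And>t F. 0 < t \<Longrightarrow> expb F \<Longrightarrow>
    lp_norm p ((delta_right ^^ 0) (conv (hker t) F)) \<le> ennreal (C0 * t powr (- real 0 / 2)) * lp_norm p F"
    by (rule lp_norm_smoothing[OF p, of 0]) blast
  obtain C1 where C1: "0 < C1" "\<And>t F. 0 < t \<Longrightarrow> expb F \<Longrightarrow>
    lp_norm p ((delta_right ^^ (2 * k)) (conv (hker t) F)) \<le> ennreal (C1 * t powr (- real (2 * k) / 2)) * lp_norm p F"
    by (rule lp_norm_smoothing[OF p, of "2 * k"]) blast
  \<comment> \<open>The factor 4 is 2 from adding the two ends of the interpolation times 2 from
    Minkowski; \<open>c\<close> is the mass of the Poisson density.\<close>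
  define C where "C = 4 * A * (C1 + C0) / c"
  have "hnorm p t ((lap ^^ k) f) \<le>
    (\<integral>\<^sup>+s. ennreal (C * t powr (- real k) * s ^ (l - 1)) * lp_norm p (pder l f s) * indicator {0<..2 * sqrt t} s \<partial>lborel)"
    if t: "0 < t" for t
  proof -
    define R where "R = sqrt t"
    have R: "0 < R" using t by (simp add: R_def)
    have R2: "1 / R ^ (2 * k) = t powr (- real k)" using powr_half_eq_sqrt_power[OF t, of "2 * k"] by (simp add: R_def)
    define g where "g = conv (hker t) f"
    have g: "wsummable 2 g" unfolding g_def by (rule wsummable_conv[OF rapid_hker f])
    have eg: "expb g" by (rule wsummable_expb[OF g])
    have lg: "(lap ^^ k) g = conv (hker t) ((lap ^^ k) f)" unfolding g_def by (rule lap_funpow_conv_right[OF rapid_hker ef])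
    define G where "G s n = A * s ^ (l - 1) * (\<bar>pder (l + 2 * k) g s n\<bar> + \<bar>pder l g s n\<bar> / R ^ (2 * k))" for s n
    have mG: "(\<lambda>s. G s n) \<in> borel_measurable lborel" for n
      unfolding G_def using measurable_pder[OF eg] by (simp add: borel_measurable_times borel_measurable_add)
    have pt: "ennreal \<bar>c * (lap ^^ k) g n\<bar> \<le> (\<integral>\<^sup>+s. ennreal \<bar>G s n\<bar> * indicator {0<..2 * R} s \<partial>lborel)" for n
    proof (rule tendsto_upperbound)
      have "((\<lambda>x. subord (poiss x) ((lap ^^ k) g) n) \<longlongrightarrow> c * (lap ^^ k) g n) (at_right 0)"
        by (rule poisson_at_0[OF wsummable_lap_funpow[OF g] c(2)])
      then show "((\<lambda>x. ennreal \<bar>subord (poiss x) ((lap ^^ k) g) n\<bar>) \<longlongrightarrow> ennreal \<bar>c * (lap ^^ k) g n\<bar>) (at_right 0)"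
        by (intro tendsto_intros)
      show "\<forall>\<^sub>F x in at_right 0. ennreal \<bar>subord (poiss x) ((lap ^^ k) g) n\<bar> \<le> (\<integral>\<^sup>+s. ennreal \<bar>G s n\<bar> * indicator {0<..2 * R} s \<partial>lborel)"
        unfolding eventually_at_right_field
      \<comment> \<open>For x < R the interval from x to x + R stays inside 0..2R, which makes the
        bound independent of x.\<close>
      proof (intro exI[of _ R] conjI allI impI R)
        fix x assume x: "0 < x" "x < R"
        have "pder (l + e) g x n = (- 1) ^ k * pder 0 ((lap ^^ k) g) x n" using pder_add[of 0 k g x n] kl(1) by simp
        then have "\<bar>subord (poiss x) ((lap ^^ k) g) n\<bar> = \<bar>pder (l + (2 * k - l)) g x n\<bar>"
          unfolding el by (simp add: pder_def abs_mult power_abs)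
        also have "ennreal \<dots> \<le> (\<integral>\<^sup>+s. ennreal (A * (s - x) ^ (l - 1) * (\<bar>pder (l + 2 * k) g s n\<bar> + \<bar>pder (l + 0) g s n\<bar> / R ^ (2 * k))) * indicator {x..x + R} s \<partial>lborel)"
          using DERIV_pder[OF g] x by (intro A(2)[where X = "\<lambda>i s. pder (l + i) g s n"] R) simp
        also have "\<dots> \<le> (\<integral>\<^sup>+s. ennreal \<bar>G s n\<bar> * indicator {0<..2 * R} s \<partial>lborel)"
        proof (rule nn_integral_mono)
          fix s
          show "ennreal (A * (s - x) ^ (l - 1) * (\<bar>pder (l + 2 * k) g s n\<bar> + \<bar>pder (l + 0) g s n\<bar> / R ^ (2 * k))) * indicator {x..x + R} s \<le>
            ennreal \<bar>G s n\<bar> * indicator {0<..2 * R} s"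
          proof (cases "s \<in> {x..x + R}")
            case True
            have "A * (s - x) ^ (l - 1) * (\<bar>pder (l + 2 * k) g s n\<bar> + \<bar>pder l g s n\<bar> / R ^ (2 * k)) \<le> G s n"
              unfolding G_def using True x A(1) R by (intro mult_right_mono mult_left_mono power_mono) auto
            then show ?thesis using True x by (auto intro!: ennreal_leI)
          qed simp
        qed
        finally show "ennreal \<bar>subord (poiss x) ((lap ^^ k) g) n\<bar> \<le> (\<integral>\<^sup>+s. ennreal \<bar>G s n\<bar> * indicator {0<..2 * R} s \<partial>lborel)" .
      qed
    qed simp
    have nG: "lp_norm p (G s) \<le> ennreal (2 * A * (C1 + C0) * t powr (- real k) * s ^ (l - 1)) * lp_norm p (pder l f s)" if s: "0 < s" for s
    proof -
      let ?N = "lp_norm p (pder l f s)"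
      have ep: "expb (pder l f s)" by (rule expb_pder[OF f s])
      have e1: "pder l g s = conv (hker t) (pder l f s)" unfolding g_def by (rule pder_conv[OF f s rapid_hker])
      have "pder l ((lap ^^ k) g) s = (lap ^^ k) (conv (hker t) (pder l f s))" unfolding pder_lap_funpow[OF g s] e1 ..
      then have "lp_norm p (pder (l + 2 * k) g s) = lp_norm p ((lap ^^ k) (conv (hker t) (pder l f s)))"
        by (intro lp_norm_abs_cong) (simp add: pder_add abs_mult power_abs)
      also have "\<dots> \<le> ennreal (C1 * t powr (- real k)) * ?N" using C1(2)[OF t ep] by (simp add: lp_norm_lap_funpow)
      finally have n1: "lp_norm p (pder (l + 2 * k) g s) \<le> ennreal (C1 * t powr (- real k)) * ?N" .
      have "lp_norm p (pder l g s) \<le> ennreal C0 * ?N" using C0(2)[OF t ep] t by (simp add: e1)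
      then have "ennreal (t powr (- real k)) * lp_norm p (pder l g s) \<le> ennreal (t powr (- real k)) * (ennreal C0 * ?N)"
        by (rule mult_left_mono) simp
      also have "ennreal (t powr (- real k)) * lp_norm p (pder l g s) = lp_norm p (\<lambda>n. t powr (- real k) * pder l g s n)"
        by (simp add: lp_norm_cmult[OF p])
      also have "ennreal (t powr (- real k)) * (ennreal C0 * ?N) = ennreal (C0 * t powr (- real k)) * ?N"
        using C0(1) by (simp add: ennreal_mult mult_ac)
      finally have n0: "lp_norm p (\<lambda>n. t powr (- real k) * pder l g s n) \<le> ennreal (C0 * t powr (- real k)) * ?N" .
      have "lp_norm p (\<lambda>n. \<bar>pder (l + 2 * k) g s n\<bar> + \<bar>pder l g s n\<bar> / R ^ (2 * k)) \<le>
        2 * (lp_norm p (pder (l + 2 * k) g s) + lp_norm p (\<lambda>n. t powr (- real k) * pder l g s n))"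
      proof (rule lp_norm_add_le[OF p])
        fix n
        have "\<bar>pder l g s n\<bar> / R ^ (2 * k) = \<bar>t powr (- real k) * pder l g s n\<bar>" unfolding R2[symmetric] using R by (simp add: abs_mult)
        then show "\<bar>\<bar>pder (l + 2 * k) g s n\<bar> + \<bar>pder l g s n\<bar> / R ^ (2 * k)\<bar> \<le> \<bar>pder (l + 2 * k) g s n\<bar> + \<bar>t powr (- real k) * pder l g s n\<bar>"
          by simp
      qed
      also have "\<dots> \<le> 2 * (ennreal (C1 * t powr (- real k)) * ?N + ennreal (C0 * t powr (- real k)) * ?N)"
        by (intro mult_left_mono add_mono n1 n0) simp
      also have "\<dots> = ennreal (2 * (C1 + C0) * t powr (- real k)) * ?N"
      proof -
        have "ennreal (2 * (C1 + C0) * t powr (- real k)) = 2 * (ennreal (C1 * t powr (- real k)) + ennreal (C0 * t powr (- real k)))"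
          unfolding distrib_left mult_2 using C0(1) C1(1)
          by (simp only: ennreal_plus[symmetric] mult_nonneg_nonneg powr_ge_zero less_imp_le add_nonneg_nonneg) (simp add: algebra_simps)
        then show ?thesis by (simp only: distrib_right distrib_left mult.assoc)
      qed
      finally have n2: "lp_norm p (\<lambda>n. \<bar>pder (l + 2 * k) g s n\<bar> + \<bar>pder l g s n\<bar> / R ^ (2 * k)) \<le> ennreal (2 * (C1 + C0) * t powr (- real k)) * ?N" .
      have "lp_norm p (G s) = ennreal (A * s ^ (l - 1)) * lp_norm p (\<lambda>n. \<bar>pder (l + 2 * k) g s n\<bar> + \<bar>pder l g s n\<bar> / R ^ (2 * k))"
        unfolding G_def[abs_def] lp_norm_cmult[OF p] using A(1) s by simp
      also have "\<dots> \<le> ennreal (A * s ^ (l - 1)) * (ennreal (2 * (C1 + C0) * t powr (- real k)) * ?N)" by (rule mult_left_mono[OF n2]) simp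
      also have "\<dots> = ennreal (A * s ^ (l - 1) * (2 * (C1 + C0) * t powr (- real k))) * ?N"
        using A(1) s C0(1) C1(1) by (subst ennreal_mult) (auto simp: mult.assoc)
      also have "A * s ^ (l - 1) * (2 * (C1 + C0) * t powr (- real k)) = 2 * A * (C1 + C0) * t powr (- real k) * s ^ (l - 1)" by simp
      finally show ?thesis .
    qed
    have "ennreal c * lp_norm p ((lap ^^ k) g) = lp_norm p (\<lambda>n. c * (lap ^^ k) g n)" using c(1) by (simp add: lp_norm_cmult[OF p])
    also have "\<dots> \<le> 2 * (\<integral>\<^sup>+s. lp_norm p (G s) * indicator {0<..2 * R} s \<partial>lborel)"
      by (rule lp_norm_nn_integral_set_le[OF mG _ p pt]) simp
    finally have "ennreal (1 / c) * (ennreal c * lp_norm p ((lap ^^ k) g)) \<le> ennreal (1 / c) * (2 * (\<integral>\<^sup>+s. lp_norm p (G s) * indicator {0<..2 * R} s \<partial>lborel))"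
      by (rule mult_left_mono) simp
    then have "lp_norm p ((lap ^^ k) g) \<le> ennreal (2 / c) * (\<integral>\<^sup>+s. lp_norm p (G s) * indicator {0<..2 * R} s \<partial>lborel)"
    proof -
      have "ennreal (1 / c) * ennreal c = 1" "ennreal (1 / c) * 2 = ennreal (2 / c)"
        using c(1) by (simp_all add: ennreal_mult[symmetric]) (simp add: ennreal_numeral[symmetric] ennreal_mult[symmetric] del: ennreal_numeral)
      then show ?thesis using \<open>ennreal (1 / c) * (ennreal c * lp_norm p ((lap ^^ k) g)) \<le> _\<close> by (simp add: mult.assoc[symmetric])
    qed
    also have "\<dots> = (\<integral>\<^sup>+s. ennreal (2 / c) * (lp_norm p (G s) * indicator {0<..2 * R} s) \<partial>lborel)"
      using mG by (intro nn_integral_cmult[symmetric] borel_measurable_times lp_norm_measurable) auto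
    also have "\<dots> \<le> (\<integral>\<^sup>+s. ennreal (C * t powr (- real k) * s ^ (l - 1)) * lp_norm p (pder l f s) * indicator {0<..2 * sqrt t} s \<partial>lborel)"
    proof (rule nn_integral_mono)
      fix s
      show "ennreal (2 / c) * (lp_norm p (G s) * indicator {0<..2 * R} s) \<le>
        ennreal (C * t powr (- real k) * s ^ (l - 1)) * lp_norm p (pder l f s) * indicator {0<..2 * sqrt t} s"
      proof (cases "s \<in> {0<..2 * R}")
        case True
        then have s: "0 < s" by simp
        have "ennreal (2 / c) * lp_norm p (G s) \<le> ennreal (2 / c) * (ennreal (2 * A * (C1 + C0) * t powr (- real k) * s ^ (l - 1)) * lp_norm p (pder l f s))"
          by (rule mult_left_mono[OF nG[OF s]]) simp
        also have "\<dots> = ennreal (2 / c * (2 * A * (C1 + C0) * t powr (- real k) * s ^ (l - 1))) * lp_norm p (pder l f s)"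
          using A(1) s C0(1) C1(1) c(1) by (subst ennreal_mult) (auto simp: mult.assoc)
        also have "2 / c * (2 * A * (C1 + C0) * t powr (- real k) * s ^ (l - 1)) = C * t powr (- real k) * s ^ (l - 1)"
          by (simp add: C_def)
        finally show ?thesis using True by (simp add: R_def)
      qed (simp add: R_def)
    qed
    finally show ?thesis unfolding lg .
  qed
  moreover have "0 \<le> C" using A(1) C0(1) C1(1) c(1) by (simp add: C_def)
  ultimately show ?thesis by (rule that[rotated])
qed

text \<open>With z = s / sqrt t the weighted kernel is z^\<alpha>
  \<open>s powr (l - \<alpha> - 1)\<close>. It decays as z tends to 0 because \<alpha> > 0, and
  large z is excluded by the range of integration. The weight s^(l-1) retained in the interpolation
  is what produces this.\<close>

lemma poisson_imp_heat:
  assumes p: "1 \<le> p" and q: "1 \<le> q" and f: "wsummable 2 f" and kl: "2 * k = l + e" "e \<le> 1" "1 \<le> l" and \<alpha>: "0 < \<alpha>"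
    and fin: "Lfin dt_over_t q (\<lambda>y. ennreal (y powr (real l - \<alpha>)) * lp_norm p (pder l f y))"
  shows "heat_fin p q (real k - \<alpha> / 2) ((lap ^^ k) f)"
proof -
  obtain C where C: "0 \<le> C" "\<And>t. 0 < t \<Longrightarrow> hnorm p t ((lap ^^ k) f) \<le>
    (\<integral>\<^sup>+s. ennreal (C * t powr (- real k) * s ^ (l - 1)) * lp_norm p (pder l f s) * indicator {0<..2 * sqrt t} s \<partial>lborel)"
    by (rule heat_le_poisson[OF p f kl]) blast
  have m: "(\<lambda>s. lp_norm p (pder l f s)) \<in> borel_measurable borel"
    by (intro lp_norm_measurable measurable_pder wsummable_expb[OF f])
  have sm: "scale_measure dt_over_t (\<lambda>t. t powr (1 / 2))" by (rule scale_measure_dt_over_t) simp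
  show ?thesis unfolding heat_fin_def
  proof (rule Lfin_schur_dt[OF sm q \<alpha>, where b = 1 and K = "C * 4 powr \<alpha>" and S = "\<lambda>t. {0<..2 * sqrt t}"
        and k = "\<lambda>t s. t powr (real k - \<alpha> / 2) * (C * t powr (- real k) * s ^ (l - 1))" and c = "real l - \<alpha>"])
    show "(\<lambda>s. lp_norm p (pder l f s)) \<in> borel_measurable (restrict_space borel {0<..})"
      by (rule measurable_restrict_space1[OF m])
    show "Lfin dt_over_t q (\<lambda>s. ennreal (s powr (real l - \<alpha>)) * lp_norm p (pder l f s))" by (rule fin)
  next
    fix t assume "t \<in> space dt_over_t"
    then have t: "0 < t" by (simp add: space_dt_over_t)
    have "ennreal (t powr (real k - \<alpha> / 2)) * hnorm p t ((lap ^^ k) f) \<le> ennreal (t powr (real k - \<alpha> / 2)) *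
      (\<integral>\<^sup>+s. ennreal (C * t powr (- real k) * s ^ (l - 1)) * lp_norm p (pder l f s) * indicator {0<..2 * sqrt t} s \<partial>lborel)"
      by (rule mult_left_mono[OF C(2)[OF t]]) simp
    also have "\<dots> = (\<integral>\<^sup>+s. ennreal (t powr (real k - \<alpha> / 2)) * (ennreal (C * t powr (- real k) * s ^ (l - 1)) * lp_norm p (pder l f s) * indicator {0<..2 * sqrt t} s) \<partial>lborel)"
      using m by (intro nn_integral_cmult[symmetric]) simp
    also have "\<dots> = (\<integral>\<^sup>+s. ennreal (t powr (real k - \<alpha> / 2) * (C * t powr (- real k) * s ^ (l - 1))) * lp_norm p (pder l f s) * indicator {0<..2 * sqrt t} s \<partial>lborel)"
    proof (intro nn_integral_cong)
      fix s
      show "ennreal (t powr (real k - \<alpha> / 2)) * (ennreal (C * t powr (- real k) * s ^ (l - 1)) * lp_norm p (pder l f s) * indicator {0<..2 * sqrt t} s) =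
        ennreal (t powr (real k - \<alpha> / 2) * (C * t powr (- real k) * s ^ (l - 1))) * lp_norm p (pder l f s) * indicator {0<..2 * sqrt t} s"
        using C(1) by (cases "s \<in> {0<..2 * sqrt t}") (auto simp: ennreal_mult mult.assoc)
    qed
    finally show "ennreal (t powr (real k - \<alpha> / 2)) * hnorm p t ((lap ^^ k) f) \<le>
      (\<integral>\<^sup>+s. ennreal (t powr (real k - \<alpha> / 2) * (C * t powr (- real k) * s ^ (l - 1))) * lp_norm p (pder l f s) * indicator {0<..2 * sqrt t} s \<partial>lborel)" .
  next
    fix t s :: real assume "t \<in> space dt_over_t" and "s \<in> {0<..2 * sqrt t}" and s: "0 < s"
    then have t: "0 < t" and s2: "s \<le> 2 * sqrt t" by (auto simp: space_dt_over_t)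
    define z where "z = s / sqrt t"
    have z: "0 < z" "z \<le> 2" using s s2 t by (auto simp: z_def divide_le_eq)
    \<comment> \<open>For 1 < z <= 2 the bound z^(2\<alpha>) <= 4^\<alpha> moves the kernel to the
      decaying branch.\<close>
    have zk: "z powr \<alpha> \<le> 4 powr \<alpha> * kappa \<alpha> z"
    proof (cases "z \<le> 1")
      case True
      have "1 * z powr \<alpha> \<le> 4 powr \<alpha> * z powr \<alpha>" using \<alpha> by (intro mult_right_mono) (auto intro: ge_one_powr_ge_zero)
      then show ?thesis using True z \<alpha> by (simp add: kappa_cases)
    next
      case False
      have "z powr \<alpha> * z powr \<alpha> = (z * z) powr \<alpha>" using z by (simp add: powr_mult)
      also have "\<dots> \<le> 4 powr \<alpha>" using z \<alpha> mult_mono[of z 2 z 2] by (intro powr_mono2) auto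
      finally show ?thesis using False z \<alpha> by (simp add: kappa_cases powr_minus divide_simps)
    qed
    have "t powr (real k - \<alpha> / 2) * t powr (- real k) * s ^ (l - 1) = z powr \<alpha> * s powr (real l - \<alpha> - 1)"
    proof -
      have "t powr (real k - \<alpha> / 2) * t powr (- real k) = sqrt t powr (- \<alpha>)"
        using t by (simp add: powr_add[symmetric] powr_half_sqrt[symmetric] powr_powr)
      moreover have "s ^ (l - 1) = s powr \<alpha> * s powr (real l - \<alpha> - 1)"
        using s kl(3) by (simp add: powr_add[symmetric] powr_realpow[symmetric] of_nat_diff)
      moreover have "z powr \<alpha> = s powr \<alpha> * sqrt t powr (- \<alpha>)"
        using s t by (simp add: z_def powr_divide powr_minus_divide)
      ultimately show ?thesis by (simp add: mult_ac)
    qed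
    then have "t powr (real k - \<alpha> / 2) * (C * t powr (- real k) * s ^ (l - 1)) = C * (z powr \<alpha> * s powr (real l - \<alpha> - 1))"
      by (simp add: mult_ac)
    also have "\<dots> \<le> C * (4 powr \<alpha> * kappa \<alpha> z * s powr (real l - \<alpha> - 1))" by (intro mult_left_mono mult_right_mono zk C) auto
    finally show "t powr (real k - \<alpha> / 2) * (C * t powr (- real k) * s ^ (l - 1)) \<le>
      C * 4 powr \<alpha> * (kappa \<alpha> (s powr 1 / t powr (1 / 2)) * s powr (real l - \<alpha> - 1))"
      using s t by (simp add: z_def powr_half_sqrt mult_ac)
  qed (use C in auto)
qed

section \<open>The function spaces\<close>

lemma Lfin_cong:
  assumes "\<And>x. x \<in> space M \<Longrightarrow> \<Phi> x = \<Psi> x"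
  shows "Lfin M q \<Phi> \<longleftrightarrow> Lfin M q \<Psi>"
  using Lfin_mono[of M q \<Phi> \<Psi>] Lfin_mono[of M q \<Psi> \<Phi>] assms by auto

lemma growth_iff_growth_fin: "0 < \<alpha> \<Longrightarrow> 1 \<le> q \<Longrightarrow> growth \<alpha> q f \<longleftrightarrow> growth_fin q \<alpha> f"
  by (simp add: growth_iff growth_fin_def)

lemma Besov_iff:
  assumes p: "1 \<le> p" and l: "l = nat \<lfloor>\<alpha>\<rfloor>"
  shows "f \<in> Besov \<alpha> p q \<longleftrightarrow>
    Lfin jump_measure q (\<lambda>j. lp_norm p (diff1 ((delta_right ^^ l) f) j) * ennreal (mag j powr (- (\<alpha> - real l))))"
proof -
  have "lp_norm p (\<lambda>n. (g (n + j) - g n) / mag j powr (\<alpha> - real l)) =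
    lp_norm p (diff1 g j) * ennreal (mag j powr (- (\<alpha> - real l)))" for g j
  proof -
    have e: "(\<lambda>n. (g (n + j) - g n) / mag j powr (\<alpha> - real l)) = (\<lambda>n. mag j powr (- (\<alpha> - real l)) * diff1 g j n)"
      unfolding powr_minus by (simp add: diff1_def fun_eq_iff inverse_eq_divide)
    show ?thesis unfolding e lp_norm_cmult[OF p] by (simp add: mult.commute)
  qed
  then show ?thesis unfolding Besov_def Let_def l[symmetric] by (simp add: jump_size_finite_iff)
qed

lemma Zygmund_iff:
  assumes p: "1 \<le> p" and q: "1 \<le> q" and a: "\<alpha> = real a" "1 \<le> a"
  shows "f \<in> Zygmund \<alpha> p q \<longleftrightarrow> growth_fin q \<alpha> f \<and>
    Lfin jump_measure q (\<lambda>j. lp_norm p (diff2 ((delta_right ^^ (a - 1)) f) j) * ennreal (mag j powr (- 1)))"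
proof -
  have "lp_norm p (\<lambda>n. (g (n - j) - 2 * g n + g (n + j)) / mag j) =
    lp_norm p (diff2 g j) * ennreal (mag j powr (- 1))" for g j
  proof -
    have e: "(\<lambda>n. (g (n - j) - 2 * g n + g (n + j)) / mag j) = (\<lambda>n. mag j powr (- 1) * diff2 g j n)"
      unfolding powr_minus by (simp add: diff2_def fun_eq_iff inverse_eq_divide)
    show ?thesis unfolding e lp_norm_cmult[OF p] by (simp add: mult.commute)
  qed
  moreover have "nat \<lfloor>\<alpha>\<rfloor> - 1 = a - 1" by (simp add: a)
  ultimately show ?thesis unfolding Zygmund_def Let_def using a by (simp add: jump_size_finite_iff growth_iff_growth_fin q)
qed

lemma mixed_norm_powr_iff:
  assumes p: "1 \<le> p" and G: "\<And>t n. 0 < t \<Longrightarrow> F t n = t powr c * G t n"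
    and m: "(\<lambda>t. lp_norm p (G t)) \<in> borel_measurable (restrict_space borel {0<..})"
  shows "mixed_norm p q F < \<top> \<longleftrightarrow> Lfin dt_over_t q (\<lambda>t. ennreal (t powr c) * lp_norm p (G t))"
proof -
  have eq: "lp_norm p (F t) = ennreal (t powr c) * lp_norm p (G t)" if "t \<in> space dt_over_t" for t
  proof -
    have "F t = (\<lambda>n. t powr c * G t n)" using G that by (simp add: fun_eq_iff space_dt_over_t)
    then show ?thesis by (simp add: lp_norm_cmult[OF p])
  qed
  have "(\<lambda>t. ennreal (t powr c)) \<in> borel_measurable (restrict_space borel {0<..})"
    by (rule measurable_restrict_space1) simp
  then have "(\<lambda>t. ennreal (t powr c) * lp_norm p (G t)) \<in> borel_measurable (restrict_space borel {0<..})"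
    using m by (rule borel_measurable_times_ennreal)
  then have "(\<lambda>t. ennreal (t powr c) * lp_norm p (G t)) \<in> borel_measurable dt_over_t"
    by (simp add: measurable_cong_sets[OF sets_dt_over_t refl])
  then have "(\<lambda>t. lp_norm p (F t)) \<in> borel_measurable dt_over_t" using measurable_cong[of dt_over_t "\<lambda>t. lp_norm p (F t)", OF eq] by blast
  from mixed_norm_finite_iff[OF this] show ?thesis using Lfin_cong[of dt_over_t "\<lambda>t. lp_norm p (F t)", OF eq] by blast
qed

text \<open>The growth condition must be available first: it gives \<open>expb\<close>, without
  which the time derivatives of the heat extension are not identified with Laplacians.\<close>

lemma Lambda_H_iff:
  assumes p: "1 \<le> p" and q: "1 \<le> q" and \<alpha>: "0 < \<alpha>" and k: "k = nat \<lfloor>\<alpha> / 2\<rfloor> + 1"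
  shows "f \<in> Lambda_H \<alpha> p q \<longleftrightarrow> growth_fin q \<alpha> f \<and> heat_fin p q (real k - \<alpha> / 2) ((lap ^^ k) f)"
proof -
  have "mixed_norm p q (\<lambda>t n. t powr (real k - \<alpha> / 2) * (deriv ^^ k) (\<lambda>s. heat s f n) t) < \<top> \<longleftrightarrow>
    heat_fin p q (real k - \<alpha> / 2) ((lap ^^ k) f)" if "growth_fin q \<alpha> f"
  proof -
    have f: "expb f" by (rule growth_fin_expb[OF q that])
    show ?thesis unfolding heat_fin_def
      by (rule mixed_norm_powr_iff[OF p]) (simp_all only: funpow_deriv_heat[OF _ f] measurable_heat_restrict[OF expb_lap_funpow[OF f]])
  qed
  then show ?thesis unfolding Lambda_H_def Let_def k[symmetric] by (auto simp: growth_iff_growth_fin[OF \<alpha> q])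
qed

lemma Lambda_P_iff:
  assumes p: "1 \<le> p" and f: "(\<lambda>j. \<bar>f j\<bar> / (1 + (mag j)\<^sup>2)) summable_on UNIV" and l: "l = nat \<lfloor>\<alpha>\<rfloor> + 1"
  shows "f \<in> Lambda_P \<alpha> p q \<longleftrightarrow> Lfin dt_over_t q (\<lambda>y. ennreal (y powr (real l - \<alpha>)) * lp_norm p (pder l f y))"
proof -
  have w: "wsummable 2 f" by (rule summable_imp_wsummable[OF f])
  have "(\<lambda>y. lp_norm p (pder l f y)) \<in> borel_measurable (restrict_space borel {0<..})"
    by (intro measurable_restrict_space1 lp_norm_measurable measurable_pder wsummable_expb[OF w])
  then have "mixed_norm p q (\<lambda>y n. y powr (real l - \<alpha>) * (deriv ^^ l) (\<lambda>s. poisson s f n) y) < \<top> \<longleftrightarrow>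
    Lfin dt_over_t q (\<lambda>y. ennreal (y powr (real l - \<alpha>)) * lp_norm p (pder l f y))"
    by (intro mixed_norm_powr_iff[OF p]) (simp_all only: funpow_deriv_poisson[OF w])
  then show ?thesis using f unfolding Lambda_P_def Let_def l[symmetric] poisson_admissible_def by simp
qed

lemma heat_fin_lap_funpow:
  assumes "expb f"
  shows "heat_fin p q c ((lap ^^ k) f) \<longleftrightarrow> heat_fin p q c ((delta_right ^^ (2 * k)) f)"
proof -
  have "hnorm p t ((lap ^^ k) f) = hnorm p t ((delta_right ^^ (2 * k)) f)" for t
    unfolding lap_funpow_conv_right[OF rapid_hker assms, symmetric] delta_right_funpow_conv_right[OF rapid_hker assms, symmetric]
    by (rule lp_norm_lap_funpow)
  then show ?thesis by (simp add: heat_fin_def)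
qed

text \<open>The l-th difference grows with exponent \<alpha> - l > 0, and each of the
  \<open>l\<close> summations adds 1.\<close>

lemma Besov_growth_fin:
  assumes p: "1 \<le> p" and q: "1 \<le> q" and \<alpha>: "0 < \<alpha>" "\<alpha> \<notin> \<nat>" and f: "f \<in> Besov \<alpha> p q"
  shows "growth_fin q \<alpha> f"
proof -
  define l where "l = nat \<lfloor>\<alpha>\<rfloor>"
  have l: "0 < \<alpha> - real l" using floor_non_integer(1)[OF \<alpha>] by (simp add: l_def)
  have "growth_fin q (\<alpha> - real l) ((delta_right ^^ l) f)"
    by (rule diff1_imp_growth_fin[OF p q l]) (use f Besov_iff[OF p l_def] in blast)
  from growth_fin_funpow[OF q l this] show ?thesis by simp
qed

lemma heat_fin_iff_Besov:
  assumes p: "1 \<le> p" and q: "1 \<le> q" and \<alpha>: "0 < \<alpha>" "\<alpha> \<notin> \<nat>" and k: "k = nat \<lfloor>\<alpha> / 2\<rfloor> + 1"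
    and f: "wsummable (nat \<lfloor>\<alpha>\<rfloor> + 2) f"
  shows "heat_fin p q (real k - \<alpha> / 2) ((lap ^^ k) f) \<longleftrightarrow> f \<in> Besov \<alpha> p q"
proof -
  have ef: "expb f" by (rule wsummable_expb[OF f])
  have "vanishing ((delta_right ^^ (nat \<lfloor>\<alpha>\<rfloor> + 1)) f)" using f by (intro vanishing_delta_right) simp
  from heat_fin_iff_diff1[OF p q ef \<alpha> refl k this] show ?thesis
    unfolding heat_fin_lap_funpow[OF ef] Besov_iff[OF p refl] .
qed

lemma Besov_eq_Lambda_H:
  assumes p: "1 \<le> p" and q: "1 \<le> q" and \<alpha>: "0 < \<alpha>" "\<alpha> \<notin> \<nat>"
  shows "Besov \<alpha> p q = Lambda_H \<alpha> p q"
proof -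
  have "f \<in> Besov \<alpha> p q \<longleftrightarrow> heat_fin p q (real (nat \<lfloor>\<alpha> / 2\<rfloor> + 1) - \<alpha> / 2) ((lap ^^ (nat \<lfloor>\<alpha> / 2\<rfloor> + 1)) f)"
    if "growth_fin q \<alpha> f" for f
  proof -
    have "wsummable (nat \<lfloor>\<alpha>\<rfloor> + 1 + 1) f"
      by (rule growth_fin_wsummable[OF q that]) (use floor_non_integer(2)[OF \<alpha>] in simp)
    then show ?thesis by (intro heat_fin_iff_Besov[OF p q \<alpha> refl, symmetric]) simp
  qed
  then show ?thesis using Lambda_H_iff[OF p q \<alpha>(1) refl] Besov_growth_fin[OF p q \<alpha>] by blast
qed

lemma heat_fin_iff_second_difference:
  assumes p: "1 \<le> p" and q: "1 \<le> q" and a: "\<alpha> = real a" "1 \<le> a" and k: "k = nat \<lfloor>\<alpha> / 2\<rfloor> + 1"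
    and f: "wsummable (a + 2) f"
  shows "heat_fin p q (real k - \<alpha> / 2) ((lap ^^ k) f) \<longleftrightarrow>
    Lfin jump_measure q (\<lambda>j. lp_norm p (diff2 ((delta_right ^^ (a - 1)) f) j) * ennreal (mag j powr (- 1)))"
proof -
  have ef: "expb f" by (rule wsummable_expb[OF f])
  have "vanishing ((delta_right ^^ (a + 1)) f)" using f by (intro vanishing_delta_right) simp
  from heat_fin_iff_diff2[OF p q ef a k this] show ?thesis unfolding heat_fin_lap_funpow[OF ef] .
qed

lemma Zygmund_eq_Lambda_H:
  assumes p: "1 \<le> p" and q: "1 \<le> q" and a: "\<alpha> = real a" "1 \<le> a"
  shows "Zygmund \<alpha> p q = Lambda_H \<alpha> p q"
proof -
  have \<alpha>: "0 < \<alpha>" using a by simp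
  have "wsummable (a + 2) f" if "growth_fin q \<alpha> f" for f
    using growth_fin_wsummable[OF q that, of "a + 1"] by (simp add: a)
  then show ?thesis
    using Lambda_H_iff[OF p q \<alpha> refl] Zygmund_iff[OF p q a] heat_fin_iff_second_difference[OF p q a refl] by blast
qed

text \<open>The seminorms are equivalent by the two transfers; what remains is the growth condition
  in the heat space. For non-integer \<alpha> it comes by way of the Besov space, for integers
  \<alpha> >= 2 from summability alone, and for \<alpha> = 1 from the averaged second
  difference.\<close>

lemma Lambda_H_iff_Lambda_P:
  assumes p: "1 \<le> p" and q: "1 \<le> q" and \<alpha>: "0 < \<alpha>"
    and f: "(\<lambda>j. \<bar>f j\<bar> / (1 + (mag j)\<^sup>2)) summable_on UNIV"
  shows "f \<in> Lambda_H \<alpha> p q \<longleftrightarrow> f \<in> Lambda_P \<alpha> p q"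
proof -
  define k where "k = nat \<lfloor>\<alpha> / 2\<rfloor> + 1"
  define l where "l = nat \<lfloor>\<alpha>\<rfloor> + 1"
  have w: "wsummable 2 f" by (rule summable_imp_wsummable[OF f])
  have "2 * k = l + 1 \<or> 2 * k = l + 0"
    using two_mult_div_two[of "nat \<lfloor>\<alpha>\<rfloor>"] floor_half[of \<alpha>] \<alpha> by (auto simp: k_def l_def)
  then obtain e where kl: "2 * k = l + e" "e \<le> 1" "1 \<le> l" unfolding l_def by auto
  have "real (nat \<lfloor>\<alpha>\<rfloor>) = of_int \<lfloor>\<alpha>\<rfloor>" using \<alpha> by simp
  then have rl: "\<alpha> < real l" "real l - 1 \<le> \<alpha>"
    using real_of_int_floor_add_one_gt[of \<alpha>] of_int_floor_le[of \<alpha>] unfolding l_def by linarith+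
  have "heat_fin p q (real k - \<alpha> / 2) ((lap ^^ k) f) \<longleftrightarrow> f \<in> Lambda_P \<alpha> p q"
    using Lambda_P_iff[OF p f l_def] heat_imp_poisson[OF p q w kl rl] poisson_imp_heat[OF p q w kl \<alpha>] by blast
  moreover have "growth_fin q \<alpha> f" if h: "heat_fin p q (real k - \<alpha> / 2) ((lap ^^ k) f)"
  proof (cases "\<alpha> \<in> \<nat>")
    case False
    have "f \<in> Besov \<alpha> p q"
      using h heat_fin_iff_Besov[OF p q \<alpha> False k_def wsummable_mono[OF w]] by simp
    then show ?thesis by (rule Besov_growth_fin[OF p q \<alpha> False])
  next
    case True
    then obtain a where a: "\<alpha> = real a" "1 \<le> a" using \<alpha> by (auto elim!: Nats_cases simp: Suc_leI)
    show ?thesis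
    proof (cases "a = 1")
      case True
      have "Lfin jump_measure q (\<lambda>j. lp_norm p (diff2 ((delta_right ^^ (a - 1)) f) j) * ennreal (mag j powr (- 1)))"
        using h heat_fin_iff_second_difference[OF p q a k_def wsummable_mono[OF w]] by simp
      then show ?thesis using diff2_imp_growth_fin_1[OF p q w] True a by simp
    next
      case False
      then show ?thesis using a by (intro wsummable_growth_fin_ge_2[OF q w]) simp
    qed
  qed
  ultimately show ?thesis using Lambda_H_iff[OF p q \<alpha> k_def] by blast
qed

theorem theorem1p1:
  fixes p q :: ennreal
  assumes "1 \<le> p" and "1 \<le> q"
  shows
    "(\<forall>\<alpha>::real. \<alpha> > 0 \<longrightarrow>
        (\<alpha> \<notin> \<nat> \<longrightarrow> Besov \<alpha> p q = Lambda_H \<alpha> p q) \<and>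
        (\<alpha> \<in> \<nat> \<longrightarrow> Zygmund \<alpha> p q = Lambda_H \<alpha> p q)) \<and>
     (\<forall>f::int \<Rightarrow> real. (\<lambda>j. \<bar>f j\<bar> / (1 + \<bar>real_of_int j\<bar>\<^sup>2)) summable_on UNIV \<longrightarrow>
        (\<forall>\<alpha>::real. \<alpha> > 0 \<and> \<alpha> \<notin> \<nat> \<longrightarrow>
           (f \<in> Besov \<alpha> p q \<longleftrightarrow> f \<in> Lambda_H \<alpha> p q) \<and>
           (f \<in> Lambda_H \<alpha> p q \<longleftrightarrow> f \<in> Lambda_P \<alpha> p q)) \<and>
        (\<forall>\<alpha>::real. \<alpha> > 0 \<and> \<alpha> \<in> \<nat> \<longrightarrow>
           (f \<in> Zygmund \<alpha> p q \<longleftrightarrow> f \<in> Lambda_H \<alpha> p q) \<and>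
           (f \<in> Lambda_H \<alpha> p q \<longleftrightarrow> f \<in> Lambda_P \<alpha> p q)))"
proof -
  have B: "Besov \<alpha> p q = Lambda_H \<alpha> p q" if "0 < \<alpha>" "\<alpha> \<notin> \<nat>" for \<alpha>
    by (rule Besov_eq_Lambda_H[OF assms that])
  have Z: "Zygmund \<alpha> p q = Lambda_H \<alpha> p q" if "0 < \<alpha>" "\<alpha> \<in> \<nat>" for \<alpha>
  proof -
    from that obtain a where "\<alpha> = real a" "1 \<le> a" by (auto elim!: Nats_cases simp: Suc_leI)
    then show ?thesis by (rule Zygmund_eq_Lambda_H[OF assms])
  qed
  show ?thesis using B Z Lambda_H_iff_Lambda_P[OF assms] by blast
qed

end
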